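(* Let $Z=(Z_t)_{t\in\mathbb{R}}$ be an integrable and centered Lévy process, and let $f:\mathbb{R}\to\mathbb{R}$ be a measurable function such that $f(t-\cdot)-f(-\cdot)\in L^\phi$ for all $t\in\mathbb{R}$. Let $$N_t=\int_{\mathbb{R}}\big(f(t-s)-f(-s)\big)\,dZ_s,\qquad t\in\mathbb{R}.$$ Then there exists a unique-in-law QOU process $X$ driven by $N$ with parameter $\lambda>0$, and $X$ is a moving average of the form $$X_t=\int_{\mathbb{R}}\psi_f(t-s)\,dZ_s,\qquad t\in\mathbb{R},$$ where $\psi_f:\mathbb{R}\to\mathbb{R}$ belongs to $L^\phi$ and is given by $$\psi_f(t)=f(t)-\lambda e^{-\lambda t}\int_{-\infty}^te^{\lambda s}f(s)\,ds,\qquad t\in\mathbb{R}.$$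
   Context: $Z$ is a Lévy process indexed by $\mathbb{R}$, with Lévy measure $\nu$ and Gaussian component $\sigma^2$; integrable and centered means $E|Z_t|<\infty$ and $E[Z_t]=0$ for all $t$. $L^\phi$ is the space of measurable functions $g:\mathbb{R}\to\mathbb{R}$ with $$\int_{\mathbb{R}}\Big(g(s)^2\sigma^2+\int_{\mathbb{R}}\big(|ug(s)|^2\wedge|ug(s)|\big)\nu(du)\Big)ds<\infty.$$ For $g\in L^\phi$ the integral $\int_{\mathbb{R}}g(s)\,dZ_s$ is the integral in the sense of Rajput and Rosiński with respect to the Lévy basis $\Lambda$ on the bounded Borel sets of $\mathbb{R}$ determined by $\Lambda((a,b])=Z_b-Z_a$ for $a<b$; it exists and is integrable if and only if $g\in L^\phi$. A measurable modification of $N$ is chosen (one exists). A QOU (quasi Ornstein--Uhlenbeck) process driven by $N$ with parameter $\lambda>0$ is a stationary process $X=(X_t)_{t\in\mathbb{R}}$ satisfying $X_t=X_0-\lambda\int_0^tX_s\,ds+N_t$ for all $t\in\mathbb{R}$, where the integral is a pathwise Lebesgue integral (with $\int_0^t=-\int_t^0$ for $t<0$). Unique in law means that any two such processes have the same law (finite-dimensional distributions). *)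

theory Defs
  imports "HOL-Probability.Probability"
begin

definition infinitely_divisible :: "real measure \<Rightarrow> bool" where
  "infinitely_divisible \<mu> \<longleftrightarrow>
     (\<forall>n::nat. n \<ge> 1 \<longrightarrow>
        (\<exists>\<rho>. real_distribution \<rho> \<and> ((\<lambda>\<tau>. convolution \<tau> \<rho>) ^^ n) (return borel 0) = \<mu>))"

definition tendsto_in_prob ::
  "'w measure \<Rightarrow> (nat \<Rightarrow> 'w \<Rightarrow> real) \<Rightarrow> ('w \<Rightarrow> real) \<Rightarrow> bool" where
  "tendsto_in_prob M Y L \<longleftrightarrow>
     (\<forall>n. Y n \<in> borel_measurable M) \<and> L \<in> borel_measurable M \<and>
     (\<forall>e>0. (\<lambda>n. measure M {\<omega> \<in> space M. \<bar>Y n \<omega> - L \<omega>\<bar> > e}) \<longlonglongrightarrow> 0)"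

definition levy_process :: "'w measure \<Rightarrow> (real \<Rightarrow> 'w \<Rightarrow> real) \<Rightarrow> bool" where
  "levy_process M Z \<longleftrightarrow>
     (\<forall>t. Z t \<in> borel_measurable M) \<and>
     (AE \<omega> in M. Z 0 \<omega> = 0) \<and>
     (\<forall>(n::nat) t. (\<forall>i<n. t i < t (Suc i)) \<longrightarrow>
        prob_space.indep_vars M (\<lambda>_. borel) (\<lambda>i \<omega>. Z (t (Suc i)) \<omega> - Z (t i) \<omega>) {..<n}) \<and>
     (\<forall>s t h. distr M borel (\<lambda>\<omega>. Z (s + h) \<omega> - Z s \<omega>) = distr M borel (\<lambda>\<omega>. Z (t + h) \<omega> - Z t \<omega>)) \<and>
     (\<forall>t. \<forall>e>0. ((\<lambda>s. measure M {\<omega> \<in> space M. \<bar>Z s \<omega> - Z t \<omega>\<bar> > e}) \<longlongrightarrow> 0) (at t)) \<and>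
     (AE \<omega> in M. \<forall>t. continuous (at_right t) (\<lambda>s. Z s \<omega>) \<and>
        (\<exists>l. ((\<lambda>s. Z s \<omega>) \<longlongrightarrow> l) (at_left t)))"

definition levy_measure :: "real measure \<Rightarrow> bool" where
  "levy_measure \<nu> \<longleftrightarrow>
     sets \<nu> = sets borel \<and> emeasure \<nu> {0} = 0 \<and> (\<integral>\<^sup>+u. ennreal (min 1 (u\<^sup>2)) \<partial>\<nu>) < \<infinity>"

text \<open>
  The Gaussian component is the variance \<open>\<sigma>\<^sup>2\<close>; it and the Levy measure do not depend on the
  truncation function used for the drift \<open>\<gamma>\<close>.
\<close>

definition has_levy_characteristics ::
  "'w measure \<Rightarrow> (real \<Rightarrow> 'w \<Rightarrow> real) \<Rightarrow> real \<Rightarrow> real measure \<Rightarrow> bool" where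
  "has_levy_characteristics M Z \<sigma> \<nu> \<longleftrightarrow>
     levy_measure \<nu> \<and>
     (\<exists>\<gamma>::real. \<forall>\<theta>::real. char (distr M borel (Z 1)) \<theta> =
        exp (\<i> * of_real (\<gamma> * \<theta>) - of_real (\<sigma>\<^sup>2 * \<theta>\<^sup>2 / 2) +
          (CLINT u|\<nu>. iexp (\<theta> * u) - 1 - \<i> * of_real (\<theta> * u * indicator {-1..1} u))))"

definition L_phi :: "real \<Rightarrow> real measure \<Rightarrow> (real \<Rightarrow> real) set" where
  "L_phi \<sigma> \<nu> = {g \<in> borel_measurable borel.
     (\<integral>\<^sup>+s. (ennreal ((g s)\<^sup>2 * \<sigma>\<^sup>2) +
        (\<integral>\<^sup>+u. ennreal (min (\<bar>u * g s\<bar>\<^sup>2) \<bar>u * g s\<bar>) \<partial>\<nu>)) \<partial>lborel) < \<infinity>}"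

abbreviation bounded_borel :: "real set \<Rightarrow> bool" where
  "bounded_borel A \<equiv> A \<in> sets borel \<and> bounded A"

text \<open>
  A Levy basis is an infinitely divisible independently scattered random measure. Values of
  \<open>\<Lambda>\<close> outside the bounded Borel sets are irrelevant.
\<close>

definition levy_basis :: "'w measure \<Rightarrow> (real set \<Rightarrow> 'w \<Rightarrow> real) \<Rightarrow> bool" where
  "levy_basis M \<Lambda> \<longleftrightarrow>
     (\<forall>A. bounded_borel A \<longrightarrow>
        \<Lambda> A \<in> borel_measurable M \<and> infinitely_divisible (distr M borel (\<Lambda> A))) \<and>
     (\<forall>A :: nat \<Rightarrow> real set. (\<forall>n. bounded_borel (A n)) \<and> disjoint_family A \<longrightarrow>
        prob_space.indep_vars M (\<lambda>_. borel) (\<lambda>n. \<Lambda> (A n)) UNIV \<and>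
        (bounded_borel (\<Union>n. A n) \<longrightarrow>
           (AE \<omega> in M. (\<lambda>n. \<Lambda> (A n) \<omega>) sums \<Lambda> (\<Union>n. A n) \<omega>)))"

definition rr_simple :: "(real \<Rightarrow> real) \<Rightarrow> bool" where
  "rr_simple g \<longleftrightarrow> simple_function borel g \<and> bounded {s. g s \<noteq> 0}"

definition rr_simple_integral ::
  "(real set \<Rightarrow> 'w \<Rightarrow> real) \<Rightarrow> real set \<Rightarrow> (real \<Rightarrow> real) \<Rightarrow> 'w \<Rightarrow> real" where
  "rr_simple_integral \<Lambda> A g \<omega> = (\<Sum>x\<in>range g - {0}. x * \<Lambda> (A \<inter> g -` {x}) \<omega>)"

text \<open>
  The Rajput--Rosinski integral. The almost everywhere convergence refers to the control measure
  of \<open>\<Lambda>\<close>; for a basis generated by a Levy process this is a multiple of Lebesgue measure.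
  The integral is a random variable determined up to null sets, hence the relational form.
\<close>

definition has_rr_integral ::
  "'w measure \<Rightarrow> (real set \<Rightarrow> 'w \<Rightarrow> real) \<Rightarrow> (real \<Rightarrow> real) \<Rightarrow> ('w \<Rightarrow> real) \<Rightarrow> bool" where
  "has_rr_integral M \<Lambda> g Y \<longleftrightarrow>
     g \<in> borel_measurable borel \<and>
     (\<exists>gn :: nat \<Rightarrow> real \<Rightarrow> real.
        (\<forall>n. rr_simple (gn n)) \<and>
        (AE s in lborel. (\<lambda>n. gn n s) \<longlonglongrightarrow> g s) \<and>
        (\<forall>A\<in>sets borel. \<exists>L. tendsto_in_prob M (\<lambda>n. rr_simple_integral \<Lambda> A (gn n)) L) \<and>
        tendsto_in_prob M (\<lambda>n. rr_simple_integral \<Lambda> UNIV (gn n)) Y)"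

text \<open>
  \<open>Y\<close> is a version of \<open>\<integral> g(s) dZ\<^sub>s\<close>. The basis \<open>\<Lambda>\<close> is determined by \<open>Z\<close> up to
  null sets on each bounded Borel set.
\<close>

definition has_levy_integral ::
  "'w measure \<Rightarrow> (real \<Rightarrow> 'w \<Rightarrow> real) \<Rightarrow> (real \<Rightarrow> real) \<Rightarrow> ('w \<Rightarrow> real) \<Rightarrow> bool" where
  "has_levy_integral M Z g Y \<longleftrightarrow>
     (\<exists>\<Lambda>. levy_basis M \<Lambda> \<and>
        (\<forall>a b. a < b \<longrightarrow> (AE \<omega> in M. \<Lambda> {a<..b} \<omega> = Z b \<omega> - Z a \<omega>)) \<and>
        has_rr_integral M \<Lambda> g Y)"

definition same_fdd ::
  "'w measure \<Rightarrow> (real \<Rightarrow> 'w \<Rightarrow> real) \<Rightarrow> (real \<Rightarrow> 'w \<Rightarrow> real) \<Rightarrow> bool" where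
  "same_fdd M X Y \<longleftrightarrow>
     (\<forall>J. finite J \<longrightarrow>
        distr M (\<Pi>\<^sub>M t\<in>J. borel) (\<lambda>\<omega>. \<lambda>t\<in>J. X t \<omega>) =
        distr M (\<Pi>\<^sub>M t\<in>J. borel) (\<lambda>\<omega>. \<lambda>t\<in>J. Y t \<omega>))"

definition stationary_process :: "'w measure \<Rightarrow> (real \<Rightarrow> 'w \<Rightarrow> real) \<Rightarrow> bool" where
  "stationary_process M X \<longleftrightarrow>
     (\<forall>t. X t \<in> borel_measurable M) \<and> (\<forall>h. same_fdd M (\<lambda>t. X (t + h)) X)"

text \<open>For \<open>t < 0\<close> the integral \<open>LBINT s=0..t\<close> is minus the integral over \<open>(t, 0)\<close>.\<close>

definition qou_process ::
  "'w measure \<Rightarrow> (real \<Rightarrow> 'w \<Rightarrow> real) \<Rightarrow> real \<Rightarrow> (real \<Rightarrow> 'w \<Rightarrow> real) \<Rightarrow> bool" where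
  "qou_process M N lam X \<longleftrightarrow>
     stationary_process M X \<and>
     (AE \<omega> in M. \<forall>t::real.
        interval_lebesgue_integrable lborel 0 (ereal t) (\<lambda>s. X s \<omega>) \<and>
        X t \<omega> = X 0 \<omega> - lam * (LBINT s=0..ereal t. X s \<omega>) + N t \<omega>)"

text \<open>
  Under the hypotheses of the theorem the integral converges absolutely unless \<open>Z\<close> vanishes; for
  \<open>Z = 0\<close> the function \<open>f\<close> is unrestricted and a divergent integral has the default value 0.
\<close>

definition psi :: "real \<Rightarrow> (real \<Rightarrow> real) \<Rightarrow> real \<Rightarrow> real" where
  "psi lam f t = f t - lam * exp (- lam * t) * (LBINT s:{..t}. exp (lam * s) * f s)"

end

theory Submission
  imports Defs
begin

text \<open>
  Two solutions driven by the same \<open>N\<close> differ by \<open>D\<^sub>0 exp (- lam t)\<close>; stationarity makes this tight as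
  \<open>t\<close> tends to \<open>-\<infinity>\<close>, which forces \<open>D\<^sub>0 = 0\<close>. So solutions are almost surely equal at every time and it
  suffices to treat the pathwise solution \<open>X\<^sub>t = N\<^sub>t - E N\<^bsub>t - V\<^esub>\<close>, where \<open>V\<close> is an exponential variable of
  rate \<open>lam\<close> that is independent of everything. Formally
  \<open>X\<^sub>t\<close> is the integral of \<open>E (f (t - s) - f (t - s - V)) = psi (t - s)\<close>, and this is a stochastic Fubini
  theorem. For it we need \<open>psi\<close> to be in the space \<open>L_phi\<close>: the modular of \<open>f - f (\<cdot> - v)\<close> is subadditive up to
  a constant, finite and measurable in \<open>v\<close>, hence locally bounded and of quadratic growth, and Jensen's
  inequality applies. First moments of the integral are controlled by the modular through
  \<open>\<bar>x\<bar> = C \<integral> (1 - cos (\<theta> x)) / \<theta>\<^sup>2 d\<theta>\<close>. The integral of a function does not depend on the approximating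
  simple functions, by a gliding hump argument on characteristic functions, and shift invariance of the
  characteristic functions gives stationarity.
\<close>

subsection \<open>A gliding hump lemma\<close>

text \<open>Only first moments are available, so isometry arguments are replaced by a quantitative
  bound: the L1 norm of an integral is at most \<open>L1_bound\<close> of its modular, a function
  that is continuous, vanishes at 0 and grows at most linearly. Continuity at 0 gives existence and
  passage to limits; linear growth gives integrability over the random time V. The bound k(c x) <=
  c^2 k(x) for |c| >= 1 is the source of the quadratic growth in v, which the moments of V absorb.

  Stochastic integrals are defined up to null sets, so versions cannot simply be picked for
  uncountably many v at once; the joint measurability of \<open>N\<close> supplies versions whose
  average over v makes sense. Likewise the average exists off a null set that depends on the time.
  Since integrability against the exponential weight on a half line passes to shorter half lines,
  integer times suffice and a single null set remains.

  If Z vanishes, then so does k, \<open>f\<close> is not constrained, and its averages may diverge.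
  That case is separated; there every integral is 0.\<close>

lemma cmod_exp_diff_le:
  assumes "Re w \<le> 0" "Re z \<le> 0"
  shows "cmod (exp w - exp z) \<le> cmod (w - z)"
proof -
  \<comment> \<open>\<open>exp\<close> is 1-Lipschitz on the left half plane: this set is convex,
    and the derivative has modulus at most 1 there.\<close>
  have "cmod (exp w - exp z) \<le> 1 * cmod (w - z)"
  proof (rule field_differentiable_bound[where S="{z. Re z \<le> 0}" and f'=exp])
    show "convex {z. Re z \<le> 0}" by (rule convex_halfspace_Re_le)
    show "(exp has_field_derivative exp z) (at z within {z. Re z \<le> 0})" for z :: complex
      by (intro DERIV_subset[OF DERIV_exp]) auto
  qed (use assms in auto)
  then show ?thesis by simp
qed

text \<open>A gliding hump argument: along a subsequence the mass of \<open>b n\<close> sits on disjoint sets \<open>D n\<close>. On the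
  union \<open>A\<close> of every other one of these sets the integrals alternate between nearly the full integral
  and nearly 0, so \<open>l A\<close> is close both to \<open>l UNIV\<close> and to 1. Working with exponentials avoids choosing
  complex logarithms.\<close>

lemma exp_integral_limit_eq_1:
  fixes b :: "nat \<Rightarrow> real \<Rightarrow> complex" and l :: "real set \<Rightarrow> complex"
  assumes int: "\<And>n. integrable lborel (b n)" and re: "\<And>n s. Re (b n s) \<le> 0"
    and lim: "AE s in lborel. (\<lambda>n. b n s) \<longlonglongrightarrow> 0"
    and conv: "\<And>A. A \<in> sets borel \<Longrightarrow> (\<lambda>n. exp (LINT s:A|lborel. b n s)) \<longlonglongrightarrow> l A"
  shows "l UNIV = 1"
proof -
  have [measurable]: "b n \<in> borel_measurable borel" for n
    using borel_measurable_integrable[OF int] by simp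
  \<comment> \<open>The bound on \<open>b n\<close> is uniform in \<open>n\<close>, so dominated
    convergence applies on each \<open>E m\<close> (\<open>small1\<close>). The sets exhaust almost
    every point because convergent sequences are bounded (\<open>small2\<close>).\<close>
  define E where "E m = {s. \<bar>s\<bar> \<le> real m \<and> (\<forall>n. cmod (b n s) \<le> real m)}" for m :: nat
  have E_meas[measurable]: "E m \<in> sets borel" for m
    unfolding E_def by measurable
  have E_mono: "E m \<subseteq> E m'" if "m \<le> m'" for m m'
    using that unfolding E_def by (auto intro: order_trans[OF _ of_nat_mono])
  define I where "I A n = (LINT s:A|lborel. cmod (b n s))" for A n
  have sint: "set_integrable lborel A (b n)" if "A \<in> sets borel" for A n
    using int[of n] that by (simp add: set_integrable_def integrable_mult_indicator)
  have sintn: "set_integrable lborel A (\<lambda>s. cmod (b n s))" if "A \<in> sets borel" for A n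
    using int[of n] that integrable_norm[OF int[of n]]
    unfolding set_integrable_def by (intro integrable_mult_indicator) auto
  have I_mono: "I A n \<le> I B n" if "A \<subseteq> B" "A \<in> sets borel" "B \<in> sets borel" for A B n
    unfolding I_def set_lebesgue_integral_def
    using sintn[OF that(2), of n] sintn[OF that(3), of n] that(1)
    by (intro integral_mono) (auto simp: set_integrable_def split: split_indicator)
  have I_sub: "I (A \<union> B) n \<le> I A n + I B n" if "A \<in> sets borel" "B \<in> sets borel" for A B n
  proof -
    have "I (A \<union> B) n \<le> (LINT s|lborel. indicator A s *\<^sub>R cmod (b n s) + indicator B s *\<^sub>R cmod (b n s))"
      unfolding I_def set_lebesgue_integral_def
      using sintn[OF that(1), of n] sintn[OF that(2), of n] sintn[OF sets.Un[OF that], of n]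
      by (intro integral_mono Bochner_Integration.integrable_add) (auto simp: set_integrable_def split: split_indicator)
    also have "\<dots> = I A n + I B n"
      unfolding I_def set_lebesgue_integral_def
      using sintn[OF that(1), of n] sintn[OF that(2), of n]
      by (intro Bochner_Integration.integral_add) (auto simp: set_integrable_def)
    finally show ?thesis .
  qed
  have I_bound: "cmod (LINT s:A|lborel. b n s) \<le> I A n" if "A \<in> sets borel" for A n
    unfolding I_def by (rule set_integral_norm_bound[OF sint[OF that]])
  have small1: "(\<lambda>n. I (E m) n) \<longlonglongrightarrow> 0" for m
  proof -
    have "(\<lambda>n. LINT s|lborel. indicator (E m) s *\<^sub>R cmod (b n s)) \<longlonglongrightarrow> (LINT s::real|lborel. (0::real))"
    proof (rule integral_dominated_convergence[where w="\<lambda>s. indicator {-real m..real m} s *\<^sub>R real m"])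
      show "integrable lborel (\<lambda>s. indicator {-real m..real m} s *\<^sub>R real m)"
        by (intro integrable_scaleR_left integrable_real_indicator) auto
      show "AE s in lborel. (\<lambda>n. indicator (E m) s *\<^sub>R cmod (b n s)) \<longlonglongrightarrow> 0"
        using lim by eventually_elim (auto intro!: tendsto_mult_right_zero tendsto_norm_zero)
      show "AE s in lborel. norm (indicator (E m) s *\<^sub>R cmod (b n s)) \<le> indicator {-real m..real m} s *\<^sub>R real m" for n
        by (auto simp: E_def split: split_indicator)
    qed auto
    then show ?thesis by (simp add: I_def set_lebesgue_integral_def)
  qed
  have small2: "(\<lambda>m. I (- E m) n) \<longlonglongrightarrow> 0" for n
  proof -
    have "(\<lambda>m. LINT s|lborel. indicator (- E m) s *\<^sub>R cmod (b n s)) \<longlonglongrightarrow> (LINT s::real|lborel. (0::real))"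
    proof (rule integral_dominated_convergence[where w="\<lambda>s. cmod (b n s)"])
      show "AE s in lborel. (\<lambda>m. indicator (- E m) s *\<^sub>R cmod (b n s)) \<longlonglongrightarrow> 0"
        using lim
      proof eventually_elim
        case (elim s)
        then obtain K where K: "\<And>n. cmod (b n s) \<le> K"
          using convergent_imp_Bseq[of "\<lambda>n. b n s"] by (auto simp: convergent_def Bseq_def)
        obtain m0 :: nat where m0: "max K \<bar>s\<bar> \<le> real m0" using real_arch_simple by blast
        have "eventually (\<lambda>m. indicator (- E m) s *\<^sub>R cmod (b n s) = 0) sequentially"
          using eventually_ge_at_top[of m0]
        proof eventually_elim
          case (elim m)
          then have "real m0 \<le> real m" by simp
          then have "s \<in> E m" using m0 K unfolding E_def
            by (auto intro: order_trans[OF K])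
          then show ?case by simp
        qed
        then show ?case by (rule tendsto_eventually)
      qed
      show "integrable lborel (\<lambda>s. cmod (b n s))" by (intro integrable_norm int)
    qed (auto split: split_indicator)
    then show ?thesis by (simp add: I_def set_lebesgue_integral_def)
  qed
  have main: "cmod (l UNIV - 1) \<le> 4 * e" if e: "e > 0" for e
  proof -
    \<comment> \<open>Pairs (n, m) are chosen alternately: n so late that \<open>b n\<close> has
      little mass on the current \<open>E m\<close>, then the next m so large that this same
      \<open>b n\<close> has little mass outside the new set.\<close>
    have "\<exists>g :: nat \<Rightarrow> nat \<times> nat. \<forall>j. True \<and> (fst (g j) < fst (g (Suc j)) \<and> snd (g j) < snd (g (Suc j)) \<and>
        I (E (snd (g j))) (fst (g (Suc j))) < e \<and> I (- E (snd (g (Suc j)))) (fst (g (Suc j))) < e)"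
    proof (rule dependent_nat_choice)
      fix x :: "nat \<times> nat" and j :: nat
      have "eventually (\<lambda>n. I (E (snd x)) n < e \<and> fst x < n) sequentially"
        using order_tendstoD(2)[OF small1 e] eventually_gt_at_top by (rule eventually_conj)
      then obtain n where n: "I (E (snd x)) n < e" "fst x < n"
        by (auto simp: eventually_sequentially)
      have "eventually (\<lambda>m. I (- E m) n < e \<and> snd x < m) sequentially"
        using order_tendstoD(2)[OF small2 e] eventually_gt_at_top by (rule eventually_conj)
      then obtain m where m: "I (- E m) n < e" "snd x < m"
        by (auto simp: eventually_sequentially)
      show "\<exists>y. True \<and> fst x < fst y \<and> snd x < snd y \<and> I (E (snd x)) (fst y) < e \<and> I (- E (snd y)) (fst y) < e"
        using n m by (intro exI[of _ "(n,m)"]) auto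
    qed auto
    then obtain g :: "nat \<Rightarrow> nat \<times> nat" where g: "\<And>j. fst (g j) < fst (g (Suc j))" "\<And>j. snd (g j) < snd (g (Suc j))"
        "\<And>j. I (E (snd (g j))) (fst (g (Suc j))) < e" "\<And>j. I (- E (snd (g (Suc j)))) (fst (g (Suc j))) < e" by auto
    define D where "D j = E (snd (g (Suc j))) - E (snd (g j))" for j
    have D_meas[measurable]: "D j \<in> sets borel" for j unfolding D_def by measurable
    have disj: "disjoint_family D"
      unfolding D_def by (rule disjoint_family_Suc) (rule E_mono[OF less_imp_le[OF g(2)]])
    have D_small: "I (- D j) (fst (g (Suc j))) \<le> 2 * e" for j
    proof -
      have "I (- D j) (fst (g (Suc j))) \<le> I (E (snd (g j)) \<union> - E (snd (g (Suc j)))) (fst (g (Suc j)))"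
        by (rule I_mono) (auto simp: D_def)
      also have "\<dots> \<le> I (E (snd (g j))) (fst (g (Suc j))) + I (- E (snd (g (Suc j)))) (fst (g (Suc j)))"
        by (rule I_sub) auto
      finally show ?thesis using g(3,4)[of j] by simp
    qed
    \<comment> \<open>Along \<open>Suc (2*k)\<close> the hump \<open>D (2*k)\<close> lies inside
      \<open>A\<close>, so little mass is left outside \<open>A\<close>; along
      \<open>Suc (Suc (2*k))\<close> the hump is disjoint from \<open>A\<close>, so little mass is
      left inside.\<close>
    define A where "A = (\<Union>k. D (2 * k))"
    have A_meas[measurable]: "A \<in> sets borel" unfolding A_def by measurable
    have re_int: "Re (LINT s:B|lborel. b n s) \<le> 0" if "B \<in> sets borel" for B n
    proof -
      have "Re (LINT s:B|lborel. b n s) = (LINT s|lborel. Re (indicator B s *\<^sub>R b n s))"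
        using sint[OF that, of n] unfolding set_lebesgue_integral_def set_integrable_def
        by (rule integral_Re[symmetric])
      also have "\<dots> = - (LINT s|lborel. - Re (indicator B s *\<^sub>R b n s))" by simp
      also have "\<dots> \<le> - (0::real)"
        using re by (intro le_imp_neg_le Bochner_Integration.integral_nonneg) (auto split: split_indicator)
      finally show ?thesis by simp
    qed
    have mono: "strict_mono (\<lambda>j. fst (g j))" using g(1) by (simp add: strict_mono_Suc_iff)
    have even: "cmod (exp (LINT s:A|lborel. b (fst (g (Suc (2*k)))) s) - exp (LINT s:UNIV|lborel. b (fst (g (Suc (2*k)))) s)) \<le> 2 * e" for k
    proof -
      let ?n = "fst (g (Suc (2*k)))"
      have "(LINT s:A \<union> - A|lborel. b ?n s) = (LINT s:A|lborel. b ?n s) + (LINT s:- A|lborel. b ?n s)"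
        by (rule set_integral_Un) (auto intro: sint)
      then have "(LINT s:UNIV|lborel. b ?n s) = (LINT s:A|lborel. b ?n s) + (LINT s:- A|lborel. b ?n s)" by simp
      then have "cmod (exp (LINT s:A|lborel. b ?n s) - exp (LINT s:UNIV|lborel. b ?n s)) \<le> cmod (LINT s:- A|lborel. b ?n s)"
        using cmod_exp_diff_le[OF re_int re_int, of A UNIV ?n ?n] by (simp add: norm_minus_commute)
      also have "\<dots> \<le> I (- A) ?n" by (rule I_bound) auto
      also have "\<dots> \<le> I (- D (2*k)) ?n" by (rule I_mono) (auto simp: A_def)
      also have "\<dots> \<le> 2 * e" by (rule D_small)
      finally show ?thesis .
    qed
    have odd: "cmod (exp (LINT s:A|lborel. b (fst (g (Suc (Suc (2*k))))) s) - 1) \<le> 2 * e" for k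
    proof -
      let ?n = "fst (g (Suc (Suc (2*k))))"
      have "D (Suc (2*k)) \<inter> D (2 * i) = {}" for i
      proof -
        have "Suc (2*k) \<noteq> 2 * i" by presburger
        then show ?thesis using disj unfolding disjoint_family_on_def by blast
      qed
      then have "A \<subseteq> - D (Suc (2*k))" by (auto simp: A_def)
      then have *: "I A ?n \<le> I (- D (Suc (2*k))) ?n" by (intro I_mono) auto
      have "cmod (exp (LINT s:A|lborel. b ?n s) - exp 0) \<le> cmod ((LINT s:A|lborel. b ?n s) - 0)"
        by (rule cmod_exp_diff_le) (auto intro: re_int)
      also have "\<dots> \<le> I A ?n" using I_bound[of A ?n] by simp
      also note * also have "I (- D (Suc (2*k))) ?n \<le> 2 * e" by (rule D_small)
      finally show ?thesis by simp
    qed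
    have c1: "(\<lambda>k. exp (LINT s:B|lborel. b (fst (g (Suc (2*k)))) s)) \<longlonglongrightarrow> l B" if "B \<in> sets borel" for B
      using LIMSEQ_subseq_LIMSEQ[OF conv[OF that] strict_mono_o[OF mono, of "\<lambda>k. Suc (2*k)"]]
      by (simp add: strict_mono_def comp_def)
    have c2: "(\<lambda>k. exp (LINT s:B|lborel. b (fst (g (Suc (Suc (2*k))))) s)) \<longlonglongrightarrow> l B" if "B \<in> sets borel" for B
      using LIMSEQ_subseq_LIMSEQ[OF conv[OF that] strict_mono_o[OF mono, of "\<lambda>k. Suc (Suc (2*k))"]]
      by (simp add: strict_mono_def comp_def)
    have "cmod (l A - l UNIV) \<le> 2 * e"
    proof (rule LIMSEQ_le_const2)
      show "(\<lambda>k. cmod (exp (LINT s:A|lborel. b (fst (g (Suc (2*k)))) s) - exp (LINT s:UNIV|lborel. b (fst (g (Suc (2*k)))) s)))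
          \<longlonglongrightarrow> cmod (l A - l UNIV)"
        by (intro tendsto_norm tendsto_diff c1 A_meas) simp
    qed (use even in blast)
    moreover have "cmod (l A - 1) \<le> 2 * e"
    proof (rule LIMSEQ_le_const2)
      show "(\<lambda>k. cmod (exp (LINT s:A|lborel. b (fst (g (Suc (Suc (2*k))))) s) - 1)) \<longlonglongrightarrow> cmod (l A - 1)"
        by (intro tendsto_norm tendsto_diff c2 A_meas tendsto_const)
    qed (use odd in blast)
    ultimately show ?thesis
      using norm_triangle_ineq[of "l UNIV - l A" "l A - 1"] by (simp add: norm_minus_commute)
  qed
  have "cmod (l UNIV - 1) \<le> 0"
  proof (rule field_le_epsilon)
    fix e :: real assume "e > 0"
    then show "cmod (l UNIV - 1) \<le> 0 + e" using main[of "e/4"] by simp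
  qed
  then show ?thesis by simp
qed

subsection \<open>Convergence in probability\<close>

lemma (in prob_space) tendsto_in_probI_L1:
  assumes "\<And>n. integrable M (Y n)" "integrable M L" "(\<lambda>n. expectation (\<lambda>\<omega>. \<bar>Y n \<omega> - L \<omega>\<bar>)) \<longlonglongrightarrow> 0"
  shows "tendsto_in_prob M Y L"
  unfolding tendsto_in_prob_def
proof (intro conjI allI impI)
  show "Y n \<in> borel_measurable M" "L \<in> borel_measurable M" for n using assms by auto
  fix e :: real assume e: "e > 0"
  show "(\<lambda>n. measure M {\<omega> \<in> space M. e < \<bar>Y n \<omega> - L \<omega>\<bar>}) \<longlonglongrightarrow> 0"
  proof (rule tendsto_sandwich[OF _ _ tendsto_const])
    have "measure M {\<omega> \<in> space M. e < \<bar>Y n \<omega> - L \<omega>\<bar>} \<le> expectation (\<lambda>\<omega>. \<bar>Y n \<omega> - L \<omega>\<bar>) / e" for n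
    proof -
      have [measurable]: "Y n \<in> borel_measurable M" "L \<in> borel_measurable M" using assms by auto
      have "measure M {\<omega> \<in> space M. e < \<bar>Y n \<omega> - L \<omega>\<bar>} \<le> measure M {\<omega> \<in> space M. e \<le> \<bar>Y n \<omega> - L \<omega>\<bar>}"
        by (intro finite_measure_mono) auto
      also have "\<dots> \<le> expectation (\<lambda>\<omega>. \<bar>Y n \<omega> - L \<omega>\<bar>) / e"
        by (rule integral_Markov_inequality_measure[where A="space M", simplified]) (use e assms in auto)
      finally show ?thesis .
    qed
    then show "\<forall>\<^sub>F n in sequentially. measure M {\<omega> \<in> space M. e < \<bar>Y n \<omega> - L \<omega>\<bar>} \<le> expectation (\<lambda>\<omega>. \<bar>Y n \<omega> - L \<omega>\<bar>) / e"
      by simp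
    show "(\<lambda>n. expectation (\<lambda>\<omega>. \<bar>Y n \<omega> - L \<omega>\<bar>) / e) \<longlonglongrightarrow> 0"
      using tendsto_divide[OF assms(3) tendsto_const[of e]] e by simp
  qed simp
qed

lemma tendsto_in_prob_measurable:
  assumes "tendsto_in_prob M Y L"
  shows "Y n \<in> borel_measurable M" "L \<in> borel_measurable M"
  using assms unfolding tendsto_in_prob_def by auto

lemma tendsto_in_prob_cong:
  assumes lim: "tendsto_in_prob M Y L"
    and AE: "\<And>n. AE \<omega> in M. Y n \<omega> = Y' n \<omega>" "AE \<omega> in M. L \<omega> = L' \<omega>"
    and [measurable]: "\<And>n. Y' n \<in> borel_measurable M" "L' \<in> borel_measurable M"
  shows "tendsto_in_prob M Y' L'"
  unfolding tendsto_in_prob_def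
proof (intro conjI allI impI)
  fix e :: real assume "e > 0"
  have [measurable]: "Y n \<in> borel_measurable M" "L \<in> borel_measurable M" for n
    using tendsto_in_prob_measurable[OF lim] by auto
  have "measure M {\<omega> \<in> space M. e < \<bar>Y n \<omega> - L \<omega>\<bar>} = measure M {\<omega> \<in> space M. e < \<bar>Y' n \<omega> - L' \<omega>\<bar>}" for n
    using AE(1)[of n] AE(2) by (intro measure_eq_AE) auto
  then show "(\<lambda>n. measure M {\<omega> \<in> space M. e < \<bar>Y' n \<omega> - L' \<omega>\<bar>}) \<longlonglongrightarrow> 0"
    using lim \<open>e > 0\<close> unfolding tendsto_in_prob_def by auto
qed auto

lemma (in prob_space) tendsto_in_prob_add:
  assumes "tendsto_in_prob M Y L" "tendsto_in_prob M W K"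
  shows "tendsto_in_prob M (\<lambda>n \<omega>. Y n \<omega> + W n \<omega>) (\<lambda>\<omega>. L \<omega> + K \<omega>)"
  unfolding tendsto_in_prob_def
proof (intro conjI allI impI)
  have [measurable]: "Y n \<in> borel_measurable M" "L \<in> borel_measurable M" "W n \<in> borel_measurable M" "K \<in> borel_measurable M" for n
    using tendsto_in_prob_measurable[OF assms(1)] tendsto_in_prob_measurable[OF assms(2)] by auto
  show "(\<lambda>\<omega>. Y n \<omega> + W n \<omega>) \<in> borel_measurable M" "(\<lambda>\<omega>. L \<omega> + K \<omega>) \<in> borel_measurable M" for n
    by measurable
  fix e :: real assume e: "e > 0"
  show "(\<lambda>n. measure M {\<omega> \<in> space M. e < \<bar>(Y n \<omega> + W n \<omega>) - (L \<omega> + K \<omega>)\<bar>}) \<longlonglongrightarrow> 0"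
  proof (rule tendsto_sandwich[OF _ _ tendsto_const])
    have "measure M {\<omega> \<in> space M. e < \<bar>(Y n \<omega> + W n \<omega>) - (L \<omega> + K \<omega>)\<bar>}
       \<le> measure M {\<omega> \<in> space M. e/2 < \<bar>Y n \<omega> - L \<omega>\<bar>} + measure M {\<omega> \<in> space M. e/2 < \<bar>W n \<omega> - K \<omega>\<bar>}" for n
    proof -
      have "measure M {\<omega> \<in> space M. e < \<bar>(Y n \<omega> + W n \<omega>) - (L \<omega> + K \<omega>)\<bar>}
        \<le> measure M ({\<omega> \<in> space M. e/2 < \<bar>Y n \<omega> - L \<omega>\<bar>} \<union> {\<omega> \<in> space M. e/2 < \<bar>W n \<omega> - K \<omega>\<bar>})"
      proof (intro finite_measure_mono subsetI)
        fix \<omega> assume "\<omega> \<in> {\<omega> \<in> space M. e < \<bar>(Y n \<omega> + W n \<omega>) - (L \<omega> + K \<omega>)\<bar>}"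
        then show "\<omega> \<in> {\<omega> \<in> space M. e/2 < \<bar>Y n \<omega> - L \<omega>\<bar>} \<union> {\<omega> \<in> space M. e/2 < \<bar>W n \<omega> - K \<omega>\<bar>}"
          using abs_triangle_ineq[of "Y n \<omega> - L \<omega>" "W n \<omega> - K \<omega>"] by (auto simp: add_diff_add)
      qed auto
      also have "\<dots> \<le> measure M {\<omega> \<in> space M. e/2 < \<bar>Y n \<omega> - L \<omega>\<bar>} + measure M {\<omega> \<in> space M. e/2 < \<bar>W n \<omega> - K \<omega>\<bar>}"
        by (intro measure_Un_le) auto
      finally show ?thesis .
    qed
    then show "\<forall>\<^sub>F n in sequentially. measure M {\<omega> \<in> space M. e < \<bar>(Y n \<omega> + W n \<omega>) - (L \<omega> + K \<omega>)\<bar>}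
       \<le> measure M {\<omega> \<in> space M. e/2 < \<bar>Y n \<omega> - L \<omega>\<bar>} + measure M {\<omega> \<in> space M. e/2 < \<bar>W n \<omega> - K \<omega>\<bar>}" by simp
    have "(\<lambda>n. measure M {\<omega> \<in> space M. e/2 < \<bar>Y n \<omega> - L \<omega>\<bar>} + measure M {\<omega> \<in> space M. e/2 < \<bar>W n \<omega> - K \<omega>\<bar>}) \<longlonglongrightarrow> 0 + 0"
      using assms half_gt_zero[OF e] unfolding tendsto_in_prob_def by (intro tendsto_add) blast+
    then show "(\<lambda>n. measure M {\<omega> \<in> space M. e/2 < \<bar>Y n \<omega> - L \<omega>\<bar>} + measure M {\<omega> \<in> space M. e/2 < \<bar>W n \<omega> - K \<omega>\<bar>}) \<longlonglongrightarrow> 0"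
      by simp
  qed simp
qed

lemma tendsto_in_prob_cmult:
  assumes "tendsto_in_prob M Y L"
  shows "tendsto_in_prob M (\<lambda>n \<omega>. c * Y n \<omega>) (\<lambda>\<omega>. c * L \<omega>)"
proof (cases "c = 0")
  case True
  then show ?thesis by (simp add: tendsto_in_prob_def)
next
  case False
  have [measurable]: "Y n \<in> borel_measurable M" "L \<in> borel_measurable M" for n
    using tendsto_in_prob_measurable[OF assms] by auto
  have "{\<omega> \<in> space M. e < \<bar>c * Y n \<omega> - c * L \<omega>\<bar>} = {\<omega> \<in> space M. e / \<bar>c\<bar> < \<bar>Y n \<omega> - L \<omega>\<bar>}" for n e
  proof -
    have "\<bar>c * Y n \<omega> - c * L \<omega>\<bar> = \<bar>c\<bar> * \<bar>Y n \<omega> - L \<omega>\<bar>" for \<omega>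
      by (simp only: abs_mult right_diff_distrib[symmetric])
    then show ?thesis using False by (simp add: pos_divide_less_eq mult.commute)
  qed
  then show ?thesis
    using assms False unfolding tendsto_in_prob_def by auto
qed

lemma (in prob_space) tendsto_in_prob_diff:
  assumes "tendsto_in_prob M Y L" "tendsto_in_prob M W K"
  shows "tendsto_in_prob M (\<lambda>n \<omega>. Y n \<omega> - W n \<omega>) (\<lambda>\<omega>. L \<omega> - K \<omega>)"
  using tendsto_in_prob_add[OF assms(1) tendsto_in_prob_cmult[OF assms(2), of "-1"]] by simp

lemma cmod_iexp_diff_le: "cmod (iexp x - iexp y) \<le> \<bar>x - y\<bar>"
proof -
  have "cmod (\<i> * x - \<i> * y) = cmod (\<i> * complex_of_real (x - y))" by (simp add: algebra_simps)
  then show ?thesis using cmod_exp_diff_le[of "\<i> * x" "\<i> * y"] by (simp add: norm_mult del: of_real_diff)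
qed

lemma (in prob_space) tendsto_in_prob_char:
  assumes "tendsto_in_prob M Y L"
  shows "(\<lambda>n. CLINT \<omega>|M. iexp (\<theta> * Y n \<omega>)) \<longlonglongrightarrow> (CLINT \<omega>|M. iexp (\<theta> * L \<omega>))"
proof (rule metric_LIMSEQ_I)
  have [measurable]: "Y n \<in> borel_measurable M" "L \<in> borel_measurable M" for n
    using tendsto_in_prob_measurable[OF assms] by auto
  fix r :: real assume r: "r > 0"
  \<comment> \<open>The summand 1 covers \<theta> = 0. Off \<open>?B n\<close> the Lipschitz bound
    gives at most r/2; on it the trivial bound 2 is used.\<close>
  define e where "e = r / (2 * (\<bar>\<theta>\<bar> + 1))"
  have e: "e > 0" "\<bar>\<theta>\<bar> * e \<le> r / 2" using r by (auto simp: e_def field_simps)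
  let ?B = "\<lambda>n. {\<omega> \<in> space M. e < \<bar>Y n \<omega> - L \<omega>\<bar>}"
  have bound: "dist (CLINT \<omega>|M. iexp (\<theta> * Y n \<omega>)) (CLINT \<omega>|M. iexp (\<theta> * L \<omega>)) \<le> r / 2 + 2 * measure M (?B n)" for n
  proof -
    have int: "complex_integrable M (\<lambda>\<omega>. iexp (\<theta> * Y n \<omega>))" "complex_integrable M (\<lambda>\<omega>. iexp (\<theta> * L \<omega>))"
      by (auto intro!: integrable_const_bound[where B=1])
    have intB: "integrable M (\<lambda>\<omega>. r / 2 + 2 * indicator (?B n) \<omega>)"
      by (rule Bochner_Integration.integrable_add) (auto simp: less_top[symmetric])
    have "dist (CLINT \<omega>|M. iexp (\<theta> * Y n \<omega>)) (CLINT \<omega>|M. iexp (\<theta> * L \<omega>))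
        = cmod (CLINT \<omega>|M. iexp (\<theta> * Y n \<omega>) - iexp (\<theta> * L \<omega>))"
      unfolding dist_norm by (simp only: Bochner_Integration.integral_diff[OF int])
    also have "\<dots> \<le> expectation (\<lambda>\<omega>. cmod (iexp (\<theta> * Y n \<omega>) - iexp (\<theta> * L \<omega>)))"
      by (rule integral_norm_bound)
    also have "\<dots> \<le> expectation (\<lambda>\<omega>. r / 2 + 2 * indicator (?B n) \<omega>)"
    proof (rule integral_mono)
      fix \<omega> assume "\<omega> \<in> space M"
      have 1: "cmod (iexp (\<theta> * Y n \<omega>) - iexp (\<theta> * L \<omega>)) \<le> 2"
        using norm_triangle_ineq4[of "iexp (\<theta> * Y n \<omega>)" "iexp (\<theta> * L \<omega>)"] by simp
      have 2: "cmod (iexp (\<theta> * Y n \<omega>) - iexp (\<theta> * L \<omega>)) \<le> \<bar>\<theta>\<bar> * \<bar>Y n \<omega> - L \<omega>\<bar>"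
        using cmod_iexp_diff_le[of "\<theta> * Y n \<omega>" "\<theta> * L \<omega>"] by (simp only: abs_mult right_diff_distrib[symmetric])
      show "cmod (iexp (\<theta> * Y n \<omega>) - iexp (\<theta> * L \<omega>)) \<le> r / 2 + 2 * indicator (?B n) \<omega>"
      proof (cases "\<omega> \<in> ?B n")
        case True then show ?thesis using 1 r by simp
      next
        case False
        then have "\<bar>Y n \<omega> - L \<omega>\<bar> \<le> e" using \<open>\<omega> \<in> space M\<close> by simp
        then have "\<bar>\<theta>\<bar> * \<bar>Y n \<omega> - L \<omega>\<bar> \<le> \<bar>\<theta>\<bar> * e" by (intro mult_left_mono) auto
        then show ?thesis using 2 e(2) False by simp
      qed
    next
      show "integrable M (\<lambda>\<omega>. cmod (iexp (\<theta> * Y n \<omega>) - iexp (\<theta> * L \<omega>)))"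
        by (intro integrable_norm Bochner_Integration.integrable_diff int)
      show "integrable M (\<lambda>\<omega>. r / 2 + 2 * indicator (?B n) \<omega>)"
        by (rule intB)
    qed
    also have "\<dots> = (LINT \<omega>|M. r / 2) + (LINT \<omega>|M. 2 * indicator (?B n) \<omega>)"
      by (rule Bochner_Integration.integral_add) (auto simp: less_top[symmetric])
    also have "\<dots> = r / 2 + 2 * measure M (?B n)"
      by (simp add: prob_space Int_absorb1)
    finally show ?thesis .
  qed
  have "(\<lambda>n. measure M (?B n)) \<longlonglongrightarrow> 0" using assms e(1) unfolding tendsto_in_prob_def by blast
  then have "eventually (\<lambda>n. measure M (?B n) < r / 4) sequentially"
    using r by (intro order_tendstoD) auto
  then obtain N where N: "\<And>n. n \<ge> N \<Longrightarrow> measure M (?B n) < r / 4" by (auto simp: eventually_sequentially)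
  show "\<exists>N. \<forall>n\<ge>N. dist (CLINT \<omega>|M. iexp (\<theta> * Y n \<omega>)) (CLINT \<omega>|M. iexp (\<theta> * L \<omega>)) < r"
  proof (intro exI allI impI)
    fix n assume "n \<ge> N"
    then show "dist (CLINT \<omega>|M. iexp (\<theta> * Y n \<omega>)) (CLINT \<omega>|M. iexp (\<theta> * L \<omega>)) < r"
      using bound[of n] N[of n] by linarith
  qed
qed

text \<open>The limit is an almost sure limit along a subsequence; Fatou's lemma then carries the
  Cauchy estimate over to the distance from this limit, for the whole sequence.\<close>

lemma L1_complete:
  fixes Y :: "nat \<Rightarrow> 'a \<Rightarrow> real"
  assumes int: "\<And>n. integrable M (Y n)"
    and cauchy: "\<And>e. e > 0 \<Longrightarrow> \<exists>N. \<forall>i\<ge>N. \<forall>j\<ge>N. (LINT x|M. \<bar>Y i x - Y j x\<bar>) < e"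
  obtains L where "integrable M L" "(\<lambda>n. LINT x|M. \<bar>Y n x - L x\<bar>) \<longlonglongrightarrow> 0"
proof -
  have [measurable]: "Y n \<in> borel_measurable M" for n using int by auto
  have "\<exists>N. \<forall>i\<ge>N. \<forall>j\<ge>N. (LINT x|M. norm (Y i x - Y j x)) < e" if "e > 0" for e
    using cauchy[OF that] by simp
  then obtain r where r: "strict_mono r" "AE x in M. Cauchy (\<lambda>i. Y (r i) x)"
    by (rule cauchy_L1_AE_cauchy_subseq[OF int])
  define L where "L x = lim (\<lambda>i. Y (r i) x)" for x
  have [measurable]: "L \<in> borel_measurable M" unfolding L_def by measurable
  have L: "AE x in M. (\<lambda>i. Y (r i) x) \<longlonglongrightarrow> L x"
    using r(2) by eventually_elim (simp add: L_def Cauchy_convergent_iff convergent_LIMSEQ_iff)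
  have bound: "(\<integral>\<^sup>+x. \<bar>Y n x - L x\<bar> \<partial>M) \<le> ennreal e" if e: "e > 0" and N: "\<forall>i\<ge>N. \<forall>j\<ge>N. (LINT x|M. \<bar>Y i x - Y j x\<bar>) < e" "n \<ge> N" for n N e
  proof -
    have "(\<integral>\<^sup>+x. \<bar>Y n x - L x\<bar> \<partial>M) = (\<integral>\<^sup>+x. liminf (\<lambda>i. ennreal \<bar>Y n x - Y (r i) x\<bar>) \<partial>M)"
    proof (rule nn_integral_cong_AE, use L in eventually_elim)
      case (elim x)
      then have "(\<lambda>i. ennreal \<bar>Y n x - Y (r i) x\<bar>) \<longlonglongrightarrow> ennreal \<bar>Y n x - L x\<bar>"
        by (intro tendsto_ennrealI tendsto_rabs tendsto_diff tendsto_const)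
      then show ?case by (rule lim_imp_Liminf[OF sequentially_bot, symmetric])
    qed
    also have "\<dots> \<le> liminf (\<lambda>i. \<integral>\<^sup>+x. ennreal \<bar>Y n x - Y (r i) x\<bar> \<partial>M)"
      by (rule nn_integral_liminf) auto
    also have "\<dots> \<le> liminf (\<lambda>i. ennreal e)"
    proof (rule Liminf_mono)
      have "eventually (\<lambda>i. i \<ge> N) sequentially" by (rule eventually_ge_at_top)
      then show "\<forall>\<^sub>F i in sequentially. (\<integral>\<^sup>+x. ennreal \<bar>Y n x - Y (r i) x\<bar> \<partial>M) \<le> ennreal e"
      proof eventually_elim
        case (elim i)
        then have "r i \<ge> N" using seq_suble[OF r(1), of i] by simp
        then have "(LINT x|M. \<bar>Y n x - Y (r i) x\<bar>) < e" using N by blast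
        then show ?case using int by (subst nn_integral_eq_integral) (auto intro!: ennreal_leI)
      qed
    qed
    also have "\<dots> = ennreal e" by (simp add: Liminf_const)
    finally show ?thesis .
  qed
  have int_diff: "integrable M (\<lambda>x. Y n x - L x)" if "e > 0" "\<forall>i\<ge>N. \<forall>j\<ge>N. (LINT x|M. \<bar>Y i x - Y j x\<bar>) < e" "n \<ge> N" for n N e
    using bound[OF that] by (intro integrableI_bounded) (auto intro: le_less_trans)
  obtain N1 where N1: "\<forall>i\<ge>N1. \<forall>j\<ge>N1. (LINT x|M. \<bar>Y i x - Y j x\<bar>) < 1" using cauchy[of 1] by auto
  have intL: "integrable M L"
    using Bochner_Integration.integrable_diff[OF int[of N1] int_diff[OF _ N1, of N1]] by simp
  have "(\<lambda>n. LINT x|M. \<bar>Y n x - L x\<bar>) \<longlonglongrightarrow> 0"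
  proof (rule metric_LIMSEQ_I)
    fix e :: real assume e: "e > 0"
    obtain N where N: "\<forall>i\<ge>N. \<forall>j\<ge>N. (LINT x|M. \<bar>Y i x - Y j x\<bar>) < e / 2" using cauchy[of "e/2"] e by auto
    show "\<exists>N. \<forall>n\<ge>N. dist (LINT x|M. \<bar>Y n x - L x\<bar>) 0 < e"
    proof (intro exI allI impI)
      fix n assume n: "n \<ge> N"
      have "ennreal (LINT x|M. \<bar>Y n x - L x\<bar>) \<le> ennreal (e / 2)"
        using bound[OF _ N n] e int intL by (subst nn_integral_eq_integral[symmetric]) auto
      then show "dist (LINT x|M. \<bar>Y n x - L x\<bar>) 0 < e"
        using e by simp
    qed
  qed
  with intL show ?thesis by (rule that)
qed

subsection \<open>Multivariate characteristic functions\<close>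

text \<open>The nonnegative weights \<open>1 + cos Y\<close> and \<open>1 + sin Y\<close> reduce the uniqueness of multivariate
  characteristic functions to Levy's one-dimensional theorem, one coordinate at a time.\<close>

lemma (in prob_space) weighted_integral_eq_of_char:
  fixes w w' X X' :: "'a \<Rightarrow> real"
  assumes [measurable]: "w \<in> borel_measurable M" "w' \<in> borel_measurable M"
      "X \<in> borel_measurable M" "X' \<in> borel_measurable M"
    and int: "integrable M w" "integrable M w'"
    and nn: "\<And>\<omega>. 0 \<le> w \<omega>" "\<And>\<omega>. 0 \<le> w' \<omega>"
    and eq: "\<And>\<theta>. (CLINT \<omega>|M. w \<omega> *\<^sub>R iexp (\<theta> * X \<omega>)) = (CLINT \<omega>|M. w' \<omega> *\<^sub>R iexp (\<theta> * X' \<omega>))"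
    and B[measurable]: "B \<in> sets borel"
  shows "(LINT \<omega>|M. w \<omega> * indicator B (X \<omega>)) = (LINT \<omega>|M. w' \<omega> * indicator B (X' \<omega>))"
proof -
  \<comment> \<open>Evaluation at \<theta> = 0 shows that both weights have the same total mass.
    Dividing by it yields probability measures, to which uniqueness applies; if the mass is 0, both
    weights vanish almost surely.\<close>
  define c where "c = (LINT \<omega>|M. w \<omega>)"
  have "complex_of_real (LINT \<omega>|M. w \<omega>) = complex_of_real (LINT \<omega>|M. w' \<omega>)"
    using eq[of 0] unfolding integral_complex_of_real[symmetric] by (simp add: scaleR_conv_of_real)
  then have c': "c = (LINT \<omega>|M. w' \<omega>)" unfolding c_def by (simp only: of_real_eq_iff)
  have c0: "c \<ge> 0" unfolding c_def using nn by (intro Bochner_Integration.integral_nonneg) auto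
  define D where "D w X = distr (density M (\<lambda>\<omega>. ennreal (w \<omega> / c))) borel X" for w X :: "'a \<Rightarrow> real"
  have D: "real_distribution (D w X)" "char (D w X) \<theta> = (1 / c) *\<^sub>R (CLINT \<omega>|M. w \<omega> *\<^sub>R iexp (\<theta> * X \<omega>))"
      "measure (D w X) B = (1 / c) * (LINT \<omega>|M. w \<omega> * indicator B (X \<omega>))"
    if c: "c > 0" "c = (LINT \<omega>|M. w \<omega>)" and int: "integrable M w" and nn: "\<And>\<omega>. 0 \<le> w \<omega>" and [measurable]: "X \<in> borel_measurable M"
    for w X \<theta>
  proof -
    have [measurable]: "w \<in> borel_measurable M" using int by auto
    have "emeasure (density M (\<lambda>\<omega>. ennreal (w \<omega> / c))) (space M) = (\<integral>\<^sup>+\<omega>. ennreal (w \<omega> / c) \<partial>M)"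
      by (subst emeasure_density) (auto intro!: nn_integral_cong)
    also have "\<dots> = ennreal (LINT \<omega>|M. w \<omega> / c)"
      using int nn c(1) by (intro nn_integral_eq_integral) auto
    also have "(LINT \<omega>|M. w \<omega> / c) = 1" using c by simp
    finally have "prob_space (density M (\<lambda>\<omega>. ennreal (w \<omega> / c)))"
      by (intro prob_spaceI) simp
    then interpret P: prob_space "density M (\<lambda>\<omega>. ennreal (w \<omega> / c))" .
    show "real_distribution (D w X)" unfolding D_def by (rule P.real_distribution_distr) simp
    have "char (D w X) \<theta> = (CLINT \<omega>|M. (w \<omega> / c) *\<^sub>R iexp (\<theta> * X \<omega>))"
      unfolding D_def char_def using nn c(1)
      by (subst integral_distr, simp, simp, subst integral_density) auto
    also have "\<dots> = (CLINT \<omega>|M. (1 / c) *\<^sub>R (w \<omega> *\<^sub>R iexp (\<theta> * X \<omega>)))" by simp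
    also have "\<dots> = (1 / c) *\<^sub>R (CLINT \<omega>|M. w \<omega> *\<^sub>R iexp (\<theta> * X \<omega>))"
      by (rule integral_scaleR_right)
    finally show "char (D w X) \<theta> = (1 / c) *\<^sub>R (CLINT \<omega>|M. w \<omega> *\<^sub>R iexp (\<theta> * X \<omega>))" .
    have "measure (D w X) B = (LINT x|D w X. indicator B x)" by (simp add: D_def)
    also have "\<dots> = (LINT \<omega>|M. (w \<omega> / c) *\<^sub>R indicator B (X \<omega>))"
      unfolding D_def using nn c(1)
      by (subst integral_distr, simp, simp, subst integral_density) auto
    also have "\<dots> = (LINT \<omega>|M. (1 / c) *\<^sub>R (w \<omega> * indicator B (X \<omega>)))" by simp
    also have "\<dots> = (1 / c) *\<^sub>R (LINT \<omega>|M. w \<omega> * indicator B (X \<omega>))"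
      by (rule integral_scaleR_right)
    finally show "measure (D w X) B = (1 / c) * (LINT \<omega>|M. w \<omega> * indicator B (X \<omega>))" by simp
  qed
  show ?thesis
  proof (cases "c = 0")
    case True
    have "AE \<omega> in M. w \<omega> = 0" "AE \<omega> in M. w' \<omega> = 0"
      using integral_nonneg_eq_0_iff_AE[OF int(1)] integral_nonneg_eq_0_iff_AE[OF int(2)] nn True c' c_def by auto
    then have "AE \<omega> in M. w \<omega> * indicator B (X \<omega>) = 0" "AE \<omega> in M. w' \<omega> * indicator B (X' \<omega>) = 0" by auto
    then show ?thesis by (simp add: integral_eq_zero_AE)
  next
    case False
    then have c: "c > 0" using c0 by simp
    note D = D[OF c c_def int(1) nn(1) assms(3)] D[OF c c' int(2) nn(2) assms(4)]
    have "char (D w X) = char (D w' X')" by (rule ext) (simp only: D eq)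
    then have "D w X = D w' X'" using D by (intro Levy_uniqueness) auto
    then show ?thesis using D c by simp
  qed
qed

text \<open>One coordinate \<open>X\<close> passes from the exponential to an indicator while the
  others, collected in \<open>Y\<close>, stay in the exponential. Since
  \<open>iexp (Y \<omega>)\<close> is not a nonnegative weight, its real and imaginary parts are
  obtained from nonnegative weights by subtracting the contribution of \<open>W\<close>
  alone.\<close>

lemma (in prob_space) weighted_char_indicator_eq:
  fixes X X' Y Y' W W' :: "'a \<Rightarrow> real"
  assumes [measurable]: "W \<in> borel_measurable M" "W' \<in> borel_measurable M"
      "X \<in> borel_measurable M" "X' \<in> borel_measurable M" "Y \<in> borel_measurable M" "Y' \<in> borel_measurable M"
    and W: "\<And>\<omega>. 0 \<le> W \<omega> \<and> W \<omega> \<le> 1" "\<And>\<omega>. 0 \<le> W' \<omega> \<and> W' \<omega> \<le> 1"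
    and eq: "\<And>\<theta> c. (CLINT \<omega>|M. W \<omega> *\<^sub>R iexp (\<theta> * X \<omega> + c * Y \<omega>)) = (CLINT \<omega>|M. W' \<omega> *\<^sub>R iexp (\<theta> * X' \<omega> + c * Y' \<omega>))"
    and B[measurable]: "B \<in> sets borel"
  shows "(CLINT \<omega>|M. (W \<omega> * indicator B (X \<omega>)) *\<^sub>R iexp (Y \<omega>)) = (CLINT \<omega>|M. (W' \<omega> * indicator B (X' \<omega>)) *\<^sub>R iexp (Y' \<omega>))"
proof -
  have intW: "complex_integrable M (\<lambda>\<omega>. W \<omega> *\<^sub>R iexp (Z \<omega>))" "complex_integrable M (\<lambda>\<omega>. W' \<omega> *\<^sub>R iexp (Z \<omega>))"
    if [measurable]: "Z \<in> borel_measurable M" for Z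
    using W by (auto intro!: integrable_const_bound[where B=1])
  have intr: "integrable M (\<lambda>\<omega>. W \<omega> * h \<omega>)" "integrable M (\<lambda>\<omega>. W' \<omega> * h \<omega>)"
    if [measurable]: "h \<in> borel_measurable M" and h: "\<And>\<omega>. \<bar>h \<omega>\<bar> \<le> 2" for h
    using W mult_mono[OF _ h, of _ 1] by (auto intro!: integrable_const_bound[where B=2] simp: abs_mult)
  \<comment> \<open>Euler's formulas: multiplied by \<open>iexp x\<close>, the weights become
    combinations of exponentials with c = 0, 1, -1, all of which are covered by
    \<open>eq\<close>.\<close>
  have cos_id: "(W0 * (1 + cos y)) *\<^sub>R iexp x = W0 *\<^sub>R iexp (x + 0 * y) + (1/2) *\<^sub>R (W0 *\<^sub>R iexp (x + 1 * y) + W0 *\<^sub>R iexp (x + (-1) * y))"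
    and sin_id: "(W0 * (1 + sin y)) *\<^sub>R iexp x = W0 *\<^sub>R iexp (x + 0 * y) + (- (\<i>/2)) * (W0 *\<^sub>R iexp (x + 1 * y) - W0 *\<^sub>R iexp (x + (-1) * y))"
    for W0 x y :: real
    unfolding cis_conv_exp[symmetric]
    by (simp_all add: complex_eq_iff cos_add sin_add cos_diff sin_diff algebra_simps add_divide_distrib diff_divide_distrib Re_divide Im_divide)
  have cb: "0 \<le> 1 + cos x" "- cos x \<le> 3" "0 \<le> 1 + sin x" "- sin x \<le> 3" for x :: real
    using cos_ge_minus_one[of x] sin_ge_minus_one[of x] by linarith+
  have C: "(LINT \<omega>|M. (W \<omega> * (1 + cos (Y \<omega>))) * indicator B (X \<omega>)) = (LINT \<omega>|M. (W' \<omega> * (1 + cos (Y' \<omega>))) * indicator B (X' \<omega>))"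
  proof (rule weighted_integral_eq_of_char)
    fix \<theta>
    show "(CLINT \<omega>|M. (W \<omega> * (1 + cos (Y \<omega>))) *\<^sub>R iexp (\<theta> * X \<omega>)) = (CLINT \<omega>|M. (W' \<omega> * (1 + cos (Y' \<omega>))) *\<^sub>R iexp (\<theta> * X' \<omega>))"
      unfolding cos_id
      by (simp only: Bochner_Integration.integral_add Bochner_Integration.integrable_add integral_scaleR_right integrable_scaleR_right intW eq
          borel_measurable_add borel_measurable_times borel_measurable_const assms(3-6))
  qed (use W in \<open>auto intro!: intr mult_nonneg_nonneg simp: abs_le_iff cb\<close>)
  have S: "(LINT \<omega>|M. (W \<omega> * (1 + sin (Y \<omega>))) * indicator B (X \<omega>)) = (LINT \<omega>|M. (W' \<omega> * (1 + sin (Y' \<omega>))) * indicator B (X' \<omega>))"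
  proof (rule weighted_integral_eq_of_char)
    fix \<theta>
    show "(CLINT \<omega>|M. (W \<omega> * (1 + sin (Y \<omega>))) *\<^sub>R iexp (\<theta> * X \<omega>)) = (CLINT \<omega>|M. (W' \<omega> * (1 + sin (Y' \<omega>))) *\<^sub>R iexp (\<theta> * X' \<omega>))"
      unfolding sin_id
      by (simp only: Bochner_Integration.integral_add Bochner_Integration.integral_diff Bochner_Integration.integrable_add 
           Bochner_Integration.integrable_diff integral_mult_right_zero integrable_mult_right intW eq
          borel_measurable_add borel_measurable_times borel_measurable_const assms(3-6))
  qed (use W in \<open>auto intro!: intr mult_nonneg_nonneg simp: abs_le_iff cb\<close>)
  have O: "(LINT \<omega>|M. W \<omega> * indicator B (X \<omega>)) = (LINT \<omega>|M. W' \<omega> * indicator B (X' \<omega>))"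
  proof (rule weighted_integral_eq_of_char)
    show "(CLINT \<omega>|M. W \<omega> *\<^sub>R iexp (\<theta> * X \<omega>)) = (CLINT \<omega>|M. W' \<omega> *\<^sub>R iexp (\<theta> * X' \<omega>))" for \<theta>
      using eq[of \<theta> 0] by simp
  qed (use W in \<open>auto intro!: integrable_const_bound[where B=1]\<close>)
  define V V' where "V \<omega> = W \<omega> * indicator B (X \<omega>)" and "V' \<omega> = W' \<omega> * indicator B (X' \<omega>)" for \<omega>
  have V[measurable]: "V \<in> borel_measurable M" "V' \<in> borel_measurable M" unfolding V_def V'_def by measurable
  have V01: "0 \<le> V \<omega> \<and> V \<omega> \<le> 1" "0 \<le> V' \<omega> \<and> V' \<omega> \<le> 1" for \<omega>
    using W by (auto simp: V_def V'_def split: split_indicator)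
  have intV: "integrable M (\<lambda>\<omega>. U \<omega> * h \<omega>)"
    if [measurable]: "h \<in> borel_measurable M" "U \<in> borel_measurable M" and h: "\<And>\<omega>. \<bar>h \<omega>\<bar> \<le> 1" and U: "\<And>\<omega>. 0 \<le> U \<omega> \<and> U \<omega> \<le> 1" for h U :: "'a \<Rightarrow> real"
  proof -
    have "\<bar>U \<omega>\<bar> * \<bar>h \<omega>\<bar> \<le> 1 * 1" for \<omega> using U h by (intro mult_mono) auto
    then show ?thesis by (auto intro!: integrable_const_bound[where B=1] simp: abs_mult)
  qed
  have split: "(CLINT \<omega>|M. U \<omega> *\<^sub>R iexp (Z \<omega>)) = complex_of_real (LINT \<omega>|M. U \<omega> * cos (Z \<omega>)) + \<i> * complex_of_real (LINT \<omega>|M. U \<omega> * sin (Z \<omega>))"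
    if [measurable]: "Z \<in> borel_measurable M" "U \<in> borel_measurable M" and U: "\<And>\<omega>. 0 \<le> U \<omega> \<and> U \<omega> \<le> 1" for Z U :: "'a \<Rightarrow> real"
  proof -
    have i: "integrable M (\<lambda>\<omega>. U \<omega> * cos (Z \<omega>))" "integrable M (\<lambda>\<omega>. U \<omega> * sin (Z \<omega>))"
      by (rule intV; use U in simp)+
    have j1: "complex_integrable M (\<lambda>\<omega>. complex_of_real (U \<omega> * cos (Z \<omega>)))"
      and j2: "complex_integrable M (\<lambda>\<omega>. \<i> * complex_of_real (U \<omega> * sin (Z \<omega>)))"
      by (intro integrable_mult_right integrable_of_real i)+
    have "(CLINT \<omega>|M. U \<omega> *\<^sub>R iexp (Z \<omega>)) = (CLINT \<omega>|M. complex_of_real (U \<omega> * cos (Z \<omega>)) + \<i> * complex_of_real (U \<omega> * sin (Z \<omega>)))"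
      unfolding cis_conv_exp[symmetric] by (intro Bochner_Integration.integral_cong) (auto simp: complex_eq_iff)
    also have "\<dots> = complex_of_real (LINT \<omega>|M. U \<omega> * cos (Z \<omega>)) + \<i> * complex_of_real (LINT \<omega>|M. U \<omega> * sin (Z \<omega>))"
      by (simp only: Bochner_Integration.integral_add[OF j1 j2] integral_mult_right_zero integral_complex_of_real)
    finally show ?thesis .
  qed
  have lin: "(LINT \<omega>|M. U \<omega> * (1 + h \<omega>)) = (LINT \<omega>|M. U \<omega>) + (LINT \<omega>|M. U \<omega> * h \<omega>)"
    if [measurable]: "h \<in> borel_measurable M" "U \<in> borel_measurable M" and h: "\<And>\<omega>. \<bar>h \<omega>\<bar> \<le> 1" and U: "\<And>\<omega>. 0 \<le> U \<omega> \<and> U \<omega> \<le> 1" for h U :: "'a \<Rightarrow> real"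
    using intV[OF that] intV[OF borel_measurable_const[of 1] that(2) _ U] by (simp add: distrib_left)
  have "(LINT \<omega>|M. V \<omega> * cos (Y \<omega>)) = (LINT \<omega>|M. V' \<omega> * cos (Y' \<omega>))"
    using C O lin[OF _ V(1) _ V01(1), of "\<lambda>\<omega>. cos (Y \<omega>)"] lin[OF _ V(2) _ V01(2), of "\<lambda>\<omega>. cos (Y' \<omega>)"]
    by (simp add: V_def V'_def mult_ac)
  moreover have "(LINT \<omega>|M. V \<omega> * sin (Y \<omega>)) = (LINT \<omega>|M. V' \<omega> * sin (Y' \<omega>))"
    using S O lin[OF _ V(1) _ V01(1), of "\<lambda>\<omega>. sin (Y \<omega>)"] lin[OF _ V(2) _ V01(2), of "\<lambda>\<omega>. sin (Y' \<omega>)"]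
    by (simp add: V_def V'_def mult_ac)
  ultimately show ?thesis
    using split[OF _ V(1) V01(1), of Y] split[OF _ V(2) V01(2), of Y'] by (simp add: V_def V'_def)
qed

lemma (in prob_space) distr_PiM_eq_of_char:
  fixes X X' :: "'i \<Rightarrow> 'a \<Rightarrow> real"
  assumes fin: "finite J"
    and X[measurable]: "\<And>j. X j \<in> borel_measurable M" "\<And>j. X' j \<in> borel_measurable M"
    and eq: "\<And>a. (CLINT \<omega>|M. iexp (\<Sum>j\<in>J. a j * X j \<omega>)) = (CLINT \<omega>|M. iexp (\<Sum>j\<in>J. a j * X' j \<omega>))"
  shows "distr M (\<Pi>\<^sub>M j\<in>J. borel) (\<lambda>\<omega>. \<lambda>j\<in>J. X j \<omega>) = distr M (\<Pi>\<^sub>M j\<in>J. borel) (\<lambda>\<omega>. \<lambda>j\<in>J. X' j \<omega>)"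
proof -
  \<comment> \<open>Coordinates in \<open>S\<close> already carry indicators, the others are still
    in the exponential. The coefficients \<open>a\<close> stay arbitrary because the induction step
    changes them; S = J gives the probabilities of rectangles.\<close>
  have main: "(CLINT \<omega>|M. (\<Prod>j\<in>S. indicator (B j) (X j \<omega>) :: real) *\<^sub>R iexp (\<Sum>j\<in>J - S. a j * X j \<omega>))
     = (CLINT \<omega>|M. (\<Prod>j\<in>S. indicator (B j) (X' j \<omega>) :: real) *\<^sub>R iexp (\<Sum>j\<in>J - S. a j * X' j \<omega>))"
    if "S \<subseteq> J" "\<And>j. B j \<in> sets borel" for S a B
    using finite_subset[OF that(1) fin] that(1)
  proof (induction S arbitrary: a rule: finite_induct)
    case empty
    then show ?case using eq by simp
  next
    case (insert i S)
    define T where "T = J - insert i S"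
    have T: "J - S = insert i T" "i \<notin> T" "finite T" using insert fin by (auto simp: T_def)
    have [measurable]: "B j \<in> sets borel" for j using that by simp
    have P01: "0 \<le> (\<Prod>j\<in>S. indicator (B j) (Z j) :: real) \<and> (\<Prod>j\<in>S. indicator (B j) (Z j) :: real) \<le> 1" for Z
      by (auto intro!: prod_nonneg prod_le_1)
    have IH: "(CLINT \<omega>|M. (\<Prod>j\<in>S. indicator (B j) (X j \<omega>) :: real) *\<^sub>R iexp (\<theta> * X i \<omega> + c * (\<Sum>j\<in>T. a j * X j \<omega>)))
     = (CLINT \<omega>|M. (\<Prod>j\<in>S. indicator (B j) (X' j \<omega>) :: real) *\<^sub>R iexp (\<theta> * X' i \<omega> + c * (\<Sum>j\<in>T. a j * X' j \<omega>)))" for \<theta> c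
    proof -
      have "(\<Sum>j\<in>insert i T. (if j = i then \<theta> else c * a j) * Z j) = \<theta> * Z i + c * (\<Sum>j\<in>T. a j * Z j)" for Z :: "'i \<Rightarrow> real"
      proof -
        have "(\<Sum>j\<in>T. (if j = i then \<theta> else c * a j) * Z j) = (\<Sum>j\<in>T. c * (a j * Z j))"
          using T(2) by (intro sum.cong) auto
        then show ?thesis using T by (simp add: sum_distrib_left)
      qed
      then show ?thesis
        using insert.IH[of "\<lambda>j. if j = i then \<theta> else c * a j"] insert.prems unfolding T(1) by simp
    qed
    have "(CLINT \<omega>|M. ((\<Prod>j\<in>S. indicator (B j) (X j \<omega>)) * indicator (B i) (X i \<omega>) :: real) *\<^sub>R iexp (\<Sum>j\<in>T. a j * X j \<omega>))
     = (CLINT \<omega>|M. ((\<Prod>j\<in>S. indicator (B j) (X' j \<omega>)) * indicator (B i) (X' i \<omega>) :: real) *\<^sub>R iexp (\<Sum>j\<in>T. a j * X' j \<omega>))"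
      by (rule weighted_char_indicator_eq) (use IH P01 in auto)
    then show ?case using insert.hyps by (simp add: T_def mult.commute)
  qed
  interpret P: prob_space "distr M (\<Pi>\<^sub>M j\<in>J. borel) (\<lambda>\<omega>. \<lambda>j\<in>J. X j \<omega>)"
    by (rule prob_space_distr) measurable
  show ?thesis
  proof (rule measure_eqI_PiM_finite[OF fin])
    fix B :: "'i \<Rightarrow> real set" assume B: "\<And>i. i \<in> J \<Longrightarrow> B i \<in> sets borel"
    \<comment> \<open>\<open>main\<close> asks for measurable sets at every index, hence the value
      \<open>UNIV\<close> outside \<open>J\<close>.\<close>
    have emb: "emeasure (distr M (\<Pi>\<^sub>M j\<in>J. borel) (\<lambda>\<omega>. \<lambda>j\<in>J. Z j \<omega>)) (Pi\<^sub>E J B)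
        = ennreal (Re (CLINT \<omega>|M. (\<Prod>j\<in>J. indicator (if j \<in> J then B j else UNIV) (Z j \<omega>) :: real) *\<^sub>R iexp (\<Sum>j\<in>J - J. 0 * Z j \<omega>)))"
      if [measurable]: "\<And>j. Z j \<in> borel_measurable M" for Z :: "'i \<Rightarrow> 'a \<Rightarrow> real"
    proof -
      let ?E = "(\<lambda>\<omega>. \<lambda>j\<in>J. Z j \<omega>) -` (Pi\<^sub>E J B) \<inter> space M"
      have PB: "Pi\<^sub>E J B \<in> sets (\<Pi>\<^sub>M j\<in>J. borel)" using B fin by (intro sets_PiM_I_finite) auto
      have "(\<Prod>j\<in>J. indicator (if j \<in> J then B j else UNIV) (Z j \<omega>) :: real) = indicator ?E \<omega>" if "\<omega> \<in> space M" for \<omega>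
        using that fin by (auto simp: indicator_def prod.If_cases PiE_iff intro!: prod_zero)
      then have "(CLINT \<omega>|M. (\<Prod>j\<in>J. indicator (if j \<in> J then B j else UNIV) (Z j \<omega>) :: real) *\<^sub>R iexp (\<Sum>j\<in>J - J. 0 * Z j \<omega>))
          = (CLINT \<omega>|M. complex_of_real (indicator ?E \<omega>))"
        by (intro Bochner_Integration.integral_cong) (auto simp: scaleR_conv_of_real)
      also have "\<dots> = complex_of_real (measure M ?E)"
        unfolding integral_complex_of_real using measurable_sets[OF _ PB, of "\<lambda>\<omega>. \<lambda>j\<in>J. Z j \<omega>" M] by simp
      finally show ?thesis
        by (subst emeasure_distr) (auto simp: emeasure_eq_measure PB)
    qed
    show "emeasure (distr M (\<Pi>\<^sub>M j\<in>J. borel) (\<lambda>\<omega>. \<lambda>j\<in>J. X j \<omega>)) (Pi\<^sub>E J B) = emeasure (distr M (\<Pi>\<^sub>M j\<in>J. borel) (\<lambda>\<omega>. \<lambda>j\<in>J. X' j \<omega>)) (Pi\<^sub>E J B)"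
      unfolding emb[OF X(1)] emb[OF X(2)]
      using B by (subst main) auto
  next
    show "range (\<lambda>i::nat. \<Pi>\<^sub>E j\<in>J. UNIV) \<subseteq> prod_algebra J (\<lambda>_. borel :: real measure)"
      using fin by (auto intro!: prod_algebraI_finite)
    show "(\<Union>i::nat. \<Pi>\<^sub>E j\<in>J. UNIV) = space (\<Pi>\<^sub>M j\<in>J. (borel :: real measure))" by (simp add: space_PiM)
  qed auto
qed

subsection \<open>Uniqueness of quasi Ornstein-Uhlenbeck processes\<close>

lemma interval_integrable_Icc_iff:
  fixes f :: "real \<Rightarrow> real"
  assumes "a \<le> b"
  shows "interval_lebesgue_integrable lborel (ereal a) (ereal b) f \<longleftrightarrow> set_integrable lborel {a..b} f"
proof -
  have "set_integrable lborel {a<..<b} f \<longleftrightarrow> set_integrable lborel {a..b} f"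
    by (rule set_integrable_discrete_difference[where X="{a, b}"]) auto
  then show ?thesis using assms by (simp add: interval_lebesgue_integrable_def)
qed

text \<open>Regularity is bootstrapped from the equation: a locally integrable \<open>D\<close> is
  affine in its own indefinite integral, hence continuous, hence differentiable, and then
  \<open>D t * exp (lam * t)\<close> has derivative 0.\<close>

lemma linear_integral_equation_unique:
  fixes D :: "real \<Rightarrow> real"
  assumes int: "\<And>t. interval_lebesgue_integrable lborel 0 (ereal t) D"
    and eq: "\<And>t. D t = D 0 - lam * (LBINT s=0..ereal t. D s)"
  shows "D t = D 0 * exp (- lam * t)"
proof -
  have deriv: "(D has_real_derivative - lam * D t) (at t)" for t
  proof -
    \<comment> \<open>An interval with both 0 and t in its interior allows a single antiderivative
      based at -K, whatever the sign of t.\<close>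
    define K where "K = \<bar>t\<bar> + 1"
    have K: "K > 0" "t \<in> {-K<..<K}" by (auto simp: K_def)
    have intK: "set_integrable lborel {-K..K} D"
    proof -
      have "set_integrable lborel {0..K} D" using int[of K] K(1) by (simp add: zero_ereal_def interval_integrable_Icc_iff)
      moreover have "set_integrable lborel {-K..0} D"
        using int[of "-K"] K(1) interval_integrable_endpoints_reverse[of "ereal (-K)" "ereal 0" D]
        by (simp add: zero_ereal_def interval_integrable_Icc_iff del: uminus_ereal.simps)
      ultimately have "set_integrable lborel ({-K..0} \<union> {0..K}) D" by (intro set_integrable_Un) auto
      moreover have "{-K..0} \<union> {0..K} = {-K..K}" using K(1) by auto
      ultimately show ?thesis by simp
    qed
    have hk: "D integrable_on {-K..K}" by (rule set_borel_integral_eq_integral(1)[OF intK])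
    have eqK: "D x = D 0 - lam * (integral {-K..x} D - integral {-K..0} D)" if x: "x \<in> {-K..K}" for x
    proof -
      have sub: "set_integrable lborel {-K..y} D" if "y \<le> K" for y
        by (rule set_integrable_subset[OF intK]) (use that in auto)
      have "(LBINT s=ereal (-K)..ereal 0. D s) + (LBINT s=ereal 0..ereal x. D s) = (LBINT s=ereal (-K)..ereal x. D s)"
      proof (rule interval_integral_sum)
        have "min (- K) (min 0 x) = - K" "max (-K) (max 0 x) \<le> K" "-K \<le> max (-K) (max 0 x)" using x K by auto
        then show "interval_lebesgue_integrable lborel (min (ereal (- K)) (min (ereal 0) (ereal x))) (max (ereal (- K)) (max (ereal 0) (ereal x))) D"
          using sub by (simp add: interval_integrable_Icc_iff flip: ereal_min ereal_max)
      qed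
      moreover have "(LBINT s=ereal (-K)..ereal 0. D s) = integral {-K..0} D" "(LBINT s=ereal (-K)..ereal x. D s) = integral {-K..x} D"
        using x K sub by (auto intro!: interval_integral_eq_integral)
      ultimately have "(LBINT s=0..ereal x. D s) = integral {-K..x} D - integral {-K..0} D" by (simp add: zero_ereal_def)
      then show ?thesis using eq[of x] by simp
    qed
    have "continuous_on {-K..K} (\<lambda>x. D 0 - lam * (integral {-K..x} D - integral {-K..0} D))"
      by (intro continuous_intros indefinite_integral_continuous_1 hk)
    then have "continuous_on {-K..K} D" by (rule continuous_on_eq) (rule eqK[symmetric])
    then have "((\<lambda>x. integral {-K..x} D) has_real_derivative D t) (at t within {-K..K})"
      using K(2) by (intro integral_has_real_derivative) auto
    then have "((\<lambda>x. integral {-K..x} D) has_real_derivative D t) (at t)"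
      using K(2) by (subst (asm) at_within_interior) (auto simp: interior_atLeastAtMost_real)
    then have "((\<lambda>x. D 0 - lam * (integral {-K..x} D - integral {-K..0} D)) has_real_derivative - lam * D t) (at t)"
      by (auto intro!: derivative_eq_intros)
    then show ?thesis
    proof (rule has_field_derivative_transform_within_open[where S="{-K<..<K}"])
      show "D 0 - lam * (integral {-K..x} D - integral {-K..0} D) = D x" if "x \<in> {-K<..<K}" for x
        by (rule eqK[symmetric]) (use that in auto)
    qed (use K in auto)
  qed
  have "((\<lambda>t. D t * exp (lam * t)) has_real_derivative 0) (at x)" for x
    by (auto intro!: derivative_eq_intros deriv)
  then have "D t * exp (lam * t) = D 0 * exp (lam * 0)" by (intro DERIV_isconst_all) auto
  then show ?thesis by (simp add: exp_minus field_simps)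
qed

lemma stationary_process_distr:
  assumes "stationary_process M X"
  shows "distr M borel (X t) = distr M borel (X 0)"
proof -
  have X[measurable]: "X s \<in> borel_measurable M" for s using assms by (simp add: stationary_process_def)
  have *: "distr (distr M (\<Pi>\<^sub>M j\<in>{0::real}. borel) (\<lambda>\<omega>. \<lambda>j\<in>{0}. Y j \<omega>)) borel (\<lambda>f. f 0) = distr M borel (Y 0)"
    if [measurable]: "\<And>s. Y s \<in> borel_measurable M" for Y :: "real \<Rightarrow> 'a \<Rightarrow> real"
    by (subst distr_distr) (auto simp: comp_def)
  have "distr M (\<Pi>\<^sub>M j\<in>{0::real}. borel) (\<lambda>\<omega>. \<lambda>j\<in>{0}. X (j + t) \<omega>) = distr M (\<Pi>\<^sub>M j\<in>{0::real}. borel) (\<lambda>\<omega>. \<lambda>j\<in>{0}. X j \<omega>)"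
    using assms by (simp add: stationary_process_def same_fdd_def)
  then show ?thesis using *[of X] *[of "\<lambda>j. X (j + t)"] by simp
qed

lemma (in prob_space) tail_prob_tendsto_0:
  fixes X :: "'a \<Rightarrow> real"
  assumes [measurable]: "X \<in> borel_measurable M" and c: "filterlim c at_top sequentially"
  shows "(\<lambda>n. measure M {\<omega> \<in> space M. c n < \<bar>X \<omega>\<bar>}) \<longlonglongrightarrow> 0"
proof -
  have "(\<lambda>n. LINT \<omega>|M. indicator {\<omega> \<in> space M. c n < \<bar>X \<omega>\<bar>} \<omega>) \<longlonglongrightarrow> (LINT \<omega>|M. (0::real))"
  proof (rule integral_dominated_convergence[where w="\<lambda>_. 1"])
    show "AE \<omega> in M. (\<lambda>n. indicator {\<omega> \<in> space M. c n < \<bar>X \<omega>\<bar>} \<omega>) \<longlonglongrightarrow> (0::real)"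
    proof (rule AE_I2)
      fix \<omega> assume "\<omega> \<in> space M"
      have "eventually (\<lambda>n. c n > \<bar>X \<omega>\<bar>) sequentially" using c by (simp add: filterlim_at_top_dense)
      then have "eventually (\<lambda>n. indicator {\<omega> \<in> space M. c n < \<bar>X \<omega>\<bar>} \<omega> = (0::real)) sequentially"
        by eventually_elim auto
      then show "(\<lambda>n. indicator {\<omega> \<in> space M. c n < \<bar>X \<omega>\<bar>} \<omega>) \<longlonglongrightarrow> (0::real)" by (rule tendsto_eventually)
    qed
  qed (auto simp: indicator_def)
  then show ?thesis by simp
qed

lemma (in prob_space) qou_process_AE_unique:
  assumes X: "qou_process M N lam X" and Y: "qou_process M N lam Y" and lam: "lam > 0"
  shows "AE \<omega> in M. X t \<omega> = Y t \<omega>"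
proof -
  have stat: "stationary_process M X" "stationary_process M Y" using X Y by (auto simp: qou_process_def)
  have [measurable]: "X s \<in> borel_measurable M" "Y s \<in> borel_measurable M" for s using stat by (auto simp: stationary_process_def)
  have diff: "AE \<omega> in M. \<forall>t. X t \<omega> - Y t \<omega> = (X 0 \<omega> - Y 0 \<omega>) * exp (- lam * t)"
    using X[unfolded qou_process_def, THEN conjunct2] Y[unfolded qou_process_def, THEN conjunct2]
  proof eventually_elim
    case (elim \<omega>)
    show ?case
    proof (rule allI, rule linear_integral_equation_unique[where D="\<lambda>t. X t \<omega> - Y t \<omega>"])
      fix t
      have i: "interval_lebesgue_integrable lborel 0 (ereal t) (\<lambda>s. X s \<omega>)" "interval_lebesgue_integrable lborel 0 (ereal t) (\<lambda>s. Y s \<omega>)"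
        using elim by blast+
      show "interval_lebesgue_integrable lborel 0 (ereal t) (\<lambda>t. X t \<omega> - Y t \<omega>)"
        by (rule interval_lebesgue_integral_diff(1)[OF i])
      have "(LBINT s=0..ereal t. X s \<omega> - Y s \<omega>) = (LBINT s=0..ereal t. X s \<omega>) - (LBINT s=0..ereal t. Y s \<omega>)"
        by (rule interval_lebesgue_integral_diff(2)[OF i])
      moreover have "X t \<omega> = X 0 \<omega> - lam * (LBINT s=0..ereal t. X s \<omega>) + N t \<omega>"
        "Y t \<omega> = Y 0 \<omega> - lam * (LBINT s=0..ereal t. Y s \<omega>) + N t \<omega>" using elim by blast+
      ultimately show "X t \<omega> - Y t \<omega> = X 0 \<omega> - Y 0 \<omega> - lam * (LBINT s=0..ereal t. X s \<omega> - Y s \<omega>)"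
        by (simp add: right_diff_distrib)
    qed
  qed
  have P0: "measure M {\<omega> \<in> space M. e < \<bar>X 0 \<omega> - Y 0 \<omega>\<bar>} = 0" if e: "e > 0" for e
  proof -
    \<comment> \<open>If the difference at time 0 exceeds e, the one at time -n exceeds 2
      \<open>c n\<close>, so one of the two processes exceeds \<open>c n\<close> there. Stationarity
      moves that event to time 0, where its probability tends to 0.\<close>
    define c where "c n = e / 2 * exp (lam * real n)" for n
    have c: "filterlim c at_top sequentially"
      unfolding c_def
      by (rule filterlim_tendsto_pos_mult_at_top[OF tendsto_const _ filterlim_compose[OF exp_at_top
            filterlim_tendsto_pos_mult_at_top[OF tendsto_const lam filterlim_real_sequentially]]]) (use e in simp)
    have shift: "measure M {\<omega> \<in> space M. c n < \<bar>V (- real n) \<omega>\<bar>} = measure M {\<omega> \<in> space M. c n < \<bar>V 0 \<omega>\<bar>}"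
      if V: "stationary_process M V" for n V
    proof -
      have [measurable]: "V s \<in> borel_measurable M" for s using V by (auto simp: stationary_process_def)
      have "measure (distr M borel (V s)) {x. c n < \<bar>x\<bar>} = measure M {\<omega> \<in> space M. c n < \<bar>V s \<omega>\<bar>}" for s
        by (subst measure_distr) (auto intro!: arg_cong[where f="measure M"])
      from this[of 0] this[of "- real n"] show ?thesis using stationary_process_distr[OF V, of "- real n"] by simp
    qed
    have le: "measure M {\<omega> \<in> space M. e < \<bar>X 0 \<omega> - Y 0 \<omega>\<bar>}
        \<le> measure M {\<omega> \<in> space M. c n < \<bar>X 0 \<omega>\<bar>} + measure M {\<omega> \<in> space M. c n < \<bar>Y 0 \<omega>\<bar>}" for n
    proof -
      have "measure M {\<omega> \<in> space M. e < \<bar>X 0 \<omega> - Y 0 \<omega>\<bar>}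
          \<le> measure M ({\<omega> \<in> space M. c n < \<bar>X (- real n) \<omega>\<bar>} \<union> {\<omega> \<in> space M. c n < \<bar>Y (- real n) \<omega>\<bar>})"
      proof (rule finite_measure_mono_AE)
        show "AE \<omega> in M. \<omega> \<in> {\<omega> \<in> space M. e < \<bar>X 0 \<omega> - Y 0 \<omega>\<bar>} \<longrightarrow> \<omega> \<in> {\<omega> \<in> space M. c n < \<bar>X (- real n) \<omega>\<bar>} \<union> {\<omega> \<in> space M. c n < \<bar>Y (- real n) \<omega>\<bar>}"
          using diff
        proof eventually_elim
          case (elim \<omega>)
          have "X (- real n) \<omega> - Y (- real n) \<omega> = (X 0 \<omega> - Y 0 \<omega>) * exp (lam * real n)"
            using elim[rule_format, of "- real n"] by simp
          then have *: "\<bar>X (- real n) \<omega> - Y (- real n) \<omega>\<bar> = \<bar>X 0 \<omega> - Y 0 \<omega>\<bar> * exp (lam * real n)"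
            by (simp add: abs_mult)
          have "2 * c n < \<bar>X (- real n) \<omega>\<bar> + \<bar>Y (- real n) \<omega>\<bar>" if "e < \<bar>X 0 \<omega> - Y 0 \<omega>\<bar>"
          proof -
            have "2 * c n < \<bar>X 0 \<omega> - Y 0 \<omega>\<bar> * exp (lam * real n)" using that by (simp add: c_def)
            also have "\<dots> \<le> \<bar>X (- real n) \<omega>\<bar> + \<bar>Y (- real n) \<omega>\<bar>" unfolding *[symmetric] by (rule abs_triangle_ineq4)
            finally show ?thesis .
          qed
          then show ?case by auto
        qed
      qed auto
      also have "\<dots> \<le> measure M {\<omega> \<in> space M. c n < \<bar>X (- real n) \<omega>\<bar>} + measure M {\<omega> \<in> space M. c n < \<bar>Y (- real n) \<omega>\<bar>}"
        by (intro measure_Un_le) auto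
      finally show ?thesis by (simp add: shift stat)
    qed
    have "(\<lambda>n. measure M {\<omega> \<in> space M. c n < \<bar>X 0 \<omega>\<bar>} + measure M {\<omega> \<in> space M. c n < \<bar>Y 0 \<omega>\<bar>}) \<longlonglongrightarrow> 0 + 0"
      by (intro tendsto_add tail_prob_tendsto_0 c) auto
    then have "measure M {\<omega> \<in> space M. e < \<bar>X 0 \<omega> - Y 0 \<omega>\<bar>} \<le> 0 + 0"
      by (rule LIMSEQ_le_const) (use le in auto)
    then show ?thesis by (simp add: measure_le_0_iff)
  qed
  have "AE \<omega> in M. \<bar>X 0 \<omega> - Y 0 \<omega>\<bar> \<le> 1 / Suc n" for n :: nat
    using P0[of "1 / Suc n"] by (subst AE_iff_measurable[OF _ refl]) (auto simp: emeasure_eq_measure not_le)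
  then have "AE \<omega> in M. \<forall>n::nat. \<bar>X 0 \<omega> - Y 0 \<omega>\<bar> \<le> 1 / Suc n" by (simp add: AE_all_countable)
  with diff show ?thesis
  proof eventually_elim
    case (elim \<omega>)
    have "\<bar>X 0 \<omega> - Y 0 \<omega>\<bar> \<le> 0"
      by (rule LIMSEQ_le_const[OF LIMSEQ_Suc[OF lim_1_over_n]]) (use elim(2) in auto)
    then show ?case using elim(1)[rule_format, of t] by simp
  qed
qed

subsection \<open>The modular and the characteristic exponent\<close>

text \<open>A smooth convex function comparable to \<open>min (x\<^sup>2) \<bar>x\<bar>\<close>, which is not convex itself.\<close>

definition phi :: "real \<Rightarrow> real" where
  "phi x = sqrt (1 + x\<^sup>2) - 1"

lemma phi_0[simp]: "phi 0 = 0" and phi_minus[simp]: "phi (- x) = phi x"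
  by (simp_all add: phi_def)

lemma phi_nonneg[simp]: "0 \<le> phi x"
  by (simp add: phi_def)

lemma phi_measurable[measurable]: "phi \<in> borel_measurable borel"
  unfolding phi_def by measurable

lemma phi_mono: "\<bar>x\<bar> \<le> \<bar>y\<bar> \<Longrightarrow> phi x \<le> phi y"
  by (simp add: phi_def abs_le_square_iff)

text \<open>Rationalising the root makes the quadratic behaviour at 0 visible; several bounds below
  reduce to bounds for this denominator.\<close>

lemma phi_alt: "phi x = x\<^sup>2 / (1 + sqrt (1 + x\<^sup>2))"
proof -
  define r where "r = sqrt (1 + x\<^sup>2)"
  have "r \<ge> 0" "r * r = 1 + x\<^sup>2" by (simp_all add: r_def)
  then have "r - 1 = x\<^sup>2 / (1 + r)" by (simp add: field_simps)
  then show ?thesis by (simp add: phi_def r_def)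
qed

lemma phi_le_square: "phi x \<le> x\<^sup>2"
proof -
  have "x\<^sup>2 / (1 + sqrt (1 + x\<^sup>2)) \<le> x\<^sup>2 / 1" by (intro divide_left_mono) (auto intro: add_pos_nonneg)
  then show ?thesis by (simp add: phi_alt)
qed

lemma phi_le_abs: "phi x \<le> \<bar>x\<bar>"
proof -
  have "sqrt (1 + x\<^sup>2) \<le> sqrt ((1 + \<bar>x\<bar>)\<^sup>2)" by (intro real_sqrt_le_mono) (simp add: power2_eq_square algebra_simps)
  then show ?thesis by (simp add: phi_def)
qed

lemma phi_le_min: "phi x \<le> min (x\<^sup>2) \<bar>x\<bar>"
  using phi_le_square phi_le_abs by simp

lemma min_le_phi: "min (x\<^sup>2) \<bar>x\<bar> \<le> 3 * phi x"
proof (cases "\<bar>x\<bar> \<le> 1")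
  \<comment> \<open>The 3 bounds the denominator in \<open>phi_alt\<close>: it is at most 1 + 2 when
    |x| <= 1, and at most 2 + |x| <= 3 |x| otherwise.\<close>
  case True
  then have "x\<^sup>2 \<le> 1" by (simp add: abs_square_le_1)
  then have "sqrt (1 + x\<^sup>2) \<le> sqrt (2\<^sup>2)" by (intro real_sqrt_le_mono) simp
  then have "1 + sqrt (1 + x\<^sup>2) \<le> 3" by simp
  then have "x\<^sup>2 / 3 \<le> phi x" unfolding phi_alt by (intro divide_left_mono) (auto intro!: mult_pos_pos add_pos_nonneg)
  then show ?thesis by simp
next
  case False
  then have "1 \<le> \<bar>x\<bar>" by simp
  moreover have "sqrt (1 + x\<^sup>2) \<le> 1 + \<bar>x\<bar>" using phi_le_abs[of x] by (simp add: phi_def)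
  ultimately have "1 + sqrt (1 + x\<^sup>2) \<le> 3 * \<bar>x\<bar>" by simp
  then have "x\<^sup>2 / (3 * \<bar>x\<bar>) \<le> phi x" unfolding phi_alt using \<open>1 \<le> \<bar>x\<bar>\<close>
    by (intro divide_left_mono) (auto intro!: mult_pos_pos add_pos_nonneg)
  moreover have "x\<^sup>2 / (3 * \<bar>x\<bar>) = \<bar>x\<bar> / 3" by (cases "x \<ge> 0") (auto simp: power2_eq_square)
  ultimately show ?thesis by simp
qed

text \<open>In \<open>phi_alt\<close> the numerator scales by the square of c while the denominator
  can only increase. The quadratic growth of all later modulars comes from this doubling
  condition.\<close>

lemma phi_scale: "1 \<le> \<bar>c\<bar> \<Longrightarrow> phi (c * x) \<le> c\<^sup>2 * phi x"
proof -
  assume c: "1 \<le> \<bar>c\<bar>"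
  then have "1 * x\<^sup>2 \<le> c\<^sup>2 * x\<^sup>2" by (intro mult_right_mono) (auto simp: abs_square_le_1 abs_le_square_iff[of 1 c, simplified])
  then have "sqrt (1 + x\<^sup>2) \<le> sqrt (1 + (c * x)\<^sup>2)" by (simp add: power_mult_distrib)
  then have "(c * x)\<^sup>2 / (1 + sqrt (1 + (c * x)\<^sup>2)) \<le> (c * x)\<^sup>2 / (1 + sqrt (1 + x\<^sup>2))"
    by (intro divide_left_mono) (auto intro!: mult_pos_pos add_pos_nonneg)
  then show ?thesis by (simp add: phi_alt power_mult_distrib)
qed

text \<open>\<open>phi x + 1\<close> is the Euclidean norm of the point (1, x), so convexity is the
  triangle inequality in the plane.\<close>

lemma convex_phi: "convex_on UNIV phi"
proof (rule convex_onI)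
  fix t x y :: real assume t: "0 < t" "t < 1"
  have "norm ((1 - t) *\<^sub>R (1::real, x) + t *\<^sub>R (1, y)) \<le> norm ((1 - t) *\<^sub>R (1::real, x)) + norm (t *\<^sub>R (1::real, y))"
    by (rule norm_triangle_ineq)
  also have "\<dots> = (1 - t) * sqrt (1 + x\<^sup>2) + t * sqrt (1 + y\<^sup>2)"
    using t by (simp only: norm_scaleR) (simp add: norm_Pair)
  finally show "phi ((1 - t) *\<^sub>R x + t *\<^sub>R y) \<le> (1 - t) * phi x + t * phi y"
    by (simp add: norm_Pair phi_def algebra_simps)
qed simp

text \<open>A quadratic and a linear Taylor estimate are both at most twice the corresponding entry
  of the minimum; \<open>min_le_phi\<close> contributes the remaining factor 3.\<close>

lemma cmod_iexp_minus_le: "cmod (iexp x - 1 - \<i> * x) \<le> 6 * phi x"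
proof -
  have "cmod (iexp x - 1 - \<i> * x) \<le> \<bar>x\<bar>\<^sup>2 / 2"
    using iexp_approx1[of x 1] by (simp add: algebra_simps numeral_2_eq_2)
  moreover have "cmod (iexp x - 1 - \<i> * x) \<le> 2 * \<bar>x\<bar>"
    using iexp_approx2[of x 1] by (simp add: algebra_simps)
  moreover have "x\<^sup>2 / 2 \<le> 2 * x\<^sup>2" by simp
  ultimately have "cmod (iexp x - 1 - \<i> * x) \<le> 2 * x\<^sup>2" "cmod (iexp x - 1 - \<i> * x) \<le> 2 * \<bar>x\<bar>"
    unfolding power2_abs by linarith+
  then have "cmod (iexp x - 1 - \<i> * x) \<le> 2 * min (x\<^sup>2) \<bar>x\<bar>" by (simp add: min_def)
  then show ?thesis using min_le_phi[of x] by linarith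
qed

text \<open>Integrability of \<open>phi\<close> combines the Levy condition near 0 with a first
  moment of the large jumps, so that jumps can be compensated without truncation.\<close>

locale centered_levy_pair =
  fixes \<sigma> :: real and \<nu> :: "real measure"
  assumes sets_\<nu>[measurable_cong]: "sets \<nu> = sets borel"
    and integrable_phi: "integrable \<nu> phi"
    and \<nu>_0: "emeasure \<nu> {0} = 0"
begin

lemma integrable_phi_mult: "integrable \<nu> (\<lambda>u. phi (u * x))"
proof (rule Bochner_Integration.integrable_bound)
  show "integrable \<nu> (\<lambda>u. (max 1 \<bar>x\<bar>)\<^sup>2 * phi u)" by (intro integrable_mult_right integrable_phi)
  show "AE u in \<nu>. norm (phi (u * x)) \<le> norm ((max 1 \<bar>x\<bar>)\<^sup>2 * phi u)"
  proof (rule AE_I2)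
    fix u
    have "phi (u * x) \<le> phi (max 1 \<bar>x\<bar> * u)"
      by (intro phi_mono) (auto simp: abs_mult mult.commute[of "\<bar>u\<bar>"] intro!: mult_right_mono)
    also have "\<dots> \<le> (max 1 \<bar>x\<bar>)\<^sup>2 * phi u" by (rule phi_scale) simp
    finally show "norm (phi (u * x)) \<le> norm ((max 1 \<bar>x\<bar>)\<^sup>2 * phi u)" by simp
  qed
qed measurable

text \<open>An Orlicz function of the pair: even, convex, doubling, and comparable to the bracket in
  \<open>L_phi\<close>. Unlike that bracket it is real valued and admits Jensen's
  inequality.\<close>

definition k :: "real \<Rightarrow> real" where
  "k x = \<sigma>\<^sup>2 * x\<^sup>2 + (LINT u|\<nu>. phi (u * x))"

lemma k_0[simp]: "k 0 = 0" and k_minus[simp]: "k (- x) = k x"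
  by (simp_all add: k_def)

lemma k_nonneg[simp]: "0 \<le> k x"
  by (simp add: k_def Bochner_Integration.integral_nonneg)

lemma k_mono: "\<bar>x\<bar> \<le> \<bar>y\<bar> \<Longrightarrow> k x \<le> k y"
  unfolding k_def
  by (intro add_mono mult_left_mono integral_mono integrable_phi_mult phi_mono)
     (auto simp: abs_le_square_iff abs_mult intro: mult_left_mono)

lemma k_scale: "1 \<le> \<bar>c\<bar> \<Longrightarrow> k (c * x) \<le> c\<^sup>2 * k x"
proof -
  assume c: "1 \<le> \<bar>c\<bar>"
  have "(LINT u|\<nu>. phi (u * (c * x))) \<le> (LINT u|\<nu>. c\<^sup>2 * phi (u * x))"
    using phi_scale[OF c] by (intro integral_mono integrable_mult_right integrable_phi_mult) (auto simp: mult.left_commute[of _ c])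
  then show ?thesis by (simp add: k_def algebra_simps power_mult_distrib)
qed

lemma convex_k: "convex_on UNIV k"
proof (rule convex_onI)
  fix t x y :: real assume t: "0 < t" "t < 1"
  have "(LINT u|\<nu>. phi (u * ((1 - t) * x + t * y))) \<le> (LINT u|\<nu>. (1 - t) * phi (u * x) + t * phi (u * y))"
  proof (intro integral_mono integrable_phi_mult Bochner_Integration.integrable_add integrable_mult_right)
    fix u
    show "phi (u * ((1 - t) * x + t * y)) \<le> (1 - t) * phi (u * x) + t * phi (u * y)"
      using convex_onD[OF convex_phi, of t "u * x" "u * y"] t by (simp add: algebra_simps)
  qed
  also have "\<dots> = (1 - t) * (LINT u|\<nu>. phi (u * x)) + t * (LINT u|\<nu>. phi (u * y))"
    by (simp add: integrable_phi_mult)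
  finally have 1: "(LINT u|\<nu>. phi (u * ((1 - t) * x + t * y))) \<le> (1 - t) * (LINT u|\<nu>. phi (u * x)) + t * (LINT u|\<nu>. phi (u * y))" .
  have "(1 - t) * x\<^sup>2 + t * y\<^sup>2 - ((1 - t) * x + t * y)\<^sup>2 = t * (1 - t) * (x - y)\<^sup>2"
    by (simp add: power2_eq_square algebra_simps)
  then have "((1 - t) * x + t * y)\<^sup>2 \<le> (1 - t) * x\<^sup>2 + t * y\<^sup>2" using t
    by (smt (verit) mult_nonneg_nonneg zero_le_power2)
  then have "\<sigma>\<^sup>2 * ((1 - t) * x + t * y)\<^sup>2 \<le> \<sigma>\<^sup>2 * ((1 - t) * x\<^sup>2 + t * y\<^sup>2)" by (rule mult_left_mono) simp
  with 1 show "k ((1 - t) *\<^sub>R x + t *\<^sub>R y) \<le> (1 - t) * k x + t * k y"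
    by (simp add: k_def algebra_simps)
qed simp

lemma isCont_k: "isCont k x"
  using convex_on_continuous[OF open_UNIV convex_k] by (simp add: continuous_on_eq_continuous_at)

lemma k_measurable[measurable]: "k \<in> borel_measurable borel"
  by (intro borel_measurable_continuous_onI convex_on_continuous convex_k) simp

text \<open>Convexity is applied to x/(1-p) and y/p; rescaling costs the square of 1/(1-p) or 1/p,
  of which the convex weight regains one factor. The free weight p lets one step be added to N steps
  at an optimal cost.\<close>

lemma k_add_weighted:
  assumes "0 < p" "p < 1"
  shows "k (x + y) \<le> k x / (1 - p) + k y / p"
proof -
  have 1: "(1 - p) * k (x / (1 - p)) \<le> k x / (1 - p)"
  proof -
    have "(1 - p) * k ((1 / (1 - p)) * x) \<le> (1 - p) * ((1 / (1 - p))\<^sup>2 * k x)"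
      using assms by (intro mult_left_mono k_scale) auto
    then show ?thesis using assms by (simp add: power2_eq_square)
  qed
  have 2: "p * k (y / p) \<le> k y / p"
  proof -
    have "p * k ((1 / p) * y) \<le> p * ((1 / p)\<^sup>2 * k y)"
      using assms by (intro mult_left_mono k_scale) auto
    then show ?thesis using assms by (simp add: power2_eq_square)
  qed
  have "k (x + y) \<le> (1 - p) * k (x / (1 - p)) + p * k (y / p)"
    using convex_onD[OF convex_k, of p "x / (1 - p)" "y / p"] assms by simp
  with 1 2 show ?thesis by linarith
qed

lemma k_add: "k (x + y) \<le> 2 * (k x + k y)"
  using k_add_weighted[of "1/2" x y] by simp

lemma k_diff: "k (x - y) \<le> 2 * (k x + k y)"
  using k_add[of x "- y"] by simp

text \<open>By convexity and k 0 = 0 the quotient k x / x is nondecreasing for x > 0, so a nonzero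
  \<open>k\<close> grows at least linearly. Integrability of k(g) over a probability space therefore
  implies that of g.\<close>

lemma k_lower: "k 1 > 0 \<Longrightarrow> \<bar>x\<bar> \<le> 1 + k x / k 1"
proof (cases "\<bar>x\<bar> \<le> 1")
  case False
  assume k1: "k 1 > 0"
  have "k 1 \<le> (1 / \<bar>x\<bar>) * k \<bar>x\<bar>"
    using convex_onD[OF convex_k, of "1 / \<bar>x\<bar>" 0 "\<bar>x\<bar>"] False by (cases "x = 0") auto
  moreover have "k \<bar>x\<bar> = k x" by (simp add: abs_if)
  ultimately have "\<bar>x\<bar> * k 1 \<le> k x" using False by (simp add: field_simps)
  then show ?thesis using k1 by (simp add: field_simps)
next
  case True
  have "0 \<le> k x / k 1" by simp
  with True show ?thesis by linarith
qed

text \<open>The degenerate case. \<open>phi\<close> vanishes at 0 alone, and \<nu> has no mass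
  there, so a vanishing integral of \<open>phi\<close> leaves no jumps at all.\<close>

lemma k_1_eq_0D:
  assumes "k 1 = 0"
  shows "\<sigma> = 0" "AE u in \<nu>. False" "k x = 0"
proof -
  have "0 \<le> (LINT u|\<nu>. phi (u * 1))" by (intro Bochner_Integration.integral_nonneg) simp
  moreover have "\<sigma>\<^sup>2 + (LINT u|\<nu>. phi (u * 1)) = 0" using assms by (simp add: k_def)
  ultimately have s: "\<sigma>\<^sup>2 = 0" and i: "(LINT u|\<nu>. phi (u * 1)) = 0" using zero_le_power2[of \<sigma>] by linarith+
  show \<sigma>: "\<sigma> = 0" using s by simp
  have "AE u in \<nu>. phi u = 0"
    using i integral_nonneg_eq_0_iff_AE[OF integrable_phi_mult[of 1]] by simp
  moreover have "AE u in \<nu>. u \<noteq> 0"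
    by (rule AE_I[of _ _ "{0}"]) (use \<nu>_0 in auto)
  ultimately show ae: "AE u in \<nu>. False"
  proof eventually_elim
    case (elim u)
    have "0 < min (u\<^sup>2) \<bar>u\<bar>" using elim by simp
    with elim min_le_phi[of u] show ?case by simp
  qed
  have "(LINT u|\<nu>. phi (u * x)) = (LINT u|\<nu>. 0)"
    by (rule integral_cong_AE) (use ae in auto)
  then show "k x = 0" by (simp add: k_def s)
qed

lemma L_phi_iff: "g \<in> L_phi \<sigma> \<nu> \<longleftrightarrow> g \<in> borel_measurable borel \<and> (\<integral>\<^sup>+s. ennreal (k (g s)) \<partial>lborel) < \<infinity>"
proof -
  define m where "m x = ennreal (x\<^sup>2 * \<sigma>\<^sup>2) + (\<integral>\<^sup>+u. ennreal (min (\<bar>u * x\<bar>\<^sup>2) \<bar>u * x\<bar>) \<partial>\<nu>)" for x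
  have k_eq: "ennreal (k x) = ennreal (x\<^sup>2 * \<sigma>\<^sup>2) + (\<integral>\<^sup>+u. ennreal (phi (u * x)) \<partial>\<nu>)" for x
    unfolding k_def by (subst nn_integral_eq_integral[OF integrable_phi_mult])
      (auto simp: ennreal_plus Bochner_Integration.integral_nonneg mult.commute)
  have 1: "ennreal (k x) \<le> m x" for x
    unfolding k_eq m_def using phi_le_min by (intro add_mono nn_integral_mono order_refl ennreal_leI) simp
  have 2: "m x \<le> 3 * ennreal (k x)" for x
  proof -
    have "(\<integral>\<^sup>+u. ennreal (min (\<bar>u * x\<bar>\<^sup>2) \<bar>u * x\<bar>) \<partial>\<nu>) \<le> (\<integral>\<^sup>+u. 3 * ennreal (phi (u * x)) \<partial>\<nu>)"
    proof (intro nn_integral_mono)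
      fix u show "ennreal (min (\<bar>u * x\<bar>\<^sup>2) \<bar>u * x\<bar>) \<le> 3 * ennreal (phi (u * x))"
        using ennreal_leI[OF min_le_phi[of "u * x"]] by (simp add: ennreal_mult)
    qed
    also have "\<dots> = 3 * (\<integral>\<^sup>+u. ennreal (phi (u * x)) \<partial>\<nu>)" by (rule nn_integral_cmult) measurable
    moreover have "ennreal (x\<^sup>2 * \<sigma>\<^sup>2) \<le> 3 * ennreal (x\<^sup>2 * \<sigma>\<^sup>2)"
      by (simp flip: ennreal_numeral ennreal_mult)
    ultimately show ?thesis unfolding k_eq m_def distrib_left by (intro add_mono) auto
  qed
  have eq: "(\<integral>\<^sup>+s. m (g s) \<partial>lborel) < \<infinity> \<longleftrightarrow> (\<integral>\<^sup>+s. ennreal (k (g s)) \<partial>lborel) < \<infinity>"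
    if [measurable]: "g \<in> borel_measurable borel"
  proof
    assume "(\<integral>\<^sup>+s. m (g s) \<partial>lborel) < \<infinity>"
    then show "(\<integral>\<^sup>+s. ennreal (k (g s)) \<partial>lborel) < \<infinity>" by (rule le_less_trans[OF nn_integral_mono[OF 1]])
  next
    assume *: "(\<integral>\<^sup>+s. ennreal (k (g s)) \<partial>lborel) < \<infinity>"
    have "(\<integral>\<^sup>+s. m (g s) \<partial>lborel) \<le> (\<integral>\<^sup>+s. 3 * ennreal (k (g s)) \<partial>lborel)" using 2 by (intro nn_integral_mono)
    also have "\<dots> = 3 * (\<integral>\<^sup>+s. ennreal (k (g s)) \<partial>lborel)" by (rule nn_integral_cmult) measurable
    also have "\<dots> < \<infinity>" using * by (simp add: ennreal_mult_less_top)
    finally show "(\<integral>\<^sup>+s. m (g s) \<partial>lborel) < \<infinity>" .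
  qed
  have L: "g \<in> L_phi \<sigma> \<nu> \<longleftrightarrow> g \<in> borel_measurable borel \<and> (\<integral>\<^sup>+s. m (g s) \<partial>lborel) < \<infinity>"
    unfolding L_phi_def m_def mem_Collect_eq ..
  show ?thesis
  proof (cases "g \<in> borel_measurable borel")
    case True
    show ?thesis unfolding L using eq[OF True] by (simp only: True)
  next
    case False
    then show ?thesis unfolding L by (simp only: False simp_thms)
  qed
qed

text \<open>The Levy exponent with fully compensated jumps. There is no drift term: in this form the
  drift is the mean, which is 0 for a centered process.\<close>

definition Psi :: "real \<Rightarrow> complex" where
  "Psi \<theta> = of_real (- (\<sigma>\<^sup>2 * \<theta>\<^sup>2 / 2)) + (CLINT u|\<nu>. iexp (\<theta> * u) - 1 - \<i> * (\<theta> * u))"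

lemma integrable_Psi: "complex_integrable \<nu> (\<lambda>u. iexp (\<theta> * u) - 1 - \<i> * (\<theta> * u))"
proof (rule Bochner_Integration.integrable_bound)
  show "integrable \<nu> (\<lambda>u. 6 * phi (u * \<theta>))" by (intro integrable_mult_right integrable_phi_mult)
  show "AE u in \<nu>. cmod (iexp (\<theta> * u) - 1 - \<i> * (\<theta> * u)) \<le> norm (6 * phi (u * \<theta>))"
  proof (rule AE_I2)
    fix u show "cmod (iexp (\<theta> * u) - 1 - \<i> * (\<theta> * u)) \<le> norm (6 * phi (u * \<theta>))"
      using cmod_iexp_minus_le[of "\<theta> * u"] unfolding mult.commute[of u \<theta>] by simp
  qed
qed measurable

lemma Psi_0[simp]: "Psi 0 = 0"
  by (simp add: Psi_def)

lemma Re_Psi: "Re (Psi \<theta>) \<le> 0"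
proof -
  have "Re (CLINT u|\<nu>. iexp (\<theta> * u) - 1 - \<i> * (\<theta> * u)) = (LINT u|\<nu>. Re (iexp (\<theta> * u) - 1 - \<i> * (\<theta> * u)))"
    by (rule integral_Re[OF integrable_Psi, symmetric])
  also have "\<dots> = - (LINT u|\<nu>. 1 - cos (\<theta> * u))"
    by (simp add: Re_exp flip: Bochner_Integration.integral_minus)
  also have "\<dots> \<le> - (0::real)"
    by (intro le_imp_neg_le Bochner_Integration.integral_nonneg) simp
  moreover have "0 \<le> \<sigma>\<^sup>2 * \<theta>\<^sup>2 / 2" by simp
  ultimately show ?thesis unfolding Psi_def plus_complex.sel Re_complex_of_real by linarith
qed

lemma cmod_Psi_le: "cmod (Psi \<theta>) \<le> 6 * k \<theta>"
proof -
  have "cmod (CLINT u|\<nu>. iexp (\<theta> * u) - 1 - \<i> * (\<theta> * u)) \<le> (LINT u|\<nu>. cmod (iexp (\<theta> * u) - 1 - \<i> * (\<theta> * u)))"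
    by (rule integral_norm_bound)
  also have "\<dots> \<le> (LINT u|\<nu>. 6 * phi (u * \<theta>))"
  proof (intro integral_mono integrable_norm integrable_Psi integrable_mult_right integrable_phi_mult)
    fix u show "cmod (iexp (\<theta> * u) - 1 - \<i> * (\<theta> * u)) \<le> 6 * phi (u * \<theta>)"
      using cmod_iexp_minus_le[of "\<theta> * u"] unfolding mult.commute[of u \<theta>] by simp
  qed
  finally have 1: "cmod (CLINT u|\<nu>. iexp (\<theta> * u) - 1 - \<i> * (\<theta> * u)) \<le> 6 * (LINT u|\<nu>. phi (u * \<theta>))" by simp
  have "cmod (Psi \<theta>) \<le> cmod (of_real (- (\<sigma>\<^sup>2 * \<theta>\<^sup>2 / 2))) + cmod (CLINT u|\<nu>. iexp (\<theta> * u) - 1 - \<i> * (\<theta> * u))"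
    unfolding Psi_def by (rule norm_triangle_ineq)
  also have "cmod (of_real (- (\<sigma>\<^sup>2 * \<theta>\<^sup>2 / 2))) = \<sigma>\<^sup>2 * \<theta>\<^sup>2 / 2" by (simp only: norm_of_real) simp
  also have "\<sigma>\<^sup>2 * \<theta>\<^sup>2 / 2 \<le> 6 * (\<sigma>\<^sup>2 * \<theta>\<^sup>2)" by simp
  finally show ?thesis using 1 by (simp add: k_def)
qed

lemma isCont_Psi: "isCont Psi \<theta>"
  unfolding continuous_at_sequentially
proof (intro allI impI)
  fix x :: "nat \<Rightarrow> real" assume x: "x \<longlonglongrightarrow> \<theta>"
  then obtain K where K: "\<And>n. \<bar>x n\<bar> \<le> K"
    using convergent_imp_Bseq[of x] by (auto simp: convergent_def Bseq_def)
  have "(\<lambda>n. CLINT u|\<nu>. iexp (x n * u) - 1 - \<i> * (x n * u)) \<longlonglongrightarrow> (CLINT u|\<nu>. iexp (\<theta> * u) - 1 - \<i> * (\<theta> * u))"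
  proof (rule integral_dominated_convergence[where w="\<lambda>u. 6 * phi (u * K)"])
    show "integrable \<nu> (\<lambda>u. 6 * phi (u * K))" by (intro integrable_mult_right integrable_phi_mult)
    show "AE u in \<nu>. (\<lambda>n. iexp (x n * u) - 1 - \<i> * (x n * u)) \<longlonglongrightarrow> iexp (\<theta> * u) - 1 - \<i> * (\<theta> * u)"
    proof (rule AE_I2)
      fix u
      have "isCont (\<lambda>y. iexp (y * u) - 1 - \<i> * (y * u)) \<theta>" by (intro continuous_intros)
      from isCont_tendsto_compose[OF this x]
      show "(\<lambda>n. iexp (x n * u) - 1 - \<i> * (x n * u)) \<longlonglongrightarrow> iexp (\<theta> * u) - 1 - \<i> * (\<theta> * u)" .
    qed
    show "AE u in \<nu>. cmod (iexp (x n * u) - 1 - \<i> * (x n * u)) \<le> 6 * phi (u * K)" for n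
    proof (rule AE_I2)
      fix u
      have "phi (x n * u) \<le> phi (u * K)"
        using K[of n] by (intro phi_mono) (auto simp: abs_mult mult.commute[of "\<bar>u\<bar>"] intro!: mult_right_mono)
      then show "cmod (iexp (x n * u) - 1 - \<i> * (x n * u)) \<le> 6 * phi (u * K)"
        using cmod_iexp_minus_le[of "x n * u"] by simp
    qed
  qed measurable
  moreover have "(\<lambda>n. complex_of_real (- (\<sigma>\<^sup>2 * (x n)\<^sup>2 / 2))) \<longlonglongrightarrow> complex_of_real (- (\<sigma>\<^sup>2 * \<theta>\<^sup>2 / 2))"
    by (intro tendsto_of_real tendsto_minus tendsto_divide tendsto_mult tendsto_const tendsto_power x) simp
  ultimately show "(Psi \<circ> x) \<longlonglongrightarrow> Psi \<theta>"
    unfolding Psi_def comp_def by (rule tendsto_add[rotated])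
qed

lemma Psi_measurable[measurable]: "Psi \<in> borel_measurable borel"
  using isCont_Psi by (intro borel_measurable_continuous_onI) (simp add: continuous_on_eq_continuous_at)

end

subsection \<open>First moments from characteristic functions\<close>

lemma nn_integral_div_square_le:
  fixes r :: "real \<Rightarrow> real"
  assumes a: "a \<ge> 0" and r: "\<And>x. r x \<le> 2" "\<And>x. r x \<le> a * x\<^sup>2"
  shows "(\<integral>\<^sup>+x. ennreal (r x / x\<^sup>2) \<partial>lborel) \<le> ennreal (6 * sqrt a)"
proof (cases "a = 0")
  case True
  then have "ennreal (r x / x\<^sup>2) = 0" for x
    using r(2)[of x] by (simp add: ennreal_neg divide_nonpos_nonneg)
  then show ?thesis by simp
next
  case False
  \<comment> \<open>At this cut \<open>a * x\<^sup>2\<close> equals 1, which balances the two bounds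
    up to a factor. The middle part and each of the two tails contribute 2 \<open>sqrt a\<close>,
    which makes 6.\<close>
  define K where "K = 1 / sqrt a"
  have K: "K > 0" using False a by (simp add: K_def)
  have tail: "(\<integral>\<^sup>+x. ennreal (2 / x\<^sup>2) * indicator {K..} x \<partial>lborel) = ennreal (2 / K)"
  proof -
    have "((\<lambda>x::real. - 2 / x) \<longlongrightarrow> 0) at_top"
      by (rule real_tendsto_divide_at_top[OF tendsto_const]) (rule filterlim_ident)
    then have "(\<integral>\<^sup>+x\<in>{K..}. ennreal (2 / x\<^sup>2) \<partial>lborel) = ennreal (0 - (- 2 / K))"
    proof (rule nn_integral_FTC_atLeast[rotated -1])
      show "((\<lambda>x. - 2 / x) has_real_derivative 2 / x\<^sup>2) (at x)" if "K \<le> x" for x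
        using that K by (auto intro!: derivative_eq_intros simp: power2_eq_square)
    qed (use K in auto)
    then show ?thesis by simp
  qed
  have tail': "(\<integral>\<^sup>+x. ennreal (2 / x\<^sup>2) * indicator {..-K} x \<partial>lborel) = ennreal (2 / K)"
    unfolding tail[symmetric]
    by (subst nn_integral_real_affine[where c="-1" and t=0]) (auto intro!: nn_integral_cong split: split_indicator)
  have "(\<integral>\<^sup>+x. ennreal (r x / x\<^sup>2) \<partial>lborel) \<le>
      (\<integral>\<^sup>+x. ennreal a * indicator {-K..K} x + (ennreal (2 / x\<^sup>2) * indicator {K..} x + ennreal (2 / x\<^sup>2) * indicator {..-K} x) \<partial>lborel)"
  proof (rule nn_integral_mono)
    fix x :: real
    consider "\<bar>x\<bar> \<le> K" | "x > K" | "x < - K" by linarith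
    then show "ennreal (r x / x\<^sup>2) \<le> ennreal a * indicator {-K..K} x + (ennreal (2 / x\<^sup>2) * indicator {K..} x + ennreal (2 / x\<^sup>2) * indicator {..-K} x)"
    proof cases
      case 1
      have "r x / x\<^sup>2 \<le> a" using r(2)[of x] a by (cases "x = 0") (auto simp: divide_le_eq)
      then have "ennreal (r x / x\<^sup>2) \<le> ennreal a * indicator {-K..K} x" using 1 by (simp add: ennreal_leI abs_le_iff)
      then show ?thesis by (rule order_trans) simp
    next
      case 2
      have "ennreal (r x / x\<^sup>2) \<le> ennreal (2 / x\<^sup>2) * indicator {K..} x"
        using 2 r(1)[of x] by (simp add: ennreal_leI divide_right_mono)
      then show ?thesis by (rule order_trans) (simp add: add.left_commute)
    next
      case 3
      have "ennreal (r x / x\<^sup>2) \<le> ennreal (2 / x\<^sup>2) * indicator {..-K} x"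
        using 3 r(1)[of x] by (simp add: ennreal_leI divide_right_mono)
      then show ?thesis by (rule order_trans) (simp add: add.assoc[symmetric])
    qed
  qed
  also have "\<dots> = ennreal a * ennreal (2 * K) + (ennreal (2 / K) + ennreal (2 / K))"
    using K by (subst nn_integral_add, simp, simp, subst nn_integral_add, simp, simp)
      (simp add: tail tail' nn_integral_cmult_indicator)
  also have "\<dots> = ennreal (a * (2 * K) + (2 / K + 2 / K))"
  proof -
    have "ennreal (a * (2 * K) + (2 / K + 2 / K)) = ennreal (a * (2 * K)) + ennreal (2 / K + 2 / K)"
      "ennreal (2 / K + 2 / K) = ennreal (2 / K) + ennreal (2 / K)" "ennreal (a * (2 * K)) = ennreal a * ennreal (2 * K)"
      using K a by (intro ennreal_plus ennreal_mult; simp)+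
    then show ?thesis by (simp only:)
  qed
  also have "a * (2 * K) + (2 / K + 2 / K) = 6 * sqrt a"
  proof -
    have "a * (2 * K) = 2 * (a / sqrt a)" by (simp add: K_def)
    then show ?thesis unfolding real_div_sqrt[OF a] by (simp add: K_def)
  qed
  finally show ?thesis .
qed

lemma one_minus_cos_le_square: "1 - cos x \<le> x\<^sup>2 / 2" for x :: real
proof -
  have "(sin (x / 2))\<^sup>2 \<le> (x / 2)\<^sup>2" using abs_sin_x_le_abs_x[of "x / 2"] unfolding abs_le_square_iff .
  then show ?thesis using cos_double_sin[of "x / 2"] by (simp add: power_divide)
qed

text \<open>The integral equals pi. It is kept abstract; finiteness and positivity carry the
  estimates below.\<close>

definition cos_const :: real where
  "cos_const = enn2real (\<integral>\<^sup>+v. ennreal ((1 - cos v) / v\<^sup>2) \<partial>lborel)"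

lemma nn_integral_cos_const:
  "(\<integral>\<^sup>+v. ennreal ((1 - cos v) / v\<^sup>2) \<partial>lborel) = ennreal cos_const"
proof -
  have "(\<integral>\<^sup>+v. ennreal ((1 - cos v) / v\<^sup>2) \<partial>lborel) \<le> ennreal (6 * sqrt (1/2))"
    using one_minus_cos_le_square by (intro nn_integral_div_square_le) auto
  then have "(\<integral>\<^sup>+v. ennreal ((1 - cos v) / v\<^sup>2) \<partial>lborel) < top" by (rule le_less_trans) simp
  then show ?thesis unfolding cos_const_def by (intro ennreal_enn2real[symmetric])
qed

text \<open>An arbitrarily small window is allowed because the large jumps are read off from the
  characteristic function near 0, where it is close to 1.\<close>

lemma nn_integral_cos_Icc_pos:
  assumes "\<delta> > 0"
  shows "(\<integral>\<^sup>+v. ennreal ((1 - cos v) / v\<^sup>2) * indicator {-\<delta>..\<delta>} v \<partial>lborel) > 0"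
proof (rule ccontr)
  assume "\<not> ?thesis"
  then have "AE v in lborel. ennreal ((1 - cos v) / v\<^sup>2) * indicator {-\<delta>..\<delta>} v = 0"
    by (subst (asm) not_gr_zero, subst (asm) nn_integral_0_iff_AE) auto
  moreover have "v \<notin> {0<..<min \<delta> pi}" if "ennreal ((1 - cos v) / v\<^sup>2) * indicator {-\<delta>..\<delta>} v = 0" for v
  proof
    assume v: "v \<in> {0<..<min \<delta> pi}"
    then have "cos v < cos 0" by (intro cos_monotone_0_pi) auto
    then have "(1 - cos v) / v\<^sup>2 > 0" using v by auto
    then show False using that v by (auto simp: ennreal_eq_0_iff)
  qed
  ultimately have "AE v in lborel. v \<notin> {0<..<min \<delta> pi}" by auto
  then have "{0<..<min \<delta> pi} \<in> null_sets lborel" by (subst AE_iff_null_sets) auto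
  then have "emeasure lborel {0<..<min \<delta> pi} = 0" by auto
  then show False using assms pi_gt_zero
    by (simp add: emeasure_lborel_Ioo ennreal_eq_0_iff min_le_iff_disj)
qed

lemma cos_const_pos: "cos_const > 0"
proof -
  have "0 < (\<integral>\<^sup>+v. ennreal ((1 - cos v) / v\<^sup>2) * indicator {-1..1} v \<partial>lborel)" by (rule nn_integral_cos_Icc_pos) simp
  also have "\<dots> \<le> ennreal cos_const" unfolding nn_integral_cos_const[symmetric]
    by (intro nn_integral_mono) (auto split: split_indicator)
  finally show ?thesis by simp
qed

text \<open>The substitution v = \<theta> x: the square in the denominator gives two powers of |x|,
  the Jacobian takes one back. \<open>A = UNIV\<close> yields the formula for |x|, a window
  \<open>A\<close> serves for the large jumps.\<close>

lemma nn_integral_cos_scale: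
  assumes "x \<noteq> 0" and [measurable]: "A \<in> sets borel"
  shows "(\<integral>\<^sup>+\<theta>. ennreal ((1 - cos (\<theta> * x)) / \<theta>\<^sup>2) * indicator A (\<theta> * x) \<partial>lborel)
    = ennreal \<bar>x\<bar> * (\<integral>\<^sup>+v. ennreal ((1 - cos v) / v\<^sup>2) * indicator A v \<partial>lborel)"
proof -
  have "(\<integral>\<^sup>+v. ennreal ((1 - cos v) / v\<^sup>2) * indicator A v \<partial>lborel)
      = ennreal \<bar>x\<bar> * (\<integral>\<^sup>+\<theta>. ennreal ((1 - cos (x * \<theta>)) / (x * \<theta>)\<^sup>2) * indicator A (x * \<theta>) \<partial>lborel)"
    using assms(1) by (subst nn_integral_real_affine[where c=x and t=0]) auto
  also have "ennreal \<bar>x\<bar> * \<dots> = (\<integral>\<^sup>+\<theta>. ennreal (x\<^sup>2) * (ennreal ((1 - cos (x * \<theta>)) / (x * \<theta>)\<^sup>2) * indicator A (x * \<theta>)) \<partial>lborel)"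
    by (subst nn_integral_cmult) (auto simp: mult.assoc[symmetric] power2_eq_square simp flip: ennreal_mult)
  also have "\<dots> = (\<integral>\<^sup>+\<theta>. ennreal ((1 - cos (\<theta> * x)) / \<theta>\<^sup>2) * indicator A (\<theta> * x) \<partial>lborel)"
    using assms(1) by (intro nn_integral_cong)
      (auto simp: mult.assoc[symmetric] power_mult_distrib mult.commute[of x] simp flip: ennreal_mult')
  finally show ?thesis by simp
qed

lemma nn_integral_cos: "(\<integral>\<^sup>+\<theta>. ennreal ((1 - cos (\<theta> * x)) / \<theta>\<^sup>2) \<partial>lborel) = ennreal (cos_const * \<bar>x\<bar>)"
proof (cases "x = 0")
  case False
  then show ?thesis using nn_integral_cos_scale[of x UNIV] cos_const_pos
    by (simp add: nn_integral_cos_const ennreal_mult mult.commute)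
qed simp

text \<open>The cosine formula for |x| is applied to each outcome and Tonelli's theorem exchanges
  the integrals; both sides may be infinite.\<close>

lemma (in prob_space) nn_integral_abs_eq_char:
  assumes [measurable]: "Y \<in> borel_measurable M"
  shows "ennreal cos_const * (\<integral>\<^sup>+\<omega>. ennreal \<bar>Y \<omega>\<bar> \<partial>M)
    = (\<integral>\<^sup>+\<theta>. ennreal ((1 - Re (char (distr M borel Y) \<theta>)) / \<theta>\<^sup>2) \<partial>lborel)"
proof -
  interpret pair_sigma_finite M lborel by standard
  have "ennreal cos_const * (\<integral>\<^sup>+\<omega>. ennreal \<bar>Y \<omega>\<bar> \<partial>M) = (\<integral>\<^sup>+\<omega>. \<integral>\<^sup>+\<theta>. ennreal ((1 - cos (\<theta> * Y \<omega>)) / \<theta>\<^sup>2) \<partial>lborel \<partial>M)"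
    using cos_const_pos by (subst nn_integral_cmult[symmetric]) (auto simp: nn_integral_cos ennreal_mult)
  also have "\<dots> = (\<integral>\<^sup>+\<theta>. \<integral>\<^sup>+\<omega>. ennreal ((1 - cos (\<theta> * Y \<omega>)) / \<theta>\<^sup>2) \<partial>M \<partial>lborel)"
    by (rule Fubini'[symmetric]) measurable
  also have "\<dots> = (\<integral>\<^sup>+\<theta>. ennreal ((1 - Re (char (distr M borel Y) \<theta>)) / \<theta>\<^sup>2) \<partial>lborel)"
  proof (rule nn_integral_cong)
    fix \<theta> :: real
    have int: "integrable M (\<lambda>\<omega>. cos (\<theta> * Y \<omega>))" "complex_integrable M (\<lambda>\<omega>. iexp (\<theta> * Y \<omega>))"
      by (auto intro!: integrable_const_bound[where B=1])
    have "Re (char (distr M borel Y) \<theta>) = Re (CLINT \<omega>|M. iexp (\<theta> * Y \<omega>))"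
      unfolding char_def by (subst integral_distr) auto
    also have "\<dots> = (LINT \<omega>|M. Re (iexp (\<theta> * Y \<omega>)))" by (rule integral_Re[OF int(2), symmetric])
    also have "\<dots> = (LINT \<omega>|M. cos (\<theta> * Y \<omega>))" by (simp add: Re_exp)
    finally have R: "Re (char (distr M borel Y) \<theta>) = (LINT \<omega>|M. cos (\<theta> * Y \<omega>))" .
    have "(\<integral>\<^sup>+\<omega>. ennreal ((1 - cos (\<theta> * Y \<omega>)) / \<theta>\<^sup>2) \<partial>M) = ennreal (LINT \<omega>|M. (1 - cos (\<theta> * Y \<omega>)) / \<theta>\<^sup>2)"
      using int(1) by (intro nn_integral_eq_integral) auto
    also have "(LINT \<omega>|M. (1 - cos (\<theta> * Y \<omega>)) / \<theta>\<^sup>2) = (1 - (LINT \<omega>|M. cos (\<theta> * Y \<omega>))) / \<theta>\<^sup>2"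
      using int(1) by (simp add: prob_space)
    finally show "(\<integral>\<^sup>+\<omega>. ennreal ((1 - cos (\<theta> * Y \<omega>)) / \<theta>\<^sup>2) \<partial>M) = ennreal ((1 - Re (char (distr M borel Y) \<theta>)) / \<theta>\<^sup>2)"
      by (simp add: R)
  qed
  finally show ?thesis .
qed

text \<open>Three bounds for different ranges: the first separates the second order real part from
  the phase and is used for |\<theta>| <= 1, the other two control the range beyond 1.\<close>

lemma one_minus_Re_exp_le:
  assumes "Re z \<le> 0"
  shows "1 - Re (exp z) \<le> - Re z + (1 - cos (Im z))" "1 - Re (exp z) \<le> cmod z" "1 - Re (exp z) \<le> 2"
proof -
  have e: "exp (Re z) \<le> 1" using assms by simp
  have "1 - exp (Re z) \<le> - Re z" using exp_ge_add_one_self[of "Re z"] by linarith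
  moreover have "exp (Re z) * (1 - cos (Im z)) \<le> 1 * (1 - cos (Im z))" using e by (intro mult_right_mono) auto
  ultimately show "1 - Re (exp z) \<le> - Re z + (1 - cos (Im z))" by (simp add: Re_exp right_diff_distrib)
  have "1 - Re (exp z) \<le> cmod (1 - exp z)" using complex_Re_le_cmod[of "1 - exp z"] by simp
  also have "\<dots> \<le> cmod z" using cmod_exp_diff_le[of 0 z] assms by simp
  finally show "1 - Re (exp z) \<le> cmod z" .
  have "\<bar>Re (exp z)\<bar> \<le> exp (Re z)" using abs_Re_le_cmod[of "exp z"] by (simp only: norm_exp_eq_Re)
  then show "1 - Re (exp z) \<le> 2" using e by linarith
qed

text \<open>Near 0 the bound on \<open>cmod (\<kappa> \<theta>)\<close> is only linear, so dividing by \<open>\<theta>\<^sup>2\<close> would cost a logarithm; the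
  real part, of second order, is therefore controlled separately and the imaginary part enters through
  its cosine.\<close>

lemma (in prob_space) nn_integral_abs_le_of_char:
  fixes \<kappa> :: "real \<Rightarrow> complex"
  assumes [measurable]: "Y \<in> borel_measurable M" "\<kappa> \<in> borel_measurable borel"
    and char: "\<And>\<theta>. char (distr M borel Y) \<theta> = exp (\<kappa> \<theta>)" and re: "\<And>\<theta>. Re (\<kappa> \<theta>) \<le> 0" and m: "m \<ge> 0"
    and small: "\<And>\<theta>. \<bar>\<theta>\<bar> \<le> 1 \<Longrightarrow> cmod (\<kappa> \<theta>) \<le> m * \<bar>\<theta>\<bar>" and large: "\<And>\<theta>. 1 \<le> \<bar>\<theta>\<bar> \<Longrightarrow> cmod (\<kappa> \<theta>) \<le> m * \<theta>\<^sup>2"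
    and Re_small: "(\<integral>\<^sup>+\<theta>. ennreal (- Re (\<kappa> \<theta>) / \<theta>\<^sup>2) * indicator {-1..1} \<theta> \<partial>lborel) \<le> ennreal m"
  shows "(\<integral>\<^sup>+\<omega>. ennreal \<bar>Y \<omega>\<bar> \<partial>M) \<le> ennreal (7 / cos_const * (m + sqrt m))"
proof -
  define r1 r2 where "r1 \<theta> = (1 - cos (Im (\<kappa> \<theta>))) * indicator {-1..1} \<theta>"
    and "r2 \<theta> = (1 - Re (exp (\<kappa> \<theta>))) * indicator (- {-1..1}) \<theta>" for \<theta>
  have [measurable]: "r1 \<in> borel_measurable borel" "r2 \<in> borel_measurable borel" unfolding r1_def r2_def by measurable
  have "ennreal cos_const * (\<integral>\<^sup>+\<omega>. ennreal \<bar>Y \<omega>\<bar> \<partial>M) = (\<integral>\<^sup>+\<theta>. ennreal ((1 - Re (exp (\<kappa> \<theta>))) / \<theta>\<^sup>2) \<partial>lborel)"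
    by (subst nn_integral_abs_eq_char) (simp_all add: char)
  also have "\<dots> \<le> (\<integral>\<^sup>+\<theta>. ennreal (- Re (\<kappa> \<theta>) / \<theta>\<^sup>2) * indicator {-1..1} \<theta> + (ennreal (r1 \<theta> / \<theta>\<^sup>2) + ennreal (r2 \<theta> / \<theta>\<^sup>2)) \<partial>lborel)"
  proof (rule nn_integral_mono)
    fix \<theta> :: real
    show "ennreal ((1 - Re (exp (\<kappa> \<theta>))) / \<theta>\<^sup>2) \<le> ennreal (- Re (\<kappa> \<theta>) / \<theta>\<^sup>2) * indicator {-1..1} \<theta> + (ennreal (r1 \<theta> / \<theta>\<^sup>2) + ennreal (r2 \<theta> / \<theta>\<^sup>2))"
    proof (cases "\<theta> \<in> {-1..1}")
      case True
      have "ennreal ((1 - Re (exp (\<kappa> \<theta>))) / \<theta>\<^sup>2) \<le> ennreal ((- Re (\<kappa> \<theta>) + (1 - cos (Im (\<kappa> \<theta>)))) / \<theta>\<^sup>2)"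
        using one_minus_Re_exp_le(1)[OF re[of \<theta>]] by (intro ennreal_leI divide_right_mono) auto
      also have "\<dots> = ennreal (- Re (\<kappa> \<theta>) / \<theta>\<^sup>2) + ennreal ((1 - cos (Im (\<kappa> \<theta>))) / \<theta>\<^sup>2)"
        unfolding add_divide_distrib using re[of \<theta>] by (intro ennreal_plus divide_nonneg_nonneg) auto
      finally show ?thesis using True by (simp add: r1_def r2_def)
    next
      case False
      then show ?thesis by (simp add: r1_def r2_def)
    qed
  qed
  also have "\<dots> = (\<integral>\<^sup>+\<theta>. ennreal (- Re (\<kappa> \<theta>) / \<theta>\<^sup>2) * indicator {-1..1} \<theta> \<partial>lborel) + ((\<integral>\<^sup>+\<theta>. ennreal (r1 \<theta> / \<theta>\<^sup>2) \<partial>lborel) + (\<integral>\<^sup>+\<theta>. ennreal (r2 \<theta> / \<theta>\<^sup>2) \<partial>lborel))"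
    by (subst nn_integral_add, simp, simp, subst nn_integral_add) simp_all
  \<comment> \<open>The phase enters squared: \<open>r1 \<theta>\<close> is at most the square of m
    \<theta>, so its root bound is again linear in m. The total m + 6 m + 6 \<open>sqrt m\<close>
    explains the constant 7.\<close>
  also have "\<dots> \<le> ennreal m + (ennreal (6 * sqrt (m\<^sup>2)) + ennreal (6 * sqrt m))"
  proof (intro add_mono Re_small nn_integral_div_square_le)
    fix \<theta> :: real
    show "r1 \<theta> \<le> 2" using cos_ge_minus_one[of "Im (\<kappa> \<theta>)"] by (auto simp: r1_def split: split_indicator)
    show "r2 \<theta> \<le> 2" using one_minus_Re_exp_le(3)[OF re[of \<theta>]] by (auto simp: r2_def split: split_indicator)
    show "r1 \<theta> \<le> m\<^sup>2 * \<theta>\<^sup>2"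
    proof (cases "\<theta> \<in> {-1..1}")
      case True
      then have "\<bar>Im (\<kappa> \<theta>)\<bar> \<le> \<bar>m * \<theta>\<bar>" using small[of \<theta>] abs_Im_le_cmod[of "\<kappa> \<theta>"] m by (simp add: abs_mult abs_le_iff)
      then have "(Im (\<kappa> \<theta>))\<^sup>2 \<le> (m * \<theta>)\<^sup>2" by (simp add: abs_le_square_iff)
      moreover have "1 - cos (Im (\<kappa> \<theta>)) \<le> (Im (\<kappa> \<theta>))\<^sup>2 / 2" by (rule one_minus_cos_le_square)
      moreover have "0 \<le> (Im (\<kappa> \<theta>))\<^sup>2" by simp
      ultimately have "1 - cos (Im (\<kappa> \<theta>)) \<le> (m * \<theta>)\<^sup>2" by linarith
      then show ?thesis using True by (simp add: r1_def power_mult_distrib)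
    qed (simp add: r1_def)
    show "r2 \<theta> \<le> m * \<theta>\<^sup>2"
      using one_minus_Re_exp_le(2)[OF re[of \<theta>]] large[of \<theta>] m
      by (auto simp: r2_def abs_if split: split_indicator if_splits)
  qed (use m in auto)
  also have "\<dots> = ennreal m + (ennreal (6 * m) + ennreal (6 * sqrt m))" using m by simp
  also have "\<dots> = ennreal (m + (6 * m + 6 * sqrt m))" using m by (subst ennreal_plus, simp, simp, subst ennreal_plus) simp_all
  also have "\<dots> \<le> ennreal (7 * (m + sqrt m))" using m by (intro ennreal_leI) simp
  also have "7 * (m + sqrt m) = cos_const * (7 / cos_const * (m + sqrt m))" using cos_const_pos by simp
  also have "ennreal \<dots> = ennreal cos_const * ennreal (7 / cos_const * (m + sqrt m))"
    using cos_const_pos m by (intro ennreal_mult) auto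
  finally show ?thesis
    using cos_const_pos by (simp add: ennreal_mult_le_mult_iff)
qed

text \<open>The sets where f is at least 1/(n+1) have finite measure by Markov's inequality, and
  positivity makes them cover the space.\<close>

lemma sigma_finite_measureI_pos:
  fixes f :: "'a \<Rightarrow> real"
  assumes [measurable]: "f \<in> borel_measurable M" and pos: "\<And>x. x \<in> space M \<Longrightarrow> f x > 0"
    and fin: "(\<integral>\<^sup>+x. ennreal (f x) \<partial>M) < \<infinity>"
  shows "sigma_finite_measure M"
proof
  define A where "A n = {x \<in> space M. 1 \<le> ennreal (real (Suc n)) * ennreal (f x)}" for n :: nat
  have meas: "A n \<in> sets M" for n unfolding A_def by measurable
  have "emeasure M (A n) \<noteq> \<infinity>" for n
  proof -
    have "emeasure M (A n) \<le> ennreal (real (Suc n)) * (\<integral>\<^sup>+x\<in>space M. ennreal (f x) \<partial>M)"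
      unfolding A_def by (rule nn_integral_Markov_inequality) auto
    also have "(\<integral>\<^sup>+x\<in>space M. ennreal (f x) \<partial>M) = (\<integral>\<^sup>+x. ennreal (f x) \<partial>M)" by (intro nn_integral_cong) auto
    also have "ennreal (real (Suc n)) * \<dots> < \<infinity>" using fin by (simp add: ennreal_mult_less_top del: of_nat_Suc)
    finally show ?thesis by simp
  qed
  moreover have "\<Union> (range A) = space M"
  proof (intro subset_antisym subsetI)
    fix x assume x: "x \<in> space M"
    obtain n where "inverse (real (Suc n)) < f x" using reals_Archimedean[OF pos[OF x]] by auto
    then have "1 \<le> real (Suc n) * f x" by (simp add: field_simps)
    then have "x \<in> A n" using x by (simp add: A_def ennreal_mult'[symmetric] del: of_nat_Suc)
    then show "x \<in> \<Union> (range A)" by blast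
  qed (auto simp: A_def)
  ultimately show "\<exists>A. countable A \<and> A \<subseteq> sets M \<and> \<Union> A = space M \<and> (\<forall>a\<in>A. emeasure M a \<noteq> \<infinity>)"
    using meas by (intro exI[of _ "range A"]) auto
qed

section \<open>Integral estimates for the exponent near 0\<close>

context centered_levy_pair begin

lemma sigma_finite_\<nu>: "sigma_finite_measure \<nu>"
\<comment> \<open>\<open>phi\<close> vanishes at 0; the indicator restores positivity there and adds
  nothing to the integral, since \<nu> does not charge 0.\<close>
proof (rule sigma_finite_measureI_pos[where f="\<lambda>u. phi u + indicator {0} u"])
  show "0 < phi u + indicator {0} u" for u
  proof (cases "u = 0")
    case False
    then have "0 < min (u\<^sup>2) \<bar>u\<bar>" by simp
    then have "0 < phi u" using min_le_phi[of u] by linarith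
    then show ?thesis by (simp add: add_pos_nonneg)
  qed simp
  have "(\<integral>\<^sup>+u. ennreal (phi u + indicator {0} u) \<partial>\<nu>) = (\<integral>\<^sup>+u. ennreal (phi u) \<partial>\<nu>) + (\<integral>\<^sup>+u. indicator {0} u \<partial>\<nu>)"
    by (subst nn_integral_add[symmetric]) (auto simp: ennreal_plus ennreal_indicator intro!: nn_integral_cong)
  also have "\<dots> = (\<integral>\<^sup>+u. ennreal (phi u) \<partial>\<nu>)" using \<nu>_0 by simp
  also have "\<dots> < \<infinity>" using integrable_phi by (subst nn_integral_eq_integral) auto
  finally show "(\<integral>\<^sup>+u. ennreal (phi u + indicator {0} u) \<partial>\<nu>) < \<infinity>" .
qed measurable

lemma Re_Psi_eq: "- Re (Psi \<theta>) = \<sigma>\<^sup>2 * \<theta>\<^sup>2 / 2 + (LINT u|\<nu>. 1 - cos (\<theta> * u))"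
proof -
  have "Re (CLINT u|\<nu>. iexp (\<theta> * u) - 1 - \<i> * (\<theta> * u)) = (LINT u|\<nu>. Re (iexp (\<theta> * u) - 1 - \<i> * (\<theta> * u)))"
    by (rule integral_Re[OF integrable_Psi, symmetric])
  also have "\<dots> = - (LINT u|\<nu>. 1 - cos (\<theta> * u))"
    by (simp add: Re_exp flip: Bochner_Integration.integral_minus)
  finally show ?thesis unfolding Psi_def plus_complex.sel Re_complex_of_real by linarith
qed

lemma integrable_one_minus_cos: "integrable \<nu> (\<lambda>u. 1 - cos (\<theta> * u))"
proof -
  have "integrable \<nu> (\<lambda>u. - Re (iexp (\<theta> * u) - 1 - \<i> * (\<theta> * u)))"
    by (intro integrable_minus integrable_Re integrable_Psi)
  then show ?thesis by (simp add: Re_exp)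
qed

text \<open>The 1 pays for the Gaussian part. In the jump part 3 comes from
  \<open>min_le_phi\<close>, and the maximum serves the quadratic and the linear regime at
  once.\<close>

definition tail_const :: real where
  "tail_const = 1 + 3 * max 1 cos_const"

lemma tail_const_ge_1: "tail_const \<ge> 1" by (simp add: tail_const_def)

lemma nn_integral_Re_Psi_le:
  "(\<integral>\<^sup>+\<theta>. ennreal (- Re (Psi (\<theta> * x)) / \<theta>\<^sup>2) * indicator {-1..1} \<theta> \<partial>lborel) \<le> ennreal (tail_const * k x)"
proof -
  interpret N: sigma_finite_measure \<nu> by (rule sigma_finite_\<nu>)
  interpret pair_sigma_finite lborel \<nu> by standard
  define C where "C = max 1 cos_const"
  have split: "ennreal (- Re (Psi (\<theta> * x)) / \<theta>\<^sup>2) * indicator {-1..1} \<theta>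
      \<le> ennreal (\<sigma>\<^sup>2 * x\<^sup>2 / 2) * indicator {-1..1} \<theta> + (\<integral>\<^sup>+u. ennreal ((1 - cos (\<theta> * (u * x))) / \<theta>\<^sup>2) * indicator {-1..1} \<theta> \<partial>\<nu>)" for \<theta>
  proof -
    have 1: "integrable \<nu> (\<lambda>u. (1 - cos (\<theta> * (u * x))) / \<theta>\<^sup>2)"
      using integrable_one_minus_cos[of "\<theta> * x"] by (simp add: mult_ac)
    have "- Re (Psi (\<theta> * x)) / \<theta>\<^sup>2 \<le> \<sigma>\<^sup>2 * x\<^sup>2 / 2 + (LINT u|\<nu>. (1 - cos (\<theta> * (u * x))) / \<theta>\<^sup>2)"
      unfolding Re_Psi_eq by (cases "\<theta> = 0") (simp_all add: power_mult_distrib add_divide_distrib mult_ac)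
    then have "ennreal (- Re (Psi (\<theta> * x)) / \<theta>\<^sup>2) \<le> ennreal (\<sigma>\<^sup>2 * x\<^sup>2 / 2 + (LINT u|\<nu>. (1 - cos (\<theta> * (u * x))) / \<theta>\<^sup>2))"
      by (rule ennreal_leI)
    also have "\<dots> = ennreal (\<sigma>\<^sup>2 * x\<^sup>2 / 2) + ennreal (LINT u|\<nu>. (1 - cos (\<theta> * (u * x))) / \<theta>\<^sup>2)"
      by (intro ennreal_plus Bochner_Integration.integral_nonneg) auto
    also have "ennreal (LINT u|\<nu>. (1 - cos (\<theta> * (u * x))) / \<theta>\<^sup>2) = (\<integral>\<^sup>+u. ennreal ((1 - cos (\<theta> * (u * x))) / \<theta>\<^sup>2) \<partial>\<nu>)"
      by (rule nn_integral_eq_integral[OF 1, symmetric]) auto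
    finally show ?thesis by (auto split: split_indicator)
  qed
  \<comment> \<open>For one jump size the window integral is at most the square of y (bound the
    integrand by half of that, on a window of length 2) and at most \<open>cos_const\<close> |y|
    (extend the window to the line). The better of the two is comparable to
    \<open>phi y\<close>.\<close>
  have inner: "(\<integral>\<^sup>+\<theta>. ennreal ((1 - cos (\<theta> * y)) / \<theta>\<^sup>2) * indicator {-1..1} \<theta> \<partial>lborel) \<le> ennreal (3 * C * phi y)" for y
  proof -
    have "(\<integral>\<^sup>+\<theta>. ennreal ((1 - cos (\<theta> * y)) / \<theta>\<^sup>2) * indicator {-1..1} \<theta> \<partial>lborel) \<le> (\<integral>\<^sup>+\<theta>. ennreal (y\<^sup>2 / 2) * indicator {-1..1::real} \<theta> \<partial>lborel)"
    proof (rule nn_integral_mono, rule mult_right_mono, rule ennreal_leI)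
      fix \<theta> :: real
      show "(1 - cos (\<theta> * y)) / \<theta>\<^sup>2 \<le> y\<^sup>2 / 2"
        using one_minus_cos_le_square[of "\<theta> * y"] by (cases "\<theta> = 0") (auto simp: power_mult_distrib divide_le_eq mult.commute)
    qed simp
    also have "\<dots> = ennreal (y\<^sup>2)" by (subst nn_integral_cmult_indicator) (auto simp flip: ennreal_mult' ennreal_numeral)
    finally have 1: "(\<integral>\<^sup>+\<theta>. ennreal ((1 - cos (\<theta> * y)) / \<theta>\<^sup>2) * indicator {-1..1} \<theta> \<partial>lborel) \<le> ennreal (y\<^sup>2)" .
    have "(\<integral>\<^sup>+\<theta>. ennreal ((1 - cos (\<theta> * y)) / \<theta>\<^sup>2) * indicator {-1..1} \<theta> \<partial>lborel) \<le> (\<integral>\<^sup>+\<theta>. ennreal ((1 - cos (\<theta> * y)) / \<theta>\<^sup>2) \<partial>lborel)"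
      by (intro nn_integral_mono) (auto split: split_indicator)
    then have 2: "(\<integral>\<^sup>+\<theta>. ennreal ((1 - cos (\<theta> * y)) / \<theta>\<^sup>2) * indicator {-1..1} \<theta> \<partial>lborel) \<le> ennreal (cos_const * \<bar>y\<bar>)"
      by (simp only: nn_integral_cos)
    have "y\<^sup>2 \<le> C * y\<^sup>2" "cos_const * \<bar>y\<bar> \<le> C * \<bar>y\<bar>" using mult_right_mono[of 1 C "y\<^sup>2"] by (auto simp: C_def intro!: mult_right_mono)
    moreover have "C * min (y\<^sup>2) \<bar>y\<bar> \<le> C * (3 * phi y)" by (intro mult_left_mono min_le_phi) (simp add: C_def)
    ultimately have "y\<^sup>2 \<le> 3 * C * phi y \<or> cos_const * \<bar>y\<bar> \<le> 3 * C * phi y" by (auto simp: min_def split: if_splits)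
    with 1 2 show ?thesis by (auto intro: order_trans[OF _ ennreal_leI])
  qed
  have "(\<integral>\<^sup>+\<theta>. ennreal (- Re (Psi (\<theta> * x)) / \<theta>\<^sup>2) * indicator {-1..1} \<theta> \<partial>lborel)
      \<le> (\<integral>\<^sup>+\<theta>. ennreal (\<sigma>\<^sup>2 * x\<^sup>2 / 2) * indicator {-1..1::real} \<theta> + (\<integral>\<^sup>+u. ennreal ((1 - cos (\<theta> * (u * x))) / \<theta>\<^sup>2) * indicator {-1..1} \<theta> \<partial>\<nu>) \<partial>lborel)"
    by (intro nn_integral_mono split)
  also have "\<dots> = (\<integral>\<^sup>+\<theta>. ennreal (\<sigma>\<^sup>2 * x\<^sup>2 / 2) * indicator {-1..1::real} \<theta> \<partial>lborel)
      + (\<integral>\<^sup>+\<theta>. \<integral>\<^sup>+u. ennreal ((1 - cos (\<theta> * (u * x))) / \<theta>\<^sup>2) * indicator {-1..1} \<theta> \<partial>\<nu> \<partial>lborel)"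
    by (rule nn_integral_add) measurable
  also have "(\<integral>\<^sup>+\<theta>. ennreal (\<sigma>\<^sup>2 * x\<^sup>2 / 2) * indicator {-1..1::real} \<theta> \<partial>lborel) = ennreal (\<sigma>\<^sup>2 * x\<^sup>2)"
    by (subst nn_integral_cmult_indicator) (auto simp flip: ennreal_mult' ennreal_numeral)
  also have "(\<integral>\<^sup>+\<theta>. \<integral>\<^sup>+u. ennreal ((1 - cos (\<theta> * (u * x))) / \<theta>\<^sup>2) * indicator {-1..1} \<theta> \<partial>\<nu> \<partial>lborel)
      = (\<integral>\<^sup>+u. \<integral>\<^sup>+\<theta>. ennreal ((1 - cos (\<theta> * (u * x))) / \<theta>\<^sup>2) * indicator {-1..1} \<theta> \<partial>lborel \<partial>\<nu>)"
    by (rule Fubini'[symmetric]) measurable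
  also have "\<dots> \<le> (\<integral>\<^sup>+u. ennreal (3 * C * phi (u * x)) \<partial>\<nu>)"
    by (intro nn_integral_mono inner)
  also have "\<dots> = ennreal (3 * C * (LINT u|\<nu>. phi (u * x)))"
    by (subst nn_integral_eq_integral) (auto simp: C_def integrable_phi_mult)
  also have "ennreal (\<sigma>\<^sup>2 * x\<^sup>2) + ennreal (3 * C * (LINT u|\<nu>. phi (u * x))) = ennreal (\<sigma>\<^sup>2 * x\<^sup>2 + 3 * C * (LINT u|\<nu>. phi (u * x)))"
    by (intro ennreal_plus[symmetric] mult_nonneg_nonneg Bochner_Integration.integral_nonneg) (auto simp: C_def)
  also have "\<dots> \<le> ennreal (tail_const * k x)"
  proof (rule ennreal_leI)
    have "0 \<le> (LINT u|\<nu>. phi (u * x))" by (intro Bochner_Integration.integral_nonneg) simp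
    moreover have "1 * (\<sigma>\<^sup>2 * x\<^sup>2) \<le> tail_const * (\<sigma>\<^sup>2 * x\<^sup>2)" by (intro mult_right_mono tail_const_ge_1) simp
    ultimately show "\<sigma>\<^sup>2 * x\<^sup>2 + 3 * C * (LINT u|\<nu>. phi (u * x)) \<le> tail_const * k x"
      by (simp add: k_def tail_const_def C_def distrib_left distrib_right)
  qed
  finally show ?thesis by (simp add: add_left_mono)
qed

text \<open>\<open>k\<close> has slope 0 at 0. Convexity of \<open>phi\<close> with
  \<open>phi 0 = 0\<close> makes \<open>phi\<close> itself a dominating function. Hence the
  compensated part of a Levy exponent does not contribute to the mean.\<close>

lemma k_small_quotient: "(\<lambda>n. real (Suc n) * k (1 / real (Suc n))) \<longlonglongrightarrow> 0"
proof -
  have "(\<lambda>n. LINT u|\<nu>. real (Suc n) * phi (u * (1 / real (Suc n)))) \<longlonglongrightarrow> (LINT u|\<nu>. 0)"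
  proof (rule integral_dominated_convergence[where w=phi])
    show "AE u in \<nu>. (\<lambda>n. real (Suc n) * phi (u * (1 / real (Suc n)))) \<longlonglongrightarrow> 0"
    proof (rule AE_I2)
      fix u :: real
      have "(\<lambda>n. u\<^sup>2 * (1 / real (Suc n))) \<longlonglongrightarrow> u\<^sup>2 * 0" by (intro tendsto_mult tendsto_const LIMSEQ_Suc[OF lim_1_over_n])
      then have lim: "(\<lambda>n. u\<^sup>2 * (1 / real (Suc n))) \<longlonglongrightarrow> 0" by simp
      show "(\<lambda>n. real (Suc n) * phi (u * (1 / real (Suc n)))) \<longlonglongrightarrow> 0"
      proof (rule tendsto_sandwich[OF _ _ tendsto_const lim])
        have "real (Suc n) * phi (u * (1 / real (Suc n))) \<le> u\<^sup>2 * (1 / real (Suc n))" for n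
        proof -
          have "real (Suc n) * phi (u * (1 / real (Suc n))) \<le> real (Suc n) * (u * (1 / real (Suc n)))\<^sup>2"
            by (intro mult_left_mono phi_le_square) simp
          also have "\<dots> = u\<^sup>2 * (1 / real (Suc n))" by (simp add: power2_eq_square del: of_nat_Suc)
          finally show ?thesis .
        qed
        then show "\<forall>\<^sub>F n in sequentially. real (Suc n) * phi (u * (1 / real (Suc n))) \<le> u\<^sup>2 * (1 / real (Suc n))" by simp
      qed simp
    qed
    show "AE u in \<nu>. norm (real (Suc n) * phi (u * (1 / real (Suc n)))) \<le> phi u" for n
    proof (rule AE_I2)
      fix u :: real
      have "phi (u * (1 / real (Suc n))) \<le> 1 / real (Suc n) * phi u"
        using convex_onD[OF convex_phi, of "1 / real (Suc n)" 0 u] by (simp add: mult.commute del: of_nat_Suc)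
      then show "norm (real (Suc n) * phi (u * (1 / real (Suc n)))) \<le> phi u" by (simp add: field_simps del: of_nat_Suc)
    qed
  qed (use integrable_phi in measurable)
  then have 1: "(\<lambda>n. LINT u|\<nu>. real (Suc n) * phi (u * (1 / real (Suc n)))) \<longlonglongrightarrow> 0" by simp
  have "(\<lambda>n. \<sigma>\<^sup>2 * (1 / real (Suc n)) + (LINT u|\<nu>. real (Suc n) * phi (u * (1 / real (Suc n))))) \<longlonglongrightarrow> \<sigma>\<^sup>2 * 0 + 0"
    by (intro tendsto_add tendsto_mult tendsto_const LIMSEQ_Suc[OF lim_1_over_n] 1)
  moreover have "real (Suc n) * k (1 / real (Suc n)) = \<sigma>\<^sup>2 * (1 / real (Suc n)) + (LINT u|\<nu>. real (Suc n) * phi (u * (1 / real (Suc n))))" for n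
    unfolding k_def by (simp add: distrib_left power2_eq_square del: of_nat_Suc)
  ultimately show ?thesis by simp
qed

end

text \<open>The derivative of the characteristic function at 0, taken along 1/(n+1). The Lipschitz
  bound for \<open>iexp\<close> makes |X| a dominating function.\<close>

lemma (in prob_space) char_difference_quotient:
  assumes int: "integrable M X"
  shows "(\<lambda>n. of_nat (Suc n) * ((CLINT \<omega>|M. iexp (X \<omega> / real (Suc n))) - 1)) \<longlonglongrightarrow> \<i> * complex_of_real (expectation X)"
proof -
  have [measurable]: "X \<in> borel_measurable M" using int by auto
  have pt: "(\<lambda>n. of_nat (Suc n) * (iexp (x / real (Suc n)) - 1)) \<longlonglongrightarrow> \<i> * complex_of_real x" for x :: real
  proof (rule LIM_zero_cancel, rule Lim_null_comparison)
    have "(\<lambda>n. 6 * x\<^sup>2 * (1 / real (Suc n))) \<longlonglongrightarrow> 6 * x\<^sup>2 * 0" by (intro tendsto_mult tendsto_const LIMSEQ_Suc[OF lim_1_over_n])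
    then show "(\<lambda>n. 6 * x\<^sup>2 * (1 / real (Suc n))) \<longlonglongrightarrow> 0" by simp
    have "cmod (of_nat (Suc n) * (iexp (x / real (Suc n)) - 1) - \<i> * complex_of_real x) \<le> 6 * x\<^sup>2 * (1 / real (Suc n))" for n
    proof -
      have "of_nat (Suc n) * (iexp (x / real (Suc n)) - 1) - \<i> * complex_of_real x
        = of_nat (Suc n) * (iexp (x / real (Suc n)) - 1 - \<i> * complex_of_real (x / real (Suc n)))"
        by (simp add: right_diff_distrib del: of_nat_Suc)
      then have "cmod (of_nat (Suc n) * (iexp (x / real (Suc n)) - 1) - \<i> * complex_of_real x)
        = real (Suc n) * cmod (iexp (x / real (Suc n)) - 1 - \<i> * complex_of_real (x / real (Suc n)))"
        by (simp only: norm_mult norm_of_nat)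
      also have "\<dots> \<le> real (Suc n) * (6 * (x / real (Suc n))\<^sup>2)"
        by (intro mult_left_mono order_trans[OF cmod_iexp_minus_le] phi_le_square) auto
      also have "\<dots> = 6 * x\<^sup>2 * (1 / real (Suc n))" by (simp add: power2_eq_square del: of_nat_Suc)
      finally show ?thesis .
    qed
    then show "\<forall>\<^sub>F n in sequentially. cmod (of_nat (Suc n) * (iexp (x / real (Suc n)) - 1) - \<i> * complex_of_real x) \<le> 6 * x\<^sup>2 * (1 / real (Suc n))"
      by simp
  qed
  have "(\<lambda>n. CLINT \<omega>|M. of_nat (Suc n) * (iexp (X \<omega> / real (Suc n)) - 1)) \<longlonglongrightarrow> (CLINT \<omega>|M. \<i> * complex_of_real (X \<omega>))"
  proof (rule integral_dominated_convergence[where w="\<lambda>\<omega>. \<bar>X \<omega>\<bar>"])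
    show "AE \<omega> in M. cmod (of_nat (Suc n) * (iexp (X \<omega> / real (Suc n)) - 1)) \<le> \<bar>X \<omega>\<bar>" for n
    proof (rule AE_I2)
      fix \<omega>
      have "cmod (of_nat (Suc n) * (iexp (X \<omega> / real (Suc n)) - 1)) \<le> real (Suc n) * \<bar>X \<omega> / real (Suc n)\<bar>"
        unfolding norm_mult norm_of_nat using cmod_iexp_diff_le[of "X \<omega> / real (Suc n)" 0]
        by (intro mult_left_mono) (simp_all del: of_nat_Suc)
      then show "cmod (of_nat (Suc n) * (iexp (X \<omega> / real (Suc n)) - 1)) \<le> \<bar>X \<omega>\<bar>" by (simp add: abs_divide del: of_nat_Suc)
    qed
  qed (use int pt in auto)
  moreover have "(CLINT \<omega>|M. of_nat (Suc n) * (iexp (X \<omega> / real (Suc n)) - 1)) = of_nat (Suc n) * ((CLINT \<omega>|M. iexp (X \<omega> / real (Suc n))) - 1)" for n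
  proof -
    have i: "complex_integrable M (\<lambda>\<omega>. iexp (X \<omega> / real (Suc n)))" by (auto intro!: integrable_const_bound[where B=1])
    have "(CLINT \<omega>|M. iexp (X \<omega> / real (Suc n)) - 1) = (CLINT \<omega>|M. iexp (X \<omega> / real (Suc n))) - (CLINT \<omega>|M. 1)"
      by (rule Bochner_Integration.integral_diff[OF i]) simp
    then show ?thesis by (simp only: integral_mult_right_zero) (simp add: prob_space)
  qed
  ultimately show ?thesis by (simp only: integral_mult_right_zero integral_complex_of_real)
qed

subsection \<open>Centered Levy characteristics\<close>

lemma levy_measure_integrable_min:
  assumes "levy_measure \<nu>"
  shows "integrable \<nu> (\<lambda>u. min 1 (u\<^sup>2))"
proof (rule integrableI_bounded)
  have [measurable_cong]: "sets \<nu> = sets borel" using assms by (simp add: levy_measure_def)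
  show "(\<lambda>u. min 1 (u\<^sup>2)) \<in> borel_measurable \<nu>" by measurable
  show "(\<integral>\<^sup>+u. ennreal (norm (min 1 (u\<^sup>2))) \<partial>\<nu>) < \<infinity>" using assms by (simp add: levy_measure_def)
qed

lemma levy_measure_sigma_finite:
  assumes "levy_measure \<nu>"
  shows "sigma_finite_measure \<nu>"
proof (rule sigma_finite_measureI_pos[where f="\<lambda>u. min 1 (u\<^sup>2) + indicator {0} u"])
  have [measurable_cong]: "sets \<nu> = sets borel" using assms by (simp add: levy_measure_def)
  show "(\<lambda>u. min 1 (u\<^sup>2) + indicator {0} u) \<in> borel_measurable \<nu>" by measurable
  show "0 < min 1 (u\<^sup>2) + indicator {0} u" for u :: real
    by (auto simp: min_def indicator_def)
  have "(\<integral>\<^sup>+u. ennreal (min 1 (u\<^sup>2) + indicator {0} u) \<partial>\<nu>) = (\<integral>\<^sup>+u. ennreal (min 1 (u\<^sup>2)) \<partial>\<nu>) + (\<integral>\<^sup>+u. indicator {0} u \<partial>\<nu>)"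
    by (subst nn_integral_add[symmetric]) (auto simp: ennreal_plus ennreal_indicator intro!: nn_integral_cong)
  also have "\<dots> < \<infinity>" using assms by (simp add: levy_measure_def)
  finally show "(\<integral>\<^sup>+u. ennreal (min 1 (u\<^sup>2) + indicator {0} u) \<partial>\<nu>) < \<infinity>" .
qed

text \<open>A first moment of the law passes to its Levy measure. Near 0 minus the logarithm of
  |char| is comparable to 1 - |char|, hence at most a multiple of 1 - Re char; divided by the square
  of \<theta> the latter integrates to a multiple of E|Y|, and Tonelli's theorem turns the former
  into the first moment of the large jumps.\<close>

lemma (in prob_space) levy_measure_big_jumps:
  assumes \<nu>: "levy_measure \<nu>" and Y: "integrable M Y"
    and char: "\<And>\<theta>. cmod (char (distr M borel Y) \<theta>) = exp (- (\<sigma>\<^sup>2 * \<theta>\<^sup>2 / 2 + (LINT u|\<nu>. 1 - cos (\<theta> * u))))"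
  shows "integrable \<nu> (\<lambda>u. \<bar>u\<bar> * indicator (- {-1..1}) u)"
proof -
  have [measurable]: "Y \<in> borel_measurable M" using Y by auto
  interpret D: real_distribution "distr M borel Y" by (rule real_distribution_distr) measurable
  have [measurable_cong]: "sets \<nu> = sets borel" using \<nu> by (simp add: levy_measure_def)
  interpret N: sigma_finite_measure \<nu> by (rule levy_measure_sigma_finite[OF \<nu>])
  interpret pair_sigma_finite lborel \<nu> by standard
  define R where "R \<theta> = (LINT u|\<nu>. 1 - cos (\<theta> * u))" for \<theta>
  have R_nonneg: "R \<theta> \<ge> 0" for \<theta> unfolding R_def by (intro Bochner_Integration.integral_nonneg) simp
  have intR: "integrable \<nu> (\<lambda>u. 1 - cos (\<theta> * u))" for \<theta>
  proof (rule Bochner_Integration.integrable_bound)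
    show "integrable \<nu> (\<lambda>u. (2 + \<theta>\<^sup>2) * min 1 (u\<^sup>2))" by (intro integrable_mult_right levy_measure_integrable_min[OF \<nu>])
    show "AE u in \<nu>. norm (1 - cos (\<theta> * u)) \<le> norm ((2 + \<theta>\<^sup>2) * min 1 (u\<^sup>2))"
    proof (rule AE_I2)
      fix u :: real
      have "1 - cos (\<theta> * u) \<le> \<theta>\<^sup>2 * u\<^sup>2" using one_minus_cos_le_square[of "\<theta> * u"] zero_le_power2[of "\<theta> * u"]
        unfolding power_mult_distrib by linarith
      moreover have "1 - cos (\<theta> * u) \<le> 2 + \<theta>\<^sup>2" using cos_ge_minus_one[of "\<theta> * u"] zero_le_power2[of \<theta>] by linarith
      moreover have "\<theta>\<^sup>2 * u\<^sup>2 \<le> (2 + \<theta>\<^sup>2) * u\<^sup>2" by (auto intro: mult_right_mono)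
      ultimately have "1 - cos (\<theta> * u) \<le> (2 + \<theta>\<^sup>2) * min 1 (u\<^sup>2)" by (simp add: min_def)
      then show "norm (1 - cos (\<theta> * u)) \<le> norm ((2 + \<theta>\<^sup>2) * min 1 (u\<^sup>2))" by simp
    qed
  qed measurable
  have "isCont (char (distr M borel Y)) 0" by (rule D.isCont_char)
  then have "\<exists>d>0. \<forall>\<theta>. norm (\<theta> - 0) < d \<longrightarrow> norm (char (distr M borel Y) \<theta> - char (distr M borel Y) 0) < 1/2"
    unfolding continuous_at_eps_delta by (elim allE[where x="1/2"]) (simp add: dist_norm)
  then obtain d where d: "d > 0" "\<And>\<theta>. \<bar>\<theta>\<bar> < d \<Longrightarrow> cmod (char (distr M borel Y) \<theta> - 1) < 1/2"
    using D.char_zero by auto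
  define \<delta> where "\<delta> = d / 2"
  have \<delta>: "\<delta> > 0" "\<delta> < d" using d by (auto simp: \<delta>_def)
  \<comment> \<open>With |char| = exp (-x), closeness to 1 and exp (-x) <= 1/(1+x) force x < 1; then
    x/2 <= x/(1+x) <= 1 - exp (-x).\<close>
  have R_le: "R \<theta> \<le> 2 * (1 - Re (char (distr M borel Y) \<theta>))" if "\<bar>\<theta>\<bar> \<le> \<delta>" for \<theta>
  proof -
    define x where "x = \<sigma>\<^sup>2 * \<theta>\<^sup>2 / 2 + R \<theta>"
    have x: "x \<ge> R \<theta>" "x \<ge> 0" using R_nonneg[of \<theta>] by (auto simp: x_def)
    have c: "cmod (char (distr M borel Y) \<theta>) = exp (- x)" by (simp add: char x_def R_def)
    have e: "exp (- x) \<le> 1 / (1 + x)" using exp_ge_add_one_self[of x] x by (simp add: exp_minus field_simps)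
    have "1 - cmod (char (distr M borel Y) \<theta>) \<le> cmod (char (distr M borel Y) \<theta> - 1)"
      using norm_triangle_ineq2[of 1 "char (distr M borel Y) \<theta>"] by (simp add: norm_minus_commute)
    then have "1/2 < exp (- x)" using d(2)[of \<theta>] that \<delta>(2) c by simp
    then have "1/2 < 1 / (1 + x)" using e by simp
    then have x1: "x < 1" using x by (simp add: field_simps)
    have "x / 2 \<le> x / (1 + x)" using x x1 by (intro divide_left_mono) auto
    also have "\<dots> = 1 - 1 / (1 + x)" using x by (simp add: field_simps)
    also have "\<dots> \<le> 1 - exp (- x)" using e by simp
    also have "\<dots> \<le> 1 - Re (char (distr M borel Y) \<theta>)" using complex_Re_le_cmod[of "char (distr M borel Y) \<theta>"] c by simp
    finally show ?thesis using x by simp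
  qed
  define c where "c = (\<integral>\<^sup>+v. ennreal ((1 - cos v) / v\<^sup>2) * indicator {-\<delta>..\<delta>} v \<partial>lborel)"
  have c: "c > 0" unfolding c_def by (rule nn_integral_cos_Icc_pos[OF \<delta>(1)])
  have "(\<integral>\<^sup>+u. c * ennreal (\<bar>u\<bar> * indicator (- {-1..1}) u) \<partial>\<nu>)
      \<le> (\<integral>\<^sup>+u. \<integral>\<^sup>+\<theta>. ennreal ((1 - cos (\<theta> * u)) / \<theta>\<^sup>2) * indicator {-\<delta>..\<delta>} \<theta> \<partial>lborel \<partial>\<nu>)"
  proof (rule nn_integral_mono)
    fix u :: real
    show "c * ennreal (\<bar>u\<bar> * indicator (- {-1..1}) u) \<le> (\<integral>\<^sup>+\<theta>. ennreal ((1 - cos (\<theta> * u)) / \<theta>\<^sup>2) * indicator {-\<delta>..\<delta>} \<theta> \<partial>lborel)"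
    proof (cases "u \<in> {-1..1}")
      case False
      then have u: "\<bar>u\<bar> > 1" by auto
      then have "c * ennreal (\<bar>u\<bar> * indicator (- {-1..1}) u) = (\<integral>\<^sup>+\<theta>. ennreal ((1 - cos (\<theta> * u)) / \<theta>\<^sup>2) * indicator {-\<delta>..\<delta>} (\<theta> * u) \<partial>lborel)"
        using False by (subst nn_integral_cos_scale) (auto simp: c_def mult.commute)
      \<comment> \<open>For |u| > 1 the condition |\<theta> u| <= \<delta> implies |\<theta>| <=
        \<delta>, so one window in \<theta> serves all large jumps.\<close>
      also have "\<dots> \<le> (\<integral>\<^sup>+\<theta>. ennreal ((1 - cos (\<theta> * u)) / \<theta>\<^sup>2) * indicator {-\<delta>..\<delta>} \<theta> \<partial>lborel)"
      proof (rule nn_integral_mono, rule mult_left_mono)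
        fix \<theta> :: real
        have "\<bar>\<theta>\<bar> * 1 \<le> \<bar>\<theta>\<bar> * \<bar>u\<bar>" using u by (intro mult_left_mono) auto
        then have "\<theta> * u \<in> {-\<delta>..\<delta>} \<Longrightarrow> \<theta> \<in> {-\<delta>..\<delta>}" unfolding atLeastAtMost_iff abs_le_iff[symmetric] minus_le_iff[of \<delta>]
          by (auto simp: abs_mult[symmetric] abs_le_iff)
        then show "indicator {-\<delta>..\<delta>} (\<theta> * u) \<le> (indicator {-\<delta>..\<delta>} \<theta> :: ennreal)" by (auto simp: indicator_def)
      qed simp
      finally show ?thesis .
    qed simp
  qed
  also have "\<dots> = (\<integral>\<^sup>+\<theta>. \<integral>\<^sup>+u. ennreal ((1 - cos (\<theta> * u)) / \<theta>\<^sup>2) * indicator {-\<delta>..\<delta>} \<theta> \<partial>\<nu> \<partial>lborel)"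
    by (rule Fubini') measurable
  also have "\<dots> \<le> (\<integral>\<^sup>+\<theta>. 2 * ennreal ((1 - Re (char (distr M borel Y) \<theta>)) / \<theta>\<^sup>2) \<partial>lborel)"
  proof (rule nn_integral_mono)
    fix \<theta> :: real
    have "(\<integral>\<^sup>+u. ennreal ((1 - cos (\<theta> * u)) / \<theta>\<^sup>2) \<partial>\<nu>) = ennreal (R \<theta> / \<theta>\<^sup>2)"
      unfolding R_def using intR[of \<theta>] by (subst nn_integral_eq_integral) auto
    moreover have "ennreal (R \<theta> / \<theta>\<^sup>2) \<le> 2 * ennreal ((1 - Re (char (distr M borel Y) \<theta>)) / \<theta>\<^sup>2)" if "\<bar>\<theta>\<bar> \<le> \<delta>"
    proof -
      have "R \<theta> / \<theta>\<^sup>2 \<le> 2 * ((1 - Re (char (distr M borel Y) \<theta>)) / \<theta>\<^sup>2)" using divide_right_mono[OF R_le[OF that], of "\<theta>\<^sup>2"] by simp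
      then show ?thesis by (subst ennreal_numeral[symmetric], subst ennreal_mult'[symmetric]) (auto intro: ennreal_leI)
    qed
    ultimately show "(\<integral>\<^sup>+u. ennreal ((1 - cos (\<theta> * u)) / \<theta>\<^sup>2) * indicator {-\<delta>..\<delta>} \<theta> \<partial>\<nu>) \<le> 2 * ennreal ((1 - Re (char (distr M borel Y) \<theta>)) / \<theta>\<^sup>2)"
      by (auto split: split_indicator)
  qed
  also have "\<dots> = 2 * (ennreal cos_const * (\<integral>\<^sup>+\<omega>. ennreal \<bar>Y \<omega>\<bar> \<partial>M))"
    by (subst nn_integral_cmult) (simp_all add: nn_integral_abs_eq_char)
  also have "\<dots> < \<infinity>"
    using Y by (subst nn_integral_eq_integral) (auto simp: ennreal_mult_less_top)
  finally have "c * (\<integral>\<^sup>+u. ennreal (\<bar>u\<bar> * indicator (- {-1..1}) u) \<partial>\<nu>) < \<infinity>"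
    by (subst (asm) nn_integral_cmult) auto
  then have "(\<integral>\<^sup>+u. ennreal (\<bar>u\<bar> * indicator (- {-1..1}) u) \<partial>\<nu>) < \<infinity>"
    using c by (auto simp: ennreal_mult_less_top)
  then show ?thesis by (intro integrableI_bounded) auto
qed

text \<open>Once the large jumps are known to be integrable, the truncated compensator can be
  extended to all jumps at the cost of a new drift. That drift is identified with the mean by
  differentiating the characteristic function at 0.\<close>

lemma (in prob_space) centered_levy_characteristics:
  assumes lc: "has_levy_characteristics M Z \<sigma> \<nu>" and Z: "integrable M (Z 1)" "expectation (Z 1) = 0"
  shows "centered_levy_pair \<nu>" "char (distr M borel (Z 1)) \<theta> = exp (centered_levy_pair.Psi \<sigma> \<nu> \<theta>)"
proof -
  have \<nu>: "levy_measure \<nu>" using lc by (simp add: has_levy_characteristics_def)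
  define h where "h \<theta> u = iexp (\<theta> * u) - 1 - \<i> * complex_of_real (\<theta> * u * indicator {-1..1} u)" for \<theta> u :: real
  obtain \<gamma> where \<gamma>: "\<And>\<theta>. char (distr M borel (Z 1)) \<theta> = exp (\<i> * of_real (\<gamma> * \<theta>) - of_real (\<sigma>\<^sup>2 * \<theta>\<^sup>2 / 2) + (CLINT u|\<nu>. h \<theta> u))"
    using lc unfolding has_levy_characteristics_def h_def by blast
  have sets[measurable_cong]: "sets \<nu> = sets borel" using \<nu> by (simp add: levy_measure_def)
  have inth: "complex_integrable \<nu> (h \<theta>)" for \<theta>
  proof (rule Bochner_Integration.integrable_bound)
    show "integrable \<nu> (\<lambda>u. (2 + 6 * \<theta>\<^sup>2) * min 1 (u\<^sup>2))" by (intro integrable_mult_right levy_measure_integrable_min[OF \<nu>])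
    show "h \<theta> \<in> borel_measurable \<nu>" unfolding h_def by measurable
    show "AE u in \<nu>. cmod (h \<theta> u) \<le> norm ((2 + 6 * \<theta>\<^sup>2) * min 1 (u\<^sup>2))"
    proof (rule AE_I2)
      fix u :: real
      have "cmod (h \<theta> u) \<le> (2 + 6 * \<theta>\<^sup>2) * min 1 (u\<^sup>2)"
      proof (cases "u \<in> {-1..1}")
        case True
        then have "\<bar>u\<bar> \<le> 1" by auto
        then have m: "min 1 (u\<^sup>2) = u\<^sup>2" using abs_square_le_1[of u] by simp
        have "cmod (h \<theta> u) \<le> 6 * phi (\<theta> * u)" using cmod_iexp_minus_le[of "\<theta> * u"] True by (simp add: h_def)
        also have "\<dots> \<le> 6 * (\<theta> * u)\<^sup>2" by (intro mult_left_mono phi_le_square) simp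
        also have "\<dots> \<le> (2 + 6 * \<theta>\<^sup>2) * u\<^sup>2" by (simp add: power_mult_distrib distrib_right)
        finally show ?thesis by (simp only: m)
      next
        case False
        then have "1 \<le> \<bar>u\<bar>" by auto
        then have m: "min 1 (u\<^sup>2) = 1" by (simp add: min_def abs_le_square_iff[of 1 u, simplified])
        have "cmod (h \<theta> u) \<le> 2" using norm_triangle_ineq4[of "iexp (\<theta> * u)" 1] False by (simp add: h_def)
        then show ?thesis unfolding m by (simp add: add_increasing2)
      qed
      then show "cmod (h \<theta> u) \<le> norm ((2 + 6 * \<theta>\<^sup>2) * min 1 (u\<^sup>2))" by simp
    qed
  qed
  have big: "integrable \<nu> (\<lambda>u. \<bar>u\<bar> * indicator (- {-1..1}) u)"
  proof (rule levy_measure_big_jumps[OF \<nu> Z(1)])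
    fix \<theta>
    have "Re (CLINT u|\<nu>. h \<theta> u) = (LINT u|\<nu>. Re (h \<theta> u))" by (rule integral_Re[OF inth, symmetric])
    also have "\<dots> = - (LINT u|\<nu>. 1 - cos (\<theta> * u))"
      by (simp add: h_def Re_exp flip: Bochner_Integration.integral_minus)
    finally show "cmod (char (distr M borel (Z 1)) \<theta>) = exp (- (\<sigma>\<^sup>2 * \<theta>\<^sup>2 / 2 + (LINT u|\<nu>. 1 - cos (\<theta> * u))))"
      unfolding \<gamma> norm_exp_eq_Re by simp
  qed
  have phi: "integrable \<nu> phi"
  proof (rule Bochner_Integration.integrable_bound)
    show "integrable \<nu> (\<lambda>u. min 1 (u\<^sup>2) + \<bar>u\<bar> * indicator (- {-1..1}) u)"
      by (intro Bochner_Integration.integrable_add levy_measure_integrable_min[OF \<nu>] big)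
    show "AE u in \<nu>. norm (phi u) \<le> norm (min 1 (u\<^sup>2) + \<bar>u\<bar> * indicator (- {-1..1}) u)"
    proof (rule AE_I2)
      fix u :: real
      show "norm (phi u) \<le> norm (min 1 (u\<^sup>2) + \<bar>u\<bar> * indicator (- {-1..1}) u)"
      proof (cases "u \<in> {-1..1}")
        case True
        then have "\<bar>u\<bar> \<le> 1" by auto
        then have m: "min 1 (u\<^sup>2) = u\<^sup>2" using abs_square_le_1[of u] by simp
        show ?thesis unfolding m using True phi_le_square[of u] by simp
      next
        case False
        have "phi u \<le> min 1 (u\<^sup>2) + \<bar>u\<bar>" using phi_le_abs[of u] by (rule order_trans) simp
        with False show ?thesis by simp
      qed
    qed
  qed measurable
  show P: "centered_levy_pair \<nu>"
    by standard (use \<nu> sets phi in \<open>auto simp: levy_measure_def\<close>)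
  interpret centered_levy_pair \<sigma> \<nu> by (rule P)
  have bigint: "integrable \<nu> (\<lambda>u. u * indicator (- {-1..1}) u)"
    by (rule Bochner_Integration.integrable_bound[OF big]) (auto simp: abs_mult)
  define g where "g = \<gamma> + (LINT u|\<nu>. u * indicator (- {-1..1}) u)"
  have char: "char (distr M borel (Z 1)) \<theta> = exp (\<i> * of_real (g * \<theta>) + Psi \<theta>)" for \<theta>
  proof -
    have "(CLINT u|\<nu>. h \<theta> u) = (CLINT u|\<nu>. (iexp (\<theta> * u) - 1 - \<i> * (\<theta> * u)) + \<i> * \<theta> * complex_of_real (u * indicator (- {-1..1}) u))"
      by (intro Bochner_Integration.integral_cong) (auto simp: h_def indicator_def)
    also have "\<dots> = (CLINT u|\<nu>. iexp (\<theta> * u) - 1 - \<i> * (\<theta> * u)) + \<i> * \<theta> * complex_of_real (LINT u|\<nu>. u * indicator (- {-1..1}) u)"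
      by (subst Bochner_Integration.integral_add[OF integrable_Psi])
        (simp_all only: integral_mult_right_zero integral_complex_of_real integrable_mult_right integrable_of_real bigint)
    finally show ?thesis unfolding \<gamma> Psi_def g_def by (simp add: algebra_simps)
  qed
  \<comment> \<open>Both sides are limits of one difference quotient: directly, and after replacing
    the law by the constant g. The replacement error is at most 6 (n+1) k(1/(n+1)), which tends to
    0.\<close>
  have "\<i> * complex_of_real g = \<i> * complex_of_real (expectation (Z 1))"
  proof (rule LIMSEQ_unique)
    have [measurable]: "Z 1 \<in> borel_measurable M" using Z by auto
    let ?n = "\<lambda>n. of_nat (Suc n) :: complex"
    have c: "(CLINT \<omega>|M. iexp (Z 1 \<omega> / real (Suc n))) = exp (\<i> * of_real (g / real (Suc n)) + Psi (1 / real (Suc n)))" for n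
      using char[of "1 / real (Suc n)"] unfolding char_def by (subst (asm) integral_distr) auto
    show "(\<lambda>n. ?n n * ((CLINT \<omega>|M. iexp (Z 1 \<omega> / real (Suc n))) - 1)) \<longlonglongrightarrow> \<i> * complex_of_real (expectation (Z 1))"
      by (rule char_difference_quotient[OF Z(1)])
    have const: "(\<lambda>n. ?n n * (iexp (g / real (Suc n)) - 1)) \<longlonglongrightarrow> \<i> * complex_of_real g"
      using char_difference_quotient[of "\<lambda>_. g"] by (simp add: prob_space)
    have "(\<lambda>n. ?n n * ((CLINT \<omega>|M. iexp (Z 1 \<omega> / real (Suc n))) - 1) - ?n n * (iexp (g / real (Suc n)) - 1)) \<longlonglongrightarrow> 0"
    proof (rule Lim_null_comparison)
      have "(\<lambda>n. 6 * (real (Suc n) * k (1 / real (Suc n)))) \<longlonglongrightarrow> 6 * 0" by (intro tendsto_mult tendsto_const k_small_quotient)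
      then show "(\<lambda>n. 6 * (real (Suc n) * k (1 / real (Suc n)))) \<longlonglongrightarrow> 0" by simp
      have "cmod (?n n * ((CLINT \<omega>|M. iexp (Z 1 \<omega> / real (Suc n))) - 1) - ?n n * (iexp (g / real (Suc n)) - 1)) \<le> 6 * (real (Suc n) * k (1 / real (Suc n)))" for n
      proof -
        have "?n n * ((CLINT \<omega>|M. iexp (Z 1 \<omega> / real (Suc n))) - 1) - ?n n * (iexp (g / real (Suc n)) - 1)
          = ?n n * (exp (\<i> * of_real (g / real (Suc n)) + Psi (1 / real (Suc n))) - exp (\<i> * of_real (g / real (Suc n))))"
          unfolding c by (simp add: right_diff_distrib del: of_nat_Suc)
        then have "cmod (?n n * ((CLINT \<omega>|M. iexp (Z 1 \<omega> / real (Suc n))) - 1) - ?n n * (iexp (g / real (Suc n)) - 1))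
          = real (Suc n) * cmod (exp (\<i> * of_real (g / real (Suc n)) + Psi (1 / real (Suc n))) - exp (\<i> * of_real (g / real (Suc n))))"
          by (simp only: norm_mult norm_of_nat)
        also have "\<dots> \<le> real (Suc n) * (6 * k (1 / real (Suc n)))"
        proof (rule mult_left_mono)
          have "cmod (exp (\<i> * of_real (g / real (Suc n)) + Psi (1 / real (Suc n))) - exp (\<i> * of_real (g / real (Suc n))))
            \<le> cmod (\<i> * of_real (g / real (Suc n)) + Psi (1 / real (Suc n)) - \<i> * of_real (g / real (Suc n)))"
            by (rule cmod_exp_diff_le) (use Re_Psi[of "1 / real (Suc n)"] in auto)
          also have "\<dots> = cmod (Psi (1 / real (Suc n)))" by simp
          also have "\<dots> \<le> 6 * k (1 / real (Suc n))" by (rule cmod_Psi_le)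
          finally show "cmod (exp (\<i> * of_real (g / real (Suc n)) + Psi (1 / real (Suc n))) - exp (\<i> * of_real (g / real (Suc n)))) \<le> 6 * k (1 / real (Suc n))" .
        qed simp
        finally show ?thesis by simp
      qed
      then show "\<forall>\<^sub>F n in sequentially. cmod (?n n * ((CLINT \<omega>|M. iexp (Z 1 \<omega> / real (Suc n))) - 1) - ?n n * (iexp (g / real (Suc n)) - 1)) \<le> 6 * (real (Suc n) * k (1 / real (Suc n)))"
        by simp
    qed
    from tendsto_add[OF this const]
    show "(\<lambda>n. ?n n * ((CLINT \<omega>|M. iexp (Z 1 \<omega> / real (Suc n))) - 1)) \<longlonglongrightarrow> \<i> * complex_of_real g" by simp
  qed
  then have "g = 0" using Z(2) by simp
  then show "char (distr M borel (Z 1)) \<theta> = exp (Psi \<theta>)" using char by simp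
qed

subsection \<open>Levy bases\<close>

lemma (in prob_space) char_distr_eq:
  assumes "X \<in> borel_measurable M"
  shows "char (distr M borel X) \<theta> = (CLINT \<omega>|M. iexp (\<theta> * X \<omega>))"
  unfolding char_def using assms by (subst integral_distr) auto

text \<open>The image of the connected line in the finite set of roots of unity is a single
  point.\<close>

lemma continuous_nth_root_of_1:
  fixes q :: "real \<Rightarrow> complex"
  assumes "continuous_on UNIV q" "\<And>x. q x ^ n = 1" "n > 0" "q 0 = 1"
  shows "q x = 1"
proof -
  have "finite (q ` UNIV)"
    by (rule finite_subset[OF _ finite_roots_unity[of n, where 'a=complex]]) (use assms in auto)
  then have "q constant_on UNIV"
    by (intro continuous_finite_range_constant assms) auto
  then obtain y where "\<And>x. q x = y" unfolding constant_on_def by auto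
  with assms(4) show ?thesis by simp
qed

text \<open>Independent stationary increments make the characteristic function multiplicative in
  time. Time 1 determines time 1/n only up to an n-th root of unity; continuity in \<theta> selects
  the branch. Stochastic continuity extends the formula from rational to real times.\<close>

lemma (in prob_space) levy_process_char:
  fixes Z :: "real \<Rightarrow> 'a \<Rightarrow> real" and \<Psi> :: "real \<Rightarrow> complex"
  assumes Z: "levy_process M Z" and char1: "\<And>\<theta>. char (distr M borel (Z 1)) \<theta> = exp (\<Psi> \<theta>)"
    and cont: "\<And>\<theta>. isCont \<Psi> \<theta>" and \<Psi>0: "\<Psi> 0 = 0" and ab: "a < b"
  shows "char (distr M borel (\<lambda>\<omega>. Z b \<omega> - Z a \<omega>)) \<theta> = exp (of_real (b - a) * \<Psi> \<theta>)"
proof -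
  have [measurable]: "Z t \<in> borel_measurable M" for t using Z by (simp add: levy_process_def)
  define c where "c t \<theta> = char (distr M borel (\<lambda>\<omega>. Z t \<omega> - Z 0 \<omega>)) \<theta>" for t \<theta>
  have stat: "char (distr M borel (\<lambda>\<omega>. Z (s + h) \<omega> - Z s \<omega>)) \<theta> = c h \<theta>" for s h \<theta>
  proof -
    have "distr M borel (\<lambda>\<omega>. Z (s + h) \<omega> - Z s \<omega>) = distr M borel (\<lambda>\<omega>. Z (0 + h) \<omega> - Z 0 \<omega>)"
      using Z unfolding levy_process_def by blast
    then show ?thesis by (simp add: c_def)
  qed
  have pow: "c (real n * h) \<theta> = c h \<theta> ^ n" if h: "h > 0" for n h \<theta>
  proof -
    define t where "t i = real i * h" for i :: nat
    have "indep_vars (\<lambda>_. borel) (\<lambda>i \<omega>. Z (t (Suc i)) \<omega> - Z (t i) \<omega>) {..<n}"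
    proof -
      have "\<forall>(n::nat) t. (\<forall>i<n. t i < t (Suc i)) \<longrightarrow> indep_vars (\<lambda>_. borel) (\<lambda>i \<omega>. Z (t (Suc i)) \<omega> - Z (t i) \<omega>) {..<n}"
        using Z unfolding levy_process_def by blast
      moreover have "\<forall>i<n. t i < t (Suc i)" using h by (simp add: t_def distrib_right)
      ultimately show ?thesis by blast
    qed
    then have "char (distr M borel (\<lambda>\<omega>. \<Sum>i<n. Z (t (Suc i)) \<omega> - Z (t i) \<omega>)) \<theta> = (\<Prod>i<n. char (distr M borel (\<lambda>\<omega>. Z (t (Suc i)) \<omega> - Z (t i) \<omega>)) \<theta>)"
      by (rule char_distr_sum)
    also have "(\<lambda>\<omega>. \<Sum>i<n. Z (t (Suc i)) \<omega> - Z (t i) \<omega>) = (\<lambda>\<omega>. Z (real n * h) \<omega> - Z 0 \<omega>)"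
      by (intro ext) (subst sum_lessThan_telescope, simp add: t_def)
    also have "(\<Prod>i<n. char (distr M borel (\<lambda>\<omega>. Z (t (Suc i)) \<omega> - Z (t i) \<omega>)) \<theta>) = (\<Prod>i<n. c h \<theta>)"
    proof (rule prod.cong[OF refl])
      fix i
      have "t (Suc i) = t i + h" by (simp add: t_def distrib_right)
      then show "char (distr M borel (\<lambda>\<omega>. Z (t (Suc i)) \<omega> - Z (t i) \<omega>)) \<theta> = c h \<theta>" using stat[of "t i" h] by simp
    qed
    finally show ?thesis by (simp add: c_def)
  qed
  have c1: "c 1 \<theta> = exp (\<Psi> \<theta>)" for \<theta>
  proof -
    have "AE \<omega> in M. Z 0 \<omega> = 0" using Z by (simp add: levy_process_def)
    then have "distr M borel (\<lambda>\<omega>. Z 1 \<omega> - Z 0 \<omega>) = distr M borel (Z 1)"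
      by (intro distr_cong_AE) auto
    then show ?thesis by (simp add: c_def char1)
  qed
  have inv: "c (1 / real (Suc n)) \<theta> = exp (of_real (1 / real (Suc n)) * \<Psi> \<theta>)" for n \<theta>
  proof -
    \<comment> \<open>The quotient of the two candidates is continuous in \<theta>, has n+1-st power
      1, and equals 1 at \<theta> = 0.\<close>
    define q where "q \<theta> = c (1 / real (Suc n)) \<theta> * exp (- (of_real (1 / real (Suc n)) * \<Psi> \<theta>))" for \<theta>
    interpret D: real_distribution "distr M borel (\<lambda>\<omega>. Z (1 / real (Suc n)) \<omega> - Z 0 \<omega>)"
      by (rule real_distribution_distr) measurable
    have "q \<theta> = 1"
    proof (rule continuous_nth_root_of_1[where n="Suc n"])
      show "continuous_on UNIV q"
        unfolding q_def c_def continuous_on_eq_continuous_at[OF open_UNIV]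
        by (intro ballI continuous_intros cont D.isCont_char)
      show "q x ^ Suc n = 1" for x
      proof -
        have "c (1 / real (Suc n)) x ^ Suc n = exp (\<Psi> x)"
          using pow[of "1 / real (Suc n)" "Suc n" x] c1[of x] by simp
        moreover have "exp (- (of_real (1 / real (Suc n)) * \<Psi> x)) ^ Suc n = exp (- \<Psi> x)"
          by (subst exp_of_nat_mult[symmetric]) (simp del: of_nat_Suc)
        ultimately show ?thesis unfolding q_def power_mult_distrib by (simp add: exp_minus)
      qed
      show "q 0 = 1" using D.char_zero by (simp add: q_def c_def \<Psi>0)
    qed simp
    then show ?thesis by (simp add: q_def exp_minus field_simps)
  qed
  have rat: "c (real m / real (Suc n)) \<theta> = exp (of_real (real m / real (Suc n)) * \<Psi> \<theta>)" for m n \<theta>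
  proof -
    have "c (real m * (1 / real (Suc n))) \<theta> = exp (of_real (1 / real (Suc n)) * \<Psi> \<theta>) ^ m"
      using pow[of "1 / real (Suc n)" m \<theta>] inv[of n \<theta>] by simp
    also have "\<dots> = exp (of_nat m * (of_real (1 / real (Suc n)) * \<Psi> \<theta>))" by (rule exp_of_nat_mult[symmetric])
    finally show ?thesis by (simp del: of_nat_Suc)
  qed
  have pos: "c t \<theta> = exp (of_real t * \<Psi> \<theta>)" if t: "t > 0" for t \<theta>
  proof (rule LIMSEQ_unique)
    \<comment> \<open>Rational approximation of t from above with denominator n+1 and error at most
      1/(n+1).\<close>
    define m where "m n = nat \<lceil>real (Suc n) * t\<rceil>" for n
    define r where "r n = real (m n) / real (Suc n)" for n
    have m: "real (m n) \<ge> real (Suc n) * t" "real (m n) \<le> real (Suc n) * t + 1" for n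
    proof -
      have "0 \<le> real (Suc n) * t" using t by simp
      then have "real (m n) = of_int \<lceil>real (Suc n) * t\<rceil>" unfolding m_def by simp
      then show "real (m n) \<ge> real (Suc n) * t" "real (m n) \<le> real (Suc n) * t + 1" by linarith+
    qed
    have r: "r \<longlonglongrightarrow> t"
    proof (rule tendsto_sandwich)
      show "\<forall>\<^sub>F n in sequentially. t \<le> r n" using m(1) by (simp add: r_def field_simps del: of_nat_Suc)
      show "\<forall>\<^sub>F n in sequentially. r n \<le> t + 1 / real (Suc n)" using m(2) by (simp add: r_def field_simps del: of_nat_Suc)
      show "(\<lambda>n. t + 1 / real (Suc n)) \<longlonglongrightarrow> t" using tendsto_add[OF tendsto_const LIMSEQ_Suc[OF lim_1_over_n]] by simp
    qed simp
    have tip: "tendsto_in_prob M (\<lambda>n. Z (r n)) (Z t)"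
      unfolding tendsto_in_prob_def
    proof (intro conjI allI impI)
      fix e :: real assume e: "e > 0"
      have "((\<lambda>s. measure M {\<omega> \<in> space M. e < \<bar>Z s \<omega> - Z t \<omega>\<bar>}) \<longlongrightarrow> 0) (at t)"
        using Z e unfolding levy_process_def by blast
      then have "isCont (\<lambda>s. measure M {\<omega> \<in> space M. e < \<bar>Z s \<omega> - Z t \<omega>\<bar>}) t"
        using e by (simp add: isCont_def)
      from isCont_tendsto_compose[OF this r]
      show "(\<lambda>n. measure M {\<omega> \<in> space M. e < \<bar>Z (r n) \<omega> - Z t \<omega>\<bar>}) \<longlonglongrightarrow> 0" using e by simp
    qed auto
    have "tendsto_in_prob M (\<lambda>n. Z 0) (Z 0)" by (simp add: tendsto_in_prob_def)
    from tendsto_in_prob_char[OF tendsto_in_prob_diff[OF tip this], of \<theta>]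
    show "(\<lambda>n. c (r n) \<theta>) \<longlonglongrightarrow> c t \<theta>" by (simp add: c_def char_distr_eq)
    have "(\<lambda>n. exp (of_real (r n) * \<Psi> \<theta>)) \<longlonglongrightarrow> exp (of_real t * \<Psi> \<theta>)"
      by (intro tendsto_exp tendsto_mult tendsto_of_real r tendsto_const)
    then show "(\<lambda>n. c (r n) \<theta>) \<longlonglongrightarrow> exp (of_real t * \<Psi> \<theta>)" by (simp only: r_def rat)
  qed
  show ?thesis using stat[of a "b - a" \<theta>] pos[of "b - a" \<theta>] ab by simp
qed

text \<open>Dynkin's induction takes complements in the whole line, which are unbounded.
  Intersecting everything with one interval around the given set keeps all sets bounded, and
  complements become relative to that interval.\<close>

lemma bounded_borel_induct [consumes 1, case_names empty Ioc diff union]: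
  assumes "bounded_borel A"
    and empty: "P {}"
    and Ioc: "\<And>a b. a < b \<Longrightarrow> P {a<..b}"
    and diff: "\<And>A m. m > 0 \<Longrightarrow> bounded_borel A \<Longrightarrow> A \<subseteq> {-m<..m} \<Longrightarrow> P A \<Longrightarrow> P ({-m<..m} - A)"
    and union: "\<And>A :: nat \<Rightarrow> real set. (\<And>n. bounded_borel (A n)) \<Longrightarrow> disjoint_family A \<Longrightarrow> bounded_borel (\<Union>n. A n) \<Longrightarrow>
        (\<And>n. P (A n)) \<Longrightarrow> P (\<Union>n. A n)"
  shows "P A"
proof -
  obtain m where m: "m > 0" "\<And>x. x \<in> A \<Longrightarrow> \<bar>x\<bar> < m"
    using assms(1) unfolding bounded_pos_less by (auto simp: real_norm_def)
  define J where "J = {-m<..m}"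
  have bJ: "bounded J" unfolding J_def by simp
  let ?G = "range (\<lambda>(a, b). {a<..b::real})"
  have sb: "sets borel = sigma_sets UNIV ?G" by (subst borel_sigma_sets_Ioc) (simp add: sets_measure_of)
  have "P (B \<inter> J)" if B: "B \<in> sets borel" for B
  proof -
    have "Int_stable ?G"
    proof (safe intro!: Int_stableI)
      fix a b a' b' :: real
      have "{a<..b} \<inter> {a'<..b'} = {max a a'<..min b b'}" by auto
      then show "{a<..b} \<inter> {a'<..b'} \<in> ?G" by auto
    qed
    moreover have "?G \<subseteq> Pow UNIV" by simp
    moreover have "B \<in> sigma_sets UNIV ?G" using B by (simp only: sb)
    ultimately show ?thesis
    proof (induction rule: sigma_sets_induct_disjoint)
      case (basic B)
      then obtain a b where B: "B = {a<..b}" by auto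
      have "B \<inter> J = {max a (-m)<..min b m}" by (auto simp: B J_def)
      then show ?case using Ioc[of "max a (-m)" "min b m"] empty by (cases "max a (-m) < min b m") auto
    next
      case empty
      show ?case using assms(2) by simp
    next
      case (compl B)
      then have B: "B \<in> sets borel" by (simp only: sb)
      have "P ({-m<..m} - (B \<inter> J))"
        using compl B m(1) bJ by (intro diff) (auto simp: J_def intro: bounded_subset)
      moreover have "{-m<..m} - (B \<inter> J) = (UNIV - B) \<inter> J" by (auto simp: J_def)
      ultimately show ?case by simp
    next
      case (union B)
      then have B: "B n \<in> sets borel" for n by (auto simp only: sb)
      have b: "bounded (S \<inter> J)" for S by (rule bounded_subset[OF bJ]) auto
      have "P (\<Union>n. B n \<inter> J)"
      proof (rule assms(5))
        show "disjoint_family (\<lambda>n. B n \<inter> J)" using union.hyps by (auto simp: disjoint_family_on_def)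
        show "bounded_borel (\<Union>n. B n \<inter> J)"
        proof
          show "(\<Union>n. B n \<inter> J) \<in> sets borel" using B by (auto simp: J_def)
          show "bounded (\<Union>n. B n \<inter> J)" by (rule bounded_subset[OF bJ]) auto
        qed
        show "bounded_borel (B n \<inter> J)" for n using B[of n] b by (auto simp: J_def)
        show "P (B n \<inter> J)" for n by (rule union.IH)
      qed
      then show ?case by simp
    qed
  qed
  moreover have "A \<inter> J = A" using m(2) by (force simp: J_def)
  ultimately show ?thesis using assms(1) by metis
qed

section \<open>Additivity and distribution of a Levy basis on bounded Borel sets\<close>

locale levy_basis_space = prob_space M for M :: "'w measure" +
  fixes \<Lambda> :: "real set \<Rightarrow> 'w \<Rightarrow> real"
  assumes basis: "levy_basis M \<Lambda>"
begin

lemma basis_measurable: "bounded_borel A \<Longrightarrow> \<Lambda> A \<in> borel_measurable M"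
  using basis unfolding levy_basis_def by blast

lemma basis_indep:
  fixes A :: "nat \<Rightarrow> real set"
  assumes "\<And>n. bounded_borel (A n)" "disjoint_family A"
  shows "indep_vars (\<lambda>_. borel) (\<lambda>n. \<Lambda> (A n)) UNIV"
  using basis assms unfolding levy_basis_def by blast

lemma basis_sums:
  fixes A :: "nat \<Rightarrow> real set"
  assumes "\<And>n. bounded_borel (A n)" "disjoint_family A" "bounded_borel (\<Union>n. A n)"
  shows "AE \<omega> in M. (\<lambda>n. \<Lambda> (A n) \<omega>) sums \<Lambda> (\<Union>n. A n) \<omega>"
  using basis assms unfolding levy_basis_def by blast

text \<open>The constant sequence of empty sets is disjoint, and a convergent series with equal
  terms has terms 0.\<close>

lemma basis_empty: "AE \<omega> in M. \<Lambda> {} \<omega> = 0"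
proof -
  have "AE \<omega> in M. (\<lambda>n::nat. \<Lambda> {} \<omega>) sums \<Lambda> (\<Union>n::nat. {}) \<omega>"
    by (rule basis_sums) (auto simp: disjoint_family_on_def)
  then show ?thesis
  proof eventually_elim
    case (elim \<omega>)
    then have "(\<lambda>n::nat. \<Lambda> {} \<omega>) \<longlonglongrightarrow> 0" by (intro summable_LIMSEQ_zero) (auto simp: sums_iff)
    then show ?case by (simp add: LIMSEQ_const_iff)
  qed
qed

lemma basis_Un:
  assumes "bounded_borel A" "bounded_borel B" "A \<inter> B = {}"
  shows "AE \<omega> in M. \<Lambda> (A \<union> B) \<omega> = \<Lambda> A \<omega> + \<Lambda> B \<omega>"
proof -
  define S where "S n = (if n = 0 then A else if n = 1 then B else {})" for n :: nat
  have U: "(\<Union>n. S n) = A \<union> B" by (auto simp: S_def split: if_splits)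
  have "AE \<omega> in M. (\<lambda>n. \<Lambda> (S n) \<omega>) sums \<Lambda> (\<Union>n. S n) \<omega>"
    by (rule basis_sums) (use assms U in \<open>auto simp: S_def disjoint_family_on_def\<close>)
  with basis_empty show ?thesis
  proof eventually_elim
    case (elim \<omega>)
    have "(\<lambda>n. \<Lambda> (S n) \<omega>) sums (\<Sum>n\<in>{0,1}. \<Lambda> (S n) \<omega>)"
      by (rule sums_finite) (use elim(1) in \<open>auto simp: S_def\<close>)
    then have "(\<lambda>n. \<Lambda> (S n) \<omega>) sums (\<Lambda> A \<omega> + \<Lambda> B \<omega>)" by (simp add: S_def)
    with elim(2) show ?case unfolding U by (rule sums_unique2)
  qed
qed

lemma basis_finite_Union:
  assumes "finite F" "\<And>i. i \<in> F \<Longrightarrow> bounded_borel (A i)" "disjoint_family_on A F"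
  shows "AE \<omega> in M. \<Lambda> (\<Union>i\<in>F. A i) \<omega> = (\<Sum>i\<in>F. \<Lambda> (A i) \<omega>)"
  using assms
proof (induction F rule: finite_induct)
  case empty
  then show ?case using basis_empty by simp
next
  case (insert i F)
  have "AE \<omega> in M. \<Lambda> (\<Union>i\<in>F. A i) \<omega> = (\<Sum>i\<in>F. \<Lambda> (A i) \<omega>)"
    using insert by (intro insert.IH) (auto simp: disjoint_family_on_def)
  moreover have "AE \<omega> in M. \<Lambda> (A i \<union> (\<Union>i\<in>F. A i)) \<omega> = \<Lambda> (A i) \<omega> + \<Lambda> (\<Union>i\<in>F. A i) \<omega>"
  proof (rule basis_Un)
    show "bounded_borel (\<Union>i\<in>F. A i)" using insert by (auto intro!: sets.finite_UN)
    show "A i \<inter> (\<Union>i\<in>F. A i) = {}" using insert.hyps insert.prems by (auto simp: disjoint_family_on_def)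
  qed (use insert in auto)
  ultimately show ?case
    by eventually_elim (use insert.hyps in simp)
qed

lemma basis_char_linear:
  assumes F: "finite F" and A: "\<And>i. i \<in> F \<Longrightarrow> bounded_borel (A i)" "disjoint_family_on A F"
  shows "char (distr M borel (\<lambda>\<omega>. \<Sum>i\<in>F. c i * \<Lambda> (A i) \<omega>)) \<theta> = (\<Prod>i\<in>F. char (distr M borel (\<Lambda> (A i))) (\<theta> * c i))"
proof -
  obtain e where e: "bij_betw e {0..<card F} F" using ex_bij_betw_nat_finite[OF F] by blast
  \<comment> \<open>Independence is given for sequences of disjoint sets, so the finite family is
    enumerated and padded with empty sets.\<close>
  define B where "B j = (if j < card F then A (e j) else {})" for j
  have eF: "e j \<in> F" if "j < card F" for j using e that by (auto simp: bij_betw_def)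
  have "indep_vars (\<lambda>_. borel) (\<lambda>n. \<Lambda> (B n)) UNIV"
  proof (rule basis_indep)
    show "bounded_borel (B n)" for n using A(1)[OF eF] by (auto simp: B_def)
    have "e i \<noteq> e j" if "i < card F" "j < card F" "i \<noteq> j" for i j
      using e that by (auto simp: bij_betw_def inj_on_def)
    then show "disjoint_family B"
      using A(2) eF by (auto simp: B_def disjoint_family_on_def)
  qed
  then have "indep_vars (\<lambda>_. borel) (\<lambda>n. \<Lambda> (B n)) {0..<card F}" by (rule indep_vars_subset) simp
  then have ind: "indep_vars (\<lambda>_. borel) (\<lambda>n \<omega>. c (e n) * \<Lambda> (B n) \<omega>) {0..<card F}"
    by (rule indep_vars_compose2[where Y="\<lambda>n x. c (e n) * x"]) auto
  have "(\<lambda>\<omega>. \<Sum>i\<in>F. c i * \<Lambda> (A i) \<omega>) = (\<lambda>\<omega>. \<Sum>n\<in>{0..<card F}. c (e n) * \<Lambda> (B n) \<omega>)"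
    by (intro ext) (subst sum.reindex_bij_betw[OF e, symmetric], simp add: B_def)
  then have "char (distr M borel (\<lambda>\<omega>. \<Sum>i\<in>F. c i * \<Lambda> (A i) \<omega>)) \<theta> = (\<Prod>n\<in>{0..<card F}. char (distr M borel (\<lambda>\<omega>. c (e n) * \<Lambda> (B n) \<omega>)) \<theta>)"
    using char_distr_sum[OF ind] by simp
  also have "\<dots> = (\<Prod>n\<in>{0..<card F}. char (distr M borel (\<Lambda> (A (e n)))) (\<theta> * c (e n)))"
  proof (rule prod.cong[OF refl])
    fix n assume "n \<in> {0..<card F}"
    then have n: "n < card F" by simp
    have [measurable]: "\<Lambda> (A (e n)) \<in> borel_measurable M" by (rule basis_measurable[OF A(1)[OF eF[OF n]]])
    show "char (distr M borel (\<lambda>\<omega>. c (e n) * \<Lambda> (B n) \<omega>)) \<theta> = char (distr M borel (\<Lambda> (A (e n)))) (\<theta> * c (e n))"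
      using n by (simp add: B_def char_distr_eq mult.assoc)
  qed
  also have "\<dots> = (\<Prod>i\<in>F. char (distr M borel (\<Lambda> (A i))) (\<theta> * c i))"
    by (rule prod.reindex_bij_betw[OF e])
  finally show ?thesis .
qed

text \<open>Both sides are multiplicative over disjoint sets, so Dynkin's induction applies.
  Relative complements need a division, which is possible because an exponential never vanishes;
  countable unions use almost sure convergence of the series.\<close>

lemma basis_char:
  fixes z :: complex
  assumes Ioc: "\<And>a b. a < b \<Longrightarrow> char (distr M borel (\<Lambda> {a<..b})) \<theta> = exp (of_real (b - a) * z)"
    and A: "bounded_borel A"
  shows "char (distr M borel (\<Lambda> A)) \<theta> = exp (of_real (measure lborel A) * z)"
  using A
proof (induction A rule: bounded_borel_induct)
  case empty
  have "distr M borel (\<Lambda> {}) = distr M borel (\<lambda>_. 0)"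
    using basis_empty basis_measurable[of "{}"] by (intro distr_cong_AE) auto
  then show ?case by (simp add: char_distr_eq prob_space del: distr_const)
next
  case (Ioc a b)
  then show ?case using assms(1)[of a b] by simp
next
  case (diff A m)
  let ?J = "{-m<..m}"
  let ?S = "\<lambda>i::nat. if i = 0 then A else ?J - A"
  have bb: "bounded_borel A" "bounded_borel (?J - A)"
    using diff by (auto intro: bounded_subset[of ?J])
  have [measurable]: "\<Lambda> A \<in> borel_measurable M" "\<Lambda> (?J - A) \<in> borel_measurable M" "\<Lambda> ?J \<in> borel_measurable M"
    using bb by (auto intro!: basis_measurable)
  have "AE \<omega> in M. \<Lambda> (A \<union> (?J - A)) \<omega> = \<Lambda> A \<omega> + \<Lambda> (?J - A) \<omega>"
    by (rule basis_Un) (use bb in auto)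
  moreover have "A \<union> (?J - A) = ?J" using diff by auto
  ultimately have "distr M borel (\<Lambda> ?J) = distr M borel (\<lambda>\<omega>. \<Sum>i\<in>{0,1}. 1 * \<Lambda> (?S i) \<omega>)"
    by (intro distr_cong_AE) auto
  moreover have "char (distr M borel (\<lambda>\<omega>. \<Sum>i\<in>{0,1}. 1 * \<Lambda> (?S i) \<omega>)) \<theta> = (\<Prod>i\<in>{0,1}. char (distr M borel (\<Lambda> (?S i))) (\<theta> * 1))"
    by (rule basis_char_linear) (use bb in \<open>auto simp: disjoint_family_on_def\<close>)
  ultimately have "exp (of_real (2 * m) * z) = exp (of_real (measure lborel A) * z) * char (distr M borel (\<Lambda> (?J - A))) \<theta>"
    using assms(1)[of "-m" m] diff by simp
  moreover have "measure lborel (?J - A) = 2 * m - measure lborel A"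
    using diff by (subst measure_Diff) (auto simp: fmeasurable_def)
  moreover have "exp (of_real (2 * m - measure lborel A) * z) = exp (of_real (2 * m) * z) / exp (of_real (measure lborel A) * z)"
    by (simp only: of_real_diff left_diff_distrib exp_diff)
  ultimately show ?case by simp
next
  case (union A)
  have [measurable]: "\<Lambda> (A n) \<in> borel_measurable M" "\<Lambda> (\<Union>n. A n) \<in> borel_measurable M" for n
    using union by (auto intro!: basis_measurable)
  have AE: "AE \<omega> in M. (\<lambda>n. \<Lambda> (A n) \<omega>) sums \<Lambda> (\<Union>n. A n) \<omega>"
    by (rule basis_sums) (use union in auto)
  show ?case
  proof (rule LIMSEQ_unique)
    have "(\<lambda>n. CLINT \<omega>|M. iexp (\<theta> * (\<Sum>i<n. 1 * \<Lambda> (A i) \<omega>))) \<longlonglongrightarrow> (CLINT \<omega>|M. iexp (\<theta> * \<Lambda> (\<Union>n. A n) \<omega>))"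
    proof (rule integral_dominated_convergence[where w="\<lambda>_. 1"])
      show "AE \<omega> in M. (\<lambda>n. iexp (\<theta> * (\<Sum>i<n. 1 * \<Lambda> (A i) \<omega>))) \<longlonglongrightarrow> iexp (\<theta> * \<Lambda> (\<Union>n. A n) \<omega>)"
        using AE
      proof eventually_elim
        case (elim \<omega>)
        then have "(\<lambda>n. \<theta> * (\<Sum>i<n. 1 * \<Lambda> (A i) \<omega>)) \<longlonglongrightarrow> \<theta> * \<Lambda> (\<Union>n. A n) \<omega>"
          unfolding sums_def by (intro tendsto_mult tendsto_const) simp
        then show ?case by (rule isCont_tendsto_compose[OF isCont_iexp])
      qed
    qed auto
    then show "(\<lambda>n. char (distr M borel (\<lambda>\<omega>. \<Sum>i<n. 1 * \<Lambda> (A i) \<omega>)) \<theta>) \<longlonglongrightarrow> char (distr M borel (\<Lambda> (\<Union>n. A n))) \<theta>"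
      by (simp add: char_distr_eq)
    have fin: "emeasure lborel (\<Union>n. A n) \<noteq> \<infinity>" using union(3) emeasure_bounded_finite[of "\<Union>n. A n"] by auto
    have "(\<lambda>n. measure lborel (A n)) sums measure lborel (\<Union>n. A n)"
      using union fin by (intro measure_UNION) auto
    then have "(\<lambda>n. exp (of_real (\<Sum>i<n. measure lborel (A i)) * z)) \<longlonglongrightarrow> exp (of_real (measure lborel (\<Union>n. A n)) * z)"
      unfolding sums_def by (intro tendsto_exp tendsto_mult tendsto_of_real tendsto_const)
    moreover have "char (distr M borel (\<lambda>\<omega>. \<Sum>i<n. 1 * \<Lambda> (A i) \<omega>)) \<theta> = exp (of_real (\<Sum>i<n. measure lborel (A i)) * z)" for n
    proof -
      have "char (distr M borel (\<lambda>\<omega>. \<Sum>i<n. 1 * \<Lambda> (A i) \<omega>)) \<theta> = (\<Prod>i<n. char (distr M borel (\<Lambda> (A i))) (\<theta> * 1))"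
        by (rule basis_char_linear) (use union in \<open>auto simp: disjoint_family_on_def\<close>)
      also have "\<dots> = (\<Prod>i<n. exp (of_real (measure lborel (A i)) * z))" using union by simp
      also have "\<dots> = exp (\<Sum>i<n. of_real (measure lborel (A i)) * z)" by (rule exp_sum[symmetric]) simp
      finally show ?thesis by (simp add: sum_distrib_right)
    qed
    ultimately show "(\<lambda>n. char (distr M borel (\<lambda>\<omega>. \<Sum>i<n. 1 * \<Lambda> (A i) \<omega>)) \<theta>) \<longlonglongrightarrow> exp (of_real (measure lborel (\<Union>n. A n)) * z)"
      by simp
  qed
qed

end

text \<open>\<open>has_levy_integral\<close> comes with a basis of its own each time; this lemma
  allows all integrals to be referred to one basis.\<close>

lemma levy_basis_AE_unique:
  assumes "levy_basis_space M \<Lambda>" "levy_basis_space M \<Lambda>'"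
    and Ioc: "\<And>a b. a < b \<Longrightarrow> AE \<omega> in M. \<Lambda> {a<..b} \<omega> = \<Lambda>' {a<..b} \<omega>"
    and A: "bounded_borel A"
  shows "AE \<omega> in M. \<Lambda> A \<omega> = \<Lambda>' A \<omega>"
  using A
proof -
  interpret L: levy_basis_space M \<Lambda> by fact
  interpret L': levy_basis_space M \<Lambda>' by fact
  show ?thesis using A
  proof (induction A rule: bounded_borel_induct)
    case empty
    show ?case using L.basis_empty L'.basis_empty by eventually_elim simp
  next
    case (Ioc a b)
    then show ?case by (rule assms(3))
  next
    case (diff A m)
    let ?J = "{-m<..m}"
    have bb: "bounded_borel A" "bounded_borel (?J - A)"
      using diff by (auto intro: bounded_subset[of ?J])
    have J: "A \<union> (?J - A) = ?J" using diff by auto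
    have "AE \<omega> in M. \<Lambda> (A \<union> (?J - A)) \<omega> = \<Lambda> A \<omega> + \<Lambda> (?J - A) \<omega>" by (rule L.basis_Un) (use bb in auto)
    moreover have "AE \<omega> in M. \<Lambda>' (A \<union> (?J - A)) \<omega> = \<Lambda>' A \<omega> + \<Lambda>' (?J - A) \<omega>" by (rule L'.basis_Un) (use bb in auto)
    moreover have "AE \<omega> in M. \<Lambda> ?J \<omega> = \<Lambda>' ?J \<omega>" using diff by (intro assms(3)) simp
    ultimately show ?case using diff.IH unfolding J by eventually_elim simp
  next
    case (union A)
    have "AE \<omega> in M. (\<lambda>n. \<Lambda> (A n) \<omega>) sums \<Lambda> (\<Union>n. A n) \<omega>" by (rule L.basis_sums) (use union in auto)
    moreover have "AE \<omega> in M. (\<lambda>n. \<Lambda>' (A n) \<omega>) sums \<Lambda>' (\<Union>n. A n) \<omega>" by (rule L'.basis_sums) (use union in auto)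
    moreover have "AE \<omega> in M. \<forall>n. \<Lambda> (A n) \<omega> = \<Lambda>' (A n) \<omega>" using union by (simp add: AE_all_countable)
    ultimately show ?case by eventually_elim (auto intro: sums_unique2)
  qed
qed

subsection \<open>Simple integrals\<close>

lemma rr_simpleI:
  assumes "g \<in> borel_measurable borel" "finite (range g)" "bounded {s. g s \<noteq> 0}"
  shows "rr_simple g"
proof -
  have "g -` {x} \<in> sets borel" for x
    using measurable_sets[OF assms(1), of "{x}"] by simp
  then show ?thesis using assms unfolding rr_simple_def simple_function_def by auto
qed

lemma rr_simpleD:
  assumes "rr_simple g"
  shows "g \<in> borel_measurable borel" "finite (range g)" "bounded {s. g s \<noteq> 0}"
  using assms borel_measurable_simple_function[of borel g] unfolding rr_simple_def simple_function_def by auto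

lemma rr_simple_level:
  assumes "rr_simple g" "A \<in> sets borel" "x \<noteq> 0"
  shows "bounded_borel (A \<inter> g -` {x})"
proof
  show "A \<inter> g -` {x} \<in> sets borel" using measurable_sets[OF rr_simpleD(1)[OF assms(1)], of "{x}"] assms(2) by auto
  show "bounded (A \<inter> g -` {x})" by (rule bounded_subset[OF rr_simpleD(3)[OF assms(1)]]) (use assms(3) in auto)
qed

lemma rr_simple_lincomb:
  assumes "rr_simple g" "rr_simple h"
  shows "rr_simple (\<lambda>s. a * g s + b * h s)"
proof (rule rr_simpleI)
  show "(\<lambda>s. a * g s + b * h s) \<in> borel_measurable borel" using rr_simpleD(1)[OF assms(1)] rr_simpleD(1)[OF assms(2)] by measurable
  have "range (\<lambda>s. a * g s + b * h s) \<subseteq> (\<lambda>(x, y). a * x + b * y) ` (range g \<times> range h)" by auto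
  then show "finite (range (\<lambda>s. a * g s + b * h s))" by (rule finite_subset) (use rr_simpleD(2)[OF assms(1)] rr_simpleD(2)[OF assms(2)] in auto)
  show "bounded {s. a * g s + b * h s \<noteq> 0}"
    by (rule bounded_subset[OF bounded_Un[THEN iffD2, OF conjI[OF rr_simpleD(3)[OF assms(1)] rr_simpleD(3)[OF assms(2)]]]]) auto
qed

lemma rr_simple_indicator:
  assumes "rr_simple g" "A \<in> sets borel"
  shows "rr_simple (\<lambda>s. g s * indicator A s)"
proof (rule rr_simpleI)
  show "(\<lambda>s. g s * indicator A s) \<in> borel_measurable borel" using rr_simpleD(1)[OF assms(1)] assms(2) by measurable
  have "range (\<lambda>s. g s * indicator A s) \<subseteq> insert 0 (range g)" by (auto simp: indicator_def)
  then show "finite (range (\<lambda>s. g s * indicator A s))" by (rule finite_subset) (use rr_simpleD(2)[OF assms(1)] in auto)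
  show "bounded {s. g s * indicator A s \<noteq> 0}"
    by (rule bounded_subset[OF rr_simpleD(3)[OF assms(1)]]) auto
qed

lemma rr_simple_shift:
  assumes "rr_simple g"
  shows "rr_simple (\<lambda>s. g (s - h))"
proof (rule rr_simpleI)
  show "(\<lambda>s. g (s - h)) \<in> borel_measurable borel" using rr_simpleD(1)[OF assms] by measurable
  have "range (\<lambda>s. g (s - h)) \<subseteq> range g" by auto
  then show "finite (range (\<lambda>s. g (s - h)))" by (rule finite_subset) (rule rr_simpleD(2)[OF assms])
  have "{s. g (s - h) \<noteq> 0} = (\<lambda>s. h + s) ` {s. g s \<noteq> 0}" by (force simp: image_iff)
  then show "bounded {s. g (s - h) \<noteq> 0}" using bounded_translation[OF rr_simpleD(3)[OF assms]] by simp
qed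

text \<open>The level set of the value 0 has infinite measure; \<open>F 0 = 0\<close> removes it
  from integral and sum.\<close>

lemma rr_simple_integral_lborel:
  fixes F :: "real \<Rightarrow> 'b :: {banach, second_countable_topology}"
  assumes g: "rr_simple g" and A: "A \<in> sets borel" and F: "F 0 = 0"
  shows "set_integrable lborel A (\<lambda>s. F (g s))"
    and "(LINT s:A|lborel. F (g s)) = (\<Sum>x\<in>range g - {0}. measure lborel (A \<inter> g -` {x}) *\<^sub>R F x)"
proof -
  have eq: "indicator A s *\<^sub>R F (g s) = (\<Sum>x\<in>range g - {0}. indicator (A \<inter> g -` {x}) s *\<^sub>R F x)" for s
  proof -
    have "(\<Sum>x\<in>range g - {0}. indicator (A \<inter> g -` {x}) s *\<^sub>R F x) = (\<Sum>x\<in>range g - {0}. if x = g s then indicator A s *\<^sub>R F x else 0)"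
      by (intro sum.cong) (auto simp: indicator_def)
    also have "\<dots> = indicator A s *\<^sub>R F (g s)"
      using rr_simpleD(2)[OF g] F by (subst sum.delta) auto
    finally show ?thesis by simp
  qed
  have i: "integrable lborel (\<lambda>s. indicator (A \<inter> g -` {x}) s *\<^sub>R F x)" if "x \<noteq> 0" for x
    using rr_simple_level[OF g A that] emeasure_bounded_finite[of "A \<inter> g -` {x}"]
    by (intro integrable_scaleR_left integrable_real_indicator) auto
  show "set_integrable lborel A (\<lambda>s. F (g s))"
    unfolding set_integrable_def eq using i by (intro Bochner_Integration.integrable_sum) auto
  have "(LINT s:A|lborel. F (g s)) = (\<Sum>x\<in>range g - {0}. LINT s|lborel. indicator (A \<inter> g -` {x}) s *\<^sub>R F x)"
    unfolding set_lebesgue_integral_def eq using i by (intro Bochner_Integration.integral_sum) auto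
  also have "\<dots> = (\<Sum>x\<in>range g - {0}. measure lborel (A \<inter> g -` {x}) *\<^sub>R F x)"
  proof (intro sum.cong refl)
    fix x assume "x \<in> range g - {0}"
    then have "integrable lborel (indicator (A \<inter> g -` {x}) :: real \<Rightarrow> real)"
      using rr_simple_level[OF g A, of x] emeasure_bounded_finite[of "A \<inter> g -` {x}"]
      by (intro integrable_real_indicator) auto
    then show "(LINT s|lborel. indicator (A \<inter> g -` {x}) s *\<^sub>R F x) = measure lborel (A \<inter> g -` {x}) *\<^sub>R F x"
      by (simp add: integral_scaleR_left)
  qed
  finally show "(LINT s:A|lborel. F (g s)) = (\<Sum>x\<in>range g - {0}. measure lborel (A \<inter> g -` {x}) *\<^sub>R F x)" .
qed

section \<open>Linearity of simple integrals and of their limits\<close>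

context levy_basis_space begin

lemma rr_simple_integral_measurable:
  assumes "rr_simple g" "A \<in> sets borel"
  shows "rr_simple_integral \<Lambda> A g \<in> borel_measurable M"
  unfolding rr_simple_integral_def
  by (intro borel_measurable_sum borel_measurable_times borel_measurable_const basis_measurable rr_simple_level assms) auto

text \<open>The integral is defined through level sets, whereas a representation may split a level
  set into several pieces. Finite additivity merges them; it holds almost surely, and so does the
  conclusion.\<close>

lemma rr_simple_integral_rep:
  assumes g: "rr_simple g" and F: "finite F" and A: "\<And>i. i \<in> F \<Longrightarrow> bounded_borel (A i)" "disjoint_family_on A F"
    and eq: "\<And>s. g s = (\<Sum>i\<in>F. c i * indicator (A i) s)"
  shows "AE \<omega> in M. rr_simple_integral \<Lambda> UNIV g \<omega> = (\<Sum>i\<in>F. c i * \<Lambda> (A i) \<omega>)"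
proof -
  have g_on: "g s = c i" if "i \<in> F" "s \<in> A i" for i s
  proof -
    have "(\<Sum>j\<in>F. c j * indicator (A j) s) = (\<Sum>j\<in>F. if j = i then c j else 0)"
      using A(2) that by (intro sum.cong) (auto simp: disjoint_family_on_def indicator_def)
    then show ?thesis using F that by (simp add: eq)
  qed
  have g_off: "g s = 0" if "\<And>i. i \<in> F \<Longrightarrow> s \<notin> A i" for s
    using that by (auto simp: eq intro!: sum.neutral)
  have level: "g -` {x} = (\<Union>i\<in>{i\<in>F. c i = x}. A i)" if "x \<noteq> 0" for x
    using that g_on g_off by (auto, metis)
  have fin: "finite (range g)" by (rule rr_simpleD(2)[OF g])
  have "AE \<omega> in M. \<forall>x\<in>range g - {0}. \<Lambda> (g -` {x}) \<omega> = (\<Sum>i\<in>{i\<in>F. c i = x}. \<Lambda> (A i) \<omega>)"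
  proof (rule AE_finite_allI)
    fix x assume "x \<in> range g - {0}"
    then have x: "x \<noteq> 0" by simp
    show "AE \<omega> in M. \<Lambda> (g -` {x}) \<omega> = (\<Sum>i\<in>{i\<in>F. c i = x}. \<Lambda> (A i) \<omega>)"
      unfolding level[OF x] by (rule basis_finite_Union) (use A F in \<open>auto simp: disjoint_family_on_def\<close>)
  qed (use fin in simp)
  with basis_empty show ?thesis
  proof eventually_elim
    case (elim \<omega>)
    have "rr_simple_integral \<Lambda> UNIV g \<omega> = (\<Sum>x\<in>range g - {0}. x * (\<Sum>i\<in>{i\<in>F. c i = x}. \<Lambda> (A i) \<omega>))"
      unfolding rr_simple_integral_def using elim(2) by (intro sum.cong) auto
    also have "\<dots> = (\<Sum>x\<in>range g - {0}. \<Sum>i\<in>F. if c i = x then c i * \<Lambda> (A i) \<omega> else 0)"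
      using F by (intro sum.cong refl) (simp add: sum_distrib_left sum.inter_filter[symmetric] cong: conj_cong)
    also have "\<dots> = (\<Sum>i\<in>F. \<Sum>x\<in>range g - {0}. if c i = x then c i * \<Lambda> (A i) \<omega> else 0)" by (rule sum.swap)
    also have "\<dots> = (\<Sum>i\<in>F. c i * \<Lambda> (A i) \<omega>)"
    proof (intro sum.cong refl)
      fix i assume i: "i \<in> F"
      show "(\<Sum>x\<in>range g - {0}. if c i = x then c i * \<Lambda> (A i) \<omega> else 0) = c i * \<Lambda> (A i) \<omega>"
      proof (cases "c i \<in> range g - {0}")
        case True
        then show ?thesis using fin by simp
      next
        case False
        \<comment> \<open>A coefficient that is not a value of \<open>g\<close> belongs to an empty
          set, where the basis vanishes almost surely.\<close>
        have "c i = 0 \<or> A i = {}"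
        proof (rule ccontr)
          assume "\<not> ?thesis"
          then obtain s where "s \<in> A i" "c i \<noteq> 0" by auto
          then have "c i \<in> range g - {0}" using g_on[OF i, of s] rangeI[of g s] by simp
          with False show False ..
        qed
        then have z: "c i * \<Lambda> (A i) \<omega> = 0" using elim(1) by auto
        show ?thesis unfolding z by simp
      qed
    qed
    finally show ?case .
  qed
qed

lemma rr_simple_integral_indicator:
  assumes g: "rr_simple g" and A: "A \<in> sets borel"
  shows "AE \<omega> in M. rr_simple_integral \<Lambda> UNIV (\<lambda>s. g s * indicator A s) \<omega> = rr_simple_integral \<Lambda> A g \<omega>"
  unfolding rr_simple_integral_def[of \<Lambda> A]
proof (rule rr_simple_integral_rep)
  show "rr_simple (\<lambda>s. g s * indicator A s)" by (rule rr_simple_indicator[OF g A])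
  show "finite (range g - {0})" using rr_simpleD(2)[OF g] by simp
  show "bounded_borel (A \<inter> g -` {x})" if "x \<in> range g - {0}" for x using that by (intro rr_simple_level g A) auto
  show "disjoint_family_on (\<lambda>x. A \<inter> g -` {x}) (range g - {0})" by (auto simp: disjoint_family_on_def)
  fix s
  have "(\<Sum>x\<in>range g - {0}. x * indicator (A \<inter> g -` {x}) s) = (\<Sum>x\<in>range g - {0}. if x = g s then x * indicator A s else 0)"
    by (intro sum.cong) (auto simp: indicator_def)
  also have "\<dots> = g s * indicator A s" using rr_simpleD(2)[OF g] by (subst sum.delta) auto
  finally show "g s * indicator A s = (\<Sum>x\<in>range g - {0}. x * indicator (A \<inter> g -` {x}) s)" by simp
qed

lemma rr_simple_integral_lincomb:
  assumes g: "rr_simple g" and h: "rr_simple h"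
  shows "AE \<omega> in M. rr_simple_integral \<Lambda> UNIV (\<lambda>s. a * g s + b * h s) \<omega> = a * rr_simple_integral \<Lambda> UNIV g \<omega> + b * rr_simple_integral \<Lambda> UNIV h \<omega>"
proof -
  \<comment> \<open>Common refinement by joint level sets. The pair (0, 0) is left out: its level
    set is unbounded, so it carries no basis value.\<close>
  let ?F = "range g \<times> range h - {(0, 0)}"
  let ?A = "\<lambda>p. g -` {fst p} \<inter> h -` {snd p}"
  have F: "finite ?F" using rr_simpleD(2)[OF g] rr_simpleD(2)[OF h] by simp
  have A: "bounded_borel (?A p)" if "p \<in> ?F" for p
  proof
    show "?A p \<in> sets borel"
      using measurable_sets[OF rr_simpleD(1)[OF g], of "{fst p}"] measurable_sets[OF rr_simpleD(1)[OF h], of "{snd p}"] by auto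
    have "fst p \<noteq> 0 \<or> snd p \<noteq> 0" using that by (cases p) auto
    then show "bounded (?A p)"
      by (intro bounded_subset[OF bounded_Un[THEN iffD2, OF conjI[OF rr_simpleD(3)[OF g] rr_simpleD(3)[OF h]]]]) auto
  qed
  have dis: "disjoint_family_on ?A ?F" by (auto simp: disjoint_family_on_def)
  \<comment> \<open>Stated for an arbitrary function \<open>c\<close> so that one identity
    represents the combination and both summands over the same partition.\<close>
  have rep: "c (g s) (h s) = (\<Sum>p\<in>?F. c (fst p) (snd p) * indicator (?A p) s)" if "c 0 0 = 0" for c :: "real \<Rightarrow> real \<Rightarrow> real" and s
  proof -
    have "(\<Sum>p\<in>?F. c (fst p) (snd p) * indicator (?A p) s) = (\<Sum>p\<in>?F. if p = (g s, h s) then c (fst p) (snd p) else 0)"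
      by (intro sum.cong) (auto simp: indicator_def)
    also have "\<dots> = c (g s) (h s)" using F that by (subst sum.delta) auto
    finally show ?thesis by simp
  qed
  have "AE \<omega> in M. rr_simple_integral \<Lambda> UNIV (\<lambda>s. a * g s + b * h s) \<omega> = (\<Sum>p\<in>?F. (a * fst p + b * snd p) * \<Lambda> (?A p) \<omega>)"
    by (rule rr_simple_integral_rep[OF rr_simple_lincomb[OF g h] F A dis]) (assumption, rule rep[of "\<lambda>x y. a * x + b * y"], simp)
  moreover have "AE \<omega> in M. rr_simple_integral \<Lambda> UNIV g \<omega> = (\<Sum>p\<in>?F. fst p * \<Lambda> (?A p) \<omega>)"
    by (rule rr_simple_integral_rep[OF g F A dis]) (assumption, rule rep[of "\<lambda>x y. x"], simp)
  moreover have "AE \<omega> in M. rr_simple_integral \<Lambda> UNIV h \<omega> = (\<Sum>p\<in>?F. snd p * \<Lambda> (?A p) \<omega>)"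
    by (rule rr_simple_integral_rep[OF h F A dis]) (assumption, rule rep[of "\<lambda>x y. y"], simp)
  ultimately show ?thesis
  proof eventually_elim
    case (elim \<omega>)
    then show ?case by (simp add: sum_distrib_left sum.distrib distrib_right mult.assoc)
  qed
qed

lemma rr_simple_integral_lincomb_set:
  assumes g: "rr_simple g" and h: "rr_simple h" and A: "A \<in> sets borel"
  shows "AE \<omega> in M. rr_simple_integral \<Lambda> A (\<lambda>s. a * g s + b * h s) \<omega> = a * rr_simple_integral \<Lambda> A g \<omega> + b * rr_simple_integral \<Lambda> A h \<omega>"
proof -
  have eq: "(\<lambda>s. (a * g s + b * h s) * indicator A s) = (\<lambda>s. a * (g s * indicator A s) + b * (h s * indicator A s))"
    by (simp add: fun_eq_iff algebra_simps)
  show ?thesis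
    using rr_simple_integral_indicator[OF rr_simple_lincomb[OF g h, of a b] A] rr_simple_integral_indicator[OF g A] rr_simple_integral_indicator[OF h A]
      rr_simple_integral_lincomb[OF rr_simple_indicator[OF g A] rr_simple_indicator[OF h A], of a b]
    unfolding eq by eventually_elim simp
qed

lemma has_rr_integral_lincomb:
  assumes g: "has_rr_integral M \<Lambda> g Y" and h: "has_rr_integral M \<Lambda> h W"
  shows "has_rr_integral M \<Lambda> (\<lambda>s. a * g s + b * h s) (\<lambda>\<omega>. a * Y \<omega> + b * W \<omega>)"
proof -
  obtain gn where gn: "\<And>n. rr_simple (gn n)" "AE s in lborel. (\<lambda>n. gn n s) \<longlonglongrightarrow> g s"
      "\<And>A. A \<in> sets borel \<Longrightarrow> \<exists>L. tendsto_in_prob M (\<lambda>n. rr_simple_integral \<Lambda> A (gn n)) L"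
      "tendsto_in_prob M (\<lambda>n. rr_simple_integral \<Lambda> UNIV (gn n)) Y"
    using g unfolding has_rr_integral_def by blast
  obtain hn where hn: "\<And>n. rr_simple (hn n)" "AE s in lborel. (\<lambda>n. hn n s) \<longlonglongrightarrow> h s"
      "\<And>A. A \<in> sets borel \<Longrightarrow> \<exists>L. tendsto_in_prob M (\<lambda>n. rr_simple_integral \<Lambda> A (hn n)) L"
      "tendsto_in_prob M (\<lambda>n. rr_simple_integral \<Lambda> UNIV (hn n)) W"
    using h unfolding has_rr_integral_def by blast
  have lim: "tendsto_in_prob M (\<lambda>n. rr_simple_integral \<Lambda> A (\<lambda>s. a * gn n s + b * hn n s)) (\<lambda>\<omega>. a * L \<omega> + b * K \<omega>)"
    if A: "A \<in> sets borel" and L: "tendsto_in_prob M (\<lambda>n. rr_simple_integral \<Lambda> A (gn n)) L"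
      and K: "tendsto_in_prob M (\<lambda>n. rr_simple_integral \<Lambda> A (hn n)) K" for A L K
  proof (rule tendsto_in_prob_cong[OF tendsto_in_prob_add[OF tendsto_in_prob_cmult[OF L, of a] tendsto_in_prob_cmult[OF K, of b]]])
    show "AE \<omega> in M. a * rr_simple_integral \<Lambda> A (gn n) \<omega> + b * rr_simple_integral \<Lambda> A (hn n) \<omega> = rr_simple_integral \<Lambda> A (\<lambda>s. a * gn n s + b * hn n s) \<omega>" for n
      using rr_simple_integral_lincomb_set[OF gn(1)[of n] hn(1)[of n] A, of a b] by eventually_elim simp
    show "rr_simple_integral \<Lambda> A (\<lambda>s. a * gn n s + b * hn n s) \<in> borel_measurable M" for n
      by (intro rr_simple_integral_measurable rr_simple_lincomb gn hn A)
    show "(\<lambda>\<omega>. a * L \<omega> + b * K \<omega>) \<in> borel_measurable M"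
      using tendsto_in_prob_measurable(2)[OF L] tendsto_in_prob_measurable(2)[OF K] by measurable
  qed simp
  show ?thesis
    unfolding has_rr_integral_def
  proof (intro conjI exI[of _ "\<lambda>n s. a * gn n s + b * hn n s"] allI ballI)
    show "(\<lambda>s. a * g s + b * h s) \<in> borel_measurable borel" using g h unfolding has_rr_integral_def by auto
    show "rr_simple (\<lambda>s. a * gn n s + b * hn n s)" for n by (intro rr_simple_lincomb gn hn)
    show "AE s in lborel. (\<lambda>n. a * gn n s + b * hn n s) \<longlonglongrightarrow> a * g s + b * h s"
      using gn(2) hn(2) by eventually_elim (intro tendsto_add tendsto_mult tendsto_const)
    show "\<exists>L. tendsto_in_prob M (\<lambda>n. rr_simple_integral \<Lambda> A (\<lambda>s. a * gn n s + b * hn n s)) L" if "A \<in> sets borel" for A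
      using gn(3)[OF that] hn(3)[OF that] lim[OF that] by blast
    show "tendsto_in_prob M (\<lambda>n. rr_simple_integral \<Lambda> UNIV (\<lambda>s. a * gn n s + b * hn n s)) (\<lambda>\<omega>. a * Y \<omega> + b * W \<omega>)"
      by (rule lim[OF _ gn(4) hn(4)]) simp
  qed
qed

lemma has_rr_integral_cong_AE:
  assumes "has_rr_integral M \<Lambda> g Y" "AE s in lborel. g s = h s" "h \<in> borel_measurable borel"
    "AE \<omega> in M. Y \<omega> = W \<omega>" "W \<in> borel_measurable M"
  shows "has_rr_integral M \<Lambda> h W"
proof -
  obtain gn where gn: "\<And>n. rr_simple (gn n)" "AE s in lborel. (\<lambda>n. gn n s) \<longlonglongrightarrow> g s"
      "\<And>A. A \<in> sets borel \<Longrightarrow> \<exists>L. tendsto_in_prob M (\<lambda>n. rr_simple_integral \<Lambda> A (gn n)) L"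
      "tendsto_in_prob M (\<lambda>n. rr_simple_integral \<Lambda> UNIV (gn n)) Y"
    using assms(1) unfolding has_rr_integral_def by blast
  have "AE s in lborel. (\<lambda>n. gn n s) \<longlonglongrightarrow> h s" using gn(2) assms(2) by eventually_elim simp
  moreover have "tendsto_in_prob M (\<lambda>n. rr_simple_integral \<Lambda> UNIV (gn n)) W"
    by (rule tendsto_in_prob_cong[OF gn(4) _ assms(4) _ assms(5)]) (auto intro: rr_simple_integral_measurable gn)
  ultimately show ?thesis
    unfolding has_rr_integral_def using gn assms(3) by (intro conjI exI[of _ gn]) auto
qed

lemma has_rr_integral_simple:
  assumes "rr_simple g"
  shows "has_rr_integral M \<Lambda> g (rr_simple_integral \<Lambda> UNIV g)"
  unfolding has_rr_integral_def
proof (intro conjI exI[of _ "\<lambda>n. g"] allI ballI)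
  show "g \<in> borel_measurable borel" by (rule rr_simpleD[OF assms])
  have "tendsto_in_prob M (\<lambda>n. rr_simple_integral \<Lambda> A g) (rr_simple_integral \<Lambda> A g)" if "A \<in> sets borel" for A
    using rr_simple_integral_measurable[OF assms that] by (simp add: tendsto_in_prob_def)
  then show "\<exists>L. tendsto_in_prob M (\<lambda>n. rr_simple_integral \<Lambda> A g) L" if "A \<in> sets borel" for A using that by blast
  show "tendsto_in_prob M (\<lambda>n. rr_simple_integral \<Lambda> UNIV g) (rr_simple_integral \<Lambda> UNIV g)"
    using rr_simple_integral_measurable[OF assms, of UNIV] by (simp add: tendsto_in_prob_def)
qed (use assms in auto)

lemma has_rr_integral_measurable:
  assumes "has_rr_integral M \<Lambda> g Y"
  shows "g \<in> borel_measurable borel" "Y \<in> borel_measurable M"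
  using assms unfolding has_rr_integral_def tendsto_in_prob_def by auto

end

lemma has_rr_integral_basis_cong:
  assumes L: "levy_basis_space M \<Lambda>" "levy_basis_space M \<Lambda>'"
    and AE: "\<And>A. bounded_borel A \<Longrightarrow> AE \<omega> in M. \<Lambda> A \<omega> = \<Lambda>' A \<omega>"
    and g: "has_rr_integral M \<Lambda> g Y"
  shows "has_rr_integral M \<Lambda>' g Y"
proof -
  interpret L: levy_basis_space M \<Lambda> by fact
  interpret L': levy_basis_space M \<Lambda>' by fact
  obtain gn where gn: "\<And>n. rr_simple (gn n)" "AE s in lborel. (\<lambda>n. gn n s) \<longlonglongrightarrow> g s"
      "\<And>A. A \<in> sets borel \<Longrightarrow> \<exists>L. tendsto_in_prob M (\<lambda>n. rr_simple_integral \<Lambda> A (gn n)) L"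
      "tendsto_in_prob M (\<lambda>n. rr_simple_integral \<Lambda> UNIV (gn n)) Y"
    using g unfolding has_rr_integral_def by blast
  have eq: "AE \<omega> in M. rr_simple_integral \<Lambda> A (gn n) \<omega> = rr_simple_integral \<Lambda>' A (gn n) \<omega>" if "A \<in> sets borel" for A n
  proof -
    have "AE \<omega> in M. \<forall>x\<in>range (gn n) - {0}. \<Lambda> (A \<inter> gn n -` {x}) \<omega> = \<Lambda>' (A \<inter> gn n -` {x}) \<omega>"
      by (rule AE_finite_allI) (use rr_simpleD(2)[OF gn(1)] rr_simple_level[OF gn(1) that] in \<open>auto intro!: AE\<close>)
    then show ?thesis unfolding rr_simple_integral_def by eventually_elim (auto intro!: sum.cong)
  qed
  have lim: "tendsto_in_prob M (\<lambda>n. rr_simple_integral \<Lambda>' A (gn n)) L" if "A \<in> sets borel" "tendsto_in_prob M (\<lambda>n. rr_simple_integral \<Lambda> A (gn n)) L" for A L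
    using tendsto_in_prob_measurable(2)[OF that(2)]
    by (intro tendsto_in_prob_cong[OF that(2) eq[OF that(1)]] L'.rr_simple_integral_measurable gn that) auto
  show ?thesis
    unfolding has_rr_integral_def
  proof (intro conjI exI[of _ gn] allI ballI)
    show "g \<in> borel_measurable borel" by (rule L.has_rr_integral_measurable(1)[OF g])
    show "rr_simple (gn n)" for n by (rule gn)
    show "AE s in lborel. (\<lambda>n. gn n s) \<longlonglongrightarrow> g s" by (rule gn)
    show "\<exists>L. tendsto_in_prob M (\<lambda>n. rr_simple_integral \<Lambda>' A (gn n)) L" if "A \<in> sets borel" for A
      using gn(3)[OF that] lim[OF that] by blast
    show "tendsto_in_prob M (\<lambda>n. rr_simple_integral \<Lambda>' UNIV (gn n)) Y"
      by (rule lim[OF _ gn(4)]) simp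
  qed
qed

subsection \<open>The Rajput-Rosinski integral\<close>

lemma (in prob_space) AE_eq_0_of_char:
  fixes Y :: "'a \<Rightarrow> real"
  assumes [measurable]: "Y \<in> borel_measurable M" and char1: "\<And>\<theta>. (CLINT \<omega>|M. iexp (\<theta> * Y \<omega>)) = 1"
  shows "AE \<omega> in M. Y \<omega> = 0"
proof -
  have "distr M borel Y = distr M borel (\<lambda>_. 0::real)"
  proof (rule Levy_uniqueness)
    show "char (distr M borel Y) = char (distr M borel (\<lambda>_. 0::real))"
      by (rule ext) (simp add: char_distr_eq char1 prob_space del: of_real_mult distr_const)
  qed (auto intro!: real_distribution_distr simp del: distr_const)
  then have "measure (distr M borel Y) {0} = measure (distr M borel (\<lambda>_. 0)) {0::real}" by (simp only:)
  then have "measure M {\<omega> \<in> space M. Y \<omega> = 0} = 1"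
    by (subst (asm) (1 2) measure_distr) (auto simp: prob_space vimage_def Int_def conj_commute)
  then show ?thesis by (subst (asm) prob_Collect_eq_1) auto
qed

section \<open>Functions of finite modular and their approximation by simple functions\<close>

context centered_levy_pair begin

text \<open>For a function with non-integrable \<open>k (g s)\<close> the value is the default 0,
  hence the companion predicate \<open>phi_integrable\<close>.\<close>

definition modular :: "(real \<Rightarrow> real) \<Rightarrow> real" where
  "modular g = (LINT s|lborel. k (g s))"

definition phi_integrable :: "(real \<Rightarrow> real) \<Rightarrow> bool" where
  "phi_integrable g \<longleftrightarrow> g \<in> borel_measurable borel \<and> integrable lborel (\<lambda>s. k (g s))"

lemma phi_integrableD[measurable_dest]: "phi_integrable g \<Longrightarrow> g \<in> borel_measurable borel"
  by (simp add: phi_integrable_def)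

lemma phi_integrable_k: "phi_integrable g \<Longrightarrow> integrable lborel (\<lambda>s. k (g s))"
  by (simp add: phi_integrable_def)

lemma L_phi_iff_phi_integrable: "g \<in> L_phi \<sigma> \<nu> \<longleftrightarrow> phi_integrable g"
  unfolding L_phi_iff phi_integrable_def by (auto simp: integrable_iff_bounded)

lemma modular_nonneg[simp]: "0 \<le> modular g"
  by (simp add: modular_def Bochner_Integration.integral_nonneg)

lemma ennreal_modular: "phi_integrable g \<Longrightarrow> ennreal (modular g) = (\<integral>\<^sup>+s. ennreal (k (g s)) \<partial>lborel)"
  unfolding modular_def phi_integrable_def by (rule nn_integral_eq_integral[symmetric]) auto

lemma phi_integrable_bound:
  assumes h: "phi_integrable h" and [measurable]: "g \<in> borel_measurable borel"
    and le: "\<And>s. k (g s) \<le> c * k (h s)"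
  shows "phi_integrable g" "modular g \<le> c * modular h"
proof -
  have ih: "integrable lborel (\<lambda>s. c * k (h s))" using h by (intro integrable_mult_right phi_integrable_k)
  show g: "phi_integrable g"
    unfolding phi_integrable_def
  proof
    show "integrable lborel (\<lambda>s. k (g s))"
      by (rule Bochner_Integration.integrable_bound[OF ih]) (auto intro!: AE_I2 order_trans[OF le])
  qed fact
  show "modular g \<le> c * modular h"
    using integral_mono[OF phi_integrable_k[OF g] ih le] by (simp add: modular_def)
qed

lemma phi_integrable_mono:
  assumes "phi_integrable h" "g \<in> borel_measurable borel" "\<And>s. \<bar>g s\<bar> \<le> \<bar>h s\<bar>"
  shows "phi_integrable g" "modular g \<le> modular h"
  using phi_integrable_bound[OF assms(1,2), of 1] k_mono[OF assms(3)] by auto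

lemma phi_integrable_cmult:
  assumes g: "phi_integrable g"
  shows "phi_integrable (\<lambda>s. c * g s)" "modular (\<lambda>s. c * g s) \<le> (max 1 \<bar>c\<bar>)\<^sup>2 * modular g"
proof -
  have le: "k (c * x) \<le> (max 1 \<bar>c\<bar>)\<^sup>2 * k x" for x
  proof -
    have "\<bar>c\<bar> * \<bar>x\<bar> \<le> max 1 \<bar>c\<bar> * \<bar>x\<bar>" by (intro mult_right_mono) auto
    then have "k (c * x) \<le> k (max 1 \<bar>c\<bar> * x)" by (intro k_mono) (simp add: abs_mult)
    also have "\<dots> \<le> (max 1 \<bar>c\<bar>)\<^sup>2 * k x" by (rule k_scale) simp
    finally show ?thesis .
  qed
  have "(\<lambda>s. c * g s) \<in> borel_measurable borel" using g by measurable
  from phi_integrable_bound[OF g this le]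
  show "phi_integrable (\<lambda>s. c * g s)" "modular (\<lambda>s. c * g s) \<le> (max 1 \<bar>c\<bar>)\<^sup>2 * modular g" by auto
qed

lemma phi_integrable_add:
  assumes g: "phi_integrable g" and h: "phi_integrable h"
  shows "phi_integrable (\<lambda>s. g s + h s)" "modular (\<lambda>s. g s + h s) \<le> 2 * (modular g + modular h)"
proof -
  have i: "integrable lborel (\<lambda>s. 2 * (k (g s) + k (h s)))" using g h by (intro integrable_mult_right Bochner_Integration.integrable_add phi_integrable_k)
  have [measurable]: "g \<in> borel_measurable borel" "h \<in> borel_measurable borel" using g h by (auto simp: phi_integrable_def)
  show p: "phi_integrable (\<lambda>s. g s + h s)"
    unfolding phi_integrable_def
  proof
    show "integrable lborel (\<lambda>s. k (g s + h s))"
      by (rule Bochner_Integration.integrable_bound[OF i]) (auto intro!: AE_I2 k_add order_trans[OF k_add] simp del: distrib_left_numeral)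
  qed measurable
  have "modular (\<lambda>s. g s + h s) \<le> (LINT s|lborel. 2 * (k (g s) + k (h s)))"
    unfolding modular_def by (intro integral_mono phi_integrable_k[OF p] i k_add)
  also have "\<dots> = 2 * (modular g + modular h)"
    using phi_integrable_k[OF g] phi_integrable_k[OF h] by (simp add: modular_def)
  finally show "modular (\<lambda>s. g s + h s) \<le> 2 * (modular g + modular h)" .
qed

lemma phi_integrable_lincomb:
  assumes "phi_integrable g" "phi_integrable h"
  shows "phi_integrable (\<lambda>s. a * g s + b * h s)"
  using assms by (intro phi_integrable_add phi_integrable_cmult)

lemma phi_integrable_diff:
  assumes g: "phi_integrable g" and h: "phi_integrable h"
  shows "phi_integrable (\<lambda>s. g s - h s)" "modular (\<lambda>s. g s - h s) \<le> 2 * (modular g + modular h)"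
proof -
  have 1: "phi_integrable (\<lambda>s. - 1 * h s)" by (rule phi_integrable_cmult[OF h])
  have 2: "modular (\<lambda>s. - 1 * h s) = modular h" by (simp add: modular_def)
  show "phi_integrable (\<lambda>s. g s - h s)" "modular (\<lambda>s. g s - h s) \<le> 2 * (modular g + modular h)"
    using phi_integrable_add[OF g 1] 2 by auto
qed

lemma phi_integrable_sum:
  assumes "finite J" "\<And>j. j \<in> J \<Longrightarrow> phi_integrable (g j)"
  shows "phi_integrable (\<lambda>s. \<Sum>j\<in>J. a j * g j s)"
  using assms
proof (induction J rule: finite_induct)
  case empty
  then show ?case by (simp add: phi_integrable_def)
next
  case (insert j J)
  then show ?case using phi_integrable_lincomb[of "g j" "\<lambda>s. \<Sum>j\<in>J. a j * g j s" "a j" 1] by simp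
qed

lemma integral_lborel_shift: "(LINT s|lborel. F (s - h)) = (LINT s|lborel. F s)"
  for F :: "real \<Rightarrow> 'b :: {banach, second_countable_topology}"
  using lborel_integral_real_affine[of 1 F "- h"] by simp

lemma phi_integrable_shift:
  assumes g: "phi_integrable g"
  shows "phi_integrable (\<lambda>s. g (s - h))" "modular (\<lambda>s. g (s - h)) = modular g"
proof -
  have "integrable lborel (\<lambda>s. k (g (- h + 1 * s)))"
    using g by (subst lborel_integrable_real_affine_iff) (auto intro: phi_integrable_k)
  then show "phi_integrable (\<lambda>s. g (s - h))" using g by (auto simp: phi_integrable_def)
  show "modular (\<lambda>s. g (s - h)) = modular g" unfolding modular_def by (rule integral_lborel_shift)
qed

lemma phi_integrable_reflect:
  assumes g: "phi_integrable g"
  shows "phi_integrable (\<lambda>s. g (t - s))" "modular (\<lambda>s. g (t - s)) = modular g"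
proof -
  have "integrable lborel (\<lambda>s. k (g (t + (- 1) * s)))"
    using g by (subst lborel_integrable_real_affine_iff) (auto intro: phi_integrable_k)
  then show "phi_integrable (\<lambda>s. g (t - s))" using g by (auto simp: phi_integrable_def)
  show "modular (\<lambda>s. g (t - s)) = modular g"
    unfolding modular_def using lborel_integral_real_affine[of "-1" "\<lambda>s. k (g s)" t] by simp
qed

lemma phi_integrable_rr_simple: "rr_simple g \<Longrightarrow> phi_integrable g"
  using rr_simple_integral_lborel(1)[of g UNIV k] rr_simpleD(1)[of g]
  by (simp add: phi_integrable_def set_integrable_def)

lemma modular_tendsto:
  assumes h: "phi_integrable h" and [measurable]: "\<And>n. g n \<in> borel_measurable borel"
    and le: "\<And>n s. k (g n s) \<le> c * k (h s)" and lim: "AE s in lborel. (\<lambda>n. g n s) \<longlonglongrightarrow> f s"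
    and [measurable]: "f \<in> borel_measurable borel"
  shows "(\<lambda>n. modular (g n)) \<longlonglongrightarrow> modular f"
  unfolding modular_def
proof (rule integral_dominated_convergence[where w="\<lambda>s. c * k (h s)"])
  show "integrable lborel (\<lambda>s. c * k (h s))" using h by (intro integrable_mult_right phi_integrable_k)
  show "AE s in lborel. (\<lambda>n. k (g n s)) \<longlonglongrightarrow> k (f s)"
    using lim by eventually_elim (rule isCont_tendsto_compose[OF isCont_k])
  show "AE s in lborel. norm (k (g n s)) \<le> c * k (h s)" for n using le by simp
qed measurable

lemma rr_simple_dense:
  assumes g: "phi_integrable g"
  obtains gn where "\<And>n. rr_simple (gn n)" "\<And>s. (\<lambda>n. gn n s) \<longlonglongrightarrow> g s" "\<And>n s. \<bar>gn n s\<bar> \<le> 2 * \<bar>g s\<bar>"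
    "(\<lambda>n. modular (\<lambda>s. gn n s - g s)) \<longlonglongrightarrow> 0" "(\<lambda>n. modular (gn n)) \<longlonglongrightarrow> modular g"
proof -
  have [measurable]: "g \<in> borel_measurable borel" using g by (simp add: phi_integrable_def)
  obtain F where F: "\<And>i. simple_function borel (F i)" "\<And>x. (\<lambda>i. F i x) \<longlonglongrightarrow> g x" "\<And>i x. dist (F i x) 0 \<le> 2 * dist (g x) 0"
    using borel_measurable_implies_sequence_metric[of g borel 0] by auto
  \<comment> \<open>The cut-off provides bounded support. The factor 2 in the domination by |g|
    becomes 4 after \<open>k_scale\<close>, and \<open>k_diff\<close> turns that into 2 (4 + 1) = 10
    for the differences.\<close>
  define gn where "gn n s = F n s * indicator {-real n..real n} s" for n s
  have Fm[measurable]: "F n \<in> borel_measurable borel" for n by (rule borel_measurable_simple_function[OF F(1)])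
  have gm[measurable]: "gn n \<in> borel_measurable borel" for n unfolding gn_def by measurable
  have simple: "rr_simple (gn n)" for n
  proof (rule rr_simpleI[OF gm])
    have "range (gn n) \<subseteq> insert 0 (range (F n))" by (auto simp: gn_def indicator_def)
    then show "finite (range (gn n))" by (rule finite_subset) (use F(1)[of n] in \<open>simp add: simple_function_def\<close>)
    show "bounded {s. gn n s \<noteq> 0}"
      by (rule bounded_subset[of "{-real n..real n}"]) (auto simp: gn_def indicator_def split: if_splits)
  qed
  have lim: "(\<lambda>n. gn n s) \<longlonglongrightarrow> g s" for s
  proof -
    obtain N :: nat where N: "\<bar>s\<bar> \<le> real N" using real_arch_simple by blast
    have "eventually (\<lambda>n. F n s = gn n s) sequentially"
      using eventually_ge_at_top[of N]
    proof eventually_elim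
      case (elim n)
      then have "s \<in> {-real n..real n}" using N by auto
      then show ?case by (simp add: gn_def)
    qed
    then show ?thesis using F(2)[of s] by (rule Lim_transform_eventually[rotated])
  qed
  have bound: "\<bar>gn n s\<bar> \<le> 2 * \<bar>g s\<bar>" for n s
    using F(3)[of n s] by (auto simp: gn_def indicator_def)
  have l4: "k (gn n s) \<le> 4 * k (g s)" for n s
  proof -
    have "k (gn n s) \<le> k (2 * g s)" using bound[of n s] by (intro k_mono) (simp add: abs_mult)
    also have "\<dots> \<le> 4 * k (g s)" using k_scale[of 2 "g s"] by simp
    finally show ?thesis .
  qed
  have l10: "k (gn n s - g s) \<le> 10 * k (g s)" for n s
    using k_diff[of "gn n s" "g s"] l4[of n s] by simp
  have "(\<lambda>n. modular (\<lambda>s. gn n s - g s)) \<longlonglongrightarrow> modular (\<lambda>s. 0)"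
  proof (rule modular_tendsto[OF g _ l10])
    show "AE s in lborel. (\<lambda>n. gn n s - g s) \<longlonglongrightarrow> 0" by (intro AE_I2 LIM_zero lim)
  qed measurable
  moreover have "(\<lambda>n. modular (gn n)) \<longlonglongrightarrow> modular g"
    by (rule modular_tendsto[OF g gm l4]) (use lim in auto)
  ultimately show ?thesis using that[OF simple lim bound] by (simp add: modular_def)
qed

end

locale levy_integration = levy_basis_space M \<Lambda> + centered_levy_pair \<sigma> \<nu>
  for M :: "'w measure" and \<Lambda> and \<sigma> and \<nu> +
  assumes char_Ioc: "\<And>a b \<theta>. a < b \<Longrightarrow> char (distr M borel (\<Lambda> {a<..b})) \<theta> = exp (of_real (b - a) * Psi \<theta>)"
begin

abbreviation S_int :: "(real \<Rightarrow> real) \<Rightarrow> 'w \<Rightarrow> real" where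
  "S_int \<equiv> rr_simple_integral \<Lambda> UNIV"

lemma char_rr_simple_integral:
  assumes g: "rr_simple g" and A: "A \<in> sets borel"
  shows "char (distr M borel (rr_simple_integral \<Lambda> A g)) \<theta> = exp (LINT s:A|lborel. Psi (\<theta> * g s))"
proof -
  have lv: "bounded_borel (A \<inter> g -` {x})" if "x \<in> range g - {0}" for x using that by (intro rr_simple_level g A) auto
  have "char (distr M borel (rr_simple_integral \<Lambda> A g)) \<theta> = (\<Prod>x\<in>range g - {0}. char (distr M borel (\<Lambda> (A \<inter> g -` {x}))) (\<theta> * x))"
    unfolding rr_simple_integral_def
    by (rule basis_char_linear) (use rr_simpleD(2)[OF g] lv in \<open>auto simp: disjoint_family_on_def\<close>)
  also have "\<dots> = (\<Prod>x\<in>range g - {0}. exp (of_real (measure lborel (A \<inter> g -` {x})) * Psi (\<theta> * x)))"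
    by (intro prod.cong refl basis_char char_Ioc lv)
  also have "\<dots> = exp (\<Sum>x\<in>range g - {0}. of_real (measure lborel (A \<inter> g -` {x})) * Psi (\<theta> * x))"
    using rr_simpleD(2)[OF g] by (intro exp_sum[symmetric]) simp
  also have "(\<Sum>x\<in>range g - {0}. of_real (measure lborel (A \<inter> g -` {x})) * Psi (\<theta> * x)) = (LINT s:A|lborel. Psi (\<theta> * g s))"
    by (subst rr_simple_integral_lborel(2)[OF g A, where F="\<lambda>x. Psi (\<theta> * x)"]) (auto simp: scaleR_conv_of_real)
  finally show ?thesis .
qed

text \<open>Convergence on every Borel set is what the gliding hump argument feeds on. Convergence
  over the whole line alone would not determine the limit: for the compensated unit rate Poisson
  basis, n times the indicator of (0, 1/n] tends to 0 almost everywhere while its integrals tend to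
  -1 in probability.\<close>

lemma has_rr_integral_unique:
  assumes Y: "has_rr_integral M \<Lambda> g Y" and W: "has_rr_integral M \<Lambda> g W"
  shows "AE \<omega> in M. Y \<omega> = W \<omega>"
proof -
  obtain gn where gn: "\<And>n. rr_simple (gn n)" "AE s in lborel. (\<lambda>n. gn n s) \<longlonglongrightarrow> g s"
      "\<And>A. A \<in> sets borel \<Longrightarrow> \<exists>L. tendsto_in_prob M (\<lambda>n. rr_simple_integral \<Lambda> A (gn n)) L"
      "tendsto_in_prob M (\<lambda>n. rr_simple_integral \<Lambda> UNIV (gn n)) Y"
    using Y unfolding has_rr_integral_def by blast
  obtain hn where hn: "\<And>n. rr_simple (hn n)" "AE s in lborel. (\<lambda>n. hn n s) \<longlonglongrightarrow> g s"
      "\<And>A. A \<in> sets borel \<Longrightarrow> \<exists>L. tendsto_in_prob M (\<lambda>n. rr_simple_integral \<Lambda> A (hn n)) L"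
      "tendsto_in_prob M (\<lambda>n. rr_simple_integral \<Lambda> UNIV (hn n)) W"
    using W unfolding has_rr_integral_def by blast
  have [measurable]: "Y \<in> borel_measurable M" "W \<in> borel_measurable M"
    using has_rr_integral_measurable[OF Y] has_rr_integral_measurable[OF W] by auto
  define d where "d n s = 1 * gn n s + (-1) * hn n s" for n s
  have d: "rr_simple (d n)" for n unfolding d_def by (intro rr_simple_lincomb gn hn)
  have d_lim: "AE s in lborel. (\<lambda>n. d n s) \<longlonglongrightarrow> 0"
    using gn(2) hn(2)
  proof eventually_elim
    case (elim s)
    then show ?case using tendsto_diff[OF elim] by (simp add: d_def)
  qed
  have tip: "tendsto_in_prob M (\<lambda>n. rr_simple_integral \<Lambda> A (d n)) (\<lambda>\<omega>. L \<omega> - K \<omega>)"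
    if A: "A \<in> sets borel" and L: "tendsto_in_prob M (\<lambda>n. rr_simple_integral \<Lambda> A (gn n)) L"
      and K: "tendsto_in_prob M (\<lambda>n. rr_simple_integral \<Lambda> A (hn n)) K" for A L K
  proof (rule tendsto_in_prob_cong[OF tendsto_in_prob_diff[OF L K]])
    show "AE \<omega> in M. rr_simple_integral \<Lambda> A (gn n) \<omega> - rr_simple_integral \<Lambda> A (hn n) \<omega> = rr_simple_integral \<Lambda> A (d n) \<omega>" for n
      using rr_simple_integral_lincomb_set[OF gn(1)[of n] hn(1)[of n] A, of 1 "-1"] unfolding d_def by eventually_elim simp
    show "rr_simple_integral \<Lambda> A (d n) \<in> borel_measurable M" for n by (intro rr_simple_integral_measurable d A)
    show "(\<lambda>\<omega>. L \<omega> - K \<omega>) \<in> borel_measurable M"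
      using tendsto_in_prob_measurable(2)[OF L] tendsto_in_prob_measurable(2)[OF K] by measurable
  qed simp
  have char1: "(CLINT \<omega>|M. iexp (\<theta> * (Y \<omega> - W \<omega>))) = 1" for \<theta>
  proof -
    define l where "l A = lim (\<lambda>n. exp (LINT s:A|lborel. Psi (\<theta> * d n s)))" for A
    have conv: "(\<lambda>n. exp (LINT s:A|lborel. Psi (\<theta> * d n s))) \<longlonglongrightarrow> (CLINT \<omega>|M. iexp (\<theta> * D \<omega>))"
      if A: "A \<in> sets borel" and D: "tendsto_in_prob M (\<lambda>n. rr_simple_integral \<Lambda> A (d n)) D" for A D
      using tendsto_in_prob_char[OF D, of \<theta>] char_rr_simple_integral[OF d A, of _ \<theta>]
        char_distr_eq[OF rr_simple_integral_measurable[OF d A], of _ \<theta>] by simp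
    have "l UNIV = 1"
    proof (rule exp_integral_limit_eq_1[where b="\<lambda>n s. Psi (\<theta> * d n s)"])
      show "complex_integrable lborel (\<lambda>s. Psi (\<theta> * d n s))" for n
        using rr_simple_integral_lborel(1)[OF d[of n], of UNIV "\<lambda>x. Psi (\<theta> * x)"] by (simp add: set_integrable_def)
      show "Re (Psi (\<theta> * d n s)) \<le> 0" for n s by (rule Re_Psi)
      show "AE s in lborel. (\<lambda>n. Psi (\<theta> * d n s)) \<longlonglongrightarrow> 0"
        using d_lim
      proof eventually_elim
        case (elim s)
        have "(\<lambda>n. Psi (\<theta> * d n s)) \<longlonglongrightarrow> Psi (\<theta> * 0)"
          by (rule isCont_tendsto_compose[OF isCont_Psi tendsto_mult[OF tendsto_const elim]])
        then show ?case by simp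
      qed
      fix A :: "real set" assume A: "A \<in> sets borel"
      obtain L K where "tendsto_in_prob M (\<lambda>n. rr_simple_integral \<Lambda> A (gn n)) L" "tendsto_in_prob M (\<lambda>n. rr_simple_integral \<Lambda> A (hn n)) K"
        using gn(3)[OF A] hn(3)[OF A] by blast
      from conv[OF A tip[OF A this]]
      show "(\<lambda>n. exp (LINT s:A|lborel. Psi (\<theta> * d n s))) \<longlonglongrightarrow> l A"
        unfolding l_def by (intro convergent_LIMSEQ_iff[THEN iffD1]) (auto simp: convergent_def)
    qed
    moreover have "l UNIV = (CLINT \<omega>|M. iexp (\<theta> * (Y \<omega> - W \<omega>)))"
      unfolding l_def by (rule limI[OF conv[OF _ tip[OF _ gn(4) hn(4)]]]) auto
    ultimately show ?thesis by simp
  qed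
  have "AE \<omega> in M. Y \<omega> - W \<omega> = 0"
    by (rule AE_eq_0_of_char) (measurable, rule char1)
  then show ?thesis by eventually_elim simp
qed

text \<open>The bound of \<open>nn_integral_abs_le_of_char\<close> with 6 \<open>tail_const\<close>
  m in place of m. The root governs small modulars, as for a variance; the linear term governs large
  ones.\<close>

definition L1_bound :: "real \<Rightarrow> real" where
  "L1_bound m = 7 / cos_const * (6 * tail_const * m + sqrt (6 * tail_const * m))"

lemma L1_bound_0[simp]: "L1_bound 0 = 0" by (simp add: L1_bound_def)

lemma L1_bound_nonneg: "0 \<le> m \<Longrightarrow> 0 \<le> L1_bound m"
  using cos_const_pos tail_const_ge_1 by (simp add: L1_bound_def)

lemma L1_bound_mono: "m \<le> m' \<Longrightarrow> L1_bound m \<le> L1_bound m'"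
  unfolding L1_bound_def using cos_const_pos tail_const_ge_1
  by (intro mult_left_mono add_mono real_sqrt_le_mono) auto

lemma isCont_L1_bound: "isCont L1_bound m"
  unfolding L1_bound_def by (intro continuous_intros)

text \<open>The root is absorbed by \<open>sqrt x \<le> 1 + x\<close>, and 84 = 7 * 12. With linear
  growth, integrability of a family of modulars dominates the corresponding first moments.\<close>

lemma L1_bound_le: "0 \<le> m \<Longrightarrow> L1_bound m \<le> 84 * tail_const / cos_const * (1 + m)"
proof -
  assume m: "0 \<le> m"
  define x where "x = 6 * tail_const * m"
  have x: "x \<ge> 0" using m tail_const_ge_1 by (simp add: x_def)
  have "sqrt x \<le> sqrt ((1 + x)\<^sup>2)" using x by (intro real_sqrt_le_mono) (simp add: power2_eq_square algebra_simps)
  then have "sqrt x \<le> 1 + x" using x by simp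
  then have "x + sqrt x \<le> 1 + 2 * x" by simp
  also have "\<dots> \<le> 12 * tail_const * (1 + m)" using tail_const_ge_1 m by (simp add: x_def algebra_simps)
  finally have "7 / cos_const * (x + sqrt x) \<le> 7 / cos_const * (12 * tail_const * (1 + m))"
    using cos_const_pos by (intro mult_left_mono) auto
  then show ?thesis by (simp add: L1_bound_def x_def)
qed

lemma rr_simple_integral_L1:
  assumes g: "rr_simple g"
  shows "integrable M (S_int g)" "expectation (\<lambda>\<omega>. \<bar>S_int g \<omega>\<bar>) \<le> L1_bound (modular g)"
proof -
  have [measurable]: "S_int g \<in> borel_measurable M" by (intro rr_simple_integral_measurable g) simp
  define m where "m = modular g"
  \<comment> \<open>Written as a finite sum over the values, the exponent is visibly measurable in
    \<theta>, and its integral against the weight splits term by term.\<close>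
  define \<kappa> where "\<kappa> \<theta> = (\<Sum>x\<in>range g - {0}. measure lborel (g -` {x}) *\<^sub>R Psi (\<theta> * x))" for \<theta>
  have \<kappa>: "\<kappa> \<theta> = (LINT s:UNIV|lborel. Psi (\<theta> * g s))" for \<theta>
    unfolding \<kappa>_def by (subst rr_simple_integral_lborel(2)[OF g, where F="\<lambda>x. Psi (\<theta> * x)"]) auto
  have m_sum: "m = (\<Sum>x\<in>range g - {0}. measure lborel (g -` {x}) * k x)"
    using rr_simple_integral_lborel(2)[OF g, of UNIV k] by (simp add: m_def modular_def set_lebesgue_integral_def)
  have m0: "m \<ge> 0" by (simp add: m_def)
  have T: "1 \<le> tail_const" by (rule tail_const_ge_1)
  have \<kappa>_le: "cmod (\<kappa> \<theta>) \<le> 6 * c * m" if c: "\<And>x. k (\<theta> * x) \<le> c * k x" for c \<theta>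
  proof -
    have "cmod (\<kappa> \<theta>) \<le> (\<Sum>x\<in>range g - {0}. cmod (measure lborel (g -` {x}) *\<^sub>R Psi (\<theta> * x)))"
      unfolding \<kappa>_def by (rule norm_sum)
    also have "\<dots> \<le> (\<Sum>x\<in>range g - {0}. measure lborel (g -` {x}) * (6 * (c * k x)))"
      unfolding norm_scaleR using c
      by (intro sum_mono mult_mono order_trans[OF cmod_Psi_le]) (auto simp del: mult_le_cancel_left)
    also have "\<dots> = 6 * c * m" by (simp add: m_sum sum_distrib_left mult_ac)
    finally show ?thesis .
  qed
  have "(\<integral>\<^sup>+\<omega>. ennreal \<bar>S_int g \<omega>\<bar> \<partial>M) \<le> ennreal (7 / cos_const * (6 * tail_const * m + sqrt (6 * tail_const * m)))"
  proof (rule nn_integral_abs_le_of_char[where \<kappa>=\<kappa>])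
    show "\<kappa> \<in> borel_measurable borel" unfolding \<kappa>_def by measurable
    show "char (distr M borel (S_int g)) \<theta> = exp (\<kappa> \<theta>)" for \<theta> by (simp add: char_rr_simple_integral[OF g] \<kappa>)
    show "Re (\<kappa> \<theta>) \<le> 0" for \<theta>
      unfolding \<kappa>_def Re_sum using Re_Psi by (intro sum_nonpos) (simp add: mult_nonneg_nonpos)
    show "0 \<le> 6 * tail_const * m" using m0 T by simp
    show "cmod (\<kappa> \<theta>) \<le> 6 * tail_const * m * \<bar>\<theta>\<bar>" if "\<bar>\<theta>\<bar> \<le> 1" for \<theta>
    proof -
      \<comment> \<open>Convexity with k 0 = 0 gives the linear bound for |\<theta>| <= 1; beyond 1
        the doubling bound \<open>k_scale\<close> takes over.\<close>
      have "k (\<theta> * x) \<le> \<bar>\<theta>\<bar> * k x" for x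
      proof -
        have "k (\<theta> * x) = k (\<bar>\<theta>\<bar> * x)" by (cases "\<theta> \<ge> 0") auto
        also have "\<dots> \<le> \<bar>\<theta>\<bar> * k x" using convex_onD[OF convex_k, of "\<bar>\<theta>\<bar>" 0 x] that by simp
        finally show ?thesis .
      qed
      from \<kappa>_le[OF this] have "cmod (\<kappa> \<theta>) \<le> 1 * (6 * \<bar>\<theta>\<bar> * m)" by simp
      also have "\<dots> \<le> tail_const * (6 * \<bar>\<theta>\<bar> * m)" using T m0 by (intro mult_right_mono) auto
      finally show ?thesis by (simp add: mult_ac)
    qed
    show "cmod (\<kappa> \<theta>) \<le> 6 * tail_const * m * \<theta>\<^sup>2" if "1 \<le> \<bar>\<theta>\<bar>" for \<theta>
    proof -
      from \<kappa>_le[OF k_scale[OF that]] have "cmod (\<kappa> \<theta>) \<le> 1 * (6 * \<theta>\<^sup>2 * m)" by simp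
      also have "\<dots> \<le> tail_const * (6 * \<theta>\<^sup>2 * m)" using T m0 by (intro mult_right_mono) auto
      finally show ?thesis by (simp add: mult_ac)
    qed
    have "(\<integral>\<^sup>+\<theta>. ennreal (- Re (\<kappa> \<theta>) / \<theta>\<^sup>2) * indicator {-1..1} \<theta> \<partial>lborel)
      = (\<integral>\<^sup>+\<theta>. (\<Sum>x\<in>range g - {0}. ennreal (measure lborel (g -` {x})) * (ennreal (- Re (Psi (\<theta> * x)) / \<theta>\<^sup>2) * indicator {-1..1} \<theta>)) \<partial>lborel)"
    proof (rule nn_integral_cong)
      fix \<theta> :: real
      have "- Re (\<kappa> \<theta>) / \<theta>\<^sup>2 = (\<Sum>x\<in>range g - {0}. measure lborel (g -` {x}) * (- Re (Psi (\<theta> * x)) / \<theta>\<^sup>2))"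
        by (simp add: \<kappa>_def sum_negf sum_divide_distrib)
      then have "ennreal (- Re (\<kappa> \<theta>) / \<theta>\<^sup>2) = (\<Sum>x\<in>range g - {0}. ennreal (measure lborel (g -` {x}) * (- Re (Psi (\<theta> * x)) / \<theta>\<^sup>2)))"
        using Re_Psi by (simp only:) (intro sum_ennreal[symmetric] mult_nonneg_nonneg divide_nonneg_nonneg; simp)
      also have "\<dots> = (\<Sum>x\<in>range g - {0}. ennreal (measure lborel (g -` {x})) * ennreal (- Re (Psi (\<theta> * x)) / \<theta>\<^sup>2))"
        by (intro sum.cong refl ennreal_mult') simp
      finally show "ennreal (- Re (\<kappa> \<theta>) / \<theta>\<^sup>2) * indicator {-1..1} \<theta> = (\<Sum>x\<in>range g - {0}. ennreal (measure lborel (g -` {x})) * (ennreal (- Re (Psi (\<theta> * x)) / \<theta>\<^sup>2) * indicator {-1..1} \<theta>))"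
        by (simp add: sum_distrib_right mult.assoc)
    qed
    also have "\<dots> = (\<Sum>x\<in>range g - {0}. ennreal (measure lborel (g -` {x})) * (\<integral>\<^sup>+\<theta>. ennreal (- Re (Psi (\<theta> * x)) / \<theta>\<^sup>2) * indicator {-1..1} \<theta> \<partial>lborel))"
      by (subst nn_integral_sum, measurable) (intro sum.cong refl nn_integral_cmult, measurable)
    also have "\<dots> \<le> (\<Sum>x\<in>range g - {0}. ennreal (measure lborel (g -` {x})) * ennreal (tail_const * k x))"
      by (intro sum_mono mult_left_mono nn_integral_Re_Psi_le) simp
    also have "\<dots> = (\<Sum>x\<in>range g - {0}. ennreal (measure lborel (g -` {x}) * (tail_const * k x)))"
      by (intro sum.cong refl ennreal_mult'[symmetric]) simp
    also have "\<dots> = ennreal (\<Sum>x\<in>range g - {0}. measure lborel (g -` {x}) * (tail_const * k x))"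
      using T by (intro sum_ennreal) simp
    also have "(\<Sum>x\<in>range g - {0}. measure lborel (g -` {x}) * (tail_const * k x)) = tail_const * m"
      by (simp add: m_sum sum_distrib_left mult_ac)
    also have "ennreal (tail_const * m) \<le> ennreal (6 * tail_const * m)" using T m0 by (intro ennreal_leI) simp
    finally show "(\<integral>\<^sup>+\<theta>. ennreal (- Re (\<kappa> \<theta>) / \<theta>\<^sup>2) * indicator {-1..1} \<theta> \<partial>lborel) \<le> ennreal (6 * tail_const * m)" .
  qed measurable
  then have *: "(\<integral>\<^sup>+\<omega>. ennreal \<bar>S_int g \<omega>\<bar> \<partial>M) \<le> ennreal (L1_bound (modular g))" by (simp add: L1_bound_def m_def)
  show int: "integrable M (S_int g)" by (rule integrableI_bounded) (use * in \<open>auto intro: le_less_trans\<close>)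
  show "expectation (\<lambda>\<omega>. \<bar>S_int g \<omega>\<bar>) \<le> L1_bound (modular g)"
    using * int L1_bound_nonneg[of "modular g"] by (subst (asm) nn_integral_eq_integral) auto
qed

end

section \<open>Existence, first moments and shift invariance of the integral\<close>

context levy_integration begin

lemma rr_simple_integral_diff_L1:
  assumes g: "rr_simple g" and h: "rr_simple h" and A: "A \<in> sets borel"
  shows "integrable M (rr_simple_integral \<Lambda> A g)"
    "expectation (\<lambda>\<omega>. \<bar>rr_simple_integral \<Lambda> A g \<omega> - rr_simple_integral \<Lambda> A h \<omega>\<bar>) \<le> L1_bound (modular (\<lambda>s. g s - h s))"
proof -
  have [measurable]: "rr_simple_integral \<Lambda> A f \<in> borel_measurable M" if "rr_simple f" for f
    by (rule rr_simple_integral_measurable[OF that A])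
  show "integrable M (rr_simple_integral \<Lambda> A g)"
    using rr_simple_integral_L1(1)[OF rr_simple_indicator[OF g A]] rr_simple_integral_indicator[OF g A] g
    by (subst integrable_cong_AE[where g="S_int (\<lambda>s. g s * indicator A s)"])
      (auto intro: rr_simple_integral_measurable A rr_simple_indicator)
  let ?d = "\<lambda>s. 1 * g s + (-1) * h s"
  have d: "rr_simple ?d" by (rule rr_simple_lincomb[OF g h])
  have "AE \<omega> in M. rr_simple_integral \<Lambda> A g \<omega> - rr_simple_integral \<Lambda> A h \<omega> = S_int (\<lambda>s. ?d s * indicator A s) \<omega>"
    using rr_simple_integral_lincomb_set[OF g h A, of 1 "-1"] rr_simple_integral_indicator[OF d A]
    by eventually_elim simp
  then have "expectation (\<lambda>\<omega>. \<bar>rr_simple_integral \<Lambda> A g \<omega> - rr_simple_integral \<Lambda> A h \<omega>\<bar>) = expectation (\<lambda>\<omega>. \<bar>S_int (\<lambda>s. ?d s * indicator A s) \<omega>\<bar>)"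
    using g h d by (intro integral_cong_AE) (auto intro!: borel_measurable_abs borel_measurable_diff rr_simple_integral_measurable rr_simple_indicator A)
  also have "\<dots> \<le> L1_bound (modular (\<lambda>s. ?d s * indicator A s))"
    by (rule rr_simple_integral_L1(2)[OF rr_simple_indicator[OF d A]])
  \<comment> \<open>Restriction to \<open>A\<close> can only lower the modular, so one sequence of
    simple functions converges over all Borel sets, as the definition of the integral
    demands.\<close>
  also have "\<dots> \<le> L1_bound (modular ?d)"
  proof (rule L1_bound_mono, rule phi_integrable_mono(2)[OF phi_integrable_rr_simple[OF d]])
    show "(\<lambda>s. ?d s * indicator A s) \<in> borel_measurable borel" by (rule rr_simpleD(1)[OF rr_simple_indicator[OF d A]])
    show "\<bar>?d s * indicator A s\<bar> \<le> \<bar>?d s\<bar>" for s by (auto simp: indicator_def)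
  qed
  finally show "expectation (\<lambda>\<omega>. \<bar>rr_simple_integral \<Lambda> A g \<omega> - rr_simple_integral \<Lambda> A h \<omega>\<bar>) \<le> L1_bound (modular (\<lambda>s. g s - h s))" by simp
qed

lemma has_rr_integral_exists:
  assumes g: "phi_integrable g"
  shows "\<exists>Y. has_rr_integral M \<Lambda> g Y \<and> integrable M Y \<and> expectation (\<lambda>\<omega>. \<bar>Y \<omega>\<bar>) \<le> L1_bound (modular g)"
proof -
  obtain gn where gn: "\<And>n. rr_simple (gn n)" "\<And>s. (\<lambda>n. gn n s) \<longlonglongrightarrow> g s" "\<And>n s. \<bar>gn n s\<bar> \<le> 2 * \<bar>g s\<bar>"
    "(\<lambda>n. modular (\<lambda>s. gn n s - g s)) \<longlonglongrightarrow> 0" "(\<lambda>n. modular (gn n)) \<longlonglongrightarrow> modular g"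
    by (rule rr_simple_dense[OF g]) blast
  have dn: "phi_integrable (\<lambda>s. gn n s - g s)" for n by (intro phi_integrable_diff phi_integrable_rr_simple gn g)
  have mij: "modular (\<lambda>s. gn i s - gn j s) \<le> 2 * (modular (\<lambda>s. gn i s - g s) + modular (\<lambda>s. gn j s - g s))" for i j
  proof -
    have "(gn i s - g s) - (gn j s - g s) = gn i s - gn j s" for s by simp
    then show ?thesis using phi_integrable_diff(2)[OF dn[of i] dn[of j]] by (simp only:)
  qed
  have conv: "\<exists>L. integrable M L \<and> (\<lambda>n. expectation (\<lambda>\<omega>. \<bar>rr_simple_integral \<Lambda> A (gn n) \<omega> - L \<omega>\<bar>)) \<longlonglongrightarrow> 0"
    if A: "A \<in> sets borel" for A
  proof (rule L1_complete[of M "\<lambda>n. rr_simple_integral \<Lambda> A (gn n)"])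
    show "integrable M (rr_simple_integral \<Lambda> A (gn n))" for n by (rule rr_simple_integral_diff_L1(1)[OF gn(1) gn(1) A])
    fix e :: real assume e: "e > 0"
    obtain d where d: "d > 0" "\<And>x. \<bar>x\<bar> < d \<Longrightarrow> \<bar>L1_bound x\<bar> < e"
    proof -
      have "\<exists>d>0. \<forall>x. norm (x - 0) < d \<longrightarrow> norm (L1_bound x - L1_bound 0) < e"
        using isCont_L1_bound[of 0] e unfolding continuous_at_eps_delta by (auto simp: dist_norm)
      then show ?thesis using that by auto
    qed
    \<comment> \<open>The modular is subadditive only up to the factor 2: two errors below d/4 give
      2 (d/4 + d/4) = d.\<close>
    have "eventually (\<lambda>n. modular (\<lambda>s. gn n s - g s) < d / 4) sequentially"
      using gn(4) d(1) by (intro order_tendstoD) auto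
    then obtain N where N: "\<And>n. n \<ge> N \<Longrightarrow> modular (\<lambda>s. gn n s - g s) < d / 4" by (auto simp: eventually_sequentially)
    show "\<exists>N. \<forall>i\<ge>N. \<forall>j\<ge>N. expectation (\<lambda>\<omega>. \<bar>rr_simple_integral \<Lambda> A (gn i) \<omega> - rr_simple_integral \<Lambda> A (gn j) \<omega>\<bar>) < e"
    proof (intro exI allI impI)
      fix i j assume ij: "N \<le> i" "N \<le> j"
      have "modular (\<lambda>s. gn i s - gn j s) < d" 
        by (rule le_less_trans[OF mij]) (use N[OF ij(1)] N[OF ij(2)] in simp)
      then have "\<bar>L1_bound (modular (\<lambda>s. gn i s - gn j s))\<bar> < e" by (intro d(2)) simp
      then show "expectation (\<lambda>\<omega>. \<bar>rr_simple_integral \<Lambda> A (gn i) \<omega> - rr_simple_integral \<Lambda> A (gn j) \<omega>\<bar>) < e"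
        using rr_simple_integral_diff_L1(2)[OF gn(1)[of i] gn(1)[of j] A] by linarith
    qed
  qed blast
  have tip: "tendsto_in_prob M (\<lambda>n. rr_simple_integral \<Lambda> A (gn n)) L"
    if "A \<in> sets borel" "integrable M L" "(\<lambda>n. expectation (\<lambda>\<omega>. \<bar>rr_simple_integral \<Lambda> A (gn n) \<omega> - L \<omega>\<bar>)) \<longlonglongrightarrow> 0" for A L
    using that by (intro tendsto_in_probI_L1 rr_simple_integral_diff_L1(1)[OF gn(1) gn(1)])
  obtain Y where Y: "integrable M Y" "(\<lambda>n. expectation (\<lambda>\<omega>. \<bar>S_int (gn n) \<omega> - Y \<omega>\<bar>)) \<longlonglongrightarrow> 0"
    using conv[of UNIV] by auto
  have "has_rr_integral M \<Lambda> g Y"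
    unfolding has_rr_integral_def
  proof (intro conjI exI[of _ gn] allI ballI)
    show "g \<in> borel_measurable borel" using g by (simp add: phi_integrable_def)
    show "\<exists>L. tendsto_in_prob M (\<lambda>n. rr_simple_integral \<Lambda> A (gn n)) L" if "A \<in> sets borel" for A
      using conv[OF that] tip[OF that] by blast
    show "tendsto_in_prob M (\<lambda>n. S_int (gn n)) Y" using Y by (intro tip) auto
  qed (use gn in auto)
  moreover have "expectation (\<lambda>\<omega>. \<bar>Y \<omega>\<bar>) \<le> L1_bound (modular g) + 0"
  proof (rule LIMSEQ_le_const)
    show "(\<lambda>n. L1_bound (modular (gn n)) + expectation (\<lambda>\<omega>. \<bar>S_int (gn n) \<omega> - Y \<omega>\<bar>)) \<longlonglongrightarrow> L1_bound (modular g) + 0"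
      by (intro tendsto_add Y isCont_tendsto_compose[OF isCont_L1_bound gn(5)])
    have "expectation (\<lambda>\<omega>. \<bar>Y \<omega>\<bar>) \<le> L1_bound (modular (gn n)) + expectation (\<lambda>\<omega>. \<bar>S_int (gn n) \<omega> - Y \<omega>\<bar>)" for n
    proof -
      have i: "integrable M (S_int (gn n))" by (rule rr_simple_integral_L1(1)[OF gn(1)])
      have "expectation (\<lambda>\<omega>. \<bar>Y \<omega>\<bar>) \<le> expectation (\<lambda>\<omega>. \<bar>S_int (gn n) \<omega>\<bar> + \<bar>S_int (gn n) \<omega> - Y \<omega>\<bar>)"
        using i Y(1) by (intro integral_mono) auto
      also have "\<dots> = expectation (\<lambda>\<omega>. \<bar>S_int (gn n) \<omega>\<bar>) + expectation (\<lambda>\<omega>. \<bar>S_int (gn n) \<omega> - Y \<omega>\<bar>)"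
        using i Y(1) by (intro Bochner_Integration.integral_add) auto
      finally show ?thesis using rr_simple_integral_L1(2)[OF gn(1)[of n]] by linarith
    qed
    then show "\<exists>N. \<forall>n\<ge>N. expectation (\<lambda>\<omega>. \<bar>Y \<omega>\<bar>) \<le> L1_bound (modular (gn n)) + expectation (\<lambda>\<omega>. \<bar>S_int (gn n) \<omega> - Y \<omega>\<bar>)" by blast
  qed
  ultimately show ?thesis using Y(1) by (intro exI[of _ Y]) simp
qed

lemma has_rr_integral_L1:
  assumes g: "phi_integrable g" and Y: "has_rr_integral M \<Lambda> g Y"
  shows "integrable M Y" "expectation (\<lambda>\<omega>. \<bar>Y \<omega>\<bar>) \<le> L1_bound (modular g)"
proof -
  obtain W where W: "has_rr_integral M \<Lambda> g W" "integrable M W" "expectation (\<lambda>\<omega>. \<bar>W \<omega>\<bar>) \<le> L1_bound (modular g)"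
    using has_rr_integral_exists[OF g] by blast
  have [measurable]: "Y \<in> borel_measurable M" "W \<in> borel_measurable M"
    using has_rr_integral_measurable Y W by auto
  have AE: "AE \<omega> in M. Y \<omega> = W \<omega>" by (rule has_rr_integral_unique[OF Y W(1)])
  show "integrable M Y" using W(2) AE by (subst integrable_cong_AE) auto
  have "expectation (\<lambda>\<omega>. \<bar>Y \<omega>\<bar>) = expectation (\<lambda>\<omega>. \<bar>W \<omega>\<bar>)" using AE by (intro integral_cong_AE) auto
  then show "expectation (\<lambda>\<omega>. \<bar>Y \<omega>\<bar>) \<le> L1_bound (modular g)" using W(3) by simp
qed

lemma has_rr_integral_diff_L1:
  assumes g: "phi_integrable g" and Y: "has_rr_integral M \<Lambda> g Y" and h: "phi_integrable h" and W: "has_rr_integral M \<Lambda> h W"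
  shows "expectation (\<lambda>\<omega>. \<bar>Y \<omega> - W \<omega>\<bar>) \<le> L1_bound (modular (\<lambda>s. g s - h s))"
  using has_rr_integral_L1(2)[OF phi_integrable_lincomb[OF g h] has_rr_integral_lincomb[OF Y W], of 1 "-1"] by simp

lemma has_rr_integral_sum:
  assumes "finite J" "\<And>j. j \<in> J \<Longrightarrow> has_rr_integral M \<Lambda> (g j) (Y j)"
  shows "has_rr_integral M \<Lambda> (\<lambda>s. \<Sum>j\<in>J. a j * g j s) (\<lambda>\<omega>. \<Sum>j\<in>J. a j * Y j \<omega>)"
  using assms
proof (induction J rule: finite_induct)
  case empty
  have "rr_simple (\<lambda>s. 0)" by (rule rr_simpleI) auto
  moreover have "S_int (\<lambda>s. 0) = (\<lambda>\<omega>. 0)" by (simp add: fun_eq_iff rr_simple_integral_def)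
  ultimately show ?case using has_rr_integral_simple[of "\<lambda>s. 0"] by simp
next
  case (insert j J)
  then show ?case using has_rr_integral_lincomb[of "g j" "Y j" "\<lambda>s. \<Sum>j\<in>J. a j * g j s" "\<lambda>\<omega>. \<Sum>j\<in>J. a j * Y j \<omega>" "a j" 1] by simp
qed

text \<open>For simple functions the characteristic function is the exponential of the Lebesgue
  integral of \<open>Psi\<close> composed with the integrand, which is translation invariant;
  approximation in L1 extends this. The argument 1 is enough because coefficients can be put into
  \<open>g\<close>.\<close>

lemma has_rr_integral_shift_char:
  assumes g: "phi_integrable g" and Y: "has_rr_integral M \<Lambda> g Y" and W: "has_rr_integral M \<Lambda> (\<lambda>s. g (s - h)) W"
  shows "(CLINT \<omega>|M. iexp (W \<omega>)) = (CLINT \<omega>|M. iexp (Y \<omega>))"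
proof -
  obtain gn where gn: "\<And>n. rr_simple (gn n)" "\<And>s. (\<lambda>n. gn n s) \<longlonglongrightarrow> g s" "\<And>n s. \<bar>gn n s\<bar> \<le> 2 * \<bar>g s\<bar>"
    "(\<lambda>n. modular (\<lambda>s. gn n s - g s)) \<longlonglongrightarrow> 0" "(\<lambda>n. modular (gn n)) \<longlonglongrightarrow> modular g"
    by (rule rr_simple_dense[OF g]) blast
  have dn: "phi_integrable (\<lambda>s. gn n s - g s)" for n by (intro phi_integrable_diff phi_integrable_rr_simple gn g)
  have L0: "(\<lambda>n. L1_bound (modular (\<lambda>s. gn n s - g s))) \<longlonglongrightarrow> 0"
    using isCont_tendsto_compose[OF isCont_L1_bound gn(4)] by simp
  have tipY: "tendsto_in_prob M (\<lambda>n. S_int (gn n)) Y"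
  proof (rule tendsto_in_probI_L1)
    show "(\<lambda>n. expectation (\<lambda>\<omega>. \<bar>S_int (gn n) \<omega> - Y \<omega>\<bar>)) \<longlonglongrightarrow> 0"
    proof (rule tendsto_sandwich[OF _ _ tendsto_const L0])
      show "\<forall>\<^sub>F n in sequentially. expectation (\<lambda>\<omega>. \<bar>S_int (gn n) \<omega> - Y \<omega>\<bar>) \<le> L1_bound (modular (\<lambda>s. gn n s - g s))"
        by (intro always_eventually allI has_rr_integral_diff_L1 phi_integrable_rr_simple has_rr_integral_simple gn g Y)
    qed simp
  qed (auto intro: rr_simple_integral_L1(1) gn has_rr_integral_L1(1)[OF g Y])
  have gs: "rr_simple (\<lambda>s. gn n (s - h))" for n by (intro rr_simple_shift gn)
  have tipW: "tendsto_in_prob M (\<lambda>n. S_int (\<lambda>s. gn n (s - h))) W"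
  proof (rule tendsto_in_probI_L1)
    show "(\<lambda>n. expectation (\<lambda>\<omega>. \<bar>S_int (\<lambda>s. gn n (s - h)) \<omega> - W \<omega>\<bar>)) \<longlonglongrightarrow> 0"
    proof (rule tendsto_sandwich[OF _ _ tendsto_const L0])
      have "expectation (\<lambda>\<omega>. \<bar>S_int (\<lambda>s. gn n (s - h)) \<omega> - W \<omega>\<bar>) \<le> L1_bound (modular (\<lambda>s. gn n (s - h) - g (s - h)))" for n
        by (intro has_rr_integral_diff_L1 phi_integrable_rr_simple has_rr_integral_simple gs phi_integrable_shift g W)
      then show "\<forall>\<^sub>F n in sequentially. expectation (\<lambda>\<omega>. \<bar>S_int (\<lambda>s. gn n (s - h)) \<omega> - W \<omega>\<bar>) \<le> L1_bound (modular (\<lambda>s. gn n s - g s))"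
        using phi_integrable_shift(2)[OF dn, of _ h] by simp
    qed simp
  qed (auto intro: rr_simple_integral_L1(1) gs has_rr_integral_L1(1)[OF phi_integrable_shift(1)[OF g] W])
  have eq: "(CLINT \<omega>|M. iexp (1 * S_int (\<lambda>s. gn n (s - h)) \<omega>)) = (CLINT \<omega>|M. iexp (1 * S_int (gn n) \<omega>))" for n
  proof -
    have "(CLINT \<omega>|M. iexp (1 * S_int q \<omega>)) = exp (LINT s|lborel. Psi (q s))" if "rr_simple q" for q
      using char_rr_simple_integral[OF that, of UNIV 1] char_distr_eq[OF rr_simple_integral_measurable[OF that, of UNIV], of 1]
      by (simp add: set_lebesgue_integral_def)
    then show ?thesis using gn(1)[of n] gs[of n] integral_lborel_shift[of "\<lambda>s. Psi (gn n s)" h] by simp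
  qed
  have "(CLINT \<omega>|M. iexp (1 * W \<omega>)) = (CLINT \<omega>|M. iexp (1 * Y \<omega>))"
    by (rule LIMSEQ_unique[OF tendsto_in_prob_char[OF tipW] tendsto_in_prob_char[OF tipY, of 1, folded eq]])
  then show ?thesis by simp
qed

text \<open>A linear combination of the process at times j + h is the integral of the kernel for the
  times j, translated by h. So all joint characteristic functions are invariant.\<close>

lemma moving_average_stationary:
  assumes g: "phi_integrable g" and X: "\<And>t. has_rr_integral M \<Lambda> (\<lambda>s. g (t - s)) (X t)"
  shows "stationary_process M X"
  unfolding stationary_process_def same_fdd_def
proof (intro conjI allI impI)
  show Xm: "X t \<in> borel_measurable M" for t using has_rr_integral_measurable[OF X] by simp
  fix h and J :: "real set" assume J: "finite J"
  show "distr M (\<Pi>\<^sub>M t\<in>J. borel) (\<lambda>\<omega>. \<lambda>t\<in>J. X (t + h) \<omega>) = distr M (\<Pi>\<^sub>M t\<in>J. borel) (\<lambda>\<omega>. \<lambda>t\<in>J. X t \<omega>)"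
  proof (rule distr_PiM_eq_of_char[OF J Xm Xm])
    fix a :: "real \<Rightarrow> real"
    show "(CLINT \<omega>|M. iexp (\<Sum>j\<in>J. a j * X (j + h) \<omega>)) = (CLINT \<omega>|M. iexp (\<Sum>j\<in>J. a j * X j \<omega>))"
    proof (rule has_rr_integral_shift_char[where g="\<lambda>s. \<Sum>j\<in>J. a j * g (j - s)" and h=h])
      show "phi_integrable (\<lambda>s. \<Sum>j\<in>J. a j * g (j - s))" by (intro phi_integrable_sum J phi_integrable_reflect g)
      show "has_rr_integral M \<Lambda> (\<lambda>s. \<Sum>j\<in>J. a j * g (j - s)) (\<lambda>\<omega>. \<Sum>j\<in>J. a j * X j \<omega>)"
        by (intro has_rr_integral_sum J X)
      have "has_rr_integral M \<Lambda> (\<lambda>s. \<Sum>j\<in>J. a j * g (j + h - s)) (\<lambda>\<omega>. \<Sum>j\<in>J. a j * X (j + h) \<omega>)"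
        by (intro has_rr_integral_sum J X)
      then show "has_rr_integral M \<Lambda> (\<lambda>s. \<Sum>j\<in>J. a j * g (j - (s - h))) (\<lambda>\<omega>. \<Sum>j\<in>J. a j * X (j + h) \<omega>)"
        by (simp add: diff_diff_eq2)
    qed
  qed
qed

end

subsection \<open>A stochastic Fubini theorem\<close>

text \<open>By \<open>k_lower\<close>, the assumption \<open>k_1\<close> turns integrability of
  \<open>k (u v s)\<close> in v into integrability of \<open>u v s\<close>, so that means exist; for
  k = 0 there would be no such control.\<close>

locale levy_mixture = levy_integration M \<Lambda> \<sigma> \<nu> + mu: prob_space \<mu>
  for M :: "'w measure" and \<Lambda> \<sigma> \<nu> and \<mu> :: "real measure" +
  assumes sets_mu[measurable_cong]: "sets \<mu> = sets borel" and k_1: "k 1 > 0"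
begin

lemma space_mu: "space \<mu> = UNIV"
  using sets_eq_imp_space_eq[OF sets_mu] by simp

definition mean :: "(real \<Rightarrow> real \<Rightarrow> real) \<Rightarrow> real \<Rightarrow> real" where
  "mean u s = (LINT v|\<mu>. u v s)"

definition mixable :: "(real \<Rightarrow> real \<Rightarrow> real) \<Rightarrow> bool" where
  "mixable u \<longleftrightarrow> case_prod u \<in> borel_measurable (borel \<Otimes>\<^sub>M borel) \<and>
     (\<forall>v. phi_integrable (u v)) \<and> integrable \<mu> (\<lambda>v. modular (u v))"

lemma mixableD:
  assumes "mixable u"
  shows "case_prod u \<in> borel_measurable (borel \<Otimes>\<^sub>M borel)" "phi_integrable (u v)" "integrable \<mu> (\<lambda>v. modular (u v))"
  using assms by (auto simp: mixable_def)

lemma mixable_measurable2: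
  assumes "mixable u"
  shows "(\<lambda>v. u v s) \<in> borel_measurable borel"
proof -
  note [measurable] = mixableD(1)[OF assms]
  show ?thesis by measurable
qed

lemma modular_measurable:
  assumes [measurable]: "case_prod u \<in> borel_measurable (borel \<Otimes>\<^sub>M borel)"
  shows "(\<lambda>v. modular (u v)) \<in> borel_measurable \<mu>"
  unfolding modular_def by measurable

lemma mixable_bound:
  assumes u: "mixable u" and [measurable]: "case_prod w \<in> borel_measurable (borel \<Otimes>\<^sub>M borel)"
    and le: "\<And>v s. k (w v s) \<le> c * k (u v s)"
  shows "mixable w" "modular (w v) \<le> c * modular (u v)"
proof -
  have m: "w v \<in> borel_measurable borel" for v by measurable
  show *: "modular (w v) \<le> c * modular (u v)" for v by (rule phi_integrable_bound(2)[OF mixableD(2)[OF u] m le])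
  have "integrable \<mu> (\<lambda>v. modular (w v))"
  proof (rule Bochner_Integration.integrable_bound[of _ "\<lambda>v. c * modular (u v)"])
    show "integrable \<mu> (\<lambda>v. c * modular (u v))" by (intro integrable_mult_right mixableD(3)[OF u])
    show "AE v in \<mu>. norm (modular (w v)) \<le> norm (c * modular (u v))" using * by (auto intro!: AE_I2 order_trans[OF *])
  qed (rule modular_measurable, measurable)
  then show "mixable w" unfolding mixable_def
    using phi_integrable_bound(1)[OF mixableD(2)[OF u] m le] by auto
qed

lemma mean_measurable:
  assumes [measurable]: "case_prod u \<in> borel_measurable (borel \<Otimes>\<^sub>M borel)"
  shows "mean u \<in> borel_measurable borel"
proof -
  have [measurable]: "(\<lambda>(s, v). u v s) \<in> borel_measurable (borel \<Otimes>\<^sub>M \<mu>)" by measurable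
  show ?thesis unfolding mean_def by measurable
qed

text \<open>Where the right-hand side is infinite there is nothing to prove, so points at which
  \<open>mean\<close> takes its default value do no harm; elsewhere \<open>k_lower\<close> supplies
  the integrability that Jensen's inequality asks for.\<close>

lemma mean_jensen: "case_prod u \<in> borel_measurable (borel \<Otimes>\<^sub>M borel) \<Longrightarrow> (\<And>v. u v \<in> borel_measurable borel) \<Longrightarrow>
   (\<lambda>v. u v s) \<in> borel_measurable borel \<Longrightarrow> ennreal (k (mean u s)) \<le> (\<integral>\<^sup>+v. ennreal (k (u v s)) \<partial>\<mu>)"
  and mean_integrable: "(\<lambda>v. u v s) \<in> borel_measurable borel \<Longrightarrow> (\<integral>\<^sup>+v. ennreal (k (u v s)) \<partial>\<mu>) < \<infinity> \<Longrightarrow> integrable \<mu> (\<lambda>v. u v s)"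
proof -
  have i: "integrable \<mu> (\<lambda>v. u v s)" "integrable \<mu> (\<lambda>v. k (u v s))"
    if [measurable]: "(\<lambda>v. u v s) \<in> borel_measurable borel" and fin: "(\<integral>\<^sup>+v. ennreal (k (u v s)) \<partial>\<mu>) < \<infinity>"
  proof -
    show ik: "integrable \<mu> (\<lambda>v. k (u v s))" using fin by (intro integrableI_bounded) auto
    show "integrable \<mu> (\<lambda>v. u v s)"
    proof (rule Bochner_Integration.integrable_bound[of _ "\<lambda>v. 1 + k (u v s) / k 1"])
      show "integrable \<mu> (\<lambda>v. 1 + k (u v s) / k 1)" using ik by auto
      show "AE v in \<mu>. norm (u v s) \<le> norm (1 + k (u v s) / k 1)"
      proof (rule AE_I2)
        fix v
        show "norm (u v s) \<le> norm (1 + k (u v s) / k 1)" using k_lower[OF k_1, of "u v s"] by simp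
      qed
    qed measurable
  qed
  show "integrable \<mu> (\<lambda>v. u v s)" if "(\<lambda>v. u v s) \<in> borel_measurable borel" "(\<integral>\<^sup>+v. ennreal (k (u v s)) \<partial>\<mu>) < \<infinity>"
    using i that by blast
  assume m[measurable]: "(\<lambda>v. u v s) \<in> borel_measurable borel"
  show "ennreal (k (mean u s)) \<le> (\<integral>\<^sup>+v. ennreal (k (u v s)) \<partial>\<mu>)"
  proof (cases "(\<integral>\<^sup>+v. ennreal (k (u v s)) \<partial>\<mu>) < \<infinity>")
    case True
    have "k (mean u s) \<le> (LINT v|\<mu>. k (u v s))"
      unfolding mean_def by (rule mu.jensens_inequality[where I=UNIV]) (use i[OF m True] convex_k in auto)
    also have "ennreal (LINT v|\<mu>. k (u v s)) = (\<integral>\<^sup>+v. ennreal (k (u v s)) \<partial>\<mu>)"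
      by (rule nn_integral_eq_integral[symmetric]) (use i[OF m True] in auto)
    finally show ?thesis using ennreal_leI by blast
  qed (simp add: less_top[symmetric])
qed

lemma mixable_mean:
  assumes u: "mixable u"
  shows "phi_integrable (mean u)" "modular (mean u) \<le> (LINT v|\<mu>. modular (u v))" "AE s in lborel. integrable \<mu> (\<lambda>v. u v s)"
proof -
  interpret pair_sigma_finite lborel \<mu> by standard
  note [measurable] = mixableD(1)[OF u] mixable_measurable2[OF u]
  have m2: "u v \<in> borel_measurable borel" for v using mixableD(2)[OF u, of v] by (simp add: phi_integrable_def)
  have "(\<integral>\<^sup>+s. \<integral>\<^sup>+v. ennreal (k (u v s)) \<partial>\<mu> \<partial>lborel) = (\<integral>\<^sup>+v. \<integral>\<^sup>+s. ennreal (k (u v s)) \<partial>lborel \<partial>\<mu>)"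
    by (rule Fubini'[symmetric]) measurable
  also have "\<dots> = (\<integral>\<^sup>+v. ennreal (modular (u v)) \<partial>\<mu>)" by (intro nn_integral_cong ennreal_modular[symmetric] mixableD(2)[OF u])
  also have "\<dots> = ennreal (LINT v|\<mu>. modular (u v))" by (rule nn_integral_eq_integral[OF mixableD(3)[OF u]]) simp
  finally have F: "(\<integral>\<^sup>+s. \<integral>\<^sup>+v. ennreal (k (u v s)) \<partial>\<mu> \<partial>lborel) = ennreal (LINT v|\<mu>. modular (u v))" .
  \<comment> \<open>Jensen's inequality at each s, combined with Tonelli's theorem in
    \<open>F\<close>, bounds the modular of the mean by the mean of the modulars.\<close>
  have "(\<integral>\<^sup>+s. ennreal (k (mean u s)) \<partial>lborel) \<le> (\<integral>\<^sup>+s. \<integral>\<^sup>+v. ennreal (k (u v s)) \<partial>\<mu> \<partial>lborel)"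
    by (intro nn_integral_mono mean_jensen mixableD(1)[OF u] m2 mixable_measurable2[OF u])
  then have le: "(\<integral>\<^sup>+s. ennreal (k (mean u s)) \<partial>lborel) \<le> ennreal (LINT v|\<mu>. modular (u v))" by (simp only: F)
  have mm: "mean u \<in> borel_measurable borel" by (rule mean_measurable[OF mixableD(1)[OF u]])
  show p: "phi_integrable (mean u)"
    unfolding L_phi_iff_phi_integrable[symmetric] L_phi_iff using le mm by (auto intro: le_less_trans)
  show "modular (mean u) \<le> (LINT v|\<mu>. modular (u v))"
    using le by (simp add: ennreal_modular[OF p, symmetric] Bochner_Integration.integral_nonneg)
  have "AE s in lborel. (\<integral>\<^sup>+v. ennreal (k (u v s)) \<partial>\<mu>) \<noteq> \<infinity>"
    by (rule nn_integral_PInf_AE) (use F in auto)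
  then show "AE s in lborel. integrable \<mu> (\<lambda>v. u v s)"
    by eventually_elim (rule mean_integrable[OF mixable_measurable2[OF u]], simp add: less_top[symmetric])
qed

lemma mixable_lincomb:
  assumes u: "mixable u" and w: "mixable w"
  shows "mixable (\<lambda>v s. a * u v s + b * w v s)" "AE s in lborel. mean (\<lambda>v s. a * u v s + b * w v s) s = a * mean u s + b * mean w s"
proof -
  note [measurable] = mixableD(1)[OF u] mixableD(1)[OF w]
  let ?c = "2 * ((max 1 \<bar>a\<bar>)\<^sup>2 + (max 1 \<bar>b\<bar>)\<^sup>2)"
  have m: "(\<lambda>(v, s). a * u v s + b * w v s) \<in> borel_measurable (borel \<Otimes>\<^sub>M borel)" by measurable
  have p: "phi_integrable (\<lambda>s. a * u v s + b * w v s)" for v by (intro phi_integrable_lincomb mixableD u w)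
  have "integrable \<mu> (\<lambda>v. modular (\<lambda>s. a * u v s + b * w v s))"
  proof (rule Bochner_Integration.integrable_bound)
    show "integrable \<mu> (\<lambda>v. 2 * ((max 1 \<bar>a\<bar>)\<^sup>2 * modular (u v) + (max 1 \<bar>b\<bar>)\<^sup>2 * modular (w v)))"
      by (intro integrable_mult_right Bochner_Integration.integrable_add mixableD u w)
    show "(\<lambda>v. modular (\<lambda>s. a * u v s + b * w v s)) \<in> borel_measurable \<mu>" by (rule modular_measurable) measurable
    have "modular (\<lambda>s. a * u v s + b * w v s) \<le> 2 * ((max 1 \<bar>a\<bar>)\<^sup>2 * modular (u v) + (max 1 \<bar>b\<bar>)\<^sup>2 * modular (w v))" for v
    proof -
      have "modular (\<lambda>s. a * u v s + b * w v s) \<le> 2 * (modular (\<lambda>s. a * u v s) + modular (\<lambda>s. b * w v s))"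
        by (intro phi_integrable_add phi_integrable_cmult mixableD u w)
      moreover have "modular (\<lambda>s. a * u v s) \<le> (max 1 \<bar>a\<bar>)\<^sup>2 * modular (u v)" "modular (\<lambda>s. b * w v s) \<le> (max 1 \<bar>b\<bar>)\<^sup>2 * modular (w v)"
        by (intro phi_integrable_cmult mixableD u w)+
      ultimately show ?thesis by simp
    qed
    then show "AE v in \<mu>. norm (modular (\<lambda>s. a * u v s + b * w v s)) \<le> norm (2 * ((max 1 \<bar>a\<bar>)\<^sup>2 * modular (u v) + (max 1 \<bar>b\<bar>)\<^sup>2 * modular (w v)))"
      by (intro AE_I2) (simp add: order_trans[OF _ abs_ge_self])
  qed
  then show "mixable (\<lambda>v s. a * u v s + b * w v s)" using m p by (simp add: mixable_def)
  show "AE s in lborel. mean (\<lambda>v s. a * u v s + b * w v s) s = a * mean u s + b * mean w s"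
    using mixable_mean(3)[OF u] mixable_mean(3)[OF w]
    by eventually_elim (simp add: mean_def)
qed

text \<open>One version is chosen for each integrand, without any coherence between different
  integrands.\<close>

definition the_int :: "(real \<Rightarrow> real) \<Rightarrow> 'w \<Rightarrow> real" where
  "the_int g = (SOME Y. has_rr_integral M \<Lambda> g Y)"

lemma the_int: "phi_integrable g \<Longrightarrow> has_rr_integral M \<Lambda> g (the_int g)"
  unfolding the_int_def using has_rr_integral_exists[of g] by (metis someI_ex)

text \<open>Integration over an event removes the dependence on the chosen version.\<close>

definition test :: "'w set \<Rightarrow> (real \<Rightarrow> real) \<Rightarrow> real" where
  "test F g = (LINT \<omega>:F|M. the_int g \<omega>)"

context
  fixes F assumes F[measurable]: "F \<in> sets M"
begin

lemma test_eq:
  assumes g: "phi_integrable g" and Y: "has_rr_integral M \<Lambda> g Y"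
  shows "test F g = (LINT \<omega>:F|M. Y \<omega>)"
proof -
  have [measurable]: "Y \<in> borel_measurable M" "the_int g \<in> borel_measurable M"
    using has_rr_integral_measurable Y the_int[OF g] by auto
  show ?thesis unfolding test_def set_lebesgue_integral_def
    by (rule integral_cong_AE) (use has_rr_integral_unique[OF the_int[OF g] Y] in auto)
qed

lemma set_integrable_rr:
  assumes "phi_integrable g" "has_rr_integral M \<Lambda> g Y"
  shows "set_integrable M F Y"
  using has_rr_integral_L1(1)[OF assms] unfolding set_integrable_def by (intro integrable_mult_indicator) auto

lemma test_lincomb:
  assumes g: "phi_integrable g" and h: "phi_integrable h"
  shows "test F (\<lambda>s. a * g s + b * h s) = a * test F g + b * test F h"
proof -
  have "test F (\<lambda>s. a * g s + b * h s) = (LINT \<omega>:F|M. a * the_int g \<omega> + b * the_int h \<omega>)"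
    by (intro test_eq phi_integrable_lincomb has_rr_integral_lincomb the_int g h)
  also have "\<dots> = (LINT \<omega>:F|M. a * the_int g \<omega>) + (LINT \<omega>:F|M. b * the_int h \<omega>)"
    by (intro set_integral_add set_integrable_mult_right set_integrable_rr[OF g the_int[OF g]] set_integrable_rr[OF h the_int[OF h]])
  finally show ?thesis by (simp add: test_def)
qed

lemma abs_test_le:
  assumes g: "phi_integrable g"
  shows "\<bar>test F g\<bar> \<le> L1_bound (modular g)"
proof -
  have i: "integrable M (the_int g)" by (rule has_rr_integral_L1(1)[OF g the_int[OF g]])
  have "\<bar>test F g\<bar> \<le> (LINT \<omega>|M. \<bar>indicator F \<omega> *\<^sub>R the_int g \<omega>\<bar>)"
    unfolding test_def set_lebesgue_integral_def by (rule integral_abs_bound)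
  also have "\<dots> \<le> expectation (\<lambda>\<omega>. \<bar>the_int g \<omega>\<bar>)"
    using i set_integrable_rr[OF g the_int[OF g]] unfolding set_integrable_def
    by (intro integral_mono integrable_abs) (auto simp: indicator_def)
  also have "\<dots> \<le> L1_bound (modular g)" by (rule has_rr_integral_L1(2)[OF g the_int[OF g]])
  finally show ?thesis .
qed

lemma abs_test_diff_le:
  assumes g: "phi_integrable g" and h: "phi_integrable h"
  shows "\<bar>test F g - test F h\<bar> \<le> L1_bound (modular (\<lambda>s. g s - h s))"
proof -
  have "test F (\<lambda>s. 1 * g s + (-1) * h s) = 1 * test F g + (-1) * test F h" by (rule test_lincomb[OF g h])
  then have "test F g - test F h = test F (\<lambda>s. 1 * g s + (-1) * h s)" by simp
  also have "\<bar>\<dots>\<bar> \<le> L1_bound (modular (\<lambda>s. 1 * g s + (-1) * h s))"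
    by (rule abs_test_le) (rule phi_integrable_lincomb[OF g h])
  finally show ?thesis by simp
qed

lemma test_cong_AE:
  assumes g: "phi_integrable g" and h: "phi_integrable h" and eq: "AE s in lborel. g s = h s"
  shows "test F g = test F h"
proof -
  have [measurable]: "g \<in> borel_measurable borel" "h \<in> borel_measurable borel" using g h by (auto simp: phi_integrable_def)
  have "modular (\<lambda>s. g s - h s) = (LINT s::real|lborel. 0)"
    unfolding modular_def by (rule integral_cong_AE) (use eq in auto)
  then show ?thesis using abs_test_diff_le[OF g h] by simp
qed

lemma test_tendsto:
  assumes g: "\<And>n. phi_integrable (g n)" "phi_integrable h" and lim: "(\<lambda>n. modular (\<lambda>s. g n s - h s)) \<longlonglongrightarrow> 0"
  shows "(\<lambda>n. test F (g n)) \<longlonglongrightarrow> test F h"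
proof (rule LIM_zero_cancel, rule Lim_null_comparison)
  show "(\<lambda>n. L1_bound (modular (\<lambda>s. g n s - h s))) \<longlonglongrightarrow> 0"
    using isCont_tendsto_compose[OF isCont_L1_bound lim] by simp
  show "\<forall>\<^sub>F n in sequentially. norm (test F (g n) - test F h) \<le> L1_bound (modular (\<lambda>s. g n s - h s))"
    using abs_test_diff_le[OF g] by (intro always_eventually allI) (simp only: real_norm_def)
qed

text \<open>Measurability in v is part of the property: the versions \<open>the_int (u v)\<close>
  are chosen separately for each v, so it too has to be carried through the approximation.\<close>

definition mixes :: "(real \<Rightarrow> real \<Rightarrow> real) \<Rightarrow> bool" where
  "mixes u \<longleftrightarrow> mixable u \<and> (\<lambda>v. test F (u v)) \<in> borel_measurable \<mu> \<and> (LINT v|\<mu>. test F (u v)) = test F (mean u)"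

lemma abs_test_le_linear:
  assumes "phi_integrable g"
  shows "\<bar>test F g\<bar> \<le> 84 * tail_const / cos_const * (1 + modular g)"
  using abs_test_le[OF assms] L1_bound_le[of "modular g"] by simp

lemma bound_const_nonneg: "0 \<le> 84 * tail_const / cos_const"
  using cos_const_pos tail_const_ge_1 by simp

lemma integrable_test:
  assumes u: "mixable u" and m: "(\<lambda>v. test F (u v)) \<in> borel_measurable \<mu>"
  shows "integrable \<mu> (\<lambda>v. test F (u v))"
proof (rule Bochner_Integration.integrable_bound[OF _ m])
  show "integrable \<mu> (\<lambda>v. 84 * tail_const / cos_const * (1 + modular (u v)))"
    by (intro integrable_mult_right Bochner_Integration.integrable_add mixableD[OF u]) simp
  show "AE v in \<mu>. norm (test F (u v)) \<le> norm (84 * tail_const / cos_const * (1 + modular (u v)))"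
    using abs_test_le_linear[OF mixableD(2)[OF u]] by (intro AE_I2) (simp only: real_norm_def order_trans[OF _ abs_ge_self])
qed

lemma mixes_lincomb:
  assumes u: "mixes u" and w: "mixes w"
  shows "mixes (\<lambda>v s. a * u v s + b * w v s)"
  unfolding mixes_def
proof (intro conjI)
  have u': "mixable u" "(\<lambda>v. test F (u v)) \<in> borel_measurable \<mu>" "(LINT v|\<mu>. test F (u v)) = test F (mean u)"
    and w': "mixable w" "(\<lambda>v. test F (w v)) \<in> borel_measurable \<mu>" "(LINT v|\<mu>. test F (w v)) = test F (mean w)"
    using u w by (auto simp: mixes_def)
  show mix: "mixable (\<lambda>v s. a * u v s + b * w v s)" by (rule mixable_lincomb(1)[OF u'(1) w'(1)])
  have t: "test F (\<lambda>s. a * u v s + b * w v s) = a * test F (u v) + b * test F (w v)" for v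
    by (intro test_lincomb mixableD u' w')
  show "(\<lambda>v. test F (\<lambda>s. a * u v s + b * w v s)) \<in> borel_measurable \<mu>" unfolding t using u'(2) w'(2) by measurable
  have "(LINT v|\<mu>. test F (\<lambda>s. a * u v s + b * w v s)) = a * test F (mean u) + b * test F (mean w)"
    unfolding t using integrable_test[OF u'(1,2)] integrable_test[OF w'(1,2)] by (simp add: u'(3) w'(3))
  also have "\<dots> = test F (\<lambda>s. a * mean u s + b * mean w s)"
    by (intro test_lincomb[symmetric] mixable_mean u' w')
  also have "\<dots> = test F (mean (\<lambda>v s. a * u v s + b * w v s))"
    by (rule test_cong_AE) (use mixable_lincomb(2)[OF u'(1) w'(1), of a b] in
      \<open>auto intro!: phi_integrable_lincomb mixable_mean(1)[OF u'(1)] mixable_mean(1)[OF w'(1)] mixable_mean(1)[OF mix] elim: eventually_mono\<close>)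
  finally show "(LINT v|\<mu>. test F (\<lambda>s. a * u v s + b * w v s)) = test F (mean (\<lambda>v s. a * u v s + b * w v s))" .
qed

text \<open>Dominated convergence acts twice: in s, for fixed v, it makes the modulars of the errors
  vanish and the tests converge; in v it then moves the limit through the mean. The factor 2 matches
  the simple approximations used later.\<close>

lemma mixes_limit:
  assumes U: "\<And>n. mixes (U n)" and u: "mixable u"
    and le: "\<And>n v s. \<bar>U n v s\<bar> \<le> 2 * \<bar>u v s\<bar>" and lim: "\<And>v s. (\<lambda>n. U n v s) \<longlonglongrightarrow> u v s"
  shows "mixes u"
proof -
  have U': "mixable (U n)" "(\<lambda>v. test F (U n v)) \<in> borel_measurable \<mu>" "(LINT v|\<mu>. test F (U n v)) = test F (mean (U n))" for n
    using U[of n] by (auto simp: mixes_def)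
  note [measurable] = mixableD(1)[OF u] mixableD(1)[OF U'(1)]
  have m: "u v \<in> borel_measurable borel" "U n v \<in> borel_measurable borel" for v n
    using mixableD(2)[OF u, of v] mixableD(2)[OF U'(1), of n v] by (auto simp: phi_integrable_def)
  have l4: "k (U n v s) \<le> 4 * k (u v s)" for n v s
  proof -
    have "k (U n v s) \<le> k (2 * u v s)" using le[of n v s] by (intro k_mono) (simp add: abs_mult)
    also have "\<dots> \<le> 4 * k (u v s)" using k_scale[of 2 "u v s"] by simp
    finally show ?thesis .
  qed
  have l10: "k (U n v s - u v s) \<le> 10 * k (u v s)" for n v s
    using k_diff[of "U n v s" "u v s"] l4[of n v s] by simp
  have D: "mixable (\<lambda>v s. U n v s - u v s)" "modular (\<lambda>s. U n v s - u v s) \<le> 10 * modular (u v)" for n v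
  proof -
    have mm: "(\<lambda>(v, s). U n v s - u v s) \<in> borel_measurable (borel \<Otimes>\<^sub>M borel)" by measurable
    show "mixable (\<lambda>v s. U n v s - u v s)" "modular (\<lambda>s. U n v s - u v s) \<le> 10 * modular (u v)"
      by (rule mixable_bound[OF u mm l10])+
  qed
  have modlim: "(\<lambda>n. modular (\<lambda>s. U n v s - u v s)) \<longlonglongrightarrow> 0" for v
  proof -
    have "(\<lambda>n. modular (\<lambda>s. U n v s - u v s)) \<longlonglongrightarrow> modular (\<lambda>s. 0)"
    proof (rule modular_tendsto[OF mixableD(2)[OF u, of v] _ l10])
      show "AE s in lborel. (\<lambda>n. U n v s - u v s) \<longlonglongrightarrow> 0" by (intro AE_I2 LIM_zero lim)
    qed (use m in auto)
    then show ?thesis by (simp add: modular_def)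
  qed
  have plim: "(\<lambda>n. test F (U n v)) \<longlonglongrightarrow> test F (u v)" for v
    by (intro test_tendsto mixableD U' u modlim)
  have meas: "(\<lambda>v. test F (u v)) \<in> borel_measurable \<mu>"
    by (rule borel_measurable_LIMSEQ_real[OF plim U'(2)])
  let ?w = "\<lambda>v. 84 * tail_const / cos_const * (1 + 4 * modular (u v))"
  have "(\<lambda>n. LINT v|\<mu>. test F (U n v)) \<longlonglongrightarrow> (LINT v|\<mu>. test F (u v))"
  proof (rule integral_dominated_convergence[where w="?w"])
    show "integrable \<mu> ?w" by (intro integrable_mult_right Bochner_Integration.integrable_add mixableD[OF u]) simp
    show "AE v in \<mu>. norm (test F (U n v)) \<le> ?w v" for n
    proof (rule AE_I2)
      fix v
      have "modular (U n v) \<le> 4 * modular (u v)" by (rule phi_integrable_bound(2)[OF mixableD(2)[OF u] m(2) l4])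
      then have "84 * tail_const / cos_const * (1 + modular (U n v)) \<le> ?w v" by (intro mult_left_mono bound_const_nonneg) simp
      then show "norm (test F (U n v)) \<le> ?w v" using abs_test_le_linear[OF mixableD(2)[OF U'(1)], of n v] by simp
    qed
  qed (use plim meas U'(2) in auto)
  moreover have "(\<lambda>n. test F (mean (U n))) \<longlonglongrightarrow> test F (mean u)"
  proof (rule test_tendsto)
    show "phi_integrable (mean (U n))" "phi_integrable (mean u)" for n by (intro mixable_mean U' u)+
    \<comment> \<open>On the side of the means Jensen's inequality reduces everything to the average
      of the error modulars. The identification of the difference of means holds almost everywhere,
      where both means exist.\<close>
    have up: "modular (\<lambda>s. mean (U n) s - mean u s) \<le> (LINT v|\<mu>. modular (\<lambda>s. U n v s - u v s))" for n
    proof -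
      have "AE s in lborel. mean (U n) s - mean u s = mean (\<lambda>v s. U n v s - u v s) s"
        using mixable_lincomb(2)[OF U'(1)[of n] u, of 1 "-1"] by eventually_elim simp
      then have "modular (\<lambda>s. mean (U n) s - mean u s) = modular (mean (\<lambda>v s. U n v s - u v s))"
        using mean_measurable[OF mixableD(1)[OF u]] mean_measurable[OF mixableD(1)[OF U'(1)[of n]]] mean_measurable[OF mixableD(1)[OF D(1)[of n]]]
        unfolding modular_def by (intro integral_cong_AE) (auto elim: eventually_mono)
      also have "\<dots> \<le> (LINT v|\<mu>. modular (\<lambda>s. U n v s - u v s))" by (rule mixable_mean(2)[OF D(1)])
      finally show ?thesis .
    qed
    have z: "(\<lambda>n. LINT v|\<mu>. modular (\<lambda>s. U n v s - u v s)) \<longlonglongrightarrow> (LINT v|\<mu>. 0)"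
    proof (rule integral_dominated_convergence[where w="\<lambda>v. 10 * modular (u v)"])
      show "integrable \<mu> (\<lambda>v. 10 * modular (u v))" by (intro integrable_mult_right mixableD[OF u])
      show "(\<lambda>v. modular (\<lambda>s. U n v s - u v s)) \<in> borel_measurable \<mu>" for n
        by (rule modular_measurable) measurable
    qed (use modlim D(2) in auto)
    show "(\<lambda>n. modular (\<lambda>s. mean (U n) s - mean u s)) \<longlonglongrightarrow> 0"
    proof (rule tendsto_sandwich[OF _ _ tendsto_const])
      show "(\<lambda>n. LINT v|\<mu>. modular (\<lambda>s. U n v s - u v s)) \<longlonglongrightarrow> 0" using z by simp
    qed (use up in auto)
  qed
  ultimately have "(LINT v|\<mu>. test F (u v)) = test F (mean u)" unfolding U'(3) by (rule LIMSEQ_unique)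
  then show ?thesis using u meas by (simp add: mixes_def)
qed

end
end

section \<open>Exchange of integrals, from rectangles to all mixable families\<close>

context levy_mixture begin

lemma mixable_box:
  assumes [measurable]: "case_prod w \<in> borel_measurable (borel \<Otimes>\<^sub>M borel)"
    and le: "\<And>v s. \<bar>w v s\<bar> \<le> K * indicator {-r..r} s"
  shows "mixable w"
proof -
  have "rr_simple (\<lambda>s. K * indicator {-r..r} s)"
  proof (rule rr_simpleI)
    have "range (\<lambda>s. K * indicator {-r..r} s) \<subseteq> {0, K}" by (auto simp: indicator_def)
    then show "finite (range (\<lambda>s. K * indicator {-r..r} s))" by (rule finite_subset) simp
    show "bounded {s. K * indicator {-r..r} s \<noteq> 0}"
      by (rule bounded_subset[of "{-r..r}"]) (auto simp: indicator_def split: if_splits)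
  qed measurable
  then have "phi_integrable (\<lambda>s. K * indicator {-r..r} s)" by (rule phi_integrable_rr_simple)
  then have u: "mixable (\<lambda>v s. K * indicator {-r..r} s)" unfolding mixable_def by simp
  show ?thesis
  proof (rule mixable_bound(1)[OF u assms(1), of 1])
    show "k (w v s) \<le> 1 * k (K * indicator {-r..r} s)" for v s
      using le[of v s] by (simp add: k_mono order_trans[OF _ abs_ge_self])
  qed
qed

lemma mixes_sum:
  assumes F: "F \<in> sets M" and J: "finite J" "\<And>j. j \<in> J \<Longrightarrow> mixes F (u j)"
  shows "mixes F (\<lambda>v s. \<Sum>j\<in>J. a j * u j v s)"
  using J
proof (induction J rule: finite_induct)
  case empty
  have z: "rr_simple (\<lambda>s. 0)" by (rule rr_simpleI) auto
  have m: "mixable (\<lambda>v s. 0)" by (rule mixable_box[where K=0 and r=0]) auto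
  have t: "test F (\<lambda>s. 0) = 0"
    using test_lincomb[OF F phi_integrable_rr_simple[OF z] phi_integrable_rr_simple[OF z], of 0 0] by simp
  have "mean (\<lambda>v s. 0) = (\<lambda>s. 0)" by (simp add: mean_def fun_eq_iff)
  then show ?case using m t by (simp add: mixes_def[OF F])
next
  case (insert j J)
  then show ?case
    using mixes_lincomb[OF F, of "u j" "\<lambda>v s. \<Sum>j\<in>J. a j * u j v s" "a j" 1] by simp
qed

text \<open>On a rectangle the integrand is a function of v times a fixed simple function of s, and
  the exchange is just homogeneity of \<open>test\<close>.\<close>

lemma mixes_rectangle:
  assumes F: "F \<in> sets M" and [measurable]: "A \<in> sets borel" "B \<in> sets borel"
  shows "mixes F (\<lambda>v s. indicator (A \<times> B) (v, s) * indicator {-r..r} s)"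
proof -
  define g where "g s = (indicator B s * indicator {-r..r} s :: real)" for s
  have gs: "rr_simple g"
  proof (rule rr_simpleI)
    show "g \<in> borel_measurable borel" unfolding g_def by measurable
    have "range g \<subseteq> {0, 1}" by (auto simp: g_def indicator_def)
    then show "finite (range g)" by (rule finite_subset) simp
    show "bounded {s. g s \<noteq> 0}"
      by (rule bounded_subset[of "{-r..r}"]) (auto simp: g_def indicator_def split: if_splits)
  qed
  have g: "phi_integrable g" by (rule phi_integrable_rr_simple[OF gs])
  have eq: "(\<lambda>v s. indicator (A \<times> B) (v, s) * indicator {-r..r} s) = (\<lambda>v s. indicator A v * g s)"
    by (auto simp: fun_eq_iff g_def indicator_def)
  have t: "test F (\<lambda>s. c * g s) = c * test F g" for c
    using test_lincomb[OF F g g, of c 0] by simp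
  have [measurable]: "g \<in> borel_measurable borel" using g by (simp add: phi_integrable_def)
  have mix: "mixable (\<lambda>v s. indicator A v * g s)"
    by (rule mixable_box[where K=1 and r=r]) (measurable, auto simp: g_def indicator_def)
  have i: "integrable \<mu> (indicator A :: real \<Rightarrow> real)"
    by (rule mu.integrable_const_bound[where B=1]) (auto simp: indicator_def)
  have mean: "mean (\<lambda>v s. indicator A v * g s) = (\<lambda>s. measure \<mu> A * g s)"
    by (simp add: mean_def fun_eq_iff space_mu)
  show ?thesis
    unfolding eq mixes_def[OF F] mean t
  proof (intro conjI mix)
    show "(\<lambda>v. indicator A v * test F g) \<in> borel_measurable \<mu>" by measurable
    show "(LINT v|\<mu>. indicator A v * test F g) = measure \<mu> A * test F g" by (simp add: space_mu)
  qed
qed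

text \<open>Rectangles generate the product sets and are closed under intersection. The window in s
  keeps every modular finite, including those of complements.\<close>

lemma mixes_indicator:
  assumes F: "F \<in> sets M" and C: "C \<in> sets (borel \<Otimes>\<^sub>M borel)"
  shows "mixes F (\<lambda>v s. indicator C (v, s) * indicator {-r..r} s)"
proof -
  let ?G = "{A \<times> B |A B. A \<in> sets (borel :: real measure) \<and> B \<in> sets (borel :: real measure)}"
  have sp: "sets (borel \<Otimes>\<^sub>M borel :: (real \<times> real) measure) = sigma_sets UNIV ?G"
    using sets_pair_measure[of "borel :: real measure" "borel :: real measure"] by simp
  have "Int_stable ?G"
  proof (rule Int_stableI, clarify)
    fix A B A' B' :: "real set" assume "A \<in> sets borel" "B \<in> sets borel" "A' \<in> sets borel" "B' \<in> sets borel"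
    then show "\<exists>A'' B''. (A \<times> B) \<inter> (A' \<times> B') = A'' \<times> B'' \<and> A'' \<in> sets borel \<and> B'' \<in> sets borel"
      by (intro exI[of _ "A \<inter> A'"] exI[of _ "B \<inter> B'"]) auto
  qed
  moreover have "?G \<subseteq> Pow UNIV" by simp
  moreover have "C \<in> sigma_sets UNIV ?G" using C by (simp only: sp)
  ultimately show ?thesis
  proof (induction rule: sigma_sets_induct_disjoint)
    case (basic C)
    then obtain A B where "C = A \<times> B" "A \<in> sets borel" "B \<in> sets borel" by blast
    then show ?case using mixes_rectangle[OF F, of A B r] by simp
  next
    case empty
    show ?case using mixes_rectangle[OF F, of "{}" "{}" r] by simp
  next
    case (compl C)
    have "mixes F (\<lambda>v s. 1 * (indicator (UNIV \<times> UNIV) (v, s) * indicator {-r..r} s) + (-1) * (indicator C (v, s) * indicator {-r..r} s))"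
      by (rule mixes_lincomb[OF F mixes_rectangle[OF F] compl.IH]) auto
    also have "(\<lambda>v s. 1 * (indicator (UNIV \<times> UNIV) (v, s) * indicator {-r..r} s) + (-1) * (indicator C (v, s) * indicator {-r..r} s))
      = (\<lambda>v s. indicator (UNIV - C) (v, s) * (indicator {-r..r} s :: real))"
      by (auto simp: fun_eq_iff indicator_def)
    finally show ?case .
  next
    case (union C)
    have Cm[measurable]: "C i \<in> sets (borel \<Otimes>\<^sub>M borel)" for i using union.hyps(2) by (auto simp only: sp)
    have part: "(\<Sum>i<n. indicator (C i) x) = (indicator (\<Union>i<n. C i) x :: real)" for n and x :: "real \<times> real"
      using union.hyps(1) by (intro indicator_UN_disjoint[symmetric]) (auto simp: disjoint_family_on_def)
    show ?case
    proof (rule mixes_limit[OF F, where U="\<lambda>n v s. \<Sum>i<n. 1 * (indicator (C i) (v, s) * indicator {-r..r} s)"])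
      show "mixes F (\<lambda>v s. \<Sum>i<n. 1 * (indicator (C i) (v, s) * indicator {-r..r} s))" for n
        by (rule mixes_sum[OF F]) (use union.IH in auto)
      show "mixable (\<lambda>v s. indicator (\<Union>i. C i) (v, s) * indicator {-r..r} s)"
        by (rule mixable_box[where K=1 and r=r]) (measurable, auto simp: indicator_def)
      fix v s :: real
      have eq: "(\<Sum>i<n. 1 * (indicator (C i) (v, s) * indicator {-r..r} s)) = indicator (\<Union>i<n. C i) (v, s) * (indicator {-r..r} s :: real)" for n
        by (simp add: part flip: sum_distrib_right)
      show "\<bar>\<Sum>i<n. 1 * (indicator (C i) (v, s) * indicator {-r..r} s)\<bar> \<le> 2 * \<bar>indicator (\<Union>i. C i) (v, s) * indicator {-r..r} s :: real\<bar>" for n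
        unfolding eq by (auto simp: indicator_def)
      show "(\<lambda>n. \<Sum>i<n. 1 * (indicator (C i) (v, s) * indicator {-r..r} s)) \<longlonglongrightarrow> (indicator (\<Union>i. C i) (v, s) * indicator {-r..r} s :: real)"
        unfolding eq by (intro tendsto_mult tendsto_const LIMSEQ_indicator_UN)
    qed
  qed
qed

text \<open>Simple functions of the pair (v, s), cut off to |s| <= i, are finite combinations of the
  indicators already treated, and they satisfy the domination of \<open>mixes_limit\<close>.\<close>

lemma mixes_all:
  assumes F: "F \<in> sets M" and u: "mixable u"
  shows "mixes F u"
proof -
  obtain S :: "nat \<Rightarrow> real \<times> real \<Rightarrow> real" where S: "\<And>i. simple_function (borel \<Otimes>\<^sub>M borel) (S i)"
    "\<And>x. (\<lambda>i. S i x) \<longlonglongrightarrow> case_prod u x" "\<And>i x. dist (S i x) 0 \<le> 2 * dist (case_prod u x) 0"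
    using borel_measurable_implies_sequence_metric[OF mixableD(1)[OF u], of 0] by (auto simp: space_pair_measure)
  have fin: "finite (range (S i))" for i using S(1)[of i] by (simp add: simple_function_def space_pair_measure)
  have lev: "S i -` {y} \<in> sets (borel \<Otimes>\<^sub>M borel)" for i y
    using borel_measurable_simple_function[OF S(1)[of i]] measurable_sets[of "S i" "borel \<Otimes>\<^sub>M borel" borel "{y}"]
    by (simp add: space_pair_measure)
  define U where "U i v s = S i (v, s) * indicator {-real i..real i} s" for i v s
  show ?thesis
  proof (rule mixes_limit[OF F _ u])
    have rep: "U i = (\<lambda>v s. \<Sum>y\<in>range (S i). y * (indicator (S i -` {y}) (v, s) * indicator {-real i..real i} s))" for i
    proof (intro ext)
      fix v s
      have "(\<Sum>y\<in>range (S i). y * (indicator (S i -` {y}) (v, s) * indicator {-real i..real i} s))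
        = (\<Sum>y\<in>range (S i). if y = S i (v, s) then y * indicator {-real i..real i} s else 0)"
        by (intro sum.cong) (auto simp: indicator_def)
      also have "\<dots> = U i v s" using fin by (subst sum.delta) (auto simp: U_def)
      finally show "U i v s = (\<Sum>y\<in>range (S i). y * (indicator (S i -` {y}) (v, s) * indicator {-real i..real i} s))" by simp
    qed
    show "mixes F (U i)" for i
      unfolding rep by (intro mixes_sum F fin mixes_indicator lev)
    show "\<bar>U i v s\<bar> \<le> 2 * \<bar>u v s\<bar>" for i v s
      using S(3)[of i "(v, s)"] by (auto simp: U_def indicator_def)
    fix v s :: real
    obtain N :: nat where N: "\<bar>s\<bar> \<le> real N" using real_arch_simple by blast
    have "eventually (\<lambda>i. S i (v, s) = U i v s) sequentially"
      using eventually_ge_at_top[of N]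
    proof eventually_elim
      case (elim i)
      then have "s \<in> {-real i..real i}" using N by auto
      then show ?case by (simp add: U_def)
    qed
    moreover have "(\<lambda>i. S i (v, s)) \<longlonglongrightarrow> u v s" using S(2)[of "(v, s)"] by simp
    ultimately show "(\<lambda>i. U i v s) \<longlonglongrightarrow> u v s" by (rule Lim_transform_eventually[rotated])
  qed
qed

text \<open>Tested against indicators of events, the stochastic integral becomes a scalar functional that is
  linear and continuous for the modular, which extends the exchange from rectangles to all \<open>u\<close>.\<close>

theorem stochastic_fubini:
  assumes u: "mixable u" and W[measurable]: "case_prod W \<in> borel_measurable (borel \<Otimes>\<^sub>M M)"
    and rr: "\<And>v. has_rr_integral M \<Lambda> (u v) (W v)"
  shows "AE \<omega> in M. integrable \<mu> (\<lambda>v. W v \<omega>)"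
    and "has_rr_integral M \<Lambda> (mean u) (\<lambda>\<omega>. LINT v|\<mu>. W v \<omega>)"
proof -
  interpret pair_sigma_finite \<mu> M by standard
  note i = has_rr_integral_L1[OF mixableD(2)[OF u] rr]
  have Wm: "case_prod W \<in> borel_measurable (\<mu> \<Otimes>\<^sub>M M)" by measurable
  \<comment> \<open>The first moment of \<open>W v\<close> grows at most linearly in
    \<open>modular (u v)\<close>, which is integrable in v; thus classical Fubini applies to the
    jointly measurable version.\<close>
  have int: "integrable (\<mu> \<Otimes>\<^sub>M M) (case_prod W)"
  proof (rule Fubini_integrable[OF Wm])
    show "AE v in \<mu>. integrable M (\<lambda>\<omega>. case_prod W (v, \<omega>))" using i(1) by simp
    show "integrable \<mu> (\<lambda>v. LINT \<omega>|M. norm (case_prod W (v, \<omega>)))"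
    proof (rule Bochner_Integration.integrable_bound)
      show "integrable \<mu> (\<lambda>v. 84 * tail_const / cos_const * (1 + modular (u v)))"
        by (intro integrable_mult_right Bochner_Integration.integrable_add mixableD[OF u]) simp
      have "expectation (\<lambda>\<omega>. \<bar>W v \<omega>\<bar>) \<le> 84 * tail_const / cos_const * (1 + modular (u v))" for v
        using i(2)[of v] L1_bound_le[of "modular (u v)"] by simp
      then show "AE v in \<mu>. norm (LINT \<omega>|M. norm (case_prod W (v, \<omega>))) \<le> norm (84 * tail_const / cos_const * (1 + modular (u v)))"
        by (intro AE_I2) (simp add: order_trans[OF _ abs_ge_self] del: times_divide_eq_left)
    qed measurable
  qed
  show "AE \<omega> in M. integrable \<mu> (\<lambda>v. W v \<omega>)" by (rule AE_integrable_snd[OF int])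
  have intW: "integrable M (\<lambda>\<omega>. LINT v|\<mu>. W v \<omega>)" by (rule integrable_snd[OF int])
  obtain Y where Y: "has_rr_integral M \<Lambda> (mean u) Y" using has_rr_integral_exists[OF mixable_mean(1)[OF u]] by blast
  have intY: "integrable M Y" by (rule has_rr_integral_L1(1)[OF mixable_mean(1)[OF u] Y])
  \<comment> \<open>The average of \<open>W\<close> is compared with an arbitrary version
    \<open>Y\<close> of the integral of the mean: two integrable variables with the same integral
    over every event agree almost surely.\<close>
  have "AE \<omega> in M. Y \<omega> = (LINT v|\<mu>. W v \<omega>)"
  proof (rule density_unique_real[OF intY intW])
    fix F assume F[measurable]: "F \<in> sets M"
    have intF: "integrable (\<mu> \<Otimes>\<^sub>M M) (\<lambda>(v, \<omega>). indicator F \<omega> *\<^sub>R W v \<omega>)"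
    proof (rule Bochner_Integration.integrable_bound[OF int])
      show "AE x in \<mu> \<Otimes>\<^sub>M M. norm (case x of (v, \<omega>) \<Rightarrow> indicator F \<omega> *\<^sub>R W v \<omega>) \<le> norm (case_prod W x)"
        by (intro AE_I2) (auto simp: indicator_def split: prod.split)
    qed measurable
    have "(LINT \<omega>:F|M. LINT v|\<mu>. W v \<omega>) = (LINT \<omega>|M. LINT v|\<mu>. indicator F \<omega> *\<^sub>R W v \<omega>)"
      unfolding set_lebesgue_integral_def by simp
    also have "\<dots> = (LINT v|\<mu>. LINT \<omega>|M. indicator F \<omega> *\<^sub>R W v \<omega>)"
      by (rule Fubini_integral[OF intF])
    also have "\<dots> = (LINT v|\<mu>. test F (u v))"
      using test_eq[OF F mixableD(2)[OF u] rr] by (simp add: set_lebesgue_integral_def)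
    also have "\<dots> = test F (mean u)" using mixes_all[OF F u] by (simp add: mixes_def[OF F])
    also have "\<dots> = (LINT \<omega>:F|M. Y \<omega>)" by (rule test_eq[OF F mixable_mean(1)[OF u] Y])
    finally show "(LINT \<omega>:F|M. Y \<omega>) = (LINT \<omega>:F|M. LINT v|\<mu>. W v \<omega>)" by simp
  qed
  then show "has_rr_integral M \<Lambda> (mean u) (\<lambda>\<omega>. LINT v|\<mu>. W v \<omega>)"
    using intW by (intro has_rr_integral_cong_AE[OF Y]) (auto intro: mean_measurable mixableD(1)[OF u])
qed

end

subsection \<open>Increments of the kernel\<close>

context centered_levy_pair begin

definition incr_modular :: "(real \<Rightarrow> real) \<Rightarrow> real \<Rightarrow> real" where
  "incr_modular f v = modular (\<lambda>x. f x - f (x - v))"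

lemma modular_add_weighted:
  assumes g: "phi_integrable g" and h: "phi_integrable h" and p: "0 < p" "p < 1"
  shows "modular (\<lambda>s. g s + h s) \<le> modular g / (1 - p) + modular h / p"
proof -
  have "modular (\<lambda>s. g s + h s) \<le> (LINT s|lborel. k (g s) / (1 - p) + k (h s) / p)"
    unfolding modular_def using g h
    by (intro integral_mono phi_integrable_k phi_integrable_add Bochner_Integration.integrable_add integrable_divide_zero k_add_weighted p) auto
  also have "\<dots> = modular g / (1 - p) + modular h / p"
    using phi_integrable_k[OF g] phi_integrable_k[OF h] by (simp add: modular_def)
  finally show ?thesis .
qed

context
  fixes f :: "real \<Rightarrow> real"
  assumes f[measurable]: "f \<in> borel_measurable borel" and incr: "\<And>v. phi_integrable (\<lambda>x. f x - f (x - v))"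
begin

lemma incr_modular_0: "incr_modular f 0 = 0"
  by (simp add: incr_modular_def modular_def)

lemma incr_modular_nonneg: "0 \<le> incr_modular f v"
  by (simp add: incr_modular_def)

lemma incr_modular_shift: "phi_integrable (\<lambda>x. f (x - v) - f (x - v - w))" "modular (\<lambda>x. f (x - v) - f (x - v - w)) = incr_modular f w"
  using phi_integrable_shift[OF incr[of w], of v] by (simp_all add: incr_modular_def)

lemma incr_modular_split:
  "modular (\<lambda>x. (f x - f (x - v)) + (f (x - v) - f (x - v - w))) = incr_modular f (v + w)"
  by (simp add: incr_modular_def diff_diff_eq)

lemma incr_modular_add: "incr_modular f (v + w) \<le> 2 * (incr_modular f v + incr_modular f w)"
  using phi_integrable_add(2)[OF incr[of v] incr_modular_shift(1)[of v w]]
  unfolding incr_modular_split incr_modular_shift(2) incr_modular_def[symmetric] .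

text \<open>The weight p = 1/(N+1) makes the induction close exactly: N(N+1) from the first N steps
  plus N+1 from the last one is the square of N+1.\<close>

lemma incr_modular_mult: "incr_modular f (real (Suc n) * v) \<le> (real (Suc n))\<^sup>2 * incr_modular f v"
proof (induction n)
  case 0
  then show ?case by simp
next
  case (Suc n)
  define N where "N = real (Suc n)"
  have N: "N > 0" by (simp add: N_def)
  have p: "0 < 1 / (N + 1)" "1 / (N + 1) < 1" using N by auto
  have q: "1 - 1 / (N + 1) = N / (N + 1)" using N by (simp add: field_simps)
  have "incr_modular f (N * v + v) \<le> incr_modular f (N * v) / (1 - 1 / (N + 1)) + incr_modular f v / (1 / (N + 1))"
    using modular_add_weighted[OF incr[of "N * v"] incr_modular_shift(1)[of "N * v" v] p]
    unfolding incr_modular_split incr_modular_shift(2) incr_modular_def[symmetric] .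
  also have "\<dots> \<le> N\<^sup>2 * incr_modular f v / (1 - 1 / (N + 1)) + incr_modular f v / (1 / (N + 1))"
    using Suc.IH N unfolding q N_def[symmetric] by (intro add_right_mono divide_right_mono) auto
  also have "\<dots> = (N + 1)\<^sup>2 * incr_modular f v"
    using N unfolding q by (simp add: field_simps power2_eq_square)
  finally show ?case using N by (simp add: N_def algebra_simps)
qed

lemma incr_modular_measurable[measurable]: "incr_modular f \<in> borel_measurable borel"
  unfolding incr_modular_def modular_def by measurable

text \<open>Steinhaus' argument: a level set of almost full measure in \<open>[-2, 2]\<close> meets its reflection at any small \<open>t\<close>.\<close>

lemma incr_modular_locally_bounded: "\<exists>B. \<forall>t. \<bar>t\<bar> \<le> 1 \<longrightarrow> incr_modular f t \<le> B"
proof -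
  define A where "A n = {s \<in> {-2..2}. incr_modular f s \<le> real n}" for n :: nat
  have Am[measurable]: "A n \<in> sets borel" for n unfolding A_def by measurable
  have "(\<lambda>n. measure lborel (A n)) \<longlonglongrightarrow> measure lborel (\<Union>n. A n)"
  proof (rule Lim_measure_incseq)
    show "range A \<subseteq> sets lborel" by auto
    show "incseq A" unfolding A_def incseq_def by (auto intro: order_trans)
    have "(\<Union>n. A n) \<subseteq> {-2..2}" by (auto simp: A_def)
    then have "emeasure lborel (\<Union>n. A n) \<le> emeasure lborel {-2..2::real}" by (intro emeasure_mono) auto
    then show "emeasure lborel (\<Union>n. A n) \<noteq> \<infinity>" by (auto simp: top_unique)
  qed
  moreover have "(\<Union>n. A n) = {-2..2}"
    using real_arch_simple[of "incr_modular f s" for s] by (auto simp: A_def)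
  ultimately have "(\<lambda>n. measure lborel (A n)) \<longlonglongrightarrow> 4" by simp
  \<comment> \<open>\<open>A n\<close> and its reflection both lie in [-3, 3], of length 6; with
    more than 7/2 each they cannot be disjoint. A common point s writes t as the sum of s and t - s,
    both in \<open>A n\<close>.\<close>
  then have "eventually (\<lambda>n. measure lborel (A n) > 7/2) sequentially" by (rule order_tendstoD) simp
  then obtain n where n: "measure lborel (A n) > 7/2" by (auto simp: eventually_sequentially)
  have "incr_modular f t \<le> 4 * real n" if t: "\<bar>t\<bar> \<le> 1" for t
  proof -
    let ?R = "(\<lambda>s. t + (-1) * s) -` A n"
    have Rm: "?R \<in> sets borel" by (rule measurable_sets_borel[of "\<lambda>s. t + (-1) * s" borel]) auto
    have sub: "A n \<union> ?R \<subseteq> {-3..3}" 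
    proof
      fix s assume "s \<in> A n \<union> ?R"
      then have "s \<in> {-2..2} \<or> t - s \<in> {-2..2}" by (auto simp: A_def)
      then show "s \<in> {-3..3}" using t by auto
    qed
    have fin: "A n \<in> fmeasurable lborel" "?R \<in> fmeasurable lborel"
    proof -
      have J: "{-3..3::real} \<in> fmeasurable lborel" by (simp add: fmeasurable_def)
      show "A n \<in> fmeasurable lborel" "?R \<in> fmeasurable lborel"
        by (rule fmeasurableI2[OF J], use sub in blast, use Rm in simp)+
    qed
    have mR: "measure lborel ?R = measure lborel (A n)"
    proof -
      have "emeasure lborel (A n) = (\<integral>\<^sup>+s. indicator (A n) (t + (-1) * s) \<partial>lborel)"
        using nn_integral_real_affine[of "indicator (A n)" "-1" t] by simp
      also have "\<dots> = (\<integral>\<^sup>+s. indicator ?R s \<partial>lborel)" by (intro nn_integral_cong) (simp add: indicator_def)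
      also have "\<dots> = emeasure lborel ?R" using Rm by simp
      finally show ?thesis by (simp add: measure_def)
    qed
    have "A n \<inter> ?R \<noteq> {}"
    proof
      assume "A n \<inter> ?R = {}"
      then have "measure lborel (A n \<union> ?R) = measure lborel (A n) + measure lborel ?R"
        using fin by (intro measure_Union) (auto simp: fmeasurable_def)
      moreover have "measure lborel (A n \<union> ?R) \<le> measure lborel {-3..3::real}"
        using sub Rm by (intro measure_mono_fmeasurable) (auto simp: fmeasurable_def)
      ultimately show False using n mR by simp
    qed
    then obtain s where s: "s \<in> A n" "t - s \<in> A n" by auto
    have "incr_modular f (s + (t - s)) \<le> 2 * (incr_modular f s + incr_modular f (t - s))" by (rule incr_modular_add)
    also have "\<dots> \<le> 2 * (real n + real n)" using s by (intro mult_left_mono add_mono) (auto simp: A_def)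
    finally show ?thesis by simp
  qed
  then show ?thesis by blast
qed

lemma incr_modular_growth: "\<exists>B\<ge>0. \<forall>t\<ge>0. incr_modular f t \<le> B * (1 + t\<^sup>2)"
proof -
  obtain B where B: "\<And>t. \<bar>t\<bar> \<le> 1 \<Longrightarrow> incr_modular f t \<le> B" using incr_modular_locally_bounded by blast
  have B0: "B \<ge> 0" using B[of 0] by (simp add: incr_modular_0)
  have "incr_modular f t \<le> 2 * B * (1 + t\<^sup>2)" if t: "t \<ge> 0" for t
  proof -
    \<comment> \<open>With N one more than the integer part of t, the step t/N stays in [0, 1],
      where the local bound applies, and N <= t + 1 keeps the growth quadratic.\<close>
    define N where "N = real (Suc (nat \<lfloor>t\<rfloor>))"
    have N: "N \<ge> t" "N \<le> t + 1" "N > 0" using t unfolding N_def by (auto; linarith)+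
    have "incr_modular f t = incr_modular f (N * (t / N))" using N by simp
    also have "\<dots> \<le> N\<^sup>2 * incr_modular f (t / N)" unfolding N_def by (rule incr_modular_mult)
    also have "\<dots> \<le> N\<^sup>2 * B" using N t by (intro mult_left_mono B) (auto simp: abs_le_iff)
    also have "\<dots> \<le> (t + 1)\<^sup>2 * B" using N t B0 by (intro mult_right_mono power_mono) auto
    also have "\<dots> \<le> (2 * (1 + t\<^sup>2)) * B"
    proof (rule mult_right_mono[OF _ B0])
      have "0 \<le> (t - 1)\<^sup>2" by simp
      then show "(t + 1)\<^sup>2 \<le> 2 * (1 + t\<^sup>2)" by (simp add: power2_eq_square algebra_simps)
    qed
    finally show ?thesis by (simp add: mult_ac)
  qed
  then show ?thesis using B0 by (intro exI[of _ "2 * B"]) auto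
qed

lemma integrable_incr_modular:
  assumes lam: "lam > 0"
  shows "integrable (density lborel (exponential_density lam)) (incr_modular f)"
proof (rule integrableI_bounded)
  show "incr_modular f \<in> borel_measurable (density lborel (exponential_density lam))" by measurable
  obtain B where B: "B \<ge> 0" "\<And>t. t \<ge> 0 \<Longrightarrow> incr_modular f t \<le> B * (1 + t\<^sup>2)" using incr_modular_growth by blast
  have "(\<integral>\<^sup>+v. ennreal (norm (incr_modular f v)) \<partial>density lborel (exponential_density lam))
      = (\<integral>\<^sup>+v. ennreal (exponential_density lam v) * ennreal (incr_modular f v) \<partial>lborel)"
    by (subst nn_integral_density) (auto simp: incr_modular_nonneg)
  also have "\<dots> \<le> (\<integral>\<^sup>+v. ennreal B * (ennreal (exponential_density lam v * v ^ 0) + ennreal (exponential_density lam v * v ^ 2)) \<partial>lborel)"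
  proof (rule nn_integral_mono)
    fix v :: real
    have e: "0 \<le> exponential_density lam v" using lam by (rule exponential_density_nonneg)
    show "ennreal (exponential_density lam v) * ennreal (incr_modular f v)
       \<le> ennreal B * (ennreal (exponential_density lam v * v ^ 0) + ennreal (exponential_density lam v * v ^ 2))"
    proof (cases "v \<ge> 0")
      case True
      have "exponential_density lam v * incr_modular f v \<le> exponential_density lam v * (B * (1 + v\<^sup>2))"
        using B(2)[OF True] e by (rule mult_left_mono)
      then have "ennreal (exponential_density lam v * incr_modular f v) \<le> ennreal (B * (exponential_density lam v * v ^ 0 + exponential_density lam v * v ^ 2))"
        by (intro ennreal_leI) (simp add: algebra_simps)
      also have "\<dots> = ennreal B * ennreal (exponential_density lam v * v ^ 0 + exponential_density lam v * v ^ 2)"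
        using B e by (intro ennreal_mult) auto
      also have "ennreal (exponential_density lam v * v ^ 0 + exponential_density lam v * v ^ 2) = ennreal (exponential_density lam v * v ^ 0) + ennreal (exponential_density lam v * v ^ 2)"
        using e by (intro ennreal_plus) auto
      also have "ennreal (exponential_density lam v * incr_modular f v) = ennreal (exponential_density lam v) * ennreal (incr_modular f v)"
        using e incr_modular_nonneg by (intro ennreal_mult)
      finally show ?thesis .
    next
      case False
      then show ?thesis by (simp add: exponential_density_def)
    qed
  qed
  also have "\<dots> = ennreal B * ((\<integral>\<^sup>+v. ennreal (exponential_density lam v * v ^ 0) \<partial>lborel) + (\<integral>\<^sup>+v. ennreal (exponential_density lam v * v ^ 2) \<partial>lborel))"
    by (subst nn_integral_cmult, measurable) (subst nn_integral_add, auto)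
  also have "\<dots> < \<infinity>"
    by (simp only: nn_integral_erlang_ith_moment[OF lam]) (simp add: ennreal_mult_less_top)
  finally show "(\<integral>\<^sup>+v. ennreal (norm (incr_modular f v)) \<partial>density lborel (exponential_density lam)) < \<infinity>" .
qed

end
end

text \<open>Substituting \<open>r = x - v\<close> turns the average of \<open>h (x - v)\<close> over an exponential variable \<open>v\<close>
  into the weighted integral that appears in \<open>psi\<close>.\<close>

lemma exponential_average:
  fixes h :: "real \<Rightarrow> real"
  assumes [measurable]: "h \<in> borel_measurable borel" and lam: "lam > 0"
  shows "integrable (density lborel (exponential_density lam)) (\<lambda>v. h (x - v)) \<longleftrightarrow> set_integrable lborel {..x} (\<lambda>s. exp (lam * s) * h s)"
    and "(LINT v|density lborel (exponential_density lam). h (x - v)) = lam * exp (- lam * x) * (LINT s:{..x}|lborel. exp (lam * s) * h s)"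
proof -
  have nn: "\<And>v. 0 \<le> exponential_density lam v" using lam by (rule exponential_density_nonneg)
  let ?H = "\<lambda>v. exponential_density lam v *\<^sub>R h (x - v)"
  let ?c = "lam * exp (- lam * x)"
  have c: "?c \<noteq> 0" using lam by simp
  have sub: "?H (x + (-1) * r) = ?c * (indicator {..x} r *\<^sub>R (exp (lam * r) * h r))" for r
  proof -
    have "exp (- (x + (-1) * r) * lam) = exp (- lam * x) * exp (lam * r)" by (simp add: mult_exp_exp algebra_simps)
    then show ?thesis by (auto simp: exponential_density_def indicator_def)
  qed
  have "integrable (density lborel (exponential_density lam)) (\<lambda>v. h (x - v)) \<longleftrightarrow> integrable lborel ?H"
    by (rule integrable_density) (auto simp: nn)
  also have "\<dots> \<longleftrightarrow> integrable lborel (\<lambda>r. ?H (x + (-1) * r))"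
    by (rule lborel_integrable_real_affine_iff[symmetric]) simp
  also have "\<dots> \<longleftrightarrow> set_integrable lborel {..x} (\<lambda>s. exp (lam * s) * h s)"
    unfolding sub set_integrable_def using c by (simp only: integrable_mult_left_iff) simp
  finally show "integrable (density lborel (exponential_density lam)) (\<lambda>v. h (x - v)) \<longleftrightarrow> set_integrable lborel {..x} (\<lambda>s. exp (lam * s) * h s)" .
  have "(LINT v|density lborel (exponential_density lam). h (x - v)) = (LINT v|lborel. ?H v)"
    by (rule integral_density) (auto simp: nn)
  also have "\<dots> = (LINT r|lborel. ?H (x + (-1) * r))"
    using lborel_integral_real_affine[of "-1" ?H x] by simp
  also have "\<dots> = ?c * (LINT s:{..x}|lborel. exp (lam * s) * h s)"
    unfolding sub set_lebesgue_integral_def by (rule integral_mult_right_zero)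
  finally show "(LINT v|density lborel (exponential_density lam). h (x - v)) = lam * exp (- lam * x) * (LINT s:{..x}|lborel. exp (lam * s) * h s)" .
qed

text \<open>No integrability is involved: if one integral diverges, so does the other, and both take
  the default value 0. The formula therefore also covers the degenerate case.\<close>

lemma psi_eq_average:
  assumes "f \<in> borel_measurable borel" "lam > 0"
  shows "psi lam f x = f x - (LINT v|density lborel (exponential_density lam). f (x - v))"
  unfolding psi_def exponential_average(2)[OF assms] by simp

text \<open>Fubini on \<open>{r \<le> s}\<close>; the paths are merely integrable, so there is no fundamental theorem of calculus to use.\<close>

lemma exponential_filter_ode:
  fixes n A :: "real \<Rightarrow> real"
  assumes [measurable]: "n \<in> borel_measurable borel" and lam: "lam > 0" and ab: "a \<le> b"
    and int: "set_integrable lborel {..b} (\<lambda>r. exp (lam * r) * n r)"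
    and A: "\<And>t. A t = lam * exp (- lam * t) * (LINT r:{..t}|lborel. exp (lam * r) * n r)"
  shows "set_integrable lborel {a..b} n" "set_integrable lborel {a..b} A"
    "lam * (LINT s:{a..b}|lborel. n s - A s) = A b - A a"
proof -
  \<comment> \<open>Cutting off at b makes the weighted path integrable on the whole line; on {..s}
    with s <= b nothing is lost.\<close>
  define h where "h r = indicator {..b} r * (lam * exp (lam * r) * n r)" for r
  have h: "integrable lborel h"
    using integrable_mult_right[OF int[unfolded set_integrable_def], of lam] by (simp add: h_def[abs_def] mult_ac)
  have [measurable]: "h \<in> borel_measurable borel" unfolding h_def by measurable
  have A_eq: "A s = exp (- lam * s) * (LINT r|lborel. indicator {..s} r * h r)" if "s \<le> b" for s
  proof -
    have "(LINT r|lborel. indicator {..s} r * h r) = (LINT r|lborel. lam * (indicator {..s} r *\<^sub>R (exp (lam * r) * n r)))"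
      using that by (intro Bochner_Integration.integral_cong) (auto simp: h_def indicator_def)
    then show ?thesis by (simp add: A set_lebesgue_integral_def)
  qed
  \<comment> \<open>Integrating out r gives \<open>lam * A s\<close> on [a, b]. Integrating out s
    first leaves an elementary exponential integral from \<open>max a r\<close> to b.\<close>
  define G where "G s r = indicator {a..b} s * (lam * exp (- lam * s)) * (if r \<le> s then h r else 0)" for s r
  have G_alt: "G s r = indicator {a..b} s * (lam * exp (- lam * s)) * (indicator {..s} r * h r)" for s r
    by (simp add: G_def indicator_def)
  define K where "K = lam * exp (lam * \<bar>a\<bar> + lam * \<bar>b\<bar>)"
  have expK: "lam * exp (- lam * s) \<le> K" if "s \<in> {a..b}" for s
  proof -
    have "- s \<le> \<bar>a\<bar> + \<bar>b\<bar>" using that by auto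
    then have "lam * (- s) \<le> lam * (\<bar>a\<bar> + \<bar>b\<bar>)" using lam by (intro mult_left_mono) auto
    then show ?thesis using lam by (simp add: K_def distrib_left)
  qed
  have K0: "0 \<le> K" using lam by (simp add: K_def)
  have "integrable lborel (\<lambda>r. indicator {a..b} r * exp (- lam * r) * h r / lam)"
  proof (rule Bochner_Integration.integrable_bound)
    show "integrable lborel (\<lambda>r. K / lam\<^sup>2 * h r)" by (intro integrable_mult_right h)
    show "AE r in lborel. norm (indicator {a..b} r * exp (- lam * r) * h r / lam) \<le> norm (K / lam\<^sup>2 * h r)"
    proof (rule AE_I2)
      fix r
      show "norm (indicator {a..b} r * exp (- lam * r) * h r / lam) \<le> norm (K / lam\<^sup>2 * h r)"
      proof (cases "r \<in> {a..b}")
        case True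
        have "exp (- lam * r) \<le> K / lam" using expK[OF True] lam by (simp add: field_simps)
        then have "exp (- lam * r) * (\<bar>h r\<bar> / lam) \<le> K / lam * (\<bar>h r\<bar> / lam)" using lam by (intro mult_right_mono) auto
        then show ?thesis using True lam K0 by (simp add: abs_mult power2_eq_square)
      qed simp
    qed
  qed measurable
  also have "(\<lambda>r. indicator {a..b} r * exp (- lam * r) * h r / lam) = (\<lambda>r. indicator {a..b} r *\<^sub>R n r)"
    using lam by (auto simp: fun_eq_iff h_def indicator_def exp_minus field_simps)
  finally show intn: "set_integrable lborel {a..b} n" by (simp add: set_integrable_def)
  have Gm: "case_prod G \<in> borel_measurable (lborel \<Otimes>\<^sub>M lborel)" unfolding G_def by measurable
  have intG: "integrable (lborel \<Otimes>\<^sub>M lborel) (case_prod G)"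
  proof (rule lborel_pair.Fubini_integrable[OF Gm])
    have i1: "integrable lborel (\<lambda>r. indicator {..s} r * h r)" for s
      using integrable_mult_indicator[OF _ h, of "{..s}"] by simp
    show "AE s in lborel. integrable lborel (\<lambda>r. case_prod G (s, r))"
      unfolding G_alt by (auto intro!: integrable_mult_right i1)
    show "integrable lborel (\<lambda>s. LINT r|lborel. norm (case_prod G (s, r)))"
    proof (rule Bochner_Integration.integrable_bound)
      show "integrable lborel (\<lambda>s. indicator {a..b} s *\<^sub>R (K * (LINT r|lborel. \<bar>h r\<bar>)))"
        by (intro integrable_scaleR_left integrable_real_indicator) (use ab in auto)
      show "AE s in lborel. norm (LINT r|lborel. norm (case_prod G (s, r))) \<le> norm (indicator {a..b} s *\<^sub>R (K * (LINT r|lborel. \<bar>h r\<bar>)))"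
      proof (rule AE_I2)
        fix s
        show "norm (LINT r|lborel. norm (case_prod G (s, r))) \<le> norm (indicator {a..b} s *\<^sub>R (K * (LINT r|lborel. \<bar>h r\<bar>)))"
        proof (cases "s \<in> {a..b}")
          case True
          have "(LINT r|lborel. norm (case_prod G (s, r))) \<le> (LINT r|lborel. K * \<bar>h r\<bar>)"
          proof (rule integral_mono)
            show "integrable lborel (\<lambda>r. norm (case_prod G (s, r)))"
              unfolding G_alt prod.case by (intro integrable_norm integrable_mult_right i1)
            show "integrable lborel (\<lambda>r. K * \<bar>h r\<bar>)" by (intro integrable_mult_right integrable_abs h)
            fix r
            have "lam * exp (- lam * s) * (indicator {..s} r * \<bar>h r\<bar>) \<le> K * \<bar>h r\<bar>"
              using expK[OF True] K0 lam by (intro mult_mono) (auto simp: indicator_def)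
            then show "norm (case_prod G (s, r)) \<le> K * \<bar>h r\<bar>" using True lam by (simp add: G_alt abs_mult)
          qed
          then show ?thesis using True K0
            by (simp add: Bochner_Integration.integral_nonneg abs_mult)
        qed (simp add: G_alt)
      qed
    next
      show "(\<lambda>s. LINT r|lborel. norm (case_prod G (s, r))) \<in> borel_measurable lborel"
        by (rule lborel.borel_measurable_lebesgue_integral) (use Gm in measurable)
    qed
  qed
  have A1: "(LINT r|lborel. G s r) = indicator {a..b} s *\<^sub>R (lam * A s)" for s
    by (auto simp: G_alt A_eq indicator_def)
  have "integrable lborel (\<lambda>s. LINT r|lborel. G s r)" using lborel_pair.integrable_fst[OF intG] by simp
  then have "integrable lborel (\<lambda>s. lam * (indicator {a..b} s *\<^sub>R A s))" unfolding A1 by (simp add: mult_ac)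
  then show intA: "set_integrable lborel {a..b} A" using lam by (simp add: set_integrable_def)
  have inner: "(LINT s|lborel. G s r) = h r * (exp (- lam * max a r) - exp (- lam * b))" for r
  proof (cases "r \<le> b")
    case True
    let ?l = "max a r"
    have lb: "?l \<le> b" using True ab by simp
    have "(LINT s|lborel. G s r) = h r * (LINT s|lborel. indicator {?l..b} s *\<^sub>R (lam * exp (- lam * s)))"
      unfolding integral_mult_right_zero[symmetric]
      by (intro Bochner_Integration.integral_cong) (auto simp: G_alt indicator_def)
    also have "(LINT s|lborel. indicator {?l..b} s *\<^sub>R (lam * exp (- lam * s))) = - exp (- lam * b) - (- exp (- lam * ?l))"
      by (rule integral_FTC_Icc[OF lb])
        (auto intro!: derivative_eq_intros continuous_intros simp: has_real_derivative_iff_has_vector_derivative[symmetric])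
    finally show ?thesis by simp
  next
    case False
    then have "h r = 0" by (simp add: h_def)
    then show ?thesis by (simp add: G_alt)
  qed
  have i_le: "integrable lborel (\<lambda>r. indicator {..a} r * h r)"
    using integrable_mult_indicator[OF _ h, of "{..a}"] by simp
  have i_ab: "integrable lborel (\<lambda>r. lam * (indicator {a..b} r *\<^sub>R n r))"
    using intn unfolding set_integrable_def by (rule integrable_mult_right)
  have "lam * (LINT s:{a..b}|lborel. A s) = (LINT s|lborel. LINT r|lborel. G s r)"
    unfolding A1 set_lebesgue_integral_def integral_mult_right_zero[symmetric] by (simp add: mult_ac)
  also have "\<dots> = (LINT r|lborel. LINT s|lborel. G s r)" by (rule lborel_pair.Fubini_integral[OF intG, symmetric])
  also have "\<dots> = (LINT r|lborel. exp (- lam * a) * (indicator {..a} r * h r) + lam * (indicator {a..b} r *\<^sub>R n r) - exp (- lam * b) * (indicator {..b} r * h r))"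
    unfolding inner
  \<comment> \<open>The closed intervals {..a} and {a..b} both contain a, so the identity can fail
    at that single point.\<close>
  proof (rule integral_discrete_difference[where X="{a}"])
    fix r assume "r \<notin> {a}"
    then consider "r < a" | "a < r" "r \<le> b" | "b < r" using ab by fastforce
    then show "h r * (exp (- lam * max a r) - exp (- lam * b))
      = exp (- lam * a) * (indicator {..a} r * h r) + lam * (indicator {a..b} r *\<^sub>R n r) - exp (- lam * b) * (indicator {..b} r * h r)"
      using ab by cases (auto simp: h_def exp_minus algebra_simps)
  qed auto
  also have "\<dots> = exp (- lam * a) * (LINT r|lborel. indicator {..a} r * h r) + lam * (LINT r|lborel. indicator {a..b} r *\<^sub>R n r) - exp (- lam * b) * (LINT r|lborel. indicator {..b} r * h r)"
  proof -
    have "integrable lborel (\<lambda>r. indicator {..b} r * h r)" using integrable_mult_indicator[OF _ h, of "{..b}"] by simp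
    then show ?thesis using i_le i_ab by simp
  qed
  also have "\<dots> = A a + lam * (LINT s:{a..b}|lborel. n s) - A b"
    using ab by (simp add: A_eq set_lebesgue_integral_def)
  finally show "lam * (LINT s:{a..b}|lborel. n s - A s) = A b - A a"
    using set_integral_diff(2)[OF intn intA] by (simp add: right_diff_distrib)
qed

subsection \<open>The moving average representation\<close>

text \<open>The expectation of \<open>h (t - V)\<close> for an exponential variable V of rate
  \<open>lam\<close>.\<close>

definition exp_filter :: "real \<Rightarrow> (real \<Rightarrow> real) \<Rightarrow> real \<Rightarrow> real" where
  "exp_filter lam h t = (LINT v|density lborel (exponential_density lam). h (t - v))"

text \<open>Assuming integrability at the integers only is what keeps the exceptional set null:
  finiteness on {..j} implies finiteness on {..b} for every b <= j.\<close>

lemma interval_equation_exp_filter: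
  fixes n :: "real \<Rightarrow> real"
  assumes n: "n \<in> borel_measurable borel" and lam: "lam > 0" and n0: "n 0 = 0"
    and int: "\<And>j::nat. integrable (density lborel (exponential_density lam)) (\<lambda>v. n (real j - v))"
  defines "X \<equiv> \<lambda>t. n t - exp_filter lam n t"
  shows "interval_lebesgue_integrable lborel 0 (ereal t) X"
    "X t = X 0 - lam * (LBINT s=0..ereal t. X s) + n t"
proof -
  have si: "set_integrable lborel {..b} (\<lambda>r. exp (lam * r) * n r)" for b
  proof -
    obtain j :: nat where j: "b \<le> real j" using real_arch_simple by blast
    have "set_integrable lborel {..real j} (\<lambda>r. exp (lam * r) * n r)"
      using int[of j] exponential_average(1)[OF n lam, of "real j"] by simp
    then show ?thesis by (rule set_integrable_subset) (use j in auto)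
  qed
  have A: "exp_filter lam n t = lam * exp (- lam * t) * (LINT r:{..t}|lborel. exp (lam * r) * n r)" for t
    unfolding exp_filter_def by (rule exponential_average(2)[OF n lam])
  note ode = exponential_filter_ode[OF n lam _ si A]
  have Xint: "set_integrable lborel {a..b} X" if "a \<le> b" for a b
    unfolding X_def by (intro set_integral_diff(1) ode[OF that])
  have XI: "lam * (LINT s:{a..b}|lborel. X s) = exp_filter lam n b - exp_filter lam n a" if "a \<le> b" for a b
    unfolding X_def by (rule ode(3)[OF that])
  have "interval_lebesgue_integrable lborel 0 (ereal t) X \<and> lam * (LBINT s=0..ereal t. X s) = exp_filter lam n t - exp_filter lam n 0"
  proof (cases "0 \<le> t")
    case True
    then have "interval_lebesgue_integrable lborel (ereal 0) (ereal t) X" using Xint by (simp add: interval_integrable_Icc_iff)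
    moreover have "(LBINT s=ereal 0..ereal t. X s) = (LINT s:{0..t}|lborel. X s)" by (rule interval_integral_Icc[OF True])
    ultimately show ?thesis using XI[OF True] by (simp add: zero_ereal_def)
  next
    case False
    then have t: "t \<le> 0" by simp
    then have "interval_lebesgue_integrable lborel (ereal t) (ereal 0) X" using Xint by (simp add: interval_integrable_Icc_iff del: ereal_eq_0)
    then have "interval_lebesgue_integrable lborel (ereal 0) (ereal t) X" by (subst interval_integrable_endpoints_reverse)
    moreover have "(LBINT s=ereal t..ereal 0. X s) = (LINT s:{t..0}|lborel. X s)" by (rule interval_integral_Icc[OF t])
    then have "(LBINT s=ereal 0..ereal t. X s) = - (LINT s:{t..0}|lborel. X s)" by (subst interval_integral_endpoints_reverse) simp
    ultimately show ?thesis using XI[OF t] by (simp add: zero_ereal_def)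
  qed
  then show "interval_lebesgue_integrable lborel 0 (ereal t) X" "X t = X 0 - lam * (LBINT s=0..ereal t. X s) + n t"
    by (auto simp: X_def n0)
qed

section \<open>The filtered driving process\<close>

context levy_integration begin

lemma has_rr_integral_modular_0:
  assumes g: "phi_integrable g" "modular g = 0" and Y: "has_rr_integral M \<Lambda> g Y"
  shows "AE \<omega> in M. Y \<omega> = 0"
proof -
  have "expectation (\<lambda>\<omega>. \<bar>Y \<omega>\<bar>) \<le> 0" using has_rr_integral_L1(2)[OF g(1) Y] g(2) by simp
  moreover have "0 \<le> expectation (\<lambda>\<omega>. \<bar>Y \<omega>\<bar>)" by (intro Bochner_Integration.integral_nonneg) simp
  ultimately have "expectation (\<lambda>\<omega>. \<bar>Y \<omega>\<bar>) = 0" by (rule antisym)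
  then have "AE \<omega> in M. \<bar>Y \<omega>\<bar> = 0"
    using has_rr_integral_L1(1)[OF g(1) Y] by (subst (asm) integral_nonneg_eq_0_iff_AE) auto
  then show ?thesis by simp
qed

context
  fixes f :: "real \<Rightarrow> real" and N :: "real \<Rightarrow> 'w \<Rightarrow> real" and lam :: real
  assumes f[measurable]: "f \<in> borel_measurable borel"
    and incr: "\<And>v. phi_integrable (\<lambda>x. f x - f (x - v))"
    and N: "\<And>t. has_rr_integral M \<Lambda> (\<lambda>s. f (t - s) - f (- s)) (N t)"
    and N_joint[measurable]: "(\<lambda>(t, \<omega>). N t \<omega>) \<in> borel_measurable (borel \<Otimes>\<^sub>M M)"
    and lam: "lam > 0"
begin

abbreviation waiting_time :: "real measure" where
  "waiting_time \<equiv> density lborel (exponential_density lam)"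

text \<open>Defined on every path; where the average over v diverges, the filter contributes its
  default value 0.\<close>

definition filtered :: "real \<Rightarrow> 'w \<Rightarrow> real" where
  "filtered t \<omega> = N t \<omega> - exp_filter lam (\<lambda>r. N r \<omega>) t"

lemma N_measurable[measurable]: "N t \<in> borel_measurable M"
  using has_rr_integral_measurable[OF N] by simp

lemma psi_exp_filter: "psi lam f x = f x - exp_filter lam f x"
  unfolding exp_filter_def by (rule psi_eq_average[OF f lam])

lemma psi_measurable[measurable]: "psi lam f \<in> borel_measurable borel"
proof -
  interpret mu: prob_space waiting_time by (rule prob_space_exponential_density[OF lam])
  show ?thesis unfolding psi_exp_filter[abs_def] exp_filter_def by measurable
qed

lemma filtered_measurable[measurable]: "filtered t \<in> borel_measurable M"
proof -
  interpret mu: prob_space waiting_time by (rule prob_space_exponential_density[OF lam])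
  have "(\<lambda>(\<omega>, v). N (t - v) \<omega>) \<in> borel_measurable (M \<Otimes>\<^sub>M waiting_time)" by measurable
  then have "(\<lambda>\<omega>. LINT v|waiting_time. N (t - v) \<omega>) \<in> borel_measurable M"
    by (rule mu.borel_measurable_lebesgue_integral)
  then show ?thesis unfolding filtered_def exp_filter_def by measurable
qed

lemma N_increment: "has_rr_integral M \<Lambda> (\<lambda>s. f (t - s) - f (t - s - v)) (\<lambda>\<omega>. N t \<omega> - N (t - v) \<omega>)"
  using has_rr_integral_lincomb[OF N[of t] N[of "t - v"], of 1 "-1"] by (simp add: algebra_simps)

text \<open>\<open>filtered t\<close> is the average over v of the increments
  \<open>N t - N (t - v)\<close>. Their kernels have modular \<open>incr_modular f v\<close>
  whatever t is, and this is integrable in v, so the stochastic Fubini theorem applies.\<close>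

lemma nondegenerate_filter:
  assumes k1: "k 1 > 0"
  shows "AE \<omega> in M. integrable waiting_time (\<lambda>v. N (t - v) \<omega>)"
    and "set_integrable lborel {..t} (\<lambda>s. exp (lam * s) * f s)"
    and "phi_integrable (psi lam f)"
    and "has_rr_integral M \<Lambda> (\<lambda>s. psi lam f (t - s)) (filtered t)"
proof -
  interpret mu: prob_space waiting_time by (rule prob_space_exponential_density[OF lam])
  interpret levy_mixture M \<Lambda> \<sigma> \<nu> waiting_time by unfold_locales (auto simp: k1)
  define u where "u t v s = f (t - s) - f (t - s - v)" for t v s
  have mix: "mixable (u t)" for t
    unfolding mixable_def
  proof (intro conjI allI)
    show "case_prod (u t) \<in> borel_measurable (borel \<Otimes>\<^sub>M borel)" unfolding u_def by measurable
    show "phi_integrable (u t v)" for v using phi_integrable_reflect(1)[OF incr[of v], of t] by (simp add: u_def[abs_def])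
    have "modular (u t v) = incr_modular f v" for v
      using phi_integrable_reflect(2)[OF incr[of v], of t] by (simp add: u_def[abs_def] incr_modular_def)
    then show "integrable waiting_time (\<lambda>v. modular (u t v))"
      using integrable_incr_modular[OF f incr lam] by simp
  qed
  \<comment> \<open>Fubini's theorem yields this for almost every point only. Averaging at -s means
    integrability on the half line {..-s}, so a good point with -s >= x settles x; such a point
    exists because [-x-1, -x] is not null.\<close>
  have f_int: "integrable waiting_time (\<lambda>v. f (x - v))" for x
  proof -
    have "AE s in lborel. integrable waiting_time (\<lambda>v. u 0 v s)" by (rule mixable_mean(3)[OF mix])
    then have ae: "AE s in lborel. integrable waiting_time (\<lambda>v. f (- s - v))"
    proof eventually_elim
      case (elim s)
      have "integrable waiting_time (\<lambda>v. f (- s) - u 0 v s)" by (intro Bochner_Integration.integrable_diff elim) simp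
      then show ?case by (simp add: u_def)
    qed
    have "\<exists>s. s \<le> - x \<and> integrable waiting_time (\<lambda>v. f (- s - v))"
    proof (rule ccontr)
      assume "\<not> ?thesis"
      with ae have "AE s in lborel. s \<notin> {- x - 1..- x}" by (auto elim!: eventually_mono)
      then have "{- x - 1..- x} \<in> null_sets lborel" by (subst AE_iff_null_sets) auto
      then have "emeasure lborel {- x - 1..- x} = 0" by auto
      then show False by simp
    qed
    then obtain s where s: "s \<le> - x" "integrable waiting_time (\<lambda>v. f (- s - v))" by blast
    then have "set_integrable lborel {..- s} (\<lambda>s. exp (lam * s) * f s)" using exponential_average(1)[OF f lam, of "- s"] by simp
    then have "set_integrable lborel {..x} (\<lambda>s. exp (lam * s) * f s)" by (rule set_integrable_subset) (use s in auto)
    then show ?thesis using exponential_average(1)[OF f lam, of x] by simp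
  qed
  show "set_integrable lborel {..t} (\<lambda>s. exp (lam * s) * f s)" using f_int exponential_average(1)[OF f lam] by simp
  have mean_u: "mean (u t) s = psi lam f (t - s)" for t s
    using f_int[of "t - s"] mu.prob_space by (simp add: mean_def u_def psi_exp_filter exp_filter_def)
  have W: "case_prod (\<lambda>v \<omega>. N t \<omega> - N (t - v) \<omega>) \<in> borel_measurable (borel \<Otimes>\<^sub>M M)" by measurable
  have rr: "has_rr_integral M \<Lambda> (u t v) (\<lambda>\<omega>. N t \<omega> - N (t - v) \<omega>)" for v
    using N_increment[of t v] by (simp add: u_def[abs_def])
  note fub = stochastic_fubini[OF mix W rr]
  show ae: "AE \<omega> in M. integrable waiting_time (\<lambda>v. N (t - v) \<omega>)"
    using fub(1)
  proof eventually_elim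
    case (elim \<omega>)
    have "integrable waiting_time (\<lambda>v. N t \<omega> - (N t \<omega> - N (t - v) \<omega>))" by (intro Bochner_Integration.integrable_diff elim) simp
    then show ?case by simp
  qed
  have "phi_integrable (mean (u 0))" by (rule mixable_mean(1)[OF mix])
  from phi_integrable_reflect(1)[OF this, of 0] show "phi_integrable (psi lam f)" by (simp add: mean_u)
  have "AE \<omega> in M. (LINT v|waiting_time. N t \<omega> - N (t - v) \<omega>) = filtered t \<omega>"
    using ae
  proof eventually_elim
    case (elim \<omega>)
    then show ?case using mu.prob_space by (simp add: filtered_def exp_filter_def)
  qed
  then show "has_rr_integral M \<Lambda> (\<lambda>s. psi lam f (t - s)) (filtered t)"
    by (intro has_rr_integral_cong_AE[OF fub(2)]) (auto simp: mean_u)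
qed

text \<open>If the Gaussian component and the Levy measure vanish, \<open>f\<close> is arbitrary and the averages of \<open>f\<close> may diverge.\<close>

lemma degenerate_filter:
  assumes k1: "k 1 = 0"
  shows "AE \<omega> in M. integrable waiting_time (\<lambda>v. N (t - v) \<omega>)"
    and "phi_integrable (psi lam f)"
    and "has_rr_integral M \<Lambda> (\<lambda>s. psi lam f (t - s)) (filtered t)"
proof -
  interpret mu: prob_space waiting_time by (rule prob_space_exponential_density[OF lam])
  interpret pair_sigma_finite waiting_time M by standard
  have p: "phi_integrable g" "modular g = 0" if "g \<in> borel_measurable borel" for g
    using that k_1_eq_0D(3)[OF k1] by (simp_all add: phi_integrable_def modular_def)
  have zero: "AE \<omega> in M. Y \<omega> = 0" if Y: "has_rr_integral M \<Lambda> g Y" for g Y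
  proof -
    have g: "g \<in> borel_measurable borel" by (rule has_rr_integral_measurable(1)[OF Y])
    show ?thesis by (rule has_rr_integral_modular_0[OF p(1)[OF g] p(2)[OF g] Y])
  qed
  show psi: "phi_integrable (psi lam f)" by (rule p) measurable
  \<comment> \<open>Each \<open>N (t - v)\<close> vanishes off a null set depending on v; joint
    measurability allows the quantifiers to be exchanged, so almost every path vanishes for almost
    every v.\<close>
  have "AE v in waiting_time. AE \<omega> in M. N (t - v) \<omega> = 0" using zero[OF N] by simp
  moreover have "{x \<in> space (waiting_time \<Otimes>\<^sub>M M). N (t - fst x) (snd x) = 0} \<in> sets (waiting_time \<Otimes>\<^sub>M M)"
    by measurable
  ultimately have sw: "AE \<omega> in M. AE v in waiting_time. N (t - v) \<omega> = 0"
    using AE_commute[where P="\<lambda>v \<omega>. N (t - v) \<omega> = 0"] by blast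
  show "AE \<omega> in M. integrable waiting_time (\<lambda>v. N (t - v) \<omega>)"
    using sw AE_space
  proof eventually_elim
    case (elim \<omega>)
    have "(\<lambda>v. N (t - v) \<omega>) \<in> borel_measurable waiting_time" using elim(2) by measurable
    then show ?case using elim(1) by (subst integrable_cong_AE[where g="\<lambda>_. 0"]) auto
  qed
  have "AE \<omega> in M. filtered t \<omega> = 0"
    using sw zero[OF N[of t]]
  proof eventually_elim
    case (elim \<omega>)
    then show ?case by (simp add: filtered_def exp_filter_def integral_eq_zero_AE)
  qed
  moreover obtain Y where Y: "has_rr_integral M \<Lambda> (\<lambda>s. psi lam f (t - s)) Y"
    using has_rr_integral_exists[OF phi_integrable_reflect(1)[OF psi, of t]] by blast
  ultimately show "has_rr_integral M \<Lambda> (\<lambda>s. psi lam f (t - s)) (filtered t)"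
    using zero[OF Y] by (intro has_rr_integral_cong_AE[OF Y]) (auto elim: eventually_elim2)
qed

lemma filtered_paths_integrable: "AE \<omega> in M. integrable waiting_time (\<lambda>v. N (t - v) \<omega>)"
  and psi_phi_integrable: "phi_integrable (psi lam f)"
  and filtered_moving_average: "has_rr_integral M \<Lambda> (\<lambda>s. psi lam f (t - s)) (filtered t)"
  using nondegenerate_filter(1,4)[of t] nondegenerate_filter(3) degenerate_filter(1,3)[of t] degenerate_filter(2) k_nonneg[of 1]
  by (cases "k 1 = 0"; simp)+

lemma filtered_qou: "qou_process M N lam filtered"
  unfolding qou_process_def
proof
  show "stationary_process M filtered"
    by (rule moving_average_stationary[OF psi_phi_integrable filtered_moving_average])
  have N0: "AE \<omega> in M. N 0 \<omega> = 0"
  proof -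
    have g: "phi_integrable (\<lambda>s. 0)" "modular (\<lambda>s. 0) = 0" by (simp_all add: phi_integrable_def modular_def)
    have rr: "has_rr_integral M \<Lambda> (\<lambda>s. 0) (N 0)" using N[of 0] by simp
    show ?thesis by (rule has_rr_integral_modular_0[OF g rr])
  qed
  \<comment> \<open>Only countably many times are imposed on a path, so one null set works for the
    equation at all real t.\<close>
  have "AE \<omega> in M. \<forall>j::nat. integrable waiting_time (\<lambda>v. N (real j - v) \<omega>)"
    using filtered_paths_integrable by (simp add: AE_all_countable)
  with N0 AE_space show "AE \<omega> in M. \<forall>t. interval_lebesgue_integrable lborel 0 (ereal t) (\<lambda>s. filtered s \<omega>) \<and>
     filtered t \<omega> = filtered 0 \<omega> - lam * (LBINT s=0..ereal t. filtered s \<omega>) + N t \<omega>"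
  proof eventually_elim
    case (elim \<omega>)
    have m: "(\<lambda>r. N r \<omega>) \<in> borel_measurable borel" using elim(2) by measurable
    show ?case
    proof
      fix t
      show "interval_lebesgue_integrable lborel 0 (ereal t) (\<lambda>s. filtered s \<omega>) \<and>
          filtered t \<omega> = filtered 0 \<omega> - lam * (LBINT s=0..ereal t. filtered s \<omega>) + N t \<omega>"
        using interval_equation_exp_filter[OF m lam elim(1) elim(3)[rule_format], where t=t] unfolding filtered_def ..
    qed
  qed
qed

end
end

lemma same_fdd_AE_eq:
  assumes X: "\<And>t. X t \<in> borel_measurable M" and Y: "\<And>t. Y t \<in> borel_measurable M" and eq: "\<And>t. AE \<omega> in M. X t \<omega> = Y t \<omega>"
  shows "same_fdd M X Y"
  unfolding same_fdd_def
proof (intro allI impI)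
  fix J :: "real set" assume J: "finite J"
  have "AE \<omega> in M. \<forall>t\<in>J. X t \<omega> = Y t \<omega>" using J eq by (intro AE_finite_allI)
  then have "AE \<omega> in M. (\<lambda>t\<in>J. X t \<omega>) = (\<lambda>t\<in>J. Y t \<omega>)" by eventually_elim (auto simp: fun_eq_iff)
  then show "distr M (\<Pi>\<^sub>M t\<in>J. borel) (\<lambda>\<omega>. \<lambda>t\<in>J. X t \<omega>) = distr M (\<Pi>\<^sub>M t\<in>J. borel) (\<lambda>\<omega>. \<lambda>t\<in>J. Y t \<omega>)"
    using X Y by (intro distr_cong_AE measurable_restrict) auto
qed

text \<open>The moving average is asserted for every solution on the given space, which is possible
  since solutions agree almost surely at each time. Convergence of the integral in
  \<open>psi\<close> is asserted unless \<open>Z 1\<close> vanishes almost surely, when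
  \<open>f\<close> may be any measurable function.\<close>

theorem proposition4p2:
  fixes M :: "'w measure" and Z N :: "real \<Rightarrow> 'w \<Rightarrow> real"
    and \<sigma> lam :: real and \<nu> :: "real measure" and f :: "real \<Rightarrow> real"
  assumes "prob_space M"
    and "levy_process M Z"
    and "has_levy_characteristics M Z \<sigma> \<nu>"
    and "\<And>t. integrable M (Z t)"
    and "\<And>t. prob_space.expectation M (Z t) = 0"
    and "f \<in> borel_measurable borel"
    and "\<And>t. (\<lambda>s. f (t - s) - f (- s)) \<in> L_phi \<sigma> \<nu>"
    and "\<And>t. has_levy_integral M Z (\<lambda>s. f (t - s) - f (- s)) (N t)"
    and "(\<lambda>(t, \<omega>). N t \<omega>) \<in> borel_measurable (borel \<Otimes>\<^sub>M M)"
    and "lam > 0"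
  shows "(\<exists>X. qou_process M N lam X) \<and>
    (\<forall>X Y. qou_process M N lam X \<longrightarrow> qou_process M N lam Y \<longrightarrow> same_fdd M X Y) \<and>
    (\<not> (AE \<omega> in M. Z 1 \<omega> = 0) \<longrightarrow>
       (\<forall>t. set_integrable lborel {..t} (\<lambda>s. exp (lam * s) * f s))) \<and>
    psi lam f \<in> L_phi \<sigma> \<nu> \<and>
    (\<forall>X. qou_process M N lam X \<longrightarrow>
       (\<forall>t. has_levy_integral M Z (\<lambda>s. psi lam f (t - s)) (X t)))"
proof -
  interpret prob_space M by fact
  note chars = centered_levy_characteristics[OF assms(3) assms(4) assms(5)]
  interpret centered_levy_pair \<sigma> \<nu> by (rule chars(1))
  have Zm[measurable]: "Z t \<in> borel_measurable M" for t using assms(2) by (simp add: levy_process_def)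
  obtain \<Lambda> where \<Lambda>: "levy_basis M \<Lambda>" "\<And>a b. a < b \<Longrightarrow> AE \<omega> in M. \<Lambda> {a<..b} \<omega> = Z b \<omega> - Z a \<omega>"
    using assms(8)[of 0] unfolding has_levy_integral_def by blast
  interpret levy_basis_space M \<Lambda> by standard (rule \<Lambda>(1))
  interpret levy_integration M \<Lambda> \<sigma> \<nu>
  proof
    fix a b \<theta> :: real assume ab: "a < b"
    have "distr M borel (\<Lambda> {a<..b}) = distr M borel (\<lambda>\<omega>. Z b \<omega> - Z a \<omega>)"
      by (rule distr_cong_AE) (use \<Lambda>(2)[OF ab] basis_measurable[of "{a<..b}"] in auto)
    then show "char (distr M borel (\<Lambda> {a<..b})) \<theta> = exp (of_real (b - a) * Psi \<theta>)"
      using levy_process_char[OF assms(2) chars(2) isCont_Psi Psi_0 ab, of \<theta>] by simp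
  qed
  \<comment> \<open>The basis \<Lambda> was taken from the hypothesis at time 0; integrals given
    with another basis are transferred to it.\<close>
  have to_rr: "has_rr_integral M \<Lambda> g Y" if h: "has_levy_integral M Z g Y" for g Y
  proof -
    obtain \<Lambda>' where \<Lambda>': "levy_basis M \<Lambda>'" "\<And>a b. a < b \<Longrightarrow> AE \<omega> in M. \<Lambda>' {a<..b} \<omega> = Z b \<omega> - Z a \<omega>" "has_rr_integral M \<Lambda>' g Y"
      using h unfolding has_levy_integral_def by blast
    have L': "levy_basis_space M \<Lambda>'" by standard (rule \<Lambda>'(1))
    have "AE \<omega> in M. \<Lambda>' {a<..b} \<omega> = \<Lambda> {a<..b} \<omega>" if "a < b" for a b
      using \<Lambda>'(2)[OF that] \<Lambda>(2)[OF that] by eventually_elim simp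
    from levy_basis_AE_unique[OF L' levy_basis_space_axioms this]
    show ?thesis by (intro has_rr_integral_basis_cong[OF L' levy_basis_space_axioms _ \<Lambda>'(3)])
  qed
  have of_rr: "has_levy_integral M Z g Y" if "has_rr_integral M \<Lambda> g Y" for g Y
    using that \<Lambda> unfolding has_levy_integral_def by blast
  have N: "has_rr_integral M \<Lambda> (\<lambda>s. f (t - s) - f (- s)) (N t)" for t by (rule to_rr[OF assms(8)])
  have incr: "phi_integrable (\<lambda>x. f x - f (x - v))" for v
  proof -
    \<comment> \<open>The hypothesis at t = -v, reflected in s and with the sign changed, is the
      increment over a step v.\<close>
    have "phi_integrable (\<lambda>s. f (- v - s) - f (- s))" using assms(7)[of "- v"] by (simp add: L_phi_iff_phi_integrable)
    from phi_integrable_cmult(1)[OF phi_integrable_reflect(1)[OF this, of 0], of "-1"]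
    show ?thesis by (simp add: algebra_simps)
  qed
  note ctx = assms(6) incr N assms(9) assms(10)
  define X where "X = filtered N lam"
  have qouX: "qou_process M N lam X" unfolding X_def by (rule filtered_qou[OF ctx])
  have rrX: "has_rr_integral M \<Lambda> (\<lambda>s. psi lam f (t - s)) (X t)" for t
    unfolding X_def by (rule filtered_moving_average[OF ctx])
  have meas: "Y t \<in> borel_measurable M" if "qou_process M N lam Y" for Y t
    using that unfolding qou_process_def stationary_process_def by blast
  show ?thesis
  proof (intro conjI allI impI)
    show "\<exists>X. qou_process M N lam X" by (intro exI[of _ X] qouX)
    show "same_fdd M Y W" if Y: "qou_process M N lam Y" and W: "qou_process M N lam W" for Y W
      by (rule same_fdd_AE_eq[OF meas[OF Y] meas[OF W] qou_process_AE_unique[OF Y W assms(10)]])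
    show "psi lam f \<in> L_phi \<sigma> \<nu>"
      unfolding L_phi_iff_phi_integrable by (rule psi_phi_integrable[OF ctx])
    show "has_levy_integral M Z (\<lambda>s. psi lam f (t - s)) (Y t)" if Y: "qou_process M N lam Y" for Y t
      by (rule of_rr, rule has_rr_integral_cong_AE[OF rrX _ has_rr_integral_measurable(1)[OF rrX]
            qou_process_AE_unique[OF qouX Y assms(10)] meas[OF Y]]) simp
    show "set_integrable lborel {..t} (\<lambda>s. exp (lam * s) * f s)" if nz: "\<not> (AE \<omega> in M. Z 1 \<omega> = 0)" for t
    proof -
      \<comment> \<open>If \<open>k\<close> vanished at 1, it would vanish everywhere, and so would
        \<open>Psi\<close>; the characteristic function of \<open>Z 1\<close> would then be
        constantly 1.\<close>
      have "k 1 \<noteq> 0"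
      proof
        assume k1: "k 1 = 0"
        have "Psi \<theta> = 0" for \<theta> using cmod_Psi_le[of \<theta>] k_1_eq_0D(3)[OF k1, of \<theta>] by simp
        then have "(CLINT \<omega>|M. iexp (\<theta> * Z 1 \<omega>)) = 1" for \<theta>
          using chars(2)[of \<theta>] char_distr_eq[of "Z 1" \<theta>] by simp
        then have "AE \<omega> in M. Z 1 \<omega> = 0" by (intro AE_eq_0_of_char Zm)
        with nz show False ..
      qed
      then have "k 1 > 0" using k_nonneg[of 1] by (simp add: less_le)
      then show ?thesis by (rule nondegenerate_filter(2)[OF ctx])
    qed
  qed
qed

end
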